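(* Let $m\geq 2$ and $d\geq 1$ be integers, let $s>\frac{(m-1)d}{2}+\frac12$, and let $\sigma$ be a (positive, finite) measure on $\mathbb{R}^{md}$ supported in the unit ball $\mathbb{B}^{md}(0,1)$ whose Fourier transform satisfies $|\widehat{\mathrm{d}\sigma}(\xi)|\lesssim (1+|\xi|)^{-s}$ for $\xi\in\mathbb{R}^{md}$. For Schwartz functions $f_1,\dots,f_m$ on $\mathbb{R}^d$, writing $\mathrm{F}=(f_1,\dots,f_m)$ and $y=(y_1,\dots,y_m)\in(\mathbb{R}^d)^m$, define \[ \mathrm{M}_\sigma(\mathrm{F})(x)=\sup_{t>0}\Big|\int \prod_{i=1}^m f_i(x-ty_i)\,\mathrm{d}\sigma(y)\Big|,\qquad x\in\mathbb{R}^d. \] Then there is a constant $C$ such that \[ \|\mathrm{M}_\sigma(\mathrm{F})\|_{L^{2/m}(\mathbb{R}^d)}\le C\prod_{i=1}^m\|f_i\|_{L^2(\mathbb{R}^d)}. \]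
   Context: $\mathbb{B}^n(x,R)$ denotes the ball in $\mathbb{R}^n$ of radius $R$ centered at $x$. $\widehat{\mathrm{d}\sigma}$ is the Fourier transform of $\sigma$. *)

theory Defs
  imports "HOL-Analysis.Analysis"
begin

definition pdiff :: "'n::finite \<Rightarrow> (real^'n \<Rightarrow> complex) \<Rightarrow> real^'n \<Rightarrow> complex" where
  "pdiff i f x = vector_derivative (\<lambda>t. f (x + t *\<^sub>R axis i 1)) (at 0)"

fun pdiffs :: "'n::finite list \<Rightarrow> (real^'n \<Rightarrow> complex) \<Rightarrow> real^'n \<Rightarrow> complex" where
  "pdiffs [] f = f"
| "pdiffs (i # is) f = pdiff i (pdiffs is f)"

text \<open>Schwartz functions: all iterated partial derivatives exist (each is everywhere
  Frechet differentiable, so f is smooth) and decay faster than any polynomial.\<close>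
definition schwartz :: "(real^'n::finite \<Rightarrow> complex) \<Rightarrow> bool" where
  "schwartz f \<longleftrightarrow> (\<forall>is. (\<forall>x. pdiffs is f differentiable (at x)) \<and>
     (\<forall>N::nat. \<exists>C. \<forall>x. (1 + norm x) ^ N * norm (pdiffs is f x) \<le> C))"

text \<open>Real powers of extended nonnegative reals (for positive exponents).\<close>
definition ennreal_powr :: "ennreal \<Rightarrow> real \<Rightarrow> ennreal" where
  "ennreal_powr a p = (if a = \<infinity> then \<infinity> else ennreal (enn2real a powr p))"

definition fourier_measure :: "('a::euclidean_space) measure \<Rightarrow> 'a \<Rightarrow> complex" where
  "fourier_measure \<sigma> \<xi> = integral\<^sup>L \<sigma> (\<lambda>y. cis (- 2 * pi * (\<xi> \<bullet> y)))"

definition maximal_op ::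
  "(real^'d::finite^'m::finite) measure \<Rightarrow> ('m \<Rightarrow> real^'d \<Rightarrow> complex) \<Rightarrow> real^'d \<Rightarrow> ennreal" where
  "maximal_op \<sigma> F x = (SUP t\<in>{0<..}. ennreal (norm (integral\<^sup>L \<sigma>
       (\<lambda>y. \<Prod>i\<in>UNIV. F i (x - t *\<^sub>R (y $ i))))))"

definition Lp_norm :: "real \<Rightarrow> ('a::euclidean_space \<Rightarrow> ennreal) \<Rightarrow> ennreal" where
  "Lp_norm p g = ennreal_powr (\<integral>\<^sup>+ x. ennreal_powr (g x) p \<partial>lborel) (1 / p)"

end

theory Submission
  imports Defs "HOL-Probability.Probability"
begin

text \<open>
  For dilations \<open>t\<close> of size \<open>2\<^sup>k\<close>, expand the product of the \<open>f\<^sub>i\<close> by telescoping over the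
  frequency truncations of all the \<open>f\<^sub>i\<close> at the spatial scales \<open>2\<^sup>k / 2\<^sup>j\<close>. The term
  \<open>j = 0\<close> is dominated by the product of the Hardy--Littlewood maximal functions of the \<open>f\<^sub>i\<close>. In
  every other term one slot \<open>i0\<close> is localised to frequencies about \<open>2\<^sup>j / 2\<^sup>k\<close> and the remaining
  slots are smooth at scale \<open>2\<^sup>k / 2\<^sup>j\<close>. The supremum over \<open>t\<close> in one octave is controlled by the
  \<open>L\<^sup>2\<close> norms in \<open>t\<close> of the term and of its derivative, at the price of a factor \<open>2\<^sup>j\<close> in the
  squares; the derivative only involves the coordinate moments of \<open>\<sigma>\<close>, whose Fourier transforms decay
  almost as fast as that of \<open>\<sigma>\<close>. Restricting a function on \<open>(\<real>\<^sup>d)\<^sup>m\<close> to the diagonal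
  costs a factor \<open>2\<close> to the power \<open>j d (m - 1)\<close> in the squares, and the decay of the Fourier transform
  gains \<open>2\<close> to the power \<open>- 2 j s\<close>. The hypothesis on \<open>s\<close> says exactly that the product of these
  factors is a negative power of \<open>2\<^sup>j\<close>.
  Local square averages of the smooth slots have maximal functions whose squared \<open>L\<^sup>2\<close> bounds grow only
  quadratically in \<open>j\<close>, the localised slot is summed over \<open>k\<close> by almost orthogonality, and
  Hoelder's inequality followed by summation in \<open>j\<close> in \<open>L\<close> to the power \<open>2 / m\<close>, where \<open>2 / m \<le> 1\<close>,
  gives the bound.
\<close>

subsection \<open>Lebesgue measure\<close>

text \<open>Two demands on the cutoffs conflict. Leaving the diagonal by Cauchy--Schwarz should give
  averages over balls comparable to the dilation, which calls for compactly supported kernels. Decay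
  of order \<open>s\<close> must meet a factor that is small at low frequency, and the transform of
  a nonzero compactly supported kernel cannot vanish on an open set. The symbol
  \<open>1 - (1 - b\<^sup>2) ^ Suc n\<close> with \<open>s \<le> real n\<close> reconciles them.
  Differences of neighbouring scales vanish to order \<open>Suc n\<close> at the origin:
  \<open>n\<close> powers turn the decay into a gain, one is left for the sum over \<open>k\<close>.
  At high frequency \<open>b\<^sup>2\<close> leaves one power to pay for a derivative, so a bump of
  class C^1 is enough. With d = \<open>DIM('a)\<close> and m = \<open>CARD('m)\<close>, the
  localised slot carries 2 to the power -j (2 s - 1 - d (m - 1)), every other slot only a power of
  \<open>j\<close>, which the m-th root taken in Hoelder's inequality cannot turn into exponential
  growth. The moments of \<sigma> lose an arbitrarily small \<delta> in the exponent, taken from the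
  strict inequality for \<open>s\<close>. The maximal function is bounded on L^2 directly, by
  linearising the supremum and a bootstrap on the constant, without covering lemmas.\<close>

lemma nn_integral_lborel_affine:
  fixes t :: "'a::euclidean_space"
  assumes "c \<noteq> 0" and [measurable]: "f \<in> borel_measurable borel"
  shows "(\<integral>\<^sup>+x. f x \<partial>lborel) = ennreal (\<bar>c\<bar> ^ DIM('a)) * (\<integral>\<^sup>+x. f (t + c *\<^sub>R x) \<partial>lborel)"
  by (subst lborel_affine[OF assms(1), of t])
     (simp add: nn_integral_density nn_integral_distr nn_integral_cmult)

lemma nn_integral_lborel_shift:
  fixes t :: "'a::euclidean_space"
  assumes "f \<in> borel_measurable borel"
  shows "(\<integral>\<^sup>+x. f (t + x) \<partial>lborel) = (\<integral>\<^sup>+x. f x \<partial>lborel)"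
  using nn_integral_lborel_affine[of 1 f t] assms by simp

lemma nn_integral_lborel_reflect:
  fixes t :: "'a::euclidean_space"
  assumes "f \<in> borel_measurable borel"
  shows "(\<integral>\<^sup>+x. f (t - x) \<partial>lborel) = (\<integral>\<^sup>+x. f x \<partial>lborel)"
  using nn_integral_lborel_affine[of "-1" f t] assms by simp

lemma integrable_lborel_affine_iff:
  fixes t :: "'a::euclidean_space" and f :: "'a \<Rightarrow> 'b::{banach, second_countable_topology}"
  assumes "c \<noteq> 0"
  shows "integrable lborel (\<lambda>x. f (t + c *\<^sub>R x)) \<longleftrightarrow> integrable lborel f"
proof -
  have imp: "integrable lborel (\<lambda>x. f (t + c *\<^sub>R x))"
    if "c \<noteq> 0" "integrable lborel f" for f :: "'a \<Rightarrow> 'b" and c :: real and t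
  proof (rule integrableI_bounded)
    have [measurable]: "f \<in> borel_measurable borel" using that(2) by simp
    show "(\<lambda>x. f (t + c *\<^sub>R x)) \<in> borel_measurable lborel" by simp
    have "ennreal (\<bar>c\<bar> ^ DIM('a)) * (\<integral>\<^sup>+x. norm (f (t + c *\<^sub>R x)) \<partial>lborel) < \<infinity>"
      using that(2) nn_integral_lborel_affine[OF that(1), of "\<lambda>x. ennreal (norm (f x))" t]
      by (auto simp: integrable_iff_bounded)
    then show "(\<integral>\<^sup>+x. norm (f (t + c *\<^sub>R x)) \<partial>lborel) < \<infinity>"
      using that(1) by (auto simp: ennreal_mult_less_top)
  qed
  \<comment> \<open>The converse implication is the same statement for the inverse affine
    map.\<close>
  have eq: "(\<lambda>x. f (t + c *\<^sub>R (- inverse c *\<^sub>R t + inverse c *\<^sub>R x))) = f"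
    using assms by (simp add: algebra_simps)
  show ?thesis
    using imp[of c f t] imp[of "inverse c" "\<lambda>x. f (t + c *\<^sub>R x)" "- inverse c *\<^sub>R t"] assms
    unfolding eq by auto
qed

lemma lborel_integral_affine:
  fixes t :: "'a::euclidean_space" and f :: "'a \<Rightarrow> 'b::{banach, second_countable_topology}"
  assumes "c \<noteq> 0" "integrable lborel f"
  shows "(\<integral>x. f x \<partial>lborel) = \<bar>c\<bar> ^ DIM('a) *\<^sub>R (\<integral>x. f (t + c *\<^sub>R x) \<partial>lborel)"
proof -
  have [measurable]: "f \<in> borel_measurable borel" using assms(2) by simp
  show ?thesis
    by (subst lborel_affine[OF assms(1), of t])
       (simp add: integral_density integral_distr)
qed

lemma lborel_integral_reflect:
  fixes t :: "'a::euclidean_space" and f :: "'a \<Rightarrow> 'b::{banach, second_countable_topology}"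
  assumes "integrable lborel f"
  shows "(\<integral>x. f (t - x) \<partial>lborel) = (\<integral>x. f x \<partial>lborel)"
  using lborel_integral_affine[of "-1" f t] assms by simp

lemma lborel_integral_shift:
  fixes t :: "'a::euclidean_space" and f :: "'a \<Rightarrow> 'b::{banach, second_countable_topology}"
  assumes "integrable lborel f"
  shows "(\<integral>x. f (t + x) \<partial>lborel) = (\<integral>x. f x \<partial>lborel)"
  using lborel_integral_affine[of 1 f t] assms by simp

section \<open>Lebesgue measure on a finite power as a product measure\<close>

lemma measurable_vec_lambda_PiM [measurable]:
  "(\<lambda>v. \<chi> i::'m::finite. v i) \<in> borel_measurable (Pi\<^sub>M UNIV (\<lambda>_. lborel :: 'a::euclidean_space measure))"
proof (rule borel_measurable_euclidean_space[THEN iffD2], rule ballI)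
  fix b :: "'a ^ 'm" assume "b \<in> Basis"
  then obtain i u where b: "b = axis i u" by (auto simp: Basis_vec_def)
  show "(\<lambda>v. (\<chi> i::'m. v i) \<bullet> b) \<in> borel_measurable (Pi\<^sub>M UNIV (\<lambda>_. lborel :: 'a measure))"
    unfolding b inner_axis by simp
qed

lemma measurable_vec_nth [measurable]:
  "(\<lambda>v::'a::euclidean_space ^ 'm::finite. v $ i) \<in> borel_measurable borel"
  by (intro borel_measurable_continuous_onI continuous_intros)

lemma prod_Basis_vec:
  "(\<Prod>b\<in>(Basis :: ('a::euclidean_space ^ 'm::finite) set). f b) = (\<Prod>i\<in>UNIV. \<Prod>u\<in>Basis. f (axis i u))"
proof -
  have "bij_betw (\<lambda>(i, u). axis i u) (UNIV \<times> Basis) (Basis :: ('a ^ 'm) set)"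
    by (auto simp: bij_betw_def inj_on_def axis_eq_axis Basis_vec_def)
  then have "(\<Prod>b\<in>(Basis :: ('a ^ 'm) set). f b) = (\<Prod>(i, u)\<in>UNIV \<times> Basis. f (axis i u))"
    by (simp add: prod.reindex_bij_betw[symmetric] case_prod_unfold)
  then show ?thesis by (simp add: prod.cartesian_product)
qed

text \<open>Lebesgue measure is determined by its values on boxes, and a box in the power is a
  product of boxes in the slots. This later lets Plancherel's theorem on the whole space factor over
  the slots.\<close>

lemma lborel_vec_eq:
  "(lborel :: ('a::euclidean_space ^ 'm::finite) measure) =
     distr (Pi\<^sub>M UNIV (\<lambda>_. lborel)) borel (\<lambda>v. \<chi> i. v i)"
proof (rule lborel_eqI)
  interpret product_sigma_finite "\<lambda>_::'m. lborel :: 'a measure" ..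
  fix l u :: "'a ^ 'm" assume lu: "\<And>b. b \<in> Basis \<Longrightarrow> l \<bullet> b \<le> u \<bullet> b"
  have lui: "l $ i \<bullet> b \<le> u $ i \<bullet> b" if "b \<in> Basis" for i b
    using lu[of "axis i b"] that by (auto simp: inner_axis Basis_vec_def)
  have "emeasure (distr (Pi\<^sub>M UNIV (\<lambda>_. lborel)) borel (\<lambda>v. \<chi> i. v i)) (box l u)
     = emeasure (Pi\<^sub>M UNIV (\<lambda>_. lborel)) (Pi\<^sub>E UNIV (\<lambda>i. box (l $ i) (u $ i)))"
    by (subst emeasure_distr)
       (auto simp: space_PiM PiE_def box_def Basis_vec_def inner_axis intro!: arg_cong2[where f=emeasure])
  also have "\<dots> = (\<Prod>i\<in>UNIV. emeasure lborel (box (l $ i) (u $ i)))"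
    by (rule emeasure_PiM) auto
  also have "\<dots> = ennreal (\<Prod>i\<in>UNIV. \<Prod>b\<in>Basis. (u $ i - l $ i) \<bullet> b)"
    by (subst prod_ennreal[symmetric])
       (auto simp: lui inner_diff_left intro!: prod_nonneg prod.cong emeasure_lborel_box)
  also have "\<dots> = ennreal (\<Prod>b\<in>Basis. (u - l) \<bullet> b)"
    by (simp add: prod_Basis_vec inner_axis)
  finally show "emeasure (distr (Pi\<^sub>M UNIV (\<lambda>_. lborel)) borel (\<lambda>v. \<chi> i. v i)) (box l u) = (\<Prod>b\<in>Basis. (u - l) \<bullet> b)" .
qed simp

lemma nn_integral_lborel_vec:
  assumes [measurable]: "f \<in> borel_measurable borel"
  shows "(\<integral>\<^sup>+w. f w \<partial>(lborel :: ('a::euclidean_space ^ 'm::finite) measure)) =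
         (\<integral>\<^sup>+v. f (\<chi> i. v i) \<partial>Pi\<^sub>M UNIV (\<lambda>_. lborel))"
  by (subst lborel_vec_eq, subst nn_integral_distr) simp_all

lemma nn_integral_lborel_vec_prod:
  assumes "\<And>i. f i \<in> borel_measurable borel"
  shows "(\<integral>\<^sup>+w. (\<Prod>i\<in>UNIV. f i (w $ i)) \<partial>(lborel :: ('a::euclidean_space ^ 'm::finite) measure)) =
         (\<Prod>i\<in>UNIV. \<integral>\<^sup>+x. f i x \<partial>lborel)"
proof -
  interpret product_sigma_finite "\<lambda>_::'m. lborel :: 'a measure" ..
  note assms[measurable]
  show ?thesis
    by (subst nn_integral_lborel_vec) (simp_all add: product_nn_integral_prod)
qed

lemma integral_lborel_vec_prod:
  fixes f :: "'m::finite \<Rightarrow> 'a::euclidean_space \<Rightarrow> complex"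
  assumes "\<And>i. integrable lborel (f i)"
  shows "integrable lborel (\<lambda>w::'a ^ 'm. \<Prod>i\<in>UNIV. f i (w $ i))"
    and "(\<integral>w. (\<Prod>i\<in>UNIV. f i (w $ i)) \<partial>(lborel :: ('a ^ 'm) measure)) = (\<Prod>i\<in>UNIV. \<integral>x. f i x \<partial>lborel)"
proof -
  interpret product_sigma_finite "\<lambda>_::'m. lborel :: 'a measure" ..
  have [measurable]: "f i \<in> borel_measurable borel" for i using assms[of i] by simp
  show "integrable lborel (\<lambda>w::'a ^ 'm. \<Prod>i\<in>UNIV. f i (w $ i))"
    by (subst lborel_vec_eq, subst integrable_distr_eq)
       (simp_all add: product_integrable_prod assms)
  show "(\<integral>w. (\<Prod>i\<in>UNIV. f i (w $ i)) \<partial>(lborel :: ('a ^ 'm) measure)) = (\<Prod>i\<in>UNIV. \<integral>x. f i x \<partial>lborel)"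
    by (subst lborel_vec_eq, subst integral_distr)
       (simp_all add: product_integral_prod assms)
qed

subsection \<open>Fourier transform and Plancherel's theorem\<close>

text \<open>A class stable under all operations used here (sums, mollification, tensor products,
  convolution with a finite measure). Its members have a pointwise defined Fourier transform and a
  finite square norm, so all arguments stay with functions instead of L^2 classes.\<close>

definition nice :: "('a::euclidean_space \<Rightarrow> complex) \<Rightarrow> bool" where
  "nice f \<longleftrightarrow> continuous_on UNIV f \<and> bounded (range f) \<and> integrable lborel f"

definition ft :: "('a::euclidean_space \<Rightarrow> complex) \<Rightarrow> 'a \<Rightarrow> complex" where
  "ft f \<xi> = (\<integral>x. f x * cis (- 2 * pi * (\<xi> \<bullet> x)) \<partial>lborel)"

text \<open>Convolution with the image under \<open>\<tau>\<close> of the complex measure of density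
  \<open>b\<close>. It serves for autocorrelation (\<open>\<tau>\<close> the reflection),
  mollification (\<open>\<tau>\<close> the identity) and the dilates of \<sigma>
  (\<open>\<tau>\<close> multiplication by \<open>t\<close>).\<close>

definition conv ::
  "'b measure \<Rightarrow> ('b \<Rightarrow> complex) \<Rightarrow> ('b \<Rightarrow> 'a::euclidean_space) \<Rightarrow> ('a \<Rightarrow> complex) \<Rightarrow> 'a \<Rightarrow> complex" where
  "conv M b \<tau> G v = (\<integral>y. b y * G (v - \<tau> y) \<partial>M)"

lemma measurable_cis [measurable]: "cis \<in> borel_measurable borel"
  by (intro borel_measurable_continuous_onI continuous_intros)

lemma measurable_nice: "nice f \<Longrightarrow> f \<in> borel_measurable borel"
  by (auto simp: nice_def intro: borel_measurable_continuous_onI)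

lemma nice_boundE:
  assumes "nice f" obtains B where "B > 0" "\<And>x. norm (f x) \<le> B"
  using assms by (auto simp: nice_def bounded_pos)

lemma integrable_mult_bounded:
  fixes f g :: "'b \<Rightarrow> complex"
  assumes "integrable M f" "g \<in> borel_measurable M" "\<And>x. norm (g x) \<le> B"
  shows "integrable M (\<lambda>x. f x * g x)"
proof (rule Bochner_Integration.integrable_bound)
  show "integrable M (\<lambda>x. B * norm (f x))" using assms(1) by simp
  show "(\<lambda>x. f x * g x) \<in> borel_measurable M" using assms(1,2) by measurable
  have "norm (f x * g x) \<le> norm (B * norm (f x))" for x
  proof -
    have "norm (f x) * norm (g x) \<le> norm (f x) * B" by (intro mult_left_mono assms) auto
    also have "\<dots> \<le> norm (B * norm (f x))" by (simp add: mult.commute abs_mult mult_right_mono)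
    finally show ?thesis by (simp add: norm_mult)
  qed
  then show "AE x in M. norm (f x * g x) \<le> norm (B * norm (f x))" by simp
qed

context
  fixes M :: "'b measure" and b :: "'b \<Rightarrow> complex" and \<tau> :: "'b \<Rightarrow> 'a::euclidean_space"
    and G :: "'a \<Rightarrow> complex"
  assumes M: "sigma_finite_measure M" and b: "integrable M b"
    and \<tau>[measurable]: "\<tau> \<in> borel_measurable M" and G: "nice G"
begin

lemma integrable_conv: "integrable M (\<lambda>y. b y * G (v - \<tau> y))"
proof -
  obtain B where "\<And>x. norm (G x) \<le> B" using nice_boundE[OF G] by metis
  note [measurable] = measurable_nice[OF G]
  show ?thesis by (rule integrable_mult_bounded[OF b]) (use \<open>\<And>x. norm (G x) \<le> B\<close> in auto)
qed

lemma continuous_on_conv: "continuous_on UNIV (conv M b \<tau> G)"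
proof -
  obtain B where B: "B > 0" "\<And>x. norm (G x) \<le> B" using nice_boundE[OF G] by metis
  note [measurable] = measurable_nice[OF G] borel_measurable_integrable[OF b]
  have cont: "isCont G x" for x
    using G by (auto simp: nice_def continuous_on_eq_continuous_at)
  have "(\<lambda>n. conv M b \<tau> G (u n)) \<longlonglongrightarrow> conv M b \<tau> G x" if "u \<longlonglongrightarrow> x" for u x
    unfolding conv_def
  proof (rule integral_dominated_convergence[where w="\<lambda>y. B * norm (b y)"])
    show "integrable M (\<lambda>y. B * norm (b y))" using b by simp
    show "AE y in M. (\<lambda>n. b y * G (u n - \<tau> y)) \<longlonglongrightarrow> b y * G (x - \<tau> y)"
      by (intro AE_I2 tendsto_intros isCont_tendsto_compose[OF cont] that)
    show "AE y in M. norm (b y * G (u n - \<tau> y)) \<le> B * norm (b y)" for n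
      by (intro AE_I2) (auto simp: norm_mult mult.commute[of B] intro!: mult_left_mono B)
  qed auto
  then show ?thesis
    by (auto simp: continuous_on_eq_continuous_at continuous_at_sequentially o_def)
qed

text \<open>The justification of Fubini for two uses: \<open>c = 1\<close> gives integrability of
  the convolution, a character \<open>c\<close> gives its Fourier transform.\<close>

lemma integrable_conv_pair:
  assumes [measurable]: "c \<in> borel_measurable borel" and c: "\<And>v. norm (c v :: complex) \<le> 1"
  shows "integrable (M \<Otimes>\<^sub>M lborel) (\<lambda>(y, v). b y * G (v - \<tau> y) * c v)"
proof -
  interpret pair_sigma_finite M "lborel :: 'a measure"
    using M by (simp add: pair_sigma_finite_def sigma_finite_lborel)
  note [measurable] = measurable_nice[OF G] borel_measurable_integrable[OF b]
  have intG: "integrable lborel (\<lambda>v. G (v - \<tau> y))" for y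
    using integrable_lborel_affine_iff[of 1 G "- \<tau> y"] G by (auto simp: nice_def)
  have intG': "integrable lborel (\<lambda>v. b y * G (v - \<tau> y) * c v)" for y
    by (rule integrable_mult_bounded[where B=1]) (use c intG in auto)
  show ?thesis
  proof (rule Fubini_integrable)
    show "(\<lambda>(y, v). b y * G (v - \<tau> y) * c v) \<in> borel_measurable (M \<Otimes>\<^sub>M lborel)" by measurable
    show "AE y in M. integrable lborel (\<lambda>v. case (y, v) of (y, v) \<Rightarrow> b y * G (v - \<tau> y) * c v)"
      using intG' by simp
    show "integrable M (\<lambda>y. \<integral>v. norm (case (y, v) of (y, v) \<Rightarrow> b y * G (v - \<tau> y) * c v) \<partial>lborel)"
    proof (rule Bochner_Integration.integrable_bound)
      show "integrable M (\<lambda>y. norm (b y) * (\<integral>v. norm (G v) \<partial>lborel))" using b by simp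
      have "norm (\<integral>v. norm (b y * G (v - \<tau> y) * c v) \<partial>lborel) \<le> norm (norm (b y) * (\<integral>v. norm (G v) \<partial>lborel))" for y
      proof -
        have "(\<integral>v. norm (b y * G (v - \<tau> y) * c v) \<partial>lborel) \<le> (\<integral>v. norm (b y) * norm (G (v - \<tau> y)) \<partial>lborel)"
          using intG'[of y] intG[of y] c
          by (intro integral_mono integrable_norm integrable_mult_right) (auto simp: norm_mult intro!: mult_left_le)
        also have "\<dots> = norm (b y) * (\<integral>v. norm (G (- \<tau> y + v)) \<partial>lborel)" by simp
        also have "(\<integral>v. norm (G (- \<tau> y + v)) \<partial>lborel) = (\<integral>v. norm (G v) \<partial>lborel)"
          using G by (intro lborel_integral_shift) (auto simp: nice_def)
        finally show ?thesis by simp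
      qed
      then show "AE y in M. norm (\<integral>v. norm (case (y, v) of (y, v) \<Rightarrow> b y * G (v - \<tau> y) * c v) \<partial>lborel)
          \<le> norm (norm (b y) * (\<integral>v. norm (G v) \<partial>lborel))" by simp
    qed measurable
  qed
qed

lemma norm_conv_le:
  assumes "\<And>x. norm (G x) \<le> B"
  shows "norm (conv M b \<tau> G v) \<le> B * (\<integral>y. norm (b y) \<partial>M)"
proof -
  have "norm (conv M b \<tau> G v) \<le> (\<integral>y. norm (b y * G (v - \<tau> y)) \<partial>M)"
    unfolding conv_def by (rule integral_norm_bound)
  also have "\<dots> \<le> (\<integral>y. B * norm (b y) \<partial>M)"
    using integrable_conv b
    by (intro integral_mono integrable_norm integrable_mult_right) (auto simp: norm_mult mult.commute[of B] intro!: mult_left_mono assms)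
  finally show ?thesis by simp
qed

lemma nice_conv: "nice (conv M b \<tau> G)"
proof -
  interpret pair_sigma_finite M "lborel :: 'a measure"
    using M by (simp add: pair_sigma_finite_def sigma_finite_lborel)
  obtain B where B: "B > 0" "\<And>x. norm (G x) \<le> B" using nice_boundE[OF G] by metis
  have "bounded (range (conv M b \<tau> G))"
    using norm_conv_le[OF B(2)] by (auto simp: bounded_iff)
  moreover have "integrable lborel (conv M b \<tau> G)"
    using integrable_snd[OF integrable_conv_pair[of "\<lambda>_. 1"]] by (simp add: conv_def[abs_def])
  ultimately show ?thesis using continuous_on_conv by (simp add: nice_def)
qed

text \<open>Translating by \<open>\<tau> y\<close> multiplies the transform by a character, so
  Fubini leaves the Fourier transform of the image measure as the first factor.\<close>

lemma ft_conv: "ft (conv M b \<tau> G) \<xi> = (\<integral>y. b y * cis (- 2 * pi * (\<xi> \<bullet> \<tau> y)) \<partial>M) * ft G \<xi>"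
proof -
  interpret pair_sigma_finite M "lborel :: 'a measure"
    using M by (simp add: pair_sigma_finite_def sigma_finite_lborel)
  define c where "c v = cis (- 2 * pi * (\<xi> \<bullet> v))" for v
  have [measurable]: "c \<in> borel_measurable borel" unfolding c_def by measurable
  have "integrable lborel (\<lambda>x. G x * c x)"
    by (rule integrable_mult_bounded[where B=1]) (use G in \<open>auto simp: nice_def c_def\<close>)
  then have int: "integrable lborel (\<lambda>v. G v * c v)" .
  have c_add: "c (p + v) = c p * c v" for p v
    by (simp add: c_def inner_add_right ring_distribs cis_mult)
  have shift: "(\<integral>v. G (v - \<tau> y) * c v \<partial>lborel) = c (\<tau> y) * ft G \<xi>" for y
  proof -
    have eq: "G (\<tau> y + v - \<tau> y) * c (\<tau> y + v) = c (\<tau> y) * (G v * c v)" for v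
      by (simp add: c_add)
    have "integrable lborel (\<lambda>v. G (\<tau> y + v - \<tau> y) * c (\<tau> y + v))"
      unfolding eq using int by simp
    then have "integrable lborel (\<lambda>v. G (v - \<tau> y) * c v)"
      using integrable_lborel_affine_iff[of 1 "\<lambda>v. G (v - \<tau> y) * c v" "\<tau> y"] by simp
    then have "(\<integral>v. G (v - \<tau> y) * c v \<partial>lborel) = (\<integral>v. G (\<tau> y + v - \<tau> y) * c (\<tau> y + v) \<partial>lborel)"
      by (rule lborel_integral_shift[symmetric])
    then show ?thesis unfolding eq by (simp add: ft_def c_def)
  qed
  have "ft (conv M b \<tau> G) \<xi> = (\<integral>v. (\<integral>y. b y * G (v - \<tau> y) * c v \<partial>M) \<partial>lborel)"
    by (simp add: ft_def conv_def c_def)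
  also have "\<dots> = (\<integral>y. (\<integral>v. b y * G (v - \<tau> y) * c v \<partial>lborel) \<partial>M)"
    by (rule Fubini_integral) (rule integrable_conv_pair, auto simp: c_def)
  also have "\<dots> = (\<integral>y. b y * c (\<tau> y) * ft G \<xi> \<partial>M)"
    by (simp add: mult.assoc shift)
  finally show ?thesis by (simp add: c_def)
qed

end

section \<open>The Gaussian and Fourier inversion at the origin\<close>

lemma cis_sum: "cis (sum f A) = (\<Prod>x\<in>A. cis (f x))"
  by (induction A rule: infinite_finite_induct) (auto simp: cis_mult[symmetric])

definition gauss :: "'a::euclidean_space \<Rightarrow> real" where
  "gauss x = (\<Prod>b\<in>Basis. std_normal_density (x \<bullet> b))"

lemma gauss_altdef:
  "gauss (x::'a::euclidean_space) = (1 / sqrt (2 * pi)) ^ DIM('a) * exp (- (norm x)\<^sup>2 / 2)"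
proof -
  have "(\<Sum>b\<in>Basis. - (x \<bullet> b)\<^sup>2 / 2) = - (norm x)\<^sup>2 / 2"
    by (simp add: norm_eq_sqrt_inner euclidean_inner[of x x] power2_eq_square sum_negf
        sum_divide_distrib[symmetric] sum_nonneg)
  then show ?thesis
    by (simp add: gauss_def std_normal_density_def prod.distrib exp_sum[symmetric] power_divide prod_dividef)
qed

text \<open>Everything factors over the coordinates, and in one dimension the value is the
  characteristic function of the standard normal law. This is why \<open>gauss\<close> is defined as
  a product of densities.\<close>

lemma integral_gauss_cis:
  fixes u :: "'a::euclidean_space"
  shows "integrable lborel (\<lambda>x. gauss x * cis (u \<bullet> x))"
    and "(\<integral>x. gauss x * cis (u \<bullet> x) \<partial>lborel) = exp (- (norm u)\<^sup>2 / 2)"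
proof -
  interpret product_sigma_finite "\<lambda>_::'a. lborel :: real measure" ..
  define g where "g b t = complex_of_real (std_normal_density t) * cis ((u \<bullet> b) * t)" for b t
  have g: "gauss x * cis (u \<bullet> x) = (\<Prod>b\<in>Basis. g b (x \<bullet> b))" for x
    by (simp add: g_def gauss_def prod.distrib euclidean_inner[of u x] cis_sum)
  have intg: "integrable lborel (g b)" for b
    unfolding g_def
    by (rule integrable_mult_bounded[where B=1])
       (auto simp: integrable_normal_density)
  have g_int: "(\<integral>t. g b t \<partial>lborel) = exp (- (u \<bullet> b)\<^sup>2 / 2)" for b
    using fun_cong[OF char_std_normal_distribution, of "u \<bullet> b"]
    by (simp add: char_def integral_density normal_density_nonneg g_def cis_conv_exp
        scaleR_conv_of_real mult_ac)
  have [measurable]: "g b \<in> borel_measurable borel" for b using intg[of b] by simp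
  have lb: "(lborel :: 'a measure) = distr (Pi\<^sub>M Basis (\<lambda>_. lborel)) borel (\<lambda>f. \<Sum>b\<in>Basis. f b *\<^sub>R b)"
    unfolding lborel_eq_real by (rule lborel_def)
  show "integrable lborel (\<lambda>x. gauss x * cis (u \<bullet> x))"
    unfolding g lb
    by (subst integrable_distr_eq) (simp_all add: product_integrable_prod intg)
  have "(\<integral>x. gauss x * cis (u \<bullet> x) \<partial>lborel) = (\<Prod>b\<in>Basis. complex_of_real (exp (- (u \<bullet> b)\<^sup>2 / 2)))"
    unfolding g lb
    by (subst integral_distr) (simp_all add: product_integral_prod intg g_int)
  also have "\<dots> = exp (\<Sum>b\<in>Basis. - (u \<bullet> b)\<^sup>2 / 2)" by (simp add: exp_sum)
  also have "(\<Sum>b\<in>Basis. - (u \<bullet> b)\<^sup>2 / 2) = - (norm u)\<^sup>2 / 2"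
    by (simp add: norm_eq_sqrt_inner euclidean_inner[of u u] power2_eq_square sum_negf
        sum_divide_distrib[symmetric] sum_nonneg)
  finally show "(\<integral>x. gauss x * cis (u \<bullet> x) \<partial>lborel) = exp (- (norm u)\<^sup>2 / 2)" .
qed


lemma gauss_nonneg [simp]: "0 \<le> gauss x"
  by (simp add: gauss_altdef)

lemma gauss_pos: "0 < gauss x"
  by (simp add: gauss_altdef)

lemma integrable_gauss: "integrable lborel (gauss :: 'a::euclidean_space \<Rightarrow> real)"
  and integral_gauss: "(\<integral>x. gauss (x::'a) \<partial>lborel) = 1"
proof -
  have 1: "integrable lborel (\<lambda>x::'a. complex_of_real (gauss x))"
    and 2: "(\<integral>x. complex_of_real (gauss (x::'a)) \<partial>lborel) = 1"
    using integral_gauss_cis[of "0::'a"] by auto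
  show "integrable lborel (gauss :: 'a \<Rightarrow> real)" using 1 by (simp add: complex_of_real_integrable_eq)
  show "(\<integral>x. gauss (x::'a) \<partial>lborel) = 1" using 2 by simp
qed

lemma measurable_gauss [measurable]: "gauss \<in> borel_measurable borel"
  using integrable_gauss by auto

text \<open>The multiplication formula: Fubini moves the transform from \<open>F\<close> to the
  Gaussian, which is its own transform up to scaling. As \<open>e\<close> tends to 0 the right side
  tends to \<open>F 0\<close>.\<close>

lemma integral_ft_gauss:
  fixes F :: "'a::euclidean_space \<Rightarrow> complex"
  assumes F: "nice F" and e: "e > 0"
  shows "(\<integral>\<xi>. ft F \<xi> * exp (- (norm ((2 * pi * e) *\<^sub>R \<xi>))\<^sup>2 / 2) \<partial>lborel) =
         (\<integral>w. gauss w * F (e *\<^sub>R w) \<partial>lborel)"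
proof -
  note [measurable] = measurable_nice[OF F]
  define E where "E \<xi> = complex_of_real (exp (- (norm ((2 * pi * e) *\<^sub>R \<xi>))\<^sup>2 / 2))" for \<xi> :: 'a
  define c where "c = (gauss (0::'a))"
  have c0: "c > 0" by (simp add: c_def gauss_pos)
  \<comment> \<open>The normalising constant occurs twice, once in \<open>gauss\<close> itself and
    once in writing the exponential through \<open>gauss\<close>; the powers of 2 pi are the
    Jacobian of the substitution.\<close>
  have c2: "c * c * (2 * pi) ^ DIM('a) = 1"
  proof -
    have "c = (1 / sqrt (2 * pi)) ^ DIM('a)" by (simp add: c_def gauss_altdef)
    then have "c * c * (2 * pi) ^ DIM('a) = (1 / sqrt (2 * pi) * (1 / sqrt (2 * pi)) * (2 * pi)) ^ DIM('a)"
      by (simp only: power_mult_distrib)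
    also have "1 / sqrt (2 * pi) * (1 / sqrt (2 * pi)) * (2 * pi) = 1"
      by (simp add: divide_simps)
    finally show ?thesis by simp
  qed
  have gc: "gauss x = c * exp (- (norm x)\<^sup>2 / 2)" for x :: 'a
    by (simp add: c_def gauss_altdef)
  have E: "E \<xi> = gauss ((2 * pi * e) *\<^sub>R \<xi>) / c" for \<xi>
    using c0 unfolding gc E_def by simp
  have gint: "integrable lborel (\<lambda>x::'a. complex_of_real (gauss x))"
    using integrable_gauss by (simp add: complex_of_real_integrable_eq)
  have Eint: "integrable lborel E"
    unfolding E using integrable_lborel_affine_iff[of "2 * pi * e" "\<lambda>x::'a. complex_of_real (gauss x)" 0] gint e
    by simp
  note [measurable] = borel_measurable_integrable[OF Eint]
  have inner: "(\<integral>\<xi>. E \<xi> * cis (- 2 * pi * (\<xi> \<bullet> x)) \<partial>lborel) = gauss ((1 / e) *\<^sub>R x) / e ^ DIM('a)" for x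
  proof -
    let ?u = "- (1 / e) *\<^sub>R x"
    have "(\<integral>w. gauss w * cis (?u \<bullet> w) \<partial>lborel)
        = \<bar>2 * pi * e\<bar> ^ DIM('a) *\<^sub>R (\<integral>\<xi>. gauss (0 + (2 * pi * e) *\<^sub>R \<xi>) * cis (?u \<bullet> (0 + (2 * pi * e) *\<^sub>R \<xi>)) \<partial>lborel)"
      by (rule lborel_integral_affine) (use e integral_gauss_cis(1)[of ?u] in auto)
    also have "(\<lambda>\<xi>. gauss (0 + (2 * pi * e) *\<^sub>R \<xi>) * cis (?u \<bullet> (0 + (2 * pi * e) *\<^sub>R \<xi>)))
        = (\<lambda>\<xi>. c * (E \<xi> * cis (- 2 * pi * (\<xi> \<bullet> x))))"
      using c0 e by (simp add: E fun_eq_iff inner_commute mult.assoc)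
    also have "(\<integral>w. gauss w * cis (?u \<bullet> w) \<partial>lborel) = gauss ((1 / e) *\<^sub>R x) / c"
      using integral_gauss_cis(2)[of ?u] c0 e by (simp add: gc)
    finally have *: "complex_of_real (gauss ((1 / e) *\<^sub>R x) / c)
        = of_real ((2 * pi) ^ DIM('a)) * (of_real (e ^ DIM('a)) * (of_real c * (\<integral>\<xi>. E \<xi> * cis (- 2 * pi * (\<xi> \<bullet> x)) \<partial>lborel)))"
      using e by (simp add: scaleR_conv_of_real power_mult_distrib)
    have c2': "complex_of_real (c * c * (2 * pi) ^ DIM('a)) = 1" by (simp only: c2 of_real_1)
    define I where "I = (\<integral>\<xi>. E \<xi> * cis (- 2 * pi * (\<xi> \<bullet> x)) \<partial>lborel)"
    have "complex_of_real (gauss ((1 / e) *\<^sub>R x)) = of_real c * complex_of_real (gauss ((1 / e) *\<^sub>R x) / c)"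
      using c0 by simp
    also have "\<dots> = complex_of_real (c * c * (2 * pi) ^ DIM('a)) * (of_real (e ^ DIM('a)) * I)"
      unfolding * I_def[symmetric] by (simp only: of_real_mult mult_ac)
    finally have "of_real (gauss ((1 / e) *\<^sub>R x)) = e ^ DIM('a) * I"
      unfolding c2' by simp
    then have "I = gauss ((1 / e) *\<^sub>R x) / e ^ DIM('a)" using e by simp
    then show ?thesis by (simp add: I_def)
  qed
  have Fint: "integrable lborel (\<lambda>x. F x * cis (- 2 * pi * (\<xi> \<bullet> x)))" for \<xi>
    by (rule integrable_mult_bounded[where B=1]) (use F in \<open>auto simp: nice_def\<close>)
  have int2: "integrable (lborel \<Otimes>\<^sub>M lborel) (\<lambda>(\<xi>, x). F x * cis (- 2 * pi * (\<xi> \<bullet> x)) * E \<xi>)"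
  proof (rule lborel_pair.Fubini_integrable)
    show "AE \<xi> in lborel. integrable lborel (\<lambda>x. case (\<xi>, x) of (\<xi>, x) \<Rightarrow> F x * cis (- 2 * pi * (\<xi> \<bullet> x)) * E \<xi>)"
      using Fint by simp
    show "integrable lborel (\<lambda>\<xi>. \<integral>x. norm (case (\<xi>, x) of (\<xi>, x) \<Rightarrow> F x * cis (- 2 * pi * (\<xi> \<bullet> x)) * E \<xi>) \<partial>lborel)"
      using Eint by (simp add: norm_mult)
  qed measurable
  have "(\<integral>\<xi>. ft F \<xi> * E \<xi> \<partial>lborel) = (\<integral>\<xi>. (\<integral>x. F x * cis (- 2 * pi * (\<xi> \<bullet> x)) * E \<xi> \<partial>lborel) \<partial>lborel)"
    by (simp add: ft_def)
  also have "\<dots> = (\<integral>x. (\<integral>\<xi>. F x * cis (- 2 * pi * (\<xi> \<bullet> x)) * E \<xi> \<partial>lborel) \<partial>lborel)"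
    by (rule lborel_pair.Fubini_integral[symmetric, OF int2])
  also have "\<dots> = (\<integral>x. F x * (gauss ((1 / e) *\<^sub>R x) / e ^ DIM('a)) \<partial>lborel)"
    using inner by (simp add: mult.assoc mult.commute[of "cis _"])
  also have "\<dots> = \<bar>e\<bar> ^ DIM('a) *\<^sub>R (\<integral>w. F (0 + e *\<^sub>R w) * (gauss ((1 / e) *\<^sub>R (0 + e *\<^sub>R w)) / e ^ DIM('a)) \<partial>lborel)"
  proof (rule lborel_integral_affine)
    obtain B where B: "\<And>x. norm (F x) \<le> B" using nice_boundE[OF F] by metis
    have "integrable lborel (\<lambda>x::'a. complex_of_real (gauss ((1 / e) *\<^sub>R x)))"
      using integrable_lborel_affine_iff[of "1 / e" "\<lambda>x::'a. complex_of_real (gauss x)" 0] gint e by simp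
    then have "integrable lborel (\<lambda>x::'a. complex_of_real (gauss ((1 / e) *\<^sub>R x)) * F x)"
      by (rule integrable_mult_bounded[where B=B]) (use B in auto)
    then show "integrable lborel (\<lambda>x. F x * (gauss ((1 / e) *\<^sub>R x) / e ^ DIM('a)))"
      by (simp add: mult.commute)
  qed (use e in auto)
  also have "\<dots> = (\<integral>w. gauss w * F (e *\<^sub>R w) \<partial>lborel)"
    using e by (simp add: mult.commute scaleR_conv_of_real)
  finally show ?thesis by (simp add: E_def)
qed

theorem plancherel:
  fixes f :: "'a::euclidean_space \<Rightarrow> complex"
  assumes f: "nice f"
  shows "(\<integral>\<^sup>+\<xi>. (norm (ft f \<xi>))\<^sup>2 \<partial>lborel) = (\<integral>\<^sup>+x. (norm (f x))\<^sup>2 \<partial>lborel)"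
proof -
  note [measurable] = measurable_nice[OF f]
  obtain B where B: "B > 0" "\<And>x. norm (f x) \<le> B" using nice_boundE[OF f] by metis
  \<comment> \<open>The autocorrelation \<open>F\<close> has transform \<open>\<bar>ft f\<bar>\<^sup>2\<close> and value \<open>\<integral>\<bar>f\<bar>\<^sup>2\<close> at 0, so inversion at 0 suffices.\<close>
  define F where "F = conv lborel (\<lambda>x. cnj (f x)) uminus f"
  have cint: "integrable lborel (\<lambda>x. cnj (f x))" using f by (simp add: nice_def)
  have F: "nice F" unfolding F_def by (intro nice_conv f cint sigma_finite_lborel) auto
  note [measurable] = measurable_nice[OF F]
  obtain K where K: "K > 0" "\<And>x. norm (F x) \<le> K" using nice_boundE[OF F] by metis
  have ftF: "ft F \<xi> = (norm (ft f \<xi>))\<^sup>2" for \<xi>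
  proof -
    have "(\<integral>y. cnj (f y) * cis (- 2 * pi * (\<xi> \<bullet> - y)) \<partial>lborel) = cnj (ft f \<xi>)"
    proof -
      have "integrable lborel (\<lambda>x. f x * cis (- 2 * pi * (\<xi> \<bullet> x)))"
        by (rule integrable_mult_bounded[where B=1]) (use f in \<open>auto simp: nice_def\<close>)
      from integral_bounded_linear[OF bounded_linear_cnj this] show ?thesis
        by (simp add: ft_def cis_cnj)
    qed
    then have "ft F \<xi> = cnj (ft f \<xi>) * ft f \<xi>"
      unfolding F_def by (subst ft_conv) (use f cint in \<open>simp_all add: sigma_finite_lborel nice_def\<close>)
    then show ?thesis using complex_norm_square[of "ft f \<xi>"] by (simp add: mult.commute)
  qed
  have [measurable]: "ft f \<in> borel_measurable borel" unfolding ft_def[abs_def] by measurable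
  have f2int: "integrable lborel (\<lambda>x. (norm (f x))\<^sup>2)"
  proof (rule Bochner_Integration.integrable_bound)
    show "integrable lborel (\<lambda>x. B * norm (f x))" using f by (simp add: nice_def)
    show "AE x in lborel. norm ((norm (f x))\<^sup>2) \<le> norm (B * norm (f x))"
      using B by (intro AE_I2) (auto simp: power2_eq_square abs_mult intro!: mult_right_mono)
  qed measurable
  have F0: "F 0 = (\<integral>x. (norm (f x))\<^sup>2 \<partial>lborel)"
  proof -
    have "cnj (f y) * f (0 - - y) = complex_of_real ((norm (f y))\<^sup>2)" for y
      using complex_norm_square[of "f y"] by (simp add: mult.commute)
    then show ?thesis unfolding F_def conv_def by (simp only: integral_complex_of_real)
  qed
  define e where "e n = 1 / (real n + 1)" for n
  have e: "e n > 0" for n by (simp add: e_def)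
  define G where "G n \<xi> = exp (- (norm ((2 * pi * e n) *\<^sub>R \<xi>))\<^sup>2 / 2)" for n and \<xi> :: 'a
  have [measurable]: "G n \<in> borel_measurable borel" for n unfolding G_def by measurable
  have e0: "e \<longlonglongrightarrow> 0" unfolding e_def by real_asymp
  have lim1: "(\<lambda>n. \<integral>\<xi>. ft F \<xi> * G n \<xi> \<partial>lborel) \<longlonglongrightarrow> F 0"
  proof -
    have "(\<lambda>n. \<integral>w. gauss w * F (e n *\<^sub>R w) \<partial>lborel) \<longlonglongrightarrow> (\<integral>w. gauss (w::'a) * F 0 \<partial>lborel)"
    proof (rule integral_dominated_convergence[where w="\<lambda>w. gauss w * K"])
      show "integrable lborel (\<lambda>w::'a. gauss w * K)" using integrable_gauss[where 'a='a] by simp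
      have cont: "isCont F 0" using F by (auto simp: nice_def continuous_on_eq_continuous_at)
      show "AE w in lborel. (\<lambda>n. gauss w * F (e n *\<^sub>R w)) \<longlonglongrightarrow> gauss w * F 0"
        by (intro AE_I2 tendsto_intros isCont_tendsto_compose[OF cont])
           (use tendsto_scaleR[OF e0 tendsto_const] in auto)
      show "AE w in lborel. norm (gauss w * F (e n *\<^sub>R w)) \<le> gauss w * K" for n
        by (intro AE_I2) (auto simp: norm_mult intro!: mult_left_mono K)
    qed measurable
    also have "(\<integral>w. gauss (w::'a) * F 0 \<partial>lborel) = F 0"
      using integral_gauss[where 'a='a] by simp
    also have "(\<lambda>n. \<integral>w. gauss w * F (e n *\<^sub>R w) \<partial>lborel) = (\<lambda>n. \<integral>\<xi>. ft F \<xi> * G n \<xi> \<partial>lborel)"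
      unfolding G_def using integral_ft_gauss[OF F e] by simp
    finally show ?thesis .
  qed
  have Gint: "integrable lborel (G n)" for n
  proof -
    have "integrable lborel (\<lambda>\<xi>::'a. gauss (0 + (2 * pi * e n) *\<^sub>R \<xi>))"
      by (subst integrable_lborel_affine_iff) (use e[of n] integrable_gauss in auto)
    then show ?thesis unfolding G_def[abs_def] by (simp add: gauss_altdef)
  qed
  obtain D where D: "\<And>\<xi>. norm (ft f \<xi>) \<le> D"
  proof
    show "norm (ft f \<xi>) \<le> (\<integral>x. norm (f x) \<partial>lborel)" for \<xi>
      unfolding ft_def using integral_norm_bound[of lborel "\<lambda>x. f x * cis (- 2 * pi * (\<xi> \<bullet> x))"]
      by (simp add: norm_mult)
  qed
  have int: "integrable lborel (\<lambda>\<xi>. (norm (ft f \<xi>))\<^sup>2 * G n \<xi>)" for n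
  proof (rule Bochner_Integration.integrable_bound)
    show "integrable lborel (\<lambda>\<xi>. D\<^sup>2 * G n \<xi>)" using Gint by simp
    show "AE \<xi> in lborel. norm ((norm (ft f \<xi>))\<^sup>2 * G n \<xi>) \<le> norm (D\<^sup>2 * G n \<xi>)"
      by (intro AE_I2) (auto simp: abs_mult G_def intro!: mult_right_mono power_mono D)
  qed measurable
  have lim2: "(\<lambda>n. \<integral>\<xi>. (norm (ft f \<xi>))\<^sup>2 * G n \<xi> \<partial>lborel) \<longlonglongrightarrow> (\<integral>x. (norm (f x))\<^sup>2 \<partial>lborel)"
  proof -
    have "(\<integral>\<xi>. ft F \<xi> * G n \<xi> \<partial>lborel) = complex_of_real (\<integral>\<xi>. (norm (ft f \<xi>))\<^sup>2 * G n \<xi> \<partial>lborel)" for n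
      unfolding ftF by (subst integral_complex_of_real[symmetric]) simp
    then show ?thesis using lim1 by (simp only: F0 tendsto_of_real_iff)
  qed
  have "(\<lambda>n. \<integral>\<^sup>+\<xi>. ennreal ((norm (ft f \<xi>))\<^sup>2 * G n \<xi>) \<partial>lborel) \<longlonglongrightarrow> (\<integral>\<^sup>+x. (norm (f x))\<^sup>2 \<partial>lborel)"
    using lim2 int f2int by (subst (1 2) nn_integral_eq_integral) (auto simp: G_def intro!: tendsto_ennrealI)
  \<comment> \<open>The Gaussian weights increase to 1 as \<open>e n\<close> decreases, so monotone
    convergence applies on this side; finiteness of the integral of the squared transform is thus a
    result of the argument and not an input.\<close>
  moreover have "(\<lambda>n. \<integral>\<^sup>+\<xi>. ennreal ((norm (ft f \<xi>))\<^sup>2 * G n \<xi>) \<partial>lborel) \<longlonglongrightarrow> (\<integral>\<^sup>+\<xi>. (norm (ft f \<xi>))\<^sup>2 \<partial>lborel)"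
  proof (rule nn_integral_LIMSEQ)
    have "e n \<le> e m" if "m \<le> n" for m n using that by (simp add: e_def field_simps)
    then show "incseq (\<lambda>n \<xi>. ennreal ((norm (ft f \<xi>))\<^sup>2 * G n \<xi>))"
      unfolding incseq_def le_fun_def G_def norm_scaleR power_mult_distrib
      by (intro allI impI ennreal_leI mult_left_mono)
         (auto simp: power_mult_distrib intro!: mult_right_mono mult_left_mono power_mono e less_imp_le[OF e])
    fix \<xi> :: 'a
    have "(\<lambda>n. (norm (ft f \<xi>))\<^sup>2 * G n \<xi>) \<longlonglongrightarrow> (norm (ft f \<xi>))\<^sup>2 * exp (- (norm ((2 * pi * 0) *\<^sub>R \<xi>))\<^sup>2 / 2)"
      unfolding G_def by (intro tendsto_intros e0) auto
    then show "(\<lambda>n. ennreal ((norm (ft f \<xi>))\<^sup>2 * G n \<xi>)) \<longlonglongrightarrow> ennreal ((norm (ft f \<xi>))\<^sup>2)"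
      by (intro tendsto_ennrealI) simp
  qed measurable
  ultimately show ?thesis by (rule LIMSEQ_unique[symmetric])
qed

subsection \<open>The Hardy--Littlewood maximal inequality on \<open>L\<^sup>2\<close>\<close>

text \<open>Normalised by \<open>\<rho> ^ DIM('a)\<close> instead of the volume of the ball, hence
  the factors \<open>unit_ball_vol\<close> in the bounds. Values in \<open>ennreal\<close> make
  Tonelli's theorem directly applicable.\<close>

definition ball_kernel :: "real \<Rightarrow> 'a::euclidean_space \<Rightarrow> 'a \<Rightarrow> ennreal" where
  "ball_kernel \<rho> x z = ennreal (1 / \<rho> ^ DIM('a)) * (if dist x z \<le> \<rho> then 1 else 0)"

definition avg :: "real \<Rightarrow> ('a::euclidean_space \<Rightarrow> ennreal) \<Rightarrow> 'a \<Rightarrow> ennreal" where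
  "avg \<rho> f x = (\<integral>\<^sup>+z. ball_kernel \<rho> x z * f z \<partial>lborel)"

lemma measurable_ball_kernel [measurable]:
  assumes [measurable]: "r \<in> borel_measurable M" "f \<in> borel_measurable M" "g \<in> borel_measurable M"
  shows "(\<lambda>x. ball_kernel (r x) (f x) (g x)) \<in> borel_measurable M"
  unfolding ball_kernel_def by measurable

lemma measurable_avg [measurable]:
  assumes [measurable]: "r \<in> borel_measurable M" "g \<in> borel_measurable M" "f \<in> borel_measurable borel"
  shows "(\<lambda>x. avg (r x) f (g x)) \<in> borel_measurable M"
  unfolding avg_def by measurable

lemma ball_kernel_commute: "ball_kernel \<rho> x z = ball_kernel \<rho> z x"
  by (simp add: ball_kernel_def dist_commute)

lemma nn_integral_ball_kernel:
  fixes x :: "'a::euclidean_space"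
  assumes "\<rho> > 0"
  shows "(\<integral>\<^sup>+z. ball_kernel \<rho> x z \<partial>lborel) = ennreal (unit_ball_vol (real DIM('a)))"
proof -
  have "(\<integral>\<^sup>+z. ball_kernel \<rho> x z \<partial>lborel) = (\<integral>\<^sup>+z. ennreal (1 / \<rho> ^ DIM('a)) * indicator (cball x \<rho>) z \<partial>lborel)"
    by (intro nn_integral_cong) (auto simp: ball_kernel_def indicator_def)
  also have "\<dots> = ennreal (1 / \<rho> ^ DIM('a)) * emeasure lborel (cball x \<rho>)"
    by (rule nn_integral_cmult_indicator) simp
  also have "\<dots> = ennreal (unit_ball_vol (real DIM('a)))"
    using assms by (simp add: emeasure_cball ennreal_mult[symmetric] unit_ball_vol_nonneg)
  finally show ?thesis .
qed

text \<open>If the two balls meet, the centres are within twice the larger radius. The wider kernel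
  is constant on its ball and becomes a kernel of doubled radius between the centres; the narrower
  one integrates out. Since either may be the wider, both terms appear.\<close>

lemma nn_integral_ball_kernel_mult_le:
  fixes x y :: "'a::euclidean_space"
  assumes "0 < \<rho>" "0 < \<rho>'"
  shows "(\<integral>\<^sup>+z. ball_kernel \<rho> x z * ball_kernel \<rho>' y z \<partial>lborel)
    \<le> ennreal (2 ^ DIM('a) * unit_ball_vol (real DIM('a))) * (ball_kernel (2 * \<rho>) x y + ball_kernel (2 * \<rho>') y x)"
proof -
  have *: "(\<integral>\<^sup>+z. ball_kernel \<rho> x z * ball_kernel \<rho>' y z \<partial>lborel)
    \<le> ennreal (2 ^ DIM('a) * unit_ball_vol (real DIM('a))) * ball_kernel (2 * \<rho>) x y"
    if "0 < \<rho>'" "\<rho>' \<le> \<rho>" for \<rho> \<rho>' and x y :: 'a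
  proof -
    have "ball_kernel \<rho> x z * ball_kernel \<rho>' y z
        \<le> ennreal (2 ^ DIM('a)) * ball_kernel (2 * \<rho>) x y * ball_kernel \<rho>' y z" for z
    proof (cases "dist x z \<le> \<rho> \<and> dist y z \<le> \<rho>'")
      case True
      then have "dist x y \<le> 2 * \<rho>" using that dist_triangle2[of x y z] by simp
      then show ?thesis using True that
        by (simp add: ball_kernel_def ennreal_mult[symmetric] power_mult_distrib)
    qed (auto simp: ball_kernel_def)
    then have "(\<integral>\<^sup>+z. ball_kernel \<rho> x z * ball_kernel \<rho>' y z \<partial>lborel)
      \<le> (\<integral>\<^sup>+z. ennreal (2 ^ DIM('a)) * ball_kernel (2 * \<rho>) x y * ball_kernel \<rho>' y z \<partial>lborel)"
      by (intro nn_integral_mono)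
    also have "\<dots> = ennreal (2 ^ DIM('a)) * ball_kernel (2 * \<rho>) x y * ennreal (unit_ball_vol (real DIM('a)))"
      by (subst nn_integral_cmult) (use that in \<open>simp_all add: nn_integral_ball_kernel\<close>)
    finally show ?thesis by (simp add: ennreal_mult unit_ball_vol_nonneg mult_ac)
  qed
  show ?thesis
  proof (cases "\<rho>' \<le> \<rho>")
    case True
    show ?thesis by (rule order_trans[OF *[OF assms(2) True]]) (simp add: ring_distribs)
  next
    case False
    have "(\<integral>\<^sup>+z. ball_kernel \<rho> x z * ball_kernel \<rho>' y z \<partial>lborel)
      \<le> ennreal (2 ^ DIM('a) * unit_ball_vol (real DIM('a))) * ball_kernel (2 * \<rho>') y x"
      using *[OF assms(1), of \<rho>' y x] False by (simp add: mult.commute)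
    then show ?thesis by (rule order_trans) (simp add: ring_distribs)
  qed
qed

text \<open>Schur's test for a symmetric kernel of mass \<open>unit_ball_vol\<close>: one factor
  comes from Cauchy--Schwarz with the square root \<open>s\<close> of the kernel, the other from
  Tonelli.\<close>

lemma L2_avg_le:
  fixes f :: "'a::euclidean_space \<Rightarrow> ennreal"
  assumes [measurable]: "f \<in> borel_measurable borel" and "\<rho> > 0"
  shows "(\<integral>\<^sup>+x. (avg \<rho> f x)\<^sup>2 \<partial>lborel) \<le> ennreal ((unit_ball_vol (real DIM('a)))\<^sup>2) * (\<integral>\<^sup>+x. (f x)\<^sup>2 \<partial>lborel)"
proof -
  define w where "w = ennreal (unit_ball_vol (real DIM('a)))"
  define s where "s x z = ennreal (sqrt (1 / \<rho> ^ DIM('a))) * (if dist x z \<le> \<rho> then 1 else 0)" for x z :: 'a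
  have [measurable]: "(\<lambda>z. s x z) \<in> borel_measurable borel" for x unfolding s_def by measurable
  have ss: "s x z * s x z = ball_kernel \<rho> x z" for x z
    using assms(2) by (simp add: s_def ball_kernel_def ennreal_mult[symmetric])
  have pt: "(avg \<rho> f x)\<^sup>2 \<le> w * (\<integral>\<^sup>+z. ball_kernel \<rho> x z * (f z)\<^sup>2 \<partial>lborel)" for x
  proof -
    have "avg \<rho> f x = (\<integral>\<^sup>+z. s x z * (s x z * f z) \<partial>lborel)"
      by (simp add: avg_def ss mult.assoc[symmetric])
    then have "(avg \<rho> f x)\<^sup>2 \<le> (\<integral>\<^sup>+z. (s x z)\<^sup>2 \<partial>lborel) * (\<integral>\<^sup>+z. (s x z * f z)\<^sup>2 \<partial>lborel)"
      by (simp only:) (rule Cauchy_Schwarz_nn_integral; measurable)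
    then show ?thesis
      using nn_integral_ball_kernel[OF assms(2), of x]
      by (simp add: power_mult_distrib power2_eq_square[of "s _ _"] ss w_def)
  qed
  have "(\<integral>\<^sup>+x. (avg \<rho> f x)\<^sup>2 \<partial>lborel) \<le> (\<integral>\<^sup>+x. w * (\<integral>\<^sup>+z. ball_kernel \<rho> x z * (f z)\<^sup>2 \<partial>lborel) \<partial>lborel)"
    by (intro nn_integral_mono pt)
  also have "\<dots> = w * (\<integral>\<^sup>+z. (\<integral>\<^sup>+x. ball_kernel \<rho> x z * (f z)\<^sup>2 \<partial>lborel) \<partial>lborel)"
  proof -
    have "(\<integral>\<^sup>+x. (\<integral>\<^sup>+z. ball_kernel \<rho> x z * (f z)\<^sup>2 \<partial>lborel) \<partial>lborel)
        = (\<integral>\<^sup>+z. (\<integral>\<^sup>+x. ball_kernel \<rho> x z * (f z)\<^sup>2 \<partial>lborel) \<partial>lborel)"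
      by (rule lborel_pair.Fubini') simp
    then show ?thesis by (simp add: nn_integral_cmult)
  qed
  also have "\<dots> = w * (\<integral>\<^sup>+z. w * (f z)\<^sup>2 \<partial>lborel)"
    using nn_integral_ball_kernel[OF assms(2), where 'a='a]
    by (simp add: nn_integral_multc ball_kernel_commute[of \<rho> _ "_::'a"] w_def)
  also have "\<dots> = w * w * (\<integral>\<^sup>+z. (f z)\<^sup>2 \<partial>lborel)"
    by (simp add: nn_integral_cmult mult.assoc)
  also have "w * w = ennreal ((unit_ball_vol (real DIM('a)))\<^sup>2)"
    by (simp add: w_def ennreal_mult[symmetric] power2_eq_square unit_ball_vol_nonneg)
  finally show ?thesis .
qed

text \<open>With the radius a fixed measurable function of the point, the average is a linear
  operator T, and \<open>S\<close> is its adjoint applied to \<open>g\<close>. Pairing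
  \<open>g\<close> with T f and using Cauchy--Schwarz leaves the quadratic form of T T* at
  \<open>g\<close>, whose kernel is an integral of two ball kernels and hence again an averaging
  kernel, of twice the radius.\<close>

lemma avg_linearised_TTstar:
  fixes f :: "'a::euclidean_space \<Rightarrow> ennreal"
  assumes f[measurable]: "f \<in> borel_measurable borel" and r[measurable]: "r \<in> borel_measurable borel"
    and r_pos: "\<And>x. r x > 0" and g_def: "g = (\<lambda>x. avg (r x) f x)"
  shows "(\<integral>\<^sup>+x. (g x)\<^sup>2 \<partial>lborel)\<^sup>2 \<le> (\<integral>\<^sup>+x. (f x)\<^sup>2 \<partial>lborel) *
     (ennreal (2 * 2 ^ DIM('a) * unit_ball_vol (real DIM('a))) * (\<integral>\<^sup>+x. g x * avg (2 * r x) g x \<partial>lborel))"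
proof -
  have g[measurable]: "g \<in> borel_measurable borel" unfolding g_def by measurable
  define U where "U x z = g x * ball_kernel (r x) x z" for x z
  have [measurable]: "case_prod U \<in> borel_measurable (lborel \<Otimes>\<^sub>M lborel)" unfolding U_def by measurable
  define S where "S z = (\<integral>\<^sup>+x. U x z \<partial>lborel)" for z
  have [measurable]: "S \<in> borel_measurable borel" unfolding S_def U_def by measurable
  define D where "D = ennreal (2 ^ DIM('a) * unit_ball_vol (real DIM('a)))"
  have "(\<integral>\<^sup>+x. (g x)\<^sup>2 \<partial>lborel) = (\<integral>\<^sup>+x. (\<integral>\<^sup>+z. U x z * f z \<partial>lborel) \<partial>lborel)"
  proof (rule nn_integral_cong)
    fix x
    have "(g x)\<^sup>2 = g x * (\<integral>\<^sup>+z. ball_kernel (r x) x z * f z \<partial>lborel)"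
      by (simp add: power2_eq_square g_def avg_def)
    also have "\<dots> = (\<integral>\<^sup>+z. U x z * f z \<partial>lborel)"
      by (subst nn_integral_cmult[symmetric]) (simp_all add: U_def mult.assoc)
    finally show "(g x)\<^sup>2 = (\<integral>\<^sup>+z. U x z * f z \<partial>lborel)" .
  qed
  also have "\<dots> = (\<integral>\<^sup>+z. (\<integral>\<^sup>+x. U x z * f z \<partial>lborel) \<partial>lborel)"
    by (rule lborel_pair.Fubini') (simp add: U_def)
  also have "\<dots> = (\<integral>\<^sup>+z. f z * S z \<partial>lborel)"
    unfolding S_def by (intro nn_integral_cong) (subst nn_integral_cmult[symmetric], simp_all add: U_def mult.commute)
  finally have "(\<integral>\<^sup>+x. (g x)\<^sup>2 \<partial>lborel)\<^sup>2 \<le> (\<integral>\<^sup>+z. (f z)\<^sup>2 \<partial>lborel) * (\<integral>\<^sup>+z. (S z)\<^sup>2 \<partial>lborel)"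
    by (simp only:) (rule Cauchy_Schwarz_nn_integral; measurable)
  moreover have "(\<integral>\<^sup>+z. (S z)\<^sup>2 \<partial>lborel) \<le> 2 * D * (\<integral>\<^sup>+x. g x * avg (2 * r x) g x \<partial>lborel)"
  proof -
    define V where "V x y = g x * g y * ball_kernel (2 * r x) x y" for x y
    have V[measurable]: "case_prod V \<in> borel_measurable (lborel \<Otimes>\<^sub>M lborel)" unfolding V_def by measurable
    have Vint: "(\<integral>\<^sup>+x. (\<integral>\<^sup>+y. V x y \<partial>lborel) \<partial>lborel) = (\<integral>\<^sup>+x. g x * avg (2 * r x) g x \<partial>lborel)"
      unfolding avg_def V_def
      by (intro nn_integral_cong, subst nn_integral_cmult[symmetric]) (simp_all add: mult_ac)
    have S2: "(S z)\<^sup>2 = (\<integral>\<^sup>+x. (\<integral>\<^sup>+y. U x z * U y z \<partial>lborel) \<partial>lborel)" for z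
      unfolding power2_eq_square
      by (subst nn_integral_cmult, simp add: U_def) (simp add: S_def[symmetric], simp add: nn_integral_multc U_def S_def)
    have "(\<integral>\<^sup>+z. (S z)\<^sup>2 \<partial>lborel) = (\<integral>\<^sup>+x. (\<integral>\<^sup>+z. (\<integral>\<^sup>+y. U x z * U y z \<partial>lborel) \<partial>lborel) \<partial>lborel)"
      unfolding S2 by (rule lborel_pair.Fubini') (simp add: U_def)
    also have "\<dots> = (\<integral>\<^sup>+x. (\<integral>\<^sup>+y. (\<integral>\<^sup>+z. U x z * U y z \<partial>lborel) \<partial>lborel) \<partial>lborel)"
      by (intro nn_integral_cong lborel_pair.Fubini') (simp add: U_def)
    also have "\<dots> \<le> (\<integral>\<^sup>+x. (\<integral>\<^sup>+y. D * (V x y + V y x) \<partial>lborel) \<partial>lborel)"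
    proof (intro nn_integral_mono)
      fix x y
      have "(\<integral>\<^sup>+z. U x z * U y z \<partial>lborel) = g x * g y * (\<integral>\<^sup>+z. ball_kernel (r x) x z * ball_kernel (r y) y z \<partial>lborel)"
        by (subst nn_integral_cmult[symmetric]) (simp_all add: U_def mult_ac)
      also have "\<dots> \<le> g x * g y * (D * (ball_kernel (2 * r x) x y + ball_kernel (2 * r y) y x))"
        unfolding D_def by (intro mult_left_mono nn_integral_ball_kernel_mult_le r_pos) auto
      also have "\<dots> = D * (V x y + V y x)" by (simp add: V_def ring_distribs mult_ac)
      finally show "(\<integral>\<^sup>+z. U x z * U y z \<partial>lborel) \<le> D * (V x y + V y x)" .
    qed
    also have "\<dots> = D * ((\<integral>\<^sup>+x. (\<integral>\<^sup>+y. V x y \<partial>lborel) \<partial>lborel) + (\<integral>\<^sup>+x. (\<integral>\<^sup>+y. V y x \<partial>lborel) \<partial>lborel))"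
      by (simp add: nn_integral_cmult nn_integral_add V_def)
    \<comment> \<open>The two halves differ only by the names of the variables, which accounts for
      the factor 2.\<close>
    also have "(\<integral>\<^sup>+x. (\<integral>\<^sup>+y. V y x \<partial>lborel) \<partial>lborel) = (\<integral>\<^sup>+x. (\<integral>\<^sup>+y. V x y \<partial>lborel) \<partial>lborel)"
      by (rule lborel_pair.Fubini') (simp add: V_def)
    finally show ?thesis unfolding Vint mult_2 by (simp only: distrib_left distrib_right)
  qed
  moreover have "2 * D = ennreal (2 * 2 ^ DIM('a) * unit_ball_vol (real DIM('a)))"
    by (simp add: D_def ennreal_mult unit_ball_vol_nonneg mult.assoc)
  ultimately show ?thesis by (metis (no_types, lifting) mult_left_mono order_trans zero_le)
qed

text \<open>With finitely many radii the maximising one is selected by comparing measurable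
  functions one at a time; this linearises the maximum.\<close>

lemma measurable_argmax_avg:
  fixes f :: "'a::euclidean_space \<Rightarrow> ennreal"
  assumes f[measurable]: "f \<in> borel_measurable borel" and "finite R" "R \<noteq> {}"
  shows "\<exists>r\<in>borel_measurable borel. \<forall>x. r x \<in> R \<and> (\<forall>\<rho>\<in>R. avg \<rho> f x \<le> avg (r x) f x)"
  using assms(2,3)
proof (induction R rule: finite_ne_induct)
  case (singleton \<rho>)
  show ?case by (intro bexI[of _ "\<lambda>_. \<rho>"]) auto
next
  case (insert \<rho> R)
  then obtain r where r[measurable]: "r \<in> borel_measurable borel"
    and rR: "\<And>x. r x \<in> R" "\<And>x \<rho>. \<rho> \<in> R \<Longrightarrow> avg \<rho> f x \<le> avg (r x) f x" by blast
  show ?case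
  proof (intro bexI[of _ "\<lambda>x. if avg (r x) f x \<le> avg \<rho> f x then \<rho> else r x"] allI conjI ballI)
    show "(\<lambda>x. if avg (r x) f x \<le> avg \<rho> f x then \<rho> else r x) \<in> borel_measurable borel" by measurable
    show "(if avg (r x) f x \<le> avg \<rho> f x then \<rho> else r x) \<in> insert \<rho> R" for x using rR by auto
    show "avg \<rho>' f x \<le> avg (if avg (r x) f x \<le> avg \<rho> f x then \<rho> else r x) f x" if "\<rho>' \<in> insert \<rho> R" for x \<rho>'
      using that rR(2)[of \<rho>' x] by (auto intro: order_trans)
  qed
qed

text \<open>A bootstrap on the constant. Adding up the single-scale bounds gives some admissible
  \<open>C\<close>, depending on \<open>n\<close>; the T T* inequality turns any admissible
  \<open>C\<close> into \<open>D * sqrt (C + w\<^sup>2)\<close>. The best constant therefore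
  satisfies a quadratic inequality free of \<open>n\<close>.\<close>

lemma finite_maximal_ineq:
  fixes f :: "'a::euclidean_space \<Rightarrow> ennreal" and n :: nat
  defines "D \<equiv> 2 * 2 ^ DIM('a) * unit_ball_vol (real DIM('a))" and "w \<equiv> unit_ball_vol (real DIM('a))"
  shows "f \<in> borel_measurable borel \<Longrightarrow>
    (\<integral>\<^sup>+x. (SUP k\<in>{- int n..int n}. avg (2 powr k) f x)\<^sup>2 \<partial>lborel)
      \<le> ennreal ((D + 1 + w\<^sup>2)\<^sup>2) * (\<integral>\<^sup>+x. (f x)\<^sup>2 \<partial>lborel)"
proof -
  define K where "K = {- int n..int n}"
  have K: "finite K" "K \<noteq> {}" by (auto simp: K_def)
  have D0: "D > 0" and w0: "w > 0" by (auto simp: D_def w_def)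
  define Mx where "Mx f x = (SUP k\<in>K. avg (2 powr k) f x)" for f and x :: 'a
  have Mx_meas[measurable]: "Mx f \<in> borel_measurable borel" if [measurable]: "f \<in> borel_measurable borel" for f
    unfolding Mx_def using K by measurable
  define valid where "valid C \<longleftrightarrow> (\<forall>f\<in>borel_measurable borel. (\<integral>\<^sup>+x. (Mx f x)\<^sup>2 \<partial>lborel) \<le> ennreal C * (\<integral>\<^sup>+x. (f x)\<^sup>2 \<partial>lborel))"
    for C :: real
  have valid_mono: "valid C'" if "valid C" "C \<le> C'" for C C'
    using that unfolding valid_def
    by (meson ennreal_leI mult_right_mono order_trans zero_le)
  have Mx_le: "(Mx f x)\<^sup>2 \<le> (\<Sum>k\<in>K. (avg (2 powr k) f x)\<^sup>2)" for f x
  proof -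
    have "Mx f x \<in> (\<lambda>k. avg (2 powr k) f x) ` K"
      unfolding Mx_def using K by (subst Max_Sup[symmetric]) (auto intro!: Max_in)
    then obtain k where "k \<in> K" "Mx f x = avg (2 powr k) f x" by auto
    then show ?thesis using K by (auto intro!: member_le_sum)
  qed
  have valid0: "valid (card K * w\<^sup>2)"
    unfolding valid_def
  proof
    fix f :: "'a \<Rightarrow> ennreal" assume [measurable]: "f \<in> borel_measurable borel"
    have "(\<integral>\<^sup>+x. (Mx f x)\<^sup>2 \<partial>lborel) \<le> (\<integral>\<^sup>+x. (\<Sum>k\<in>K. (avg (2 powr k) f x)\<^sup>2) \<partial>lborel)"
      by (intro nn_integral_mono Mx_le)
    also have "\<dots> = (\<Sum>k\<in>K. \<integral>\<^sup>+x. (avg (2 powr k) f x)\<^sup>2 \<partial>lborel)"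
      by (rule nn_integral_sum) measurable
    also have "\<dots> \<le> (\<Sum>k\<in>K. ennreal (w\<^sup>2) * (\<integral>\<^sup>+x. (f x)\<^sup>2 \<partial>lborel))"
      unfolding w_def by (intro sum_mono L2_avg_le) auto
    also have "\<dots> = ennreal (card K * w\<^sup>2) * (\<integral>\<^sup>+x. (f x)\<^sup>2 \<partial>lborel)"
      by (simp add: ennreal_mult ennreal_of_nat_eq_real_of_nat mult.assoc)
    finally show "(\<integral>\<^sup>+x. (Mx f x)\<^sup>2 \<partial>lborel) \<le> ennreal (card K * w\<^sup>2) * (\<integral>\<^sup>+x. (f x)\<^sup>2 \<partial>lborel)" .
  qed
  \<comment> \<open>The doubled radius is again dyadic. It stays in the window \<open>K\<close>
    unless it is \<open>2 powr (n + 1)\<close>, and that single radius is paid for by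
    \<open>w\<^sup>2\<close> through \<open>L2_avg_le\<close>.\<close>
  have step: "valid (D * sqrt (C + w\<^sup>2))" if C: "valid C" "C \<ge> 0" for C
    unfolding valid_def
  proof
    fix f :: "'a \<Rightarrow> ennreal" assume f[measurable]: "f \<in> borel_measurable borel"
    define F where "F = (\<integral>\<^sup>+x. (f x)\<^sup>2 \<partial>lborel)"
    define G where "G = (\<integral>\<^sup>+x. (Mx f x)\<^sup>2 \<partial>lborel)"
    have GF: "G \<le> ennreal C * F" using C(1) f unfolding valid_def G_def F_def by blast
    have "\<exists>r\<in>borel_measurable borel. \<forall>x. r x \<in> (\<lambda>k::int. 2 powr k) ` K \<and>
        (\<forall>\<rho>\<in>(\<lambda>k::int. 2 powr k) ` K. avg \<rho> f x \<le> avg (r x) f x)"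
      by (rule measurable_argmax_avg) (use K in auto)
    then obtain r where r[measurable]: "r \<in> borel_measurable borel"
      and rK: "\<And>x. r x \<in> (\<lambda>k::int. 2 powr k) ` K" "\<And>x k. k \<in> K \<Longrightarrow> avg (2 powr k) f x \<le> avg (r x) f x"
      by blast
    define g where "g = (\<lambda>x. avg (r x) f x)"
    have r_pos: "r x > 0" for x using rK(1)[of x] by auto
    have Mg: "Mx f = g"
    proof
      fix x
      obtain k where "k \<in> K" "r x = 2 powr k" using rK(1)[of x] by auto
      then show "Mx f x = g x"
        unfolding Mx_def g_def by (intro antisym SUP_least rK(2) SUP_upper2[of k]) auto
    qed
    have [measurable]: "g \<in> borel_measurable borel" unfolding g_def by measurable
    define h where "h x = avg (2 * r x) g x" for x
    have [measurable]: "h \<in> borel_measurable borel" unfolding h_def by measurable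
    have h2: "(h x)\<^sup>2 \<le> (Mx g x)\<^sup>2 + (avg (2 powr (n + 1)) g x)\<^sup>2" for x
    proof -
      obtain k where k: "k \<in> K" "r x = 2 powr k" using rK(1)[of x] by auto
      then have hk: "h x = avg (2 powr (k + 1)) g x" by (simp add: h_def powr_add mult.commute)
      show ?thesis
      proof (cases "k = int n")
        case True
        then show ?thesis by (simp add: hk add.commute)
      next
        case False
        then have "k + 1 \<in> K" using k by (auto simp: K_def)
        then have "h x \<le> Mx g x" unfolding hk Mx_def by (intro SUP_upper2[of "k + 1"]) auto
        then show ?thesis by (intro add_increasing2 power_mono) auto
      qed
    qed
    have "(\<integral>\<^sup>+x. (h x)\<^sup>2 \<partial>lborel) \<le> (\<integral>\<^sup>+x. (Mx g x)\<^sup>2 + (avg (2 powr (n + 1)) g x)\<^sup>2 \<partial>lborel)"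
      by (intro nn_integral_mono h2)
    also have "\<dots> = (\<integral>\<^sup>+x. (Mx g x)\<^sup>2 \<partial>lborel) + (\<integral>\<^sup>+x. (avg (2 powr (n + 1)) g x)\<^sup>2 \<partial>lborel)"
      by (rule nn_integral_add) measurable
    also have "\<dots> \<le> ennreal C * (\<integral>\<^sup>+x. (g x)\<^sup>2 \<partial>lborel) + ennreal (w\<^sup>2) * (\<integral>\<^sup>+x. (g x)\<^sup>2 \<partial>lborel)"
      unfolding w_def by (intro add_mono L2_avg_le C(1)[unfolded valid_def, rule_format]) auto
    also have "\<dots> = ennreal (C + w\<^sup>2) * G"
      using C(2) by (simp add: G_def Mg ring_distribs)
    finally have hG: "(\<integral>\<^sup>+x. (h x)\<^sup>2 \<partial>lborel) \<le> ennreal (C + w\<^sup>2) * G" .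
    have "(\<integral>\<^sup>+x. g x * h x \<partial>lborel)\<^sup>2 \<le> (\<integral>\<^sup>+x. (g x)\<^sup>2 \<partial>lborel) * (\<integral>\<^sup>+x. (h x)\<^sup>2 \<partial>lborel)"
      by (rule Cauchy_Schwarz_nn_integral) measurable
    also have "\<dots> \<le> G * (ennreal (C + w\<^sup>2) * G)"
      using hG by (auto simp: G_def Mg intro!: mult_left_mono)
    finally have gh: "(\<integral>\<^sup>+x. g x * h x \<partial>lborel)\<^sup>2 \<le> G * (ennreal (C + w\<^sup>2) * G)" .
    have GH: "G\<^sup>2 \<le> F * (ennreal D * (\<integral>\<^sup>+x. g x * h x \<partial>lborel))"
      unfolding G_def F_def Mg h_def D_def by (rule avg_linearised_TTstar[OF f r r_pos g_def])
    show "(\<integral>\<^sup>+x. (Mx f x)\<^sup>2 \<partial>lborel) \<le> ennreal (D * sqrt (C + w\<^sup>2)) * (\<integral>\<^sup>+x. (f x)\<^sup>2 \<partial>lborel)"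
    proof (cases "F = \<infinity> \<or> G = 0")
      case True
      have "D * sqrt (C + w\<^sup>2) > 0" using D0 w0 C(2) by (intro mult_pos_pos) (auto intro: add_nonneg_pos)
      then show ?thesis using True
        unfolding F_def[symmetric] G_def[symmetric] by (auto simp: ennreal_mult_top)
    next
      case False
      then obtain F' where F': "F = ennreal F'" "F' \<ge> 0" by (cases F) auto
      \<comment> \<open>The old constant, however bad, makes \<open>G\<close> finite; this permits
        the division by \<open>G\<close> at the end.\<close>
      have "G < \<infinity>" using GF by (rule order.strict_trans1) (auto simp: F' ennreal_mult[symmetric] C(2))
      then obtain G' where G': "G = ennreal G'" "G' > 0" using False by (cases G) (auto simp: ennreal_zero_less_top le_less)
      define H where "H = (\<integral>\<^sup>+x. g x * h x \<partial>lborel)"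
      have "H\<^sup>2 \<le> G * (ennreal (C + w\<^sup>2) * G)" using gh by (simp only: H_def)
      also have "\<dots> < \<infinity>" using G' by (auto simp: ennreal_mult_less_top)
      finally have "H\<^sup>2 < \<infinity>" .
      then obtain H' where H': "H = ennreal H'" "H' \<ge> 0" by (cases H) auto
      have "H'\<^sup>2 \<le> G' * ((C + w\<^sup>2) * G')"
        using gh G' H' C(2) unfolding H_def[symmetric]
        by (simp add: ennreal_mult[symmetric] ennreal_power ennreal_plus[symmetric] del: ennreal_plus)
      then have "H' \<le> sqrt ((C + w\<^sup>2) * G'\<^sup>2)" by (intro real_le_rsqrt) (simp add: power2_eq_square mult_ac)
      then have H'': "H' \<le> sqrt (C + w\<^sup>2) * G'" using G' by (simp add: real_sqrt_mult)
      have "G'\<^sup>2 \<le> F' * (D * H')"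
        using GH G' H' F' D0 unfolding H_def[symmetric] by (simp add: ennreal_mult[symmetric] ennreal_power)
      also have "\<dots> \<le> F' * (D * (sqrt (C + w\<^sup>2) * G'))"
        using H'' F' D0 by (intro mult_left_mono) auto
      finally have "G' * G' \<le> (D * sqrt (C + w\<^sup>2) * F') * G'" by (simp add: power2_eq_square mult_ac)
      then have "G' \<le> D * sqrt (C + w\<^sup>2) * F'" using G' by simp
      then show ?thesis using D0 C(2) F'
        unfolding F_def[symmetric] G_def[symmetric] F' G' by (simp add: ennreal_mult[symmetric])
    qed
  qed
  \<comment> \<open>The least admissible natural number replaces the infimum of the admissible
    constants; rounding up costs the summand 1 below.\<close>
  define N where "N = (LEAST N::nat. valid N)"
  have "valid (nat \<lceil>card K * w\<^sup>2\<rceil>)" by (rule valid_mono[OF valid0]) linarith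
  then have N: "valid N" unfolding N_def by (rule LeastI)
  define s where "s = sqrt (N + w\<^sup>2)"
  have "valid (nat \<lceil>D * s\<rceil>)" unfolding s_def by (rule valid_mono[OF step[OF N]]) (auto, linarith)
  then have "N \<le> nat \<lceil>D * s\<rceil>" unfolding N_def by (rule Least_le)
  moreover have "D * s \<ge> 0" using D0 by (simp add: s_def)
  ultimately have "N \<le> D * s + 1" by linarith
  moreover have s2: "s\<^sup>2 = N + w\<^sup>2" by (simp add: s_def)
  ultimately have s2_le: "s\<^sup>2 \<le> D * s + (1 + w\<^sup>2)" by simp
  have "s \<le> D + 1 + w\<^sup>2"
  proof (rule ccontr)
    assume "\<not> s \<le> D + 1 + w\<^sup>2"
    then have *: "s > D + 1 + w\<^sup>2" by simp
    then have s1: "s \<ge> 1" using D0 by (smt (verit) zero_le_power2)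
    have "D * s + (1 + w\<^sup>2) \<le> (D + 1 + w\<^sup>2) * s"
      using s1 mult_left_mono[OF s1, of "1 + w\<^sup>2"] by (simp add: ring_distribs)
    also have "\<dots> < s * s" using * s1 by (intro mult_strict_right_mono) auto
    finally show False using s2_le by (simp add: power2_eq_square)
  qed
  then have "s\<^sup>2 \<le> (D + 1 + w\<^sup>2)\<^sup>2" by (intro power_mono) (auto simp: s_def)
  then have "N \<le> (D + 1 + w\<^sup>2)\<^sup>2" using s2 by (smt (verit) zero_le_power2)
  then have "valid ((D + 1 + w\<^sup>2)\<^sup>2)" by (rule valid_mono[OF N])
  then show "f \<in> borel_measurable borel \<Longrightarrow>
    (\<integral>\<^sup>+x. (SUP k\<in>{- int n..int n}. avg (2 powr k) f x)\<^sup>2 \<partial>lborel)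
      \<le> ennreal ((D + 1 + w\<^sup>2)\<^sup>2) * (\<integral>\<^sup>+x. (f x)\<^sup>2 \<partial>lborel)"
    unfolding valid_def Mx_def K_def by blast
qed

lemma tendsto_power2_ennreal:
  fixes a :: ennreal
  assumes "(f \<longlongrightarrow> a) F"
  shows "((\<lambda>x. (f x)\<^sup>2) \<longlongrightarrow> a\<^sup>2) F"
  unfolding power2_eq_square by (rule tendsto_mult_ennreal[OF assms assms]) auto

text \<open>The bounds for finite windows of scales are uniform in the window, so monotone
  convergence reaches all scales.\<close>

theorem dyadic_maximal_L2:
  obtains C where "C > 0" "\<And>f::'a::euclidean_space \<Rightarrow> ennreal. f \<in> borel_measurable borel \<Longrightarrow>
    (\<integral>\<^sup>+x. (SUP k::int. avg (2 powr k) f x)\<^sup>2 \<partial>lborel) \<le> ennreal C * (\<integral>\<^sup>+x. (f x)\<^sup>2 \<partial>lborel)"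
proof
  let ?D = "2 * 2 ^ DIM('a) * unit_ball_vol (real DIM('a))" and ?w = "unit_ball_vol (real DIM('a))"
  let ?C = "(?D + 1 + ?w\<^sup>2)\<^sup>2"
  have "?D + 1 + ?w\<^sup>2 > 0" by (intro add_pos_nonneg) auto
  then show "?C > 0" by simp
  fix f :: "'a \<Rightarrow> ennreal" assume [measurable]: "f \<in> borel_measurable borel"
  define g where "g n x = (SUP k\<in>{- int n..int n}. avg (2 powr k) f x)" for n x
  have [measurable]: "g n \<in> borel_measurable borel" for n unfolding g_def by measurable
  have inc: "g n x \<le> g m x" if "n \<le> m" for n m x
    unfolding g_def using that by (intro SUP_subset_mono) auto
  have "(SUP k::int. avg (2 powr k) f x) = (SUP n. g n x)" for x
  proof (intro antisym SUP_least)
    show "avg (2 powr k) f x \<le> (SUP n. g n x)" for k :: int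
      unfolding g_def by (rule SUP_upper2[of "nat \<bar>k\<bar>"], simp, rule SUP_upper2[of k]) auto
    show "g n x \<le> (SUP k::int. avg (2 powr k) f x)" for n
      unfolding g_def by (intro SUP_subset_mono) auto
  qed
  then have lim: "(\<lambda>n. g n x) \<longlonglongrightarrow> (SUP k::int. avg (2 powr k) f x)" for x
    using LIMSEQ_SUP[of "\<lambda>n. g n x"] inc by (simp add: incseq_def)
  have "(\<lambda>n. \<integral>\<^sup>+x. (g n x)\<^sup>2 \<partial>lborel) \<longlonglongrightarrow> (\<integral>\<^sup>+x. (SUP k::int. avg (2 powr k) f x)\<^sup>2 \<partial>lborel)"
  proof (rule nn_integral_LIMSEQ)
    show "incseq (\<lambda>n x. (g n x)\<^sup>2)" by (auto simp: incseq_def le_fun_def intro!: power_mono inc)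
    show "(\<lambda>n. (g n x)\<^sup>2) \<longlonglongrightarrow> (SUP k::int. avg (2 powr k) f x)\<^sup>2" for x
      by (rule tendsto_power2_ennreal[OF lim])
  qed measurable
  then show "(\<integral>\<^sup>+x. (SUP k::int. avg (2 powr k) f x)\<^sup>2 \<partial>lborel) \<le> ennreal ?C * (\<integral>\<^sup>+x. (f x)\<^sup>2 \<partial>lborel)"
    by (rule LIMSEQ_le_const2) (auto simp: g_def intro!: exI[of _ 0] finite_maximal_ineq)
qed

subsection \<open>A compactly supported mollifier\<close>

lemma nice_diff: "nice f \<Longrightarrow> nice g \<Longrightarrow> nice (\<lambda>x. f x - g x)"
  unfolding nice_def by (auto intro!: continuous_intros bounded_minus_comp)

lemma nice_0: "nice (\<lambda>_. 0)"
  by (simp add: nice_def)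

lemma nice_add: "nice f \<Longrightarrow> nice g \<Longrightarrow> nice (\<lambda>x. f x + g x)"
  unfolding nice_def by (auto intro!: continuous_intros bounded_plus_comp)

lemma nice_sum: "(\<And>i. i \<in> I \<Longrightarrow> nice (f i)) \<Longrightarrow> nice (\<lambda>x. \<Sum>i\<in>I. f i x)"
  by (induction I rule: infinite_finite_induct) (auto intro: nice_0 nice_add)

lemma integrable_nice_cis: "nice f \<Longrightarrow> integrable lborel (\<lambda>x. f x * cis (- 2 * pi * (\<xi> \<bullet> x)))"
  by (rule integrable_mult_bounded[where B=1]) (auto simp: nice_def)

lemma ft_diff: "nice f \<Longrightarrow> nice g \<Longrightarrow> ft (\<lambda>x. f x - g x) \<xi> = ft f \<xi> - ft g \<xi>"
  unfolding ft_def left_diff_distrib by (intro Bochner_Integration.integral_diff integrable_nice_cis)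

lemma ft_sum: "(\<And>i. i \<in> I \<Longrightarrow> nice (f i)) \<Longrightarrow> ft (\<lambda>x. \<Sum>i\<in>I. f i x) \<xi> = (\<Sum>i\<in>I. ft (f i) \<xi>)"
  unfolding ft_def sum_distrib_right by (intro Bochner_Integration.integral_sum integrable_nice_cis)

lemma norm_ft_le: "norm (ft f \<xi>) \<le> (\<integral>x. norm (f x) \<partial>lborel)"
  unfolding ft_def using integral_norm_bound[of lborel "\<lambda>x. f x * cis (- 2 * pi * (\<xi> \<bullet> x))"]
  by (simp add: norm_mult)

lemma nice_compact_support:
  fixes f :: "'a::euclidean_space \<Rightarrow> complex"
  assumes cont: "continuous_on UNIV f" and supp: "\<And>x. norm x > r \<Longrightarrow> f x = 0"
  shows "nice f"
proof -
  have "bounded (f ` cball 0 r)"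
    by (intro compact_imp_bounded compact_continuous_image continuous_on_subset[OF cont]) auto
  then obtain B where B: "\<And>x. x \<in> cball 0 r \<Longrightarrow> norm (f x) \<le> B" by (metis bounded_iff image_eqI)
  have B': "norm (f x) \<le> \<bar>B\<bar>" for x
    using B[of x] supp[of x] by (cases "norm x \<le> r") auto
  have "integrable lborel (\<lambda>x. indicator (cball 0 r) x *\<^sub>R f x)"
    by (rule borel_integrable_compact) (auto intro: continuous_on_subset[OF cont])
  also have "(\<lambda>x. indicator (cball 0 r) x *\<^sub>R f x) = f"
    by (auto simp: fun_eq_iff indicator_def supp)
  finally show ?thesis using cont B' by (auto simp: nice_def bounded_iff)
qed

definition star :: "('a::euclidean_space \<Rightarrow> complex) \<Rightarrow> ('a \<Rightarrow> complex) \<Rightarrow> 'a \<Rightarrow> complex" where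
  "star k f = conv lborel k (\<lambda>v. v) f"

lemma star_altdef: "star k f x = (\<integral>v. k v * f (x - v) \<partial>lborel)"
  by (simp add: star_def conv_def)

lemma nice_star: "nice k \<Longrightarrow> nice f \<Longrightarrow> nice (star k f)"
  unfolding star_def by (rule nice_conv) (auto simp: sigma_finite_lborel nice_def)

lemma ft_star: "nice k \<Longrightarrow> nice f \<Longrightarrow> ft (star k f) \<xi> = ft k \<xi> * ft f \<xi>"
  unfolding star_def by (subst ft_conv) (auto simp: sigma_finite_lborel nice_def ft_def)

lemma integrable_star: "nice k \<Longrightarrow> nice f \<Longrightarrow> integrable lborel (\<lambda>v. k v * f (x - v))"
  by (rule integrable_conv[where \<tau>="\<lambda>v. v"]) (auto simp: sigma_finite_lborel nice_def)

text \<open>Puts the free variable into the kernel, so that difference quotients of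
  \<open>star k f\<close> fall on \<open>k\<close>.\<close>

lemma star_swap:
  assumes "nice k" "nice f"
  shows "star k f x = (\<integral>w. k (x - w) * f w \<partial>lborel)"
  unfolding star_altdef
  using lborel_integral_reflect[OF integrable_star[OF assms], of x x] by simp

lemma star_sum:
  assumes "nice k" "\<And>i. i \<in> I \<Longrightarrow> nice (f i)"
  shows "star k (\<lambda>x. \<Sum>i\<in>I. f i x) x = (\<Sum>i\<in>I. star k (f i) x)"
  unfolding star_altdef sum_distrib_left
  by (intro Bochner_Integration.integral_sum integrable_star assms)

lemma ennreal_norm_star_le:
  assumes "nice k" "nice f"
  shows "ennreal (norm (star k f x)) \<le> (\<integral>\<^sup>+v. ennreal (norm (k v)) * ennreal (norm (f (x - v))) \<partial>lborel)"
  unfolding star_altdef ennreal_mult'[OF norm_ge_zero, symmetric] norm_mult[symmetric]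
  by (rule integral_norm_bound_ennreal[OF integrable_star[OF assms]])

text \<open>An explicit compactly supported function of class C^1: squaring the positive part
  removes its corner, and only one derivative of the kernel is ever taken.\<close>

definition bump :: "'a::euclidean_space \<Rightarrow> real" where
  "bump x = (max 0 (1 - (norm x)\<^sup>2))\<^sup>2"

definition bump_const :: "'a::euclidean_space itself \<Rightarrow> real" where
  "bump_const _ = 1 / (\<integral>x. bump (x::'a) \<partial>lborel)"

definition bk :: "real \<Rightarrow> 'a::euclidean_space \<Rightarrow> complex" where
  "bk r v = of_real (bump_const TYPE('a) / r ^ DIM('a) * bump ((1 / r) *\<^sub>R v))"

text \<open>The derivative of \<open>bk r\<close> in the direction \<open>a\<close>: one factor 2
  from the outer square, one from the squared norm.\<close>

definition bkd :: "real \<Rightarrow> 'a \<Rightarrow> 'a::euclidean_space \<Rightarrow> complex" where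
  "bkd r a v = of_real (bump_const TYPE('a) / r ^ DIM('a) *
     (- 4 / r\<^sup>2 * max 0 (1 - (norm ((1 / r) *\<^sub>R v))\<^sup>2) * (v \<bullet> a)))"

lemma bump_bounds: "0 \<le> bump x" "bump x \<le> 1"
proof -
  show "0 \<le> bump x" by (simp add: bump_def)
  have "max 0 (1 - (norm x)\<^sup>2) \<le> 1" by simp
  then show "bump x \<le> 1" unfolding bump_def by (intro power_le_one) auto
qed

lemma integrable_bump: "integrable lborel (bump :: 'a::euclidean_space \<Rightarrow> real)"
  and integral_bump_pos: "(\<integral>x. bump (x::'a) \<partial>lborel) > 0"
proof -
  have "nice (\<lambda>x::'a. complex_of_real (bump x))"
    by (rule nice_compact_support[where r=1]) (auto simp: bump_def intro!: continuous_intros)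
  then show int: "integrable lborel (bump :: 'a \<Rightarrow> real)"
    by (simp add: nice_def complex_of_real_integrable_eq)
  \<comment> \<open>On the ball of radius 1/2 the bump is at least (1 - 1/4)^2 = 9/16, and this ball
    has positive measure.\<close>
  have "(\<integral>x. indicator (cball 0 (1/2)) (x::'a) * (9/16) \<partial>lborel) \<le> (\<integral>x. bump (x::'a) \<partial>lborel)"
  proof (intro integral_mono int)
    show "integrable lborel (\<lambda>x::'a. indicator (cball 0 (1/2)) x * (9/16) :: real)"
      by (intro integrable_mult_left integrable_real_indicator) (use emeasure_lborel_cball_finite[of "0::'a" "1/2"] in auto)
    fix x :: 'a
    show "indicator (cball 0 (1/2)) x * (9/16) \<le> bump x"
    proof (cases "norm x \<le> 1/2")
      case True
      then have "(norm x)\<^sup>2 \<le> (1/2)\<^sup>2" by (intro power_mono) auto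
      then have "(norm x)\<^sup>2 \<le> 1/4" by (simp add: power_divide)
      then have "3/4 \<le> max 0 (1 - (norm x)\<^sup>2)" by (intro max.coboundedI2) linarith
      then have "(3/4)\<^sup>2 \<le> (max 0 (1 - (norm x)\<^sup>2))\<^sup>2" by (rule power_mono) simp
      moreover have "(3/4)\<^sup>2 = (9/16::real)" by (simp add: power2_eq_square)
      ultimately have "9/16 \<le> bump x" unfolding bump_def by (simp only:)
      then show ?thesis using True by simp
    qed (auto simp: bump_bounds)
  qed
  moreover have "(\<integral>x. indicator (cball 0 (1/2)) (x::'a) * (9/16) \<partial>lborel) = measure lborel (cball 0 (1/2) :: 'a set) * (9/16::real)"
    by simp
  moreover have "measure lborel (cball 0 (1/2) :: 'a set) > 0"
    using content_cball_gt_0_iff[of "0::'a" "1/2"] by (simp add: measure_completion)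
  ultimately show "(\<integral>x. bump (x::'a) \<partial>lborel) > 0" by linarith
qed

lemma bump_const_pos: "bump_const TYPE('a::euclidean_space) > 0"
  using integral_bump_pos[where 'a='a] by (simp add: bump_const_def)

context
  fixes r :: real
  assumes r: "r > 0"
begin

lemma bk_eq_0: "r < norm v \<Longrightarrow> bk r v = 0"
  and bkd_eq_0: "r < norm v \<Longrightarrow> bkd r a v = 0"
proof -
  assume "r < norm v"
  then have "1 \<le> (norm ((1 / r) *\<^sub>R v))\<^sup>2" using r by (simp add: field_simps)
  then show "bk r v = 0" "bkd r a v = 0" by (auto simp: bk_def bkd_def bump_def)
qed

lemma nice_bk: "nice (bk r)" and nice_bkd: "nice (bkd r a)"
proof -
  show "nice (bk r)"
    by (rule nice_compact_support[where r=r], unfold bk_def[abs_def] bump_def)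
       (intro continuous_intros, use bk_eq_0 in \<open>simp add: bk_def bump_def\<close>)
  show "nice (bkd r a)"
    by (rule nice_compact_support[where r=r], unfold bkd_def[abs_def])
       (intro continuous_intros, use bkd_eq_0[of _ a] in \<open>simp add: bkd_def\<close>)
qed

lemma norm_bk_eq: "norm (bk r v) = Re (bk r v)" and bk_eq_norm: "bk r v = of_real (norm (bk r v))"
  for v :: "'a::euclidean_space"
proof -
  have "0 \<le> bump_const TYPE('a) / r ^ DIM('a) * bump ((1 / r) *\<^sub>R v)"
    using bump_const_pos[where 'a='a] bump_bounds(1)[of "(1 / r) *\<^sub>R v"] r by simp
  then show "norm (bk r v) = Re (bk r v)" "bk r v = of_real (norm (bk r v))"
    unfolding bk_def norm_of_real by (simp_all only: abs_of_nonneg Re_complex_of_real)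
qed

lemma integral_bk: "(\<integral>v. bk r (v::'a::euclidean_space) \<partial>lborel) = 1"
  and integral_norm_bk: "(\<integral>v. norm (bk r (v::'a)) \<partial>lborel) = 1"
proof -
  define I where "I = (\<integral>v. bump ((1 / r) *\<^sub>R (v::'a)) \<partial>lborel)"
  have "(\<integral>v. bump (v::'a) \<partial>lborel) = 1 / r ^ DIM('a) * I"
    using lborel_integral_affine[of "1 / r" bump "0::'a"] r integrable_bump by (simp add: power_one_over I_def)
  moreover from this have "I \<noteq> 0" using integral_bump_pos[where 'a='a] by auto
  ultimately have "bump_const TYPE('a) / r ^ DIM('a) * I = 1"
    using r by (simp add: bump_const_def)
  then have "(\<integral>v. bump_const TYPE('a) / r ^ DIM('a) * bump ((1 / r) *\<^sub>R (v::'a)) \<partial>lborel) = 1"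
    by (simp only: integral_mult_right_zero I_def)
  then show 1: "(\<integral>v. bk r (v::'a) \<partial>lborel) = 1"
    unfolding bk_def integral_complex_of_real by (simp only: of_real_1)
  have "complex_of_real (\<integral>v. norm (bk r (v::'a)) \<partial>lborel) = 1"
    unfolding integral_complex_of_real[symmetric] bk_eq_norm[symmetric] by (rule 1)
  then show "(\<integral>v. norm (bk r (v::'a)) \<partial>lborel) = 1" by simp
qed

lemma norm_bk_le: "norm (bk r v) \<le> bump_const TYPE('a) / r ^ DIM('a)" for v :: "'a::euclidean_space"
proof -
  have "bump_const TYPE('a) / r ^ DIM('a) * bump ((1 / r) *\<^sub>R v) \<le> bump_const TYPE('a) / r ^ DIM('a) * 1"
    using bump_const_pos[where 'a='a] r by (intro mult_left_mono bump_bounds) auto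
  then show ?thesis
    unfolding norm_bk_eq by (simp add: bk_def)
qed

lemma abs_bkd_aux:
  fixes v u :: "'a::euclidean_space"
  shows "\<bar>bump_const TYPE('a) / r ^ DIM('a) * (- 4 / r\<^sup>2 * max 0 (1 - (norm ((1 / r) *\<^sub>R v))\<^sup>2) * (v \<bullet> u))\<bar>
    \<le> 4 * bump_const TYPE('a) / r ^ DIM('a) / r * norm u"
proof -
  have "max 0 (1 - (norm ((1 / r) *\<^sub>R v))\<^sup>2) * \<bar>v \<bullet> u\<bar> \<le> r * norm u"
  proof (cases "norm v \<le> r")
    case True
    have "max 0 (1 - (norm ((1 / r) *\<^sub>R v))\<^sup>2) * \<bar>v \<bullet> u\<bar> \<le> 1 * (r * norm u)"
      using True r by (intro mult_mono order_trans[OF Cauchy_Schwarz_ineq2] mult_right_mono) auto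
    then show ?thesis by simp
  next
    case False
    then have "1 \<le> (norm ((1 / r) *\<^sub>R v))\<^sup>2" using r by (simp add: field_simps)
    then show ?thesis using r by simp
  qed
  then have "bump_const TYPE('a) / r ^ DIM('a) * (4 / r\<^sup>2 * (max 0 (1 - (norm ((1 / r) *\<^sub>R v))\<^sup>2) * \<bar>v \<bullet> u\<bar>))
      \<le> bump_const TYPE('a) / r ^ DIM('a) * (4 / r\<^sup>2 * (r * norm u))"
    using bump_const_pos[where 'a='a] r by (intro mult_left_mono) auto
  then show ?thesis
    using bump_const_pos[where 'a='a] r by (simp add: abs_mult power2_eq_square field_simps)
qed

lemma norm_bkd_le:
  "a \<in> Basis \<Longrightarrow> norm (bkd r a v) \<le> 4 * bump_const TYPE('a) / r ^ DIM('a) / r" for v :: "'a::euclidean_space"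
  using abs_bkd_aux[of v a] by (simp add: bkd_def norm_mult[symmetric] del: of_real_mult of_real_divide norm_mult)

end

text \<open>Away from 0 the function agrees locally with a square or with 0; at 0 the difference
  quotient is at most \<open>\<bar>h\<bar>\<close>.\<close>

lemma DERIV_max_0_power2: "((\<lambda>s::real. (max 0 s)\<^sup>2) has_real_derivative 2 * max 0 s) (at s)"
proof -
  consider "s > 0" | "s < 0" | "s = 0" by linarith
  then show ?thesis
  proof cases
    case 1
    have "((\<lambda>s::real. s\<^sup>2) has_real_derivative 2 * max 0 s) (at s)"
      using 1 by (auto intro!: derivative_eq_intros)
    then show ?thesis
      by (rule has_field_derivative_transform_within_open[where S="{0<..}"]) (use 1 in auto)
  next
    case 2
    have "((\<lambda>s::real. 0) has_real_derivative 2 * max 0 s) (at s)" using 2 by simp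
    then show ?thesis
      by (rule has_field_derivative_transform_within_open[where S="{..<0}"]) (use 2 in auto)
  next
    case 3
    have "((\<lambda>h::real. (max 0 h)\<^sup>2 / h) \<longlongrightarrow> 0) (at 0)"
    proof (rule Lim_null_comparison)
      show "\<forall>\<^sub>F h in at 0. norm ((max 0 h)\<^sup>2 / h) \<le> \<bar>h\<bar>"
        by (intro always_eventually) (auto simp: max_def power2_eq_square)
      show "((\<lambda>h::real. \<bar>h\<bar>) \<longlongrightarrow> 0) (at 0)" by (rule tendsto_rabs_zero[OF tendsto_ident_at])
    qed
    then show ?thesis using 3 by (simp add: DERIV_def)
  qed
qed

lemma bk_line_derivative:
  fixes p u :: "'a::euclidean_space"
  assumes r: "r > 0"
  shows "((\<lambda>s. Re (bk r (p + s *\<^sub>R u))) has_real_derivative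
    bump_const TYPE('a) / r ^ DIM('a) * (- 4 / r\<^sup>2 * max 0 (1 - (norm ((1 / r) *\<^sub>R (p + s *\<^sub>R u)))\<^sup>2) * ((p + s *\<^sub>R u) \<bullet> u))) (at s)"
proof -
  define \<phi> where "\<phi> s = 1 - (norm ((1 / r) *\<^sub>R (p + s *\<^sub>R u)))\<^sup>2" for s
  have \<phi>: "\<phi> s = 1 - (p \<bullet> p + 2 * s * (p \<bullet> u) + s\<^sup>2 * (u \<bullet> u)) / r\<^sup>2" for s
  proof -
    have "(norm ((1 / r) *\<^sub>R (p + s *\<^sub>R u)))\<^sup>2 = ((p + s *\<^sub>R u) \<bullet> (p + s *\<^sub>R u)) / r\<^sup>2"
      unfolding power2_norm_eq_inner by (simp only: inner_scaleR_left inner_scaleR_right) (simp add: power2_eq_square)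
    also have "(p + s *\<^sub>R u) \<bullet> (p + s *\<^sub>R u) = p \<bullet> p + 2 * s * (p \<bullet> u) + s\<^sup>2 * (u \<bullet> u)"
      by (simp add: inner_add inner_commute[of u p] power2_eq_square algebra_simps)
    finally show ?thesis by (simp add: \<phi>_def)
  qed
  have "(\<phi> has_real_derivative - 2 / r\<^sup>2 * ((p + s *\<^sub>R u) \<bullet> u)) (at s)"
  proof -
    define c where "c = 1 / r\<^sup>2"
    have "((\<lambda>s. 1 - (p \<bullet> p + 2 * s * (p \<bullet> u) + s\<^sup>2 * (u \<bullet> u)) * c) has_real_derivative - 2 * c * ((p + s *\<^sub>R u) \<bullet> u)) (at s)"
      by (auto intro!: derivative_eq_intros simp: inner_add_left algebra_simps)
    then show ?thesis by (simp add: \<phi>[abs_def] c_def)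
  qed
  from DERIV_chain2[OF DERIV_max_0_power2 this]
  have "((\<lambda>s. (max 0 (\<phi> s))\<^sup>2) has_real_derivative 2 * max 0 (\<phi> s) * (- 2 / r\<^sup>2 * ((p + s *\<^sub>R u) \<bullet> u))) (at s)" .
  from DERIV_cmult[OF this, of "bump_const TYPE('a) / r ^ DIM('a)"]
  show ?thesis by (simp add: bk_def bump_def \<phi>_def mult_ac)
qed

text \<open>The mean value theorem along the segment. It supplies the integrable majorants whenever
  difference quotients of \<open>bk\<close> pass to the limit under an integral.\<close>

lemma bk_lipschitz:
  fixes p u :: "'a::euclidean_space"
  assumes r: "r > 0"
  shows "norm (bk r (p + u) - bk r p) \<le> 4 * bump_const TYPE('a) / r ^ DIM('a) / r * norm u"
proof -
  have "\<exists>z. z > 0 \<and> z < 1 \<and> Re (bk r (p + 1 *\<^sub>R u)) - Re (bk r (p + 0 *\<^sub>R u)) =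
     (1 - 0) * (bump_const TYPE('a) / r ^ DIM('a) * (- 4 / r\<^sup>2 * max 0 (1 - (norm ((1 / r) *\<^sub>R (p + z *\<^sub>R u)))\<^sup>2) * ((p + z *\<^sub>R u) \<bullet> u)))"
    by (rule MVT2) (auto intro!: bk_line_derivative[OF r, simplified])
  then obtain z where z: "Re (bk r (p + u)) - Re (bk r p) =
     bump_const TYPE('a) / r ^ DIM('a) * (- 4 / r\<^sup>2 * max 0 (1 - (norm ((1 / r) *\<^sub>R (p + z *\<^sub>R u)))\<^sup>2) * ((p + z *\<^sub>R u) \<bullet> u))"
    by auto
  have "bk r (p + u) - bk r p = of_real (Re (bk r (p + u)) - Re (bk r p))"
    by (simp add: bk_def)
  then have "norm (bk r (p + u) - bk r p) = \<bar>Re (bk r (p + u)) - Re (bk r p)\<bar>"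
    by (simp only: norm_of_real)
  also have "\<dots> \<le> 4 * bump_const TYPE('a) / r ^ DIM('a) / r * norm u"
    unfolding z by (rule abs_bkd_aux[OF r])
  finally show ?thesis .
qed

lemma bk_line_quotient_tendsto:
  fixes p u :: "'a::euclidean_space"
  assumes r: "r > 0"
  shows "((\<lambda>h. (bk r (p + h *\<^sub>R u) - bk r p) /\<^sub>R h) \<longlongrightarrow> (\<Sum>a\<in>Basis. (u \<bullet> a) *\<^sub>R bkd r a p)) (at 0)"
proof -
  have "((\<lambda>h. (Re (bk r (p + h *\<^sub>R u)) - Re (bk r p)) / h) \<longlongrightarrow>
    bump_const TYPE('a) / r ^ DIM('a) * (- 4 / r\<^sup>2 * max 0 (1 - (norm ((1 / r) *\<^sub>R p))\<^sup>2) * (p \<bullet> u))) (at 0)"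
    (is "(?q \<longlongrightarrow> ?d) _")
    using bk_line_derivative[OF r, of p u 0] by (simp add: DERIV_def)
  then have "((\<lambda>h. complex_of_real (?q h)) \<longlongrightarrow> of_real ?d) (at 0)" by (rule tendsto_of_real)
  moreover have "complex_of_real (?q h) = (bk r (p + h *\<^sub>R u) - bk r p) /\<^sub>R h" for h
    by (simp add: bk_def scaleR_conv_of_real field_simps)
  moreover have "complex_of_real ?d = (\<Sum>a\<in>Basis. (u \<bullet> a) *\<^sub>R bkd r a p)"
  proof -
    define K where "K = bump_const TYPE('a) / r ^ DIM('a) * (- 4 / r\<^sup>2 * max 0 (1 - (norm ((1 / r) *\<^sub>R p))\<^sup>2))"
    have "?d = K * (\<Sum>a\<in>Basis. (p \<bullet> a) * (u \<bullet> a))"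
      by (simp only: euclidean_inner[of p u, symmetric] K_def mult.assoc)
    also have "\<dots> = (\<Sum>a\<in>Basis. (u \<bullet> a) * (bump_const TYPE('a) / r ^ DIM('a) *
         (- 4 / r\<^sup>2 * max 0 (1 - (norm ((1 / r) *\<^sub>R p))\<^sup>2) * (p \<bullet> a))))"
      unfolding sum_distrib_left K_def by (intro sum.cong refl) (simp only: mult_ac)
    finally have "?d = (\<Sum>a\<in>Basis. (u \<bullet> a) * (bump_const TYPE('a) / r ^ DIM('a) *
         (- 4 / r\<^sup>2 * max 0 (1 - (norm ((1 / r) *\<^sub>R p))\<^sup>2) * (p \<bullet> a))))" .
    then show ?thesis by (simp only: of_real_sum of_real_mult bkd_def scaleR_conv_of_real)
  qed
  ultimately show ?thesis by simp
qed

text \<open>Differentiation under the integral sign with the variable moved into the kernel; the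
  Lipschitz bound for \<open>bk\<close> gives the majorant \<open>L * norm (g w)\<close>. The minus
  sign comes from moving along \<open>x - t *\<^sub>R y\<close>.\<close>

lemma has_vector_derivative_star_bk:
  fixes g :: "'a::euclidean_space \<Rightarrow> complex"
  assumes r: "r > 0" and g: "nice g"
  shows "((\<lambda>t. star (bk r) g (x - t *\<^sub>R y)) has_vector_derivative
     - (\<Sum>a\<in>Basis. (y \<bullet> a) *\<^sub>R star (bkd r a) g (x - t *\<^sub>R y))) (at t)"
proof -
  define L where "L = 4 * bump_const TYPE('a) / r ^ DIM('a) / r * norm y"
  let ?D = "- (\<Sum>a\<in>Basis. (y \<bullet> a) *\<^sub>R star (bkd r a) g (x - t *\<^sub>R y))"
  have [measurable]: "(bk r :: 'a \<Rightarrow> complex) \<in> borel_measurable borel" "bkd r a \<in> borel_measurable borel"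
    "g \<in> borel_measurable borel" for a :: 'a
    by (intro measurable_nice nice_bk nice_bkd r g)+
  have intk: "integrable lborel (\<lambda>w. k (z - w) * g w)" if "nice k" for k z
    using integrable_lborel_affine_iff[of "-1" "\<lambda>v. k v * g (z - v)" z] integrable_star[OF that g, of z] by simp
  have D: "?D = (\<integral>w. (\<Sum>a\<in>Basis. (- y \<bullet> a) *\<^sub>R bkd r a (x - t *\<^sub>R y - w)) * g w \<partial>lborel)"
    unfolding sum_distrib_right
    by (subst Bochner_Integration.integral_sum)
       (auto simp: star_swap[OF nice_bkd[OF r] g] sum_negf[symmetric] intro!: intk nice_bkd r)
  have "((\<lambda>h. (star (bk r) g (x - (t + h) *\<^sub>R y) - star (bk r) g (x - t *\<^sub>R y)) /\<^sub>R h) \<longlongrightarrow> ?D) (at 0)"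
    unfolding tendsto_at_iff_sequentially o_def
  proof (intro allI impI)
    fix h :: "nat \<Rightarrow> real" assume h: "\<forall>n. h n \<in> UNIV - {0}" "h \<longlonglongrightarrow> 0"
    have eq: "(star (bk r) g (x - (t + h n) *\<^sub>R y) - star (bk r) g (x - t *\<^sub>R y)) /\<^sub>R h n
       = (\<integral>w. ((bk r (x - t *\<^sub>R y - w + h n *\<^sub>R (- y)) - bk r (x - t *\<^sub>R y - w)) /\<^sub>R h n) * g w \<partial>lborel)" for n
    proof -
      have "star (bk r) g (x - (t + h n) *\<^sub>R y) - star (bk r) g (x - t *\<^sub>R y)
         = (\<integral>w. bk r (x - (t + h n) *\<^sub>R y - w) * g w - bk r (x - t *\<^sub>R y - w) * g w \<partial>lborel)"
        by (simp add: star_swap[OF nice_bk[OF r] g] intk nice_bk r)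
      also have "\<dots> /\<^sub>R h n = (\<integral>w. (bk r (x - (t + h n) *\<^sub>R y - w) * g w - bk r (x - t *\<^sub>R y - w) * g w) /\<^sub>R h n \<partial>lborel)"
        by simp
      finally show ?thesis by (simp add: algebra_simps)
    qed
    show "(\<lambda>n. (star (bk r) g (x - (t + h n) *\<^sub>R y) - star (bk r) g (x - t *\<^sub>R y)) /\<^sub>R h n) \<longlonglongrightarrow> ?D"
      unfolding eq D
    proof (rule integral_dominated_convergence[where w="\<lambda>w. L * norm (g w)"])
      show "integrable lborel (\<lambda>w. L * norm (g w))" using g by (simp add: nice_def)
      show "AE w in lborel. (\<lambda>n. ((bk r (x - t *\<^sub>R y - w + h n *\<^sub>R (- y)) - bk r (x - t *\<^sub>R y - w)) /\<^sub>R h n) * g w)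
          \<longlonglongrightarrow> (\<Sum>a\<in>Basis. (- y \<bullet> a) *\<^sub>R bkd r a (x - t *\<^sub>R y - w)) * g w"
      proof (intro AE_I2 tendsto_mult_right)
        fix w
        show "(\<lambda>n. (bk r (x - t *\<^sub>R y - w + h n *\<^sub>R (- y)) - bk r (x - t *\<^sub>R y - w)) /\<^sub>R h n)
          \<longlonglongrightarrow> (\<Sum>a\<in>Basis. (- y \<bullet> a) *\<^sub>R bkd r a (x - t *\<^sub>R y - w))"
          using bk_line_quotient_tendsto[OF r, of "x - t *\<^sub>R y - w" "- y"] h
          unfolding tendsto_at_iff_sequentially o_def by blast
      qed
      show "AE w in lborel. norm (((bk r (x - t *\<^sub>R y - w + h n *\<^sub>R (- y)) - bk r (x - t *\<^sub>R y - w)) /\<^sub>R h n) * g w) \<le> L * norm (g w)" for n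
      proof (intro AE_I2)
        fix w
        have "norm (bk r (x - t *\<^sub>R y - w + h n *\<^sub>R (- y)) - bk r (x - t *\<^sub>R y - w)) \<le> L * \<bar>h n\<bar>"
          using bk_lipschitz[OF r, of "x - t *\<^sub>R y - w" "h n *\<^sub>R (- y)"] by (simp add: L_def mult_ac)
        then have "norm ((bk r (x - t *\<^sub>R y - w + h n *\<^sub>R (- y)) - bk r (x - t *\<^sub>R y - w)) /\<^sub>R h n) \<le> L"
          using h(1) unfolding norm_scaleR abs_inverse
          by (simp only: mult.commute[of "inverse _"] divide_inverse[symmetric]) (simp add: pos_divide_le_eq)
        then show "norm (((bk r (x - t *\<^sub>R y - w + h n *\<^sub>R (- y)) - bk r (x - t *\<^sub>R y - w)) /\<^sub>R h n) * g w) \<le> L * norm (g w)"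
          unfolding norm_mult by (rule mult_right_mono) simp
      qed
    qed measurable
  qed
  from tendsto_norm_zero[OF LIM_zero[OF this]]
  have "((\<lambda>h. norm (star (bk r) g (x - (t + h) *\<^sub>R y) - star (bk r) g (x - t *\<^sub>R y) - h *\<^sub>R ?D) / norm h) \<longlongrightarrow> 0) (at 0)"
  proof (rule Lim_transform_eventually)
    have "norm ((star (bk r) g (x - (t + h) *\<^sub>R y) - star (bk r) g (x - t *\<^sub>R y)) /\<^sub>R h - ?D)
        = norm (star (bk r) g (x - (t + h) *\<^sub>R y) - star (bk r) g (x - t *\<^sub>R y) - h *\<^sub>R ?D) / norm h"
      (is "norm (?A /\<^sub>R h - _) = _") if "h \<noteq> 0" for h
    proof -
      have "?A /\<^sub>R h - ?D = (?A - h *\<^sub>R ?D) /\<^sub>R h"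
        using that by (simp only: scaleR_diff_right scaleR_scaleR) simp
      then show ?thesis by (simp only: norm_scaleR) (simp add: divide_inverse mult.commute)
    qed
    then show "\<forall>\<^sub>F h in at 0. norm ((star (bk r) g (x - (t + h) *\<^sub>R y) - star (bk r) g (x - t *\<^sub>R y)) /\<^sub>R h - ?D)
        = norm (star (bk r) g (x - (t + h) *\<^sub>R y) - star (bk r) g (x - t *\<^sub>R y) - h *\<^sub>R ?D) / norm h"
      by (auto simp: eventually_at_filter)
  qed
  then show ?thesis
    unfolding has_vector_derivative_def has_derivative_at by (intro conjI bounded_linear_scaleR_left)
qed

section \<open>Fourier transform of the mollifier at low and high frequency\<close>

lemma norm_cis_minus_1_le: "norm (cis x - 1) \<le> \<bar>x\<bar>"
proof -
  have "norm (cis x - 1) = 2 * \<bar>sin (x / 2)\<bar>"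
    using dist_exp_i_1[of x] by (simp add: cis_conv_exp)
  also have "\<dots> \<le> 2 * \<bar>x / 2\<bar>" by (intro mult_left_mono abs_sin_x_le_abs_x) auto
  finally show ?thesis by simp
qed

lemma norm_ft_bk_le_1: "r > 0 \<Longrightarrow> norm (ft (bk r) \<xi>) \<le> 1"
  using norm_ft_le[of "bk r" \<xi>] by (simp add: integral_norm_bk)

text \<open>The kernel has mass one and lives on the ball of radius \<open>r\<close>, where the
  character differs from 1 by at most \<open>2 * pi * (r * norm \<xi>)\<close>.\<close>

lemma norm_1_minus_ft_bk_le:
  fixes \<xi> :: "'a::euclidean_space"
  assumes r: "r > 0"
  shows "norm (1 - ft (bk r) \<xi>) \<le> 2 * pi * (r * norm \<xi>)"
proof -
  let ?c = "\<lambda>v. cis (- 2 * pi * (\<xi> \<bullet> v))"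
  have int: "integrable lborel (bk r :: 'a \<Rightarrow> complex)" using nice_bk[OF r, where 'a='a] by (simp add: nice_def)
  have intc: "integrable lborel (\<lambda>v. bk r v * ?c v)" by (rule integrable_nice_cis[OF nice_bk[OF r]])
  have "1 - ft (bk r) \<xi> = (\<integral>v. bk r v - bk r v * ?c v \<partial>lborel)"
    unfolding ft_def using int intc integral_bk[OF r, where 'a='a] by simp
  also have "norm \<dots> \<le> (\<integral>v. norm (bk r v - bk r v * ?c v) \<partial>lborel)" by (rule integral_norm_bound)
  also have "\<dots> \<le> (\<integral>v. 2 * pi * (r * norm \<xi>) * norm (bk r (v::'a)) \<partial>lborel)"
  proof (rule integral_mono)
    fix v :: 'a
    show "norm (bk r v - bk r v * ?c v) \<le> 2 * pi * (r * norm \<xi>) * norm (bk r v)"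
    proof (cases "norm v \<le> r")
      case True
      have "norm (1 - ?c v) \<le> \<bar>- 2 * pi * (\<xi> \<bullet> v)\<bar>"
        using norm_cis_minus_1_le[of "- 2 * pi * (\<xi> \<bullet> v)"] by (simp add: norm_minus_commute)
      also have "\<dots> = 2 * pi * \<bar>\<xi> \<bullet> v\<bar>" by (simp add: abs_mult)
      also have "\<dots> \<le> 2 * pi * (r * norm \<xi>)"
        using True Cauchy_Schwarz_ineq2[of \<xi> v] mult_left_mono[OF True, of "norm \<xi>"]
        by (intro mult_left_mono) (auto simp: mult.commute)
      finally have "norm (1 - ?c v) * norm (bk r v) \<le> 2 * pi * (r * norm \<xi>) * norm (bk r v)"
        by (rule mult_right_mono) simp
      moreover have "bk r v - bk r v * ?c v = (1 - ?c v) * bk r v" by (simp add: algebra_simps)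
      ultimately show ?thesis by (simp only: norm_mult)
    qed (simp add: bk_eq_0[OF r])
  qed (use int intc in auto)
  also have "\<dots> = 2 * pi * (r * norm \<xi>)" by (simp add: integral_norm_bk[OF r])
  finally show ?thesis .
qed

text \<open>The transform \<open>I n\<close> of a difference quotient is computed twice: dominated
  convergence gives the transform of the derivative, translation in the integral gives the
  difference quotient of an exponential.\<close>

lemma ft_bkd:
  fixes \<xi> :: "'a::euclidean_space"
  assumes r: "r > 0" and a: "a \<in> Basis"
  shows "ft (bkd r a) \<xi> = 2 * pi * \<i> * (\<xi> \<bullet> a) * ft (bk r) \<xi>"
proof (rule LIMSEQ_unique)
  define c where "c v = cis (- 2 * pi * (\<xi> \<bullet> v))" for v
  define h where "h n = 1 / (real n + 1)" for n
  have h: "h n > 0" "h n \<le> 1" for n by (auto simp: h_def)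
  have h0: "h \<longlonglongrightarrow> 0" unfolding h_def by real_asymp
  have [measurable]: "(bk r :: 'a \<Rightarrow> complex) \<in> borel_measurable borel" "bkd r a \<in> borel_measurable borel"
    "c \<in> borel_measurable borel"
    unfolding c_def by (intro measurable_nice nice_bk nice_bkd r, intro measurable_nice nice_bk nice_bkd r, measurable)
  define L where "L = 4 * bump_const TYPE('a) / r ^ DIM('a) / r"
  have L0: "L \<ge> 0" using bump_const_pos[where 'a='a] r by (simp add: L_def)
  have intbk: "integrable lborel (\<lambda>v. bk r v * c v)" unfolding c_def by (rule integrable_nice_cis[OF nice_bk[OF r]])
  define I where "I n = (\<integral>v. ((bk r (v + h n *\<^sub>R a) - bk r v) /\<^sub>R h n) * c v \<partial>lborel)" for n
  show "I \<longlonglongrightarrow> ft (bkd r a) \<xi>"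
    unfolding ft_def I_def c_def[symmetric]
  proof (rule integral_dominated_convergence[where w="\<lambda>v. L * indicator (cball 0 (r + 1)) v"])
    \<comment> \<open>Since \<open>h n \<le> 1\<close>, all the difference quotients vanish outside
      the ball of radius \<open>r + 1\<close>.\<close>
    show "integrable lborel (\<lambda>v. L * indicator (cball 0 (r + 1)) (v::'a))"
      by (intro integrable_mult_right integrable_real_indicator) (use emeasure_lborel_cball_finite[of "0::'a" "r + 1"] in auto)
    show "AE v in lborel. (\<lambda>n. (bk r (v + h n *\<^sub>R a) - bk r v) /\<^sub>R h n * c v) \<longlonglongrightarrow> bkd r a v * c v"
    proof (intro AE_I2 tendsto_mult_right)
      fix v
      have "(\<Sum>b\<in>Basis. (a \<bullet> b) *\<^sub>R bkd r b v) = bkd r a v"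
        using a by (subst sum.remove[OF _ a]) (auto simp: inner_Basis a intro!: sum.neutral split: if_splits)
      then have "((\<lambda>e. (bk r (v + e *\<^sub>R a) - bk r v) /\<^sub>R e) \<longlongrightarrow> bkd r a v) (at 0)"
        using bk_line_quotient_tendsto[OF r, of v a] by simp
      moreover have "filterlim h (at 0) sequentially"
      proof (rule filterlim_atI[OF h0])
        have "h n \<noteq> 0" for n using h(1)[of n] by simp
        then show "\<forall>\<^sub>F n in sequentially. h n \<noteq> 0" by simp
      qed
      ultimately show "(\<lambda>n. (bk r (v + h n *\<^sub>R a) - bk r v) /\<^sub>R h n) \<longlonglongrightarrow> bkd r a v"
        by (rule filterlim_compose)
    qed
    show "AE v in lborel. norm ((bk r (v + h n *\<^sub>R a) - bk r v) /\<^sub>R h n * c v) \<le> L * indicator (cball 0 (r + 1)) v" for n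
    proof (intro AE_I2)
      fix v
      show "norm ((bk r (v + h n *\<^sub>R a) - bk r v) /\<^sub>R h n * c v) \<le> L * indicator (cball 0 (r + 1)) v"
      proof (cases "norm v \<le> r + 1")
        case True
        have "norm (bk r (v + h n *\<^sub>R a) - bk r v) \<le> L * h n"
          using bk_lipschitz[OF r, of v "h n *\<^sub>R a"] a h(1)[of n] by (simp add: L_def)
        then have "norm (bk r (v + h n *\<^sub>R a) - bk r v) / h n \<le> L"
          using h(1)[of n] by (simp add: pos_divide_le_eq)
        then show ?thesis using True h(1)[of n] by (simp add: norm_mult c_def divide_inverse mult.commute)
      next
        case False
        have "norm v \<le> norm (v + h n *\<^sub>R a) + norm (h n *\<^sub>R a)"
          using norm_triangle_ineq4[of "v + h n *\<^sub>R a" "h n *\<^sub>R a"] by simp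
        then have "r < norm (v + h n *\<^sub>R a)" using False a h[of n] by simp
        then show ?thesis using False by (simp add: bk_eq_0[OF r])
      qed
    qed
  qed measurable
  have shift: "(\<integral>v. bk r (v + h n *\<^sub>R a) * c v \<partial>lborel) = cis (2 * pi * (\<xi> \<bullet> a) * h n) * ft (bk r) \<xi>"
    and shift_int: "integrable lborel (\<lambda>v. bk r (v + h n *\<^sub>R a) * c v)" for n
  proof -
    have eq: "bk r (v + h n *\<^sub>R a) * c v = cis (2 * pi * (\<xi> \<bullet> a) * h n) * (bk r (h n *\<^sub>R a + v) * c (h n *\<^sub>R a + v))" for v
      by (simp add: c_def cis_mult inner_add_right algebra_simps)
    have i: "integrable lborel (\<lambda>v. bk r (h n *\<^sub>R a + v) * c (h n *\<^sub>R a + v))"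
      using integrable_lborel_affine_iff[of 1 "\<lambda>v. bk r v * c v" "h n *\<^sub>R a"] intbk by simp
    then show "integrable lborel (\<lambda>v. bk r (v + h n *\<^sub>R a) * c v)" unfolding eq by simp
    show "(\<integral>v. bk r (v + h n *\<^sub>R a) * c v \<partial>lborel) = cis (2 * pi * (\<xi> \<bullet> a) * h n) * ft (bk r) \<xi>"
      unfolding eq using lborel_integral_shift[OF intbk, of "h n *\<^sub>R a"] by (simp add: ft_def c_def)
  qed
  define k where "k = 2 * pi * (\<xi> \<bullet> a)"
  have I: "I n = ((exp (\<i> * of_real k * of_real (h n)) - 1) / of_real (h n)) * ft (bk r) \<xi>" for n
  proof -
    have "I n = (\<integral>v. (bk r (v + h n *\<^sub>R a) * c v - bk r v * c v) /\<^sub>R h n \<partial>lborel)"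
      unfolding I_def by (simp add: algebra_simps)
    also have "\<dots> = (cis (k * h n) * ft (bk r) \<xi> - ft (bk r) \<xi>) /\<^sub>R h n"
      using shift_int[of n] intbk shift[of n] by (simp add: ft_def c_def k_def)
    finally show ?thesis by (simp add: cis_conv_exp scaleR_conv_of_real field_simps)
  qed
  have "((\<lambda>z. exp (\<i> * of_real k * z)) has_field_derivative exp (\<i> * of_real k * 0) * (\<i> * of_real k)) (at 0)"
    by (auto intro!: derivative_eq_intros)
  then have "((\<lambda>z. (exp (\<i> * of_real k * z) - 1) / z) \<longlongrightarrow> \<i> * of_real k) (at 0)"
    by (simp add: DERIV_def)
  moreover have "filterlim (\<lambda>n. complex_of_real (h n)) (at 0) sequentially"
  proof (rule filterlim_atI)
    show "(\<lambda>n. complex_of_real (h n)) \<longlonglongrightarrow> 0" using tendsto_of_real[OF h0, where 'a=complex] by simp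
    have "complex_of_real (h n) \<noteq> 0" for n using h(1)[of n] by simp
    then show "\<forall>\<^sub>F n in sequentially. complex_of_real (h n) \<noteq> 0" by simp
  qed
  ultimately have "(\<lambda>n. (exp (\<i> * of_real k * of_real (h n)) - 1) / of_real (h n)) \<longlonglongrightarrow> \<i> * of_real k"
    by (rule filterlim_compose)
  then have "I \<longlonglongrightarrow> \<i> * of_real k * ft (bk r) \<xi>" unfolding I by (intro tendsto_mult_right)
  then show "I \<longlonglongrightarrow> 2 * pi * \<i> * (\<xi> \<bullet> a) * ft (bk r) \<xi>" by (simp add: k_def mult_ac)
qed

text \<open>One derivative costs \<open>1 / r\<close> in L^1 and multiplies the transform by a
  frequency component; summing over coordinates gives one power of decay in the scale-invariant
  quantity \<open>r * norm \<xi>\<close>.\<close>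

lemma norm_ft_bk_decay:
  obtains B where "B > 0" "\<And>r \<xi>::'a::euclidean_space. r > 0 \<Longrightarrow> norm (ft (bk r) \<xi>) * (r * norm \<xi>) \<le> B"
proof
  let ?w = "unit_ball_vol (real DIM('a))" and ?c = "bump_const TYPE('a)"
  show "real DIM('a) * (4 * ?c * ?w) > 0" using bump_const_pos[where 'a='a] by simp
  fix r :: real and \<xi> :: 'a assume r: "r > 0"
  have *: "r * (norm (ft (bk r) \<xi>) * \<bar>\<xi> \<bullet> a\<bar>) \<le> 4 * ?c * ?w" if a: "a \<in> Basis" for a
  proof -
    have "norm (ft (bkd r a) \<xi>) \<le> (\<integral>v. norm (bkd r a v) \<partial>lborel)" by (rule norm_ft_le)
    also have "\<dots> \<le> (\<integral>v. 4 * ?c / r ^ DIM('a) / r * indicator (cball 0 r) (v::'a) \<partial>lborel)"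
    proof (rule integral_mono)
      show "integrable lborel (\<lambda>v. norm (bkd r a v))" using nice_bkd[OF r] by (auto simp: nice_def)
      show "integrable lborel (\<lambda>v. 4 * ?c / r ^ DIM('a) / r * indicator (cball 0 r) (v::'a))"
        by (intro integrable_mult_right integrable_real_indicator) (use emeasure_lborel_cball_finite[of "0::'a" r] in auto)
      show "norm (bkd r a v) \<le> 4 * ?c / r ^ DIM('a) / r * indicator (cball 0 r) v" for v
        using norm_bkd_le[OF r a, of v] bkd_eq_0[OF r, of v a] by (cases "norm v \<le> r") auto
    qed
    also have "\<dots> = 4 * ?c / r ^ DIM('a) / r * (?w * r ^ DIM('a))"
      using r by (simp add: measure_def emeasure_cball unit_ball_vol_nonneg)
    also have "\<dots> = 4 * ?c * ?w / r" using r by simp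
    finally have "2 * pi * (\<bar>\<xi> \<bullet> a\<bar> * norm (ft (bk r) \<xi>)) \<le> 4 * ?c * ?w / r"
      unfolding ft_bkd[OF r a] by (simp add: norm_mult)
    moreover have "1 * (\<bar>\<xi> \<bullet> a\<bar> * norm (ft (bk r) \<xi>)) \<le> 2 * pi * (\<bar>\<xi> \<bullet> a\<bar> * norm (ft (bk r) \<xi>))"
      using pi_ge_two by (intro mult_right_mono) auto
    ultimately have "\<bar>\<xi> \<bullet> a\<bar> * norm (ft (bk r) \<xi>) \<le> 4 * ?c * ?w / r" by linarith
    then show ?thesis using r by (simp add: field_simps)
  qed
  have "norm (ft (bk r) \<xi>) * (r * norm \<xi>) \<le> norm (ft (bk r) \<xi>) * (r * (\<Sum>a\<in>Basis. \<bar>\<xi> \<bullet> a\<bar>))"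
    using r by (intro mult_left_mono norm_le_l1) auto
  also have "\<dots> = (\<Sum>a\<in>Basis. r * (norm (ft (bk r) \<xi>) * \<bar>\<xi> \<bullet> a\<bar>))"
    by (simp add: sum_distrib_left mult_ac)
  also have "\<dots> \<le> (\<Sum>a\<in>(Basis::'a set). 4 * ?c * ?w)" by (intro sum_mono *)
  finally show "norm (ft (bk r) \<xi>) * (r * norm \<xi>) \<le> real DIM('a) * (4 * ?c * ?w)" by simp
qed

subsection \<open>Frequency truncations built from the mollifier\<close>

text \<open>On the Fourier side, with \<open>b = ft (bk r)\<close>, the operator \<open>fdiff r\<close> is multiplication by
  \<open>1 - b\<^sup>2\<close> and \<open>trunc n r\<close> is multiplication by \<open>1 - (1 - b\<^sup>2)\<^sup>n\<close>, which is
  flat to order \<open>n\<close> at the origin. One factor \<open>b\<close> is split off in \<open>pretrunc\<close>.\<close>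

definition fdiff :: "real \<Rightarrow> ('a::euclidean_space \<Rightarrow> complex) \<Rightarrow> 'a \<Rightarrow> complex" where
  "fdiff r g x = g x - star (bk r) (star (bk r) g) x"

definition pretrunc :: "nat \<Rightarrow> real \<Rightarrow> ('a::euclidean_space \<Rightarrow> complex) \<Rightarrow> 'a \<Rightarrow> complex" where
  "pretrunc n r f x = (\<Sum>i<n. star (bk r) ((fdiff r ^^ i) f) x)"

definition trunc :: "nat \<Rightarrow> real \<Rightarrow> ('a::euclidean_space \<Rightarrow> complex) \<Rightarrow> 'a \<Rightarrow> complex" where
  "trunc n r f = star (bk r) (pretrunc n r f)"

context
  fixes r :: real and f :: "'a::euclidean_space \<Rightarrow> complex"
  assumes r: "r > 0" and f: "nice f"
begin

lemma nice_fdiff: "nice g \<Longrightarrow> nice (fdiff r g)" for g :: "'a \<Rightarrow> complex"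
  unfolding fdiff_def[abs_def] by (intro nice_diff nice_star nice_bk r)

lemma nice_fdiff_pow: "nice ((fdiff r ^^ i) f)"
  by (induction i) (auto intro: f nice_fdiff)

lemma nice_pretrunc: "nice (pretrunc n r f)"
  unfolding pretrunc_def[abs_def] by (intro nice_sum nice_star nice_bk r nice_fdiff_pow)

lemma nice_trunc: "nice (trunc n r f)"
  unfolding trunc_def by (intro nice_star nice_bk r nice_pretrunc)

lemma ft_fdiff_pow: "ft ((fdiff r ^^ i) f) \<xi> = (1 - (ft (bk r) \<xi>)\<^sup>2) ^ i * ft f \<xi>"
proof (induction i)
  case (Suc i)
  have "ft (fdiff r ((fdiff r ^^ i) f)) \<xi> = ft ((fdiff r ^^ i) f) \<xi> - ft (bk r) \<xi> * (ft (bk r) \<xi> * ft ((fdiff r ^^ i) f) \<xi>)"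
    unfolding fdiff_def[of r "(fdiff r ^^ i) f", abs_def]
    by (simp add: ft_diff ft_star nice_star nice_bk r nice_fdiff_pow)
  then show ?case by (simp add: Suc algebra_simps power2_eq_square)
qed simp

lemma ft_pretrunc: "ft (pretrunc n r f) \<xi> = (\<Sum>i<n. ft (bk r) \<xi> * (1 - (ft (bk r) \<xi>)\<^sup>2) ^ i) * ft f \<xi>"
  unfolding pretrunc_def[abs_def]
  by (subst ft_sum) (auto simp: ft_star nice_star nice_bk r nice_fdiff_pow ft_fdiff_pow sum_distrib_right mult.assoc)

lemma ft_trunc: "ft (trunc n r f) \<xi> = (1 - (1 - (ft (bk r) \<xi>)\<^sup>2) ^ n) * ft f \<xi>"
proof -
  let ?b = "ft (bk r) \<xi>"
  have "ft (trunc n r f) \<xi> = ?b * ((\<Sum>i<n. ?b * (1 - ?b\<^sup>2) ^ i) * ft f \<xi>)"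
    unfolding trunc_def by (simp add: ft_star nice_bk r nice_pretrunc ft_pretrunc)
  also have "\<dots> = (1 - (1 - ?b\<^sup>2)) * (\<Sum>i<n. (1 - ?b\<^sup>2) ^ i) * ft f \<xi>"
    by (simp add: sum_distrib_left power2_eq_square mult_ac)
  also have "(1 - (1 - ?b\<^sup>2)) * (\<Sum>i<n. (1 - ?b\<^sup>2) ^ i) = 1 - (1 - ?b\<^sup>2) ^ n"
    by (rule one_diff_power_eq[symmetric])
  finally show ?thesis .
qed

text \<open>This is the purpose of splitting off one factor \<open>b\<close>: the derivative of a
  truncation is a \<open>star\<close> with \<open>bkd\<close> in place of \<open>bk\<close>, and its
  transform is still the transform of \<open>trunc\<close> times a frequency component.\<close>

lemma ft_star_bkd_pretrunc:
  assumes "a \<in> Basis"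
  shows "ft (star (bkd r a) (pretrunc n r f)) \<xi> = 2 * pi * \<i> * (\<xi> \<bullet> a) * ft (trunc n r f) \<xi>"
  unfolding trunc_def using assms by (simp add: ft_star nice_bk nice_bkd r nice_pretrunc ft_bkd mult.assoc)

text \<open>The geometric sum telescopes in physical space. The remainder is an iterated
  \<open>fdiff\<close>, which is what gives uniform bounds and convergence without any Fourier
  inversion.\<close>

lemma trunc_eq_diff: "trunc n r f x = f x - (fdiff r ^^ n) f x"
proof -
  have "trunc n r f x = (\<Sum>i<n. star (bk r) (star (bk r) ((fdiff r ^^ i) f)) x)"
    unfolding trunc_def pretrunc_def[abs_def]
    by (rule star_sum) (auto intro: nice_star nice_bk r nice_fdiff_pow)
  also have "\<dots> = (\<Sum>i<n. (fdiff r ^^ i) f x - (fdiff r ^^ Suc i) f x)"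
    by (simp add: fdiff_def)
  also have "\<dots> = f x - (fdiff r ^^ n) f x"
    by (subst sum_lessThan_telescope') simp
  finally show ?thesis .
qed

end

text \<open>The Littlewood--Paley weight concentrated at \<open>z\<close> near 1, with geometric
  decay both ways. With division by zero equal to 0 its value at 0 is 0.\<close>

definition lp_weight :: "real \<Rightarrow> real" where
  "lp_weight z = min z (1 / z)"

lemma lp_weight_nonneg: "z \<ge> 0 \<Longrightarrow> lp_weight z \<ge> 0"
  by (simp add: lp_weight_def)

section \<open>Bounds for the symbols of the truncations\<close>

lemma norm_power_1_minus_square_le:
  fixes b :: complex
  assumes "norm b \<le> 1" "norm (1 - b) \<le> B * z"
  shows "norm (1 - b\<^sup>2) \<le> 2 * B * z" "norm (1 - b\<^sup>2) \<le> 2"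
proof -
  have 1: "norm (1 + b) \<le> 2" using norm_triangle_ineq[of 1 b] assms(1) by simp
  have "1 - b\<^sup>2 = (1 + b) * (1 - b)" by (simp add: algebra_simps power2_eq_square)
  then have "norm (1 - b\<^sup>2) = norm (1 + b) * norm (1 - b)" by (simp only: norm_mult)
  also have "\<dots> \<le> 2 * (B * z)" using 1 assms by (intro mult_mono) auto
  finally show "norm (1 - b\<^sup>2) \<le> 2 * B * z" by simp
  have "norm (1 - b\<^sup>2) \<le> 1 + norm b ^ 2" using norm_triangle_ineq4[of 1 "b\<^sup>2"] by (simp add: norm_power)
  also have "\<dots> \<le> 2" using assms(1) by (simp add: power_le_one)
  finally show "norm (1 - b\<^sup>2) \<le> 2" .
qed

lemma sum_powers_of_2: "(\<Sum>i<n. (2::real) ^ i) \<le> 2 ^ n"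
  by (induction n) auto

text \<open>Here \<open>z\<close> stands for \<open>r * norm \<xi>\<close>. For
  \<open>z \<le> 1\<close> both powers are of order \<open>z ^ Suc n\<close>: \<open>n\<close>
  factors for the decay of the measure, one for \<open>lp_weight\<close>. For \<open>z > 1\<close>
  each power differs from 1 by a multiple of \<open>b\<^sup>2\<close>, hence by order 1/z^2; the
  second power of 1/z pays for the extra \<open>z\<close> in the second bound, which is the one used
  for derivatives.\<close>

lemma trunc_symbol_bound:
  fixes b b' :: complex and n :: nat
  assumes b: "norm b \<le> 1" "norm (1 - b) \<le> B * z" "norm b * z \<le> B"
    and b': "norm b' \<le> 1" "norm (1 - b') \<le> B * z" "norm b' * z \<le> B"
    and B: "B \<ge> 1" and z: "z \<ge> 0"
  defines "C \<equiv> 2 * (2 * B) ^ Suc n * B\<^sup>2"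
  defines "q \<equiv> (1 - b\<^sup>2) ^ Suc n - (1 - b'\<^sup>2) ^ Suc n"
  shows "norm q \<le> C * (min 1 z ^ n * lp_weight z)" "z * norm q \<le> C * (min 1 z ^ n * lp_weight z)"
proof -
  have C0: "C \<ge> 0" using B by (simp add: C_def)
  have main: "norm q \<le> C * (min 1 z ^ n * lp_weight z) \<and> z * norm q \<le> C * (min 1 z ^ n * lp_weight z)"
  proof (cases "z \<le> 1")
    case True
    have pw: "norm ((1 - c\<^sup>2) ^ Suc n) \<le> (2 * B) ^ Suc n * z ^ Suc n" if "norm c \<le> 1" "norm (1 - c) \<le> B * z" for c :: complex
      unfolding norm_power power_mult_distrib[symmetric]
      by (intro power_mono norm_power_1_minus_square_le that) auto
    have "norm q \<le> 2 * (2 * B) ^ Suc n * z ^ Suc n"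
      unfolding q_def using norm_triangle_ineq4[of "(1 - b\<^sup>2) ^ Suc n" "(1 - b'\<^sup>2) ^ Suc n"] pw[OF b(1,2)] pw[OF b'(1,2)] by linarith
    also have "\<dots> \<le> 2 * (2 * B) ^ Suc n * z ^ Suc n * B\<^sup>2"
      using B z mult_left_mono[of 1 "B\<^sup>2" "2 * (2 * B) ^ Suc n * z ^ Suc n"] by (simp add: one_le_power)
    also have "\<dots> = C * (z ^ n * z)" by (simp add: C_def)
    finally have 1: "norm q \<le> C * (z ^ n * z)" .
    moreover have "z \<le> 1 / z \<or> z = 0" using True z by (auto simp: field_simps mult_le_one)
    then have "lp_weight z = z" by (auto simp: lp_weight_def)
    moreover have "z * norm q \<le> 1 * norm q" using True by (intro mult_right_mono) auto
    ultimately show ?thesis using True by (simp add: min_def)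
  next
    case False
    have pw: "norm (1 - (1 - c\<^sup>2) ^ Suc n) * z\<^sup>2 \<le> 2 ^ Suc n * B\<^sup>2"
      if c: "norm c \<le> 1" "norm (1 - c) \<le> B * z" "norm c * z \<le> B" for c :: complex
    proof -
      have "1 - (1 - c\<^sup>2) ^ Suc n = (1 - (1 - c\<^sup>2)) * (\<Sum>i<Suc n. (1 - c\<^sup>2) ^ i)" by (rule one_diff_power_eq)
      then have "norm (1 - (1 - c\<^sup>2) ^ Suc n) = (norm c)\<^sup>2 * norm (\<Sum>i<Suc n. (1 - c\<^sup>2) ^ i)"
        by (simp add: norm_mult norm_power del: sum.lessThan_Suc)
      also have "\<dots> \<le> (norm c)\<^sup>2 * 2 ^ Suc n"
      proof (rule mult_left_mono)
        have "norm (\<Sum>i<Suc n. (1 - c\<^sup>2) ^ i) \<le> (\<Sum>i<Suc n. 2 ^ i)"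
          by (intro sum_norm_le) (auto simp: norm_power intro!: power_mono norm_power_1_minus_square_le(2)[OF c(1,2)])
        then show "norm (\<Sum>i<Suc n. (1 - c\<^sup>2) ^ i) \<le> 2 ^ Suc n" using sum_powers_of_2[of "Suc n"] by linarith
      qed simp
      finally have "norm (1 - (1 - c\<^sup>2) ^ Suc n) * z\<^sup>2 \<le> (norm c)\<^sup>2 * 2 ^ Suc n * z\<^sup>2" by (intro mult_right_mono) auto
      also have "\<dots> = 2 ^ Suc n * (norm c * z)\<^sup>2" by (simp add: power_mult_distrib)
      also have "\<dots> \<le> 2 ^ Suc n * B\<^sup>2" using c z by (intro mult_left_mono power_mono) auto
      finally show ?thesis .
    qed
    \<comment> \<open>Both powers are close to 1 at high frequency, so \<open>q\<close> is estimated
      through their distances from 1.\<close>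
    have "norm q * z\<^sup>2 \<le> (norm (1 - (1 - b'\<^sup>2) ^ Suc n) + norm (1 - (1 - b\<^sup>2) ^ Suc n)) * z\<^sup>2"
      using norm_triangle_ineq4[of "1 - (1 - b'\<^sup>2) ^ Suc n" "1 - (1 - b\<^sup>2) ^ Suc n"]
      by (intro mult_right_mono) (auto simp: q_def)
    also have "\<dots> \<le> 2 * (2 ^ Suc n * B\<^sup>2)" using pw[OF b] pw[OF b'] by (simp add: distrib_right)
    also have "\<dots> \<le> C"
      using B unfolding C_def by (simp add: power_mult_distrib mult_le_cancel_left1 mult_le_cancel_right1 one_le_power mult_ge1_I)
    finally have *: "norm q * z\<^sup>2 \<le> C" .
    have z1: "z > 1" using False by simp
    have "z * norm q \<le> C * (1 / z)" using * z1 by (simp add: field_simps power2_eq_square)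
    moreover have "norm q \<le> z * norm q" using z1 by (simp add: mult_le_cancel_right1)
    moreover have "1 / z \<le> z" using z1 by (simp add: field_simps) (metis less_imp_le mult_le_cancel_left1 one_le_numeral order_less_le_trans less_1_mult)
    then have "lp_weight z = 1 / z" by (simp add: lp_weight_def)
    ultimately show ?thesis using z1 by (simp add: min_def)
  qed
  then show "norm q \<le> C * (min 1 z ^ n * lp_weight z)" "z * norm q \<le> C * (min 1 z ^ n * lp_weight z)" by auto
qed

text \<open>At low frequency each symbol is 1 up to order \<open>z\<close>: the term
  \<open>i = 0\<close> is near 1 and the others contain a factor \<open>1 - b\<^sup>2\<close>. The
  value 1 cancels in the difference. At high frequency the single factor \<open>b\<close> gives
  order \<open>1 / z\<close>.\<close>

lemma pretrunc_symbol_bound: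
  fixes b b' :: complex
  assumes b: "norm b \<le> 1" "norm (1 - b) \<le> B * z" "norm b * z \<le> B"
    and b': "norm b' \<le> 1" "norm (1 - b') \<le> B * z" "norm b' * z \<le> B"
    and B: "B \<ge> 1" and z: "z \<ge> 0"
  shows "norm ((\<Sum>i<Suc n. b' * (1 - b'\<^sup>2) ^ i) - (\<Sum>i<Suc n. b * (1 - b\<^sup>2) ^ i)) \<le> (2 * B + 2 ^ Suc (Suc n) * B) * lp_weight z"
proof (cases "z \<le> 1")
  case True
  have pw: "norm ((\<Sum>i<Suc n. c * (1 - c\<^sup>2) ^ i) - 1) \<le> (B + 2 ^ Suc n * B) * z"
    if c: "norm c \<le> 1" "norm (1 - c) \<le> B * z" for c :: complex
  proof -
    have "(\<Sum>i<Suc n. c * (1 - c\<^sup>2) ^ i) - 1 = - (1 - c) + (\<Sum>i<n. c * (1 - c\<^sup>2) ^ Suc i)"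
      by (simp only: sum.lessThan_Suc_shift) simp
    also have "norm \<dots> \<le> norm (1 - c) + (\<Sum>i<n. norm (c * (1 - c\<^sup>2) ^ Suc i))"
      by (rule order_trans[OF norm_triangle_ineq]) (simp only: norm_minus_cancel add_left_mono norm_sum)
    also have "(\<Sum>i<n. norm (c * (1 - c\<^sup>2) ^ Suc i)) \<le> (\<Sum>i<n. 2 * B * z * 2 ^ i)"
    proof (intro sum_mono)
      fix i
      have "norm (c * (1 - c\<^sup>2) ^ Suc i) = norm c * (norm (1 - c\<^sup>2) * norm (1 - c\<^sup>2) ^ i)"
        by (simp add: norm_mult norm_power)
      also have "\<dots> \<le> 1 * (2 * B * z * 2 ^ i)"
        using norm_power_1_minus_square_le[OF c] c B z by (intro mult_mono power_mono) auto
      finally show "norm (c * (1 - c\<^sup>2) ^ Suc i) \<le> 2 * B * z * 2 ^ i" by simp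
    qed
    also have "\<dots> = 2 * B * z * (\<Sum>i<n. 2 ^ i)" by (simp add: sum_distrib_left)
    also have "\<dots> \<le> 2 * B * z * 2 ^ n" using B z by (intro mult_left_mono sum_powers_of_2) auto
    finally show ?thesis using c(2) by (simp add: algebra_simps)
  qed
  have "norm ((\<Sum>i<Suc n. b' * (1 - b'\<^sup>2) ^ i) - (\<Sum>i<Suc n. b * (1 - b\<^sup>2) ^ i)) \<le> 2 * ((B + 2 ^ Suc n * B) * z)"
  proof -
    have "norm (X - Y) \<le> norm (X - 1) + norm (Y - 1)" for X Y :: complex
      using norm_triangle_ineq4[of "X - 1" "Y - 1"] by simp
    from order_trans[OF this add_mono[OF pw[OF b'(1,2)] pw[OF b(1,2)]]]
    show ?thesis by (simp only: mult_2)
  qed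
  moreover have "z \<le> 1 / z \<or> z = 0" using True z by (auto simp: field_simps mult_le_one)
  then have "lp_weight z = z" by (auto simp: lp_weight_def)
  ultimately show ?thesis by (simp add: algebra_simps)
next
  case False
  then have z1: "z > 1" by simp
  have pw: "norm (\<Sum>i<Suc n. c * (1 - c\<^sup>2) ^ i) * z \<le> 2 ^ Suc n * B"
    if c: "norm c \<le> 1" "norm (1 - c) \<le> B * z" "norm c * z \<le> B" for c :: complex
  proof -
    have "norm (\<Sum>i<Suc n. c * (1 - c\<^sup>2) ^ i) \<le> (\<Sum>i<Suc n. norm c * 2 ^ i)"
      by (intro sum_norm_le) (auto simp: norm_mult norm_power intro!: mult_left_mono power_mono norm_power_1_minus_square_le(2)[OF c(1,2)])
    also have "\<dots> = norm c * (\<Sum>i<Suc n. 2 ^ i)" by (simp only: sum_distrib_left)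
    also have "\<dots> \<le> norm c * 2 ^ Suc n" by (intro mult_left_mono sum_powers_of_2) auto
    finally have "norm (\<Sum>i<Suc n. c * (1 - c\<^sup>2) ^ i) * z \<le> norm c * 2 ^ Suc n * z" using z by (intro mult_right_mono) auto
    also have "\<dots> = 2 ^ Suc n * (norm c * z)" by simp
    also have "\<dots> \<le> 2 ^ Suc n * B" using c by (intro mult_left_mono) auto
    finally show ?thesis .
  qed
  have "norm ((\<Sum>i<Suc n. b' * (1 - b'\<^sup>2) ^ i) - (\<Sum>i<Suc n. b * (1 - b\<^sup>2) ^ i)) * z
     \<le> (norm (\<Sum>i<Suc n. b' * (1 - b'\<^sup>2) ^ i) + norm (\<Sum>i<Suc n. b * (1 - b\<^sup>2) ^ i)) * z"
    using z by (intro mult_right_mono norm_triangle_ineq4) auto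
  also have "\<dots> \<le> 2 ^ Suc (Suc n) * B" using pw[OF b] pw[OF b'] by (simp add: distrib_right del: sum.lessThan_Suc)
  also have "\<dots> \<le> 2 * B + 2 ^ Suc (Suc n) * B" using B by simp
  finally have "norm ((\<Sum>i<Suc n. b' * (1 - b'\<^sup>2) ^ i) - (\<Sum>i<Suc n. b * (1 - b\<^sup>2) ^ i)) \<le> (2 * B + 2 ^ Suc (Suc n) * B) / z"
    using z1 by (simp only: pos_le_divide_eq)
  moreover have "1 / z \<le> z" using z1 less_1_mult[of z z] by (simp add: field_simps)
  then have "lp_weight z = 1 / z" by (simp add: lp_weight_def)
  ultimately show ?thesis by simp
qed

text \<open>The square of the L^2 norm, kept without the root so that it is additive and multiplies
  over slots.\<close>

definition l2 :: "('a::euclidean_space \<Rightarrow> complex) \<Rightarrow> ennreal" where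
  "l2 f = (\<integral>\<^sup>+x. ennreal ((norm (f x))\<^sup>2) \<partial>lborel)"

lemma ft_bk_bounds:
  obtains B where "B \<ge> 1"
    "\<And>r \<xi>::'a::euclidean_space. r > 0 \<Longrightarrow> norm (1 - ft (bk r) \<xi>) \<le> B * (r * norm \<xi>)"
    "\<And>r \<xi>::'a. r > 0 \<Longrightarrow> norm (ft (bk r) \<xi>) * (r * norm \<xi>) \<le> B"
    "\<And>r \<xi>::'a. r > 0 \<Longrightarrow> norm (1 - ft (bk (r / 2)) \<xi>) \<le> B * (r * norm \<xi>)"
    "\<And>r \<xi>::'a. r > 0 \<Longrightarrow> norm (ft (bk (r / 2)) \<xi>) * (r * norm \<xi>) \<le> B"
proof -
  obtain B where B: "B > 0" "\<And>r \<xi>::'a. r > 0 \<Longrightarrow> norm (ft (bk r) \<xi>) * (r * norm \<xi>) \<le> B"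
    using norm_ft_bk_decay by blast
  \<comment> \<open>Measuring the kernel of scale \<open>r / 2\<close> against \<open>r\<close>
    doubles the decay constant, hence \<open>2 * B\<close>.\<close>
  define K where "K = 2 * pi + 2 * B"
  have K: "2 * pi \<le> K" "2 * B \<le> K" "B \<le> K" "K \<ge> 1" using B(1) pi_gt3 by (auto simp: K_def)
  have 1: "norm (1 - ft (bk r) \<xi>) \<le> K * (r * norm \<xi>)" if "r > 0" for r and \<xi> :: 'a
  proof -
    have "2 * pi * (r * norm \<xi>) \<le> K * (r * norm \<xi>)" using that by (intro mult_right_mono K(1)) auto
    then show ?thesis using norm_1_minus_ft_bk_le[OF that, of \<xi>] by linarith
  qed
  show thesis
  proof (rule that[OF K(4) 1])
    fix r :: real and \<xi> :: 'a assume r: "r > 0"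
    show "norm (ft (bk r) \<xi>) * (r * norm \<xi>) \<le> K" using B(2)[OF r, of \<xi>] K by linarith
    have "K * (r / 2 * norm \<xi>) \<le> K * (r * norm \<xi>)" using r K by (intro mult_left_mono mult_right_mono) auto
    then show "norm (1 - ft (bk (r / 2)) \<xi>) \<le> K * (r * norm \<xi>)" using 1[of "r / 2" \<xi>] r by simp
    show "norm (ft (bk (r / 2)) \<xi>) * (r * norm \<xi>) \<le> K" using B(2)[of "r / 2" \<xi>] r K by simp
  qed
qed

lemma ft_trunc_diff_bound:
  obtains C where "C > 0"
    "\<And>r f \<xi>::'a::euclidean_space. r > 0 \<Longrightarrow> nice f \<Longrightarrow>
      norm (ft (trunc (Suc n) (r / 2) f) \<xi> - ft (trunc (Suc n) r f) \<xi>)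
        \<le> C * (min 1 (r * norm \<xi>) ^ n * lp_weight (r * norm \<xi>)) * norm (ft f \<xi>)"
    "\<And>r f \<xi>::'a. r > 0 \<Longrightarrow> nice f \<Longrightarrow>
      r * norm \<xi> * norm (ft (trunc (Suc n) (r / 2) f) \<xi> - ft (trunc (Suc n) r f) \<xi>)
        \<le> C * (min 1 (r * norm \<xi>) ^ n * lp_weight (r * norm \<xi>)) * norm (ft f \<xi>)"
proof -
  obtain B where B: "B \<ge> 1"
    "\<And>r \<xi>::'a. r > 0 \<Longrightarrow> norm (1 - ft (bk r) \<xi>) \<le> B * (r * norm \<xi>)"
    "\<And>r \<xi>::'a. r > 0 \<Longrightarrow> norm (ft (bk r) \<xi>) * (r * norm \<xi>) \<le> B"
    "\<And>r \<xi>::'a. r > 0 \<Longrightarrow> norm (1 - ft (bk (r / 2)) \<xi>) \<le> B * (r * norm \<xi>)"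
    "\<And>r \<xi>::'a. r > 0 \<Longrightarrow> norm (ft (bk (r / 2)) \<xi>) * (r * norm \<xi>) \<le> B"
    using ft_bk_bounds by metis
  define C where "C = 2 * (2 * B) ^ Suc n * B\<^sup>2"
  have eq: "ft (trunc (Suc n) (r / 2) f) \<xi> - ft (trunc (Suc n) r f) \<xi>
      = ((1 - (ft (bk r) \<xi>)\<^sup>2) ^ Suc n - (1 - (ft (bk (r / 2)) \<xi>)\<^sup>2) ^ Suc n) * ft f \<xi>"
    if "r > 0" "nice f" for r f and \<xi> :: 'a
    using that by (simp add: ft_trunc left_diff_distrib)
  show thesis
  proof (rule that[of C])
    show "C > 0" using B(1) by (simp add: C_def)
    fix r :: real and f :: "'a \<Rightarrow> complex" and \<xi> :: 'a assume r: "r > 0" and f: "nice f"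
    note sb = trunc_symbol_bound[OF norm_ft_bk_le_1[OF r] B(2,3)[OF r] norm_ft_bk_le_1[OF half_gt_zero[OF r]] B(4,5)[OF r] B(1), of \<xi> n, folded C_def]
    show "norm (ft (trunc (Suc n) (r / 2) f) \<xi> - ft (trunc (Suc n) r f) \<xi>)
        \<le> C * (min 1 (r * norm \<xi>) ^ n * lp_weight (r * norm \<xi>)) * norm (ft f \<xi>)"
      unfolding eq[OF r f] norm_mult using r by (intro mult_right_mono sb(1)) auto
    show "r * norm \<xi> * norm (ft (trunc (Suc n) (r / 2) f) \<xi> - ft (trunc (Suc n) r f) \<xi>)
        \<le> C * (min 1 (r * norm \<xi>) ^ n * lp_weight (r * norm \<xi>)) * norm (ft f \<xi>)"
      unfolding eq[OF r f] norm_mult mult.assoc[of "r * norm \<xi>", symmetric]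
      using r by (intro mult_right_mono sb(2)) auto
  qed
qed

lemma ft_pretrunc_diff_bound:
  obtains C where "C > 0"
    "\<And>r f \<xi>::'a::euclidean_space. r > 0 \<Longrightarrow> nice f \<Longrightarrow>
      norm (ft (pretrunc (Suc n) (r / 2) f) \<xi> - ft (pretrunc (Suc n) r f) \<xi>)
        \<le> C * lp_weight (r * norm \<xi>) * norm (ft f \<xi>)"
proof -
  obtain B where B: "B \<ge> 1"
    "\<And>r \<xi>::'a. r > 0 \<Longrightarrow> norm (1 - ft (bk r) \<xi>) \<le> B * (r * norm \<xi>)"
    "\<And>r \<xi>::'a. r > 0 \<Longrightarrow> norm (ft (bk r) \<xi>) * (r * norm \<xi>) \<le> B"
    "\<And>r \<xi>::'a. r > 0 \<Longrightarrow> norm (1 - ft (bk (r / 2)) \<xi>) \<le> B * (r * norm \<xi>)"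
    "\<And>r \<xi>::'a. r > 0 \<Longrightarrow> norm (ft (bk (r / 2)) \<xi>) * (r * norm \<xi>) \<le> B"
    using ft_bk_bounds by metis
  show thesis
  proof (rule that[of "2 * B + 2 ^ Suc (Suc n) * B"])
    show "2 * B + 2 ^ Suc (Suc n) * B > 0" using B(1) by (intro add_pos_pos) auto
    fix r :: real and f :: "'a \<Rightarrow> complex" and \<xi> :: 'a assume r: "r > 0" and f: "nice f"
    have eq: "ft (pretrunc (Suc n) (r / 2) f) \<xi> - ft (pretrunc (Suc n) r f) \<xi>
      = ((\<Sum>i<Suc n. ft (bk (r / 2)) \<xi> * (1 - (ft (bk (r / 2)) \<xi>)\<^sup>2) ^ i)
          - (\<Sum>i<Suc n. ft (bk r) \<xi> * (1 - (ft (bk r) \<xi>)\<^sup>2) ^ i)) * ft f \<xi>"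
      using r f by (simp only: ft_pretrunc half_gt_zero left_diff_distrib)
    show "norm (ft (pretrunc (Suc n) (r / 2) f) \<xi> - ft (pretrunc (Suc n) r f) \<xi>)
        \<le> (2 * B + 2 ^ Suc (Suc n) * B) * lp_weight (r * norm \<xi>) * norm (ft f \<xi>)"
      unfolding eq norm_mult
      by (intro mult_right_mono pretrunc_symbol_bound norm_ft_bk_le_1 B r) (use r in auto)
  qed
qed

subsection \<open>Sums over dyadic scales\<close>

lemma nn_integral_int_le:
  "(\<integral>\<^sup>+k. f k \<partial>count_space (UNIV :: int set)) \<le> (\<Sum>n. f (int n)) + (\<Sum>n. f (- int n))"
proof -
  have "(\<integral>\<^sup>+k. f k \<partial>count_space (UNIV :: int set))
      \<le> (\<integral>\<^sup>+k. f k * indicator (range int) k + f k * indicator (range (\<lambda>n. - int n)) k \<partial>count_space UNIV)"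
  proof (intro nn_integral_mono)
    fix k :: int
    have "k \<in> range int \<or> k \<in> range (\<lambda>n. - int n)"
      by (cases k rule: int_cases2) auto
    then show "f k \<le> f k * indicator (range int) k + f k * indicator (range (\<lambda>n. - int n)) k"
      by (auto simp: indicator_def)
  qed
  also have "\<dots> = (\<integral>\<^sup>+k. f k * indicator (range int) k \<partial>count_space UNIV)
      + (\<integral>\<^sup>+k. f k * indicator (range (\<lambda>n. - int n)) k \<partial>count_space UNIV)"
    by (rule nn_integral_add) auto
  also have "(\<integral>\<^sup>+k. f k * indicator (range int) k \<partial>count_space UNIV) = (\<Sum>n. f (int n))"
    by (subst nn_integral_count_space_indicator[symmetric], simp,
        subst nn_integral_bij_count_space[symmetric, where g=int and A=UNIV])
       (auto simp: bij_betw_def nn_integral_count_space_nat)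
  also have "(\<integral>\<^sup>+k. f k * indicator (range (\<lambda>n. - int n)) k \<partial>count_space UNIV) = (\<Sum>n. f (- int n))"
    by (subst nn_integral_count_space_indicator[symmetric], simp,
        subst nn_integral_bij_count_space[symmetric, where g="\<lambda>n. - int n" and A=UNIV])
       (auto simp: bij_betw_def inj_on_def nn_integral_count_space_nat)
  finally show ?thesis .
qed

text \<open>The weights decay geometrically on both sides of the scale where
  \<open>2 powr k * z\<close> is about 1. The bound is uniform in \<open>z\<close>: each half
  contributes at most 16/3, and 12 exceeds 32/3.\<close>

lemma sum_lp_weight_le:
  assumes z: "z \<ge> 0"
  shows "(\<integral>\<^sup>+k. ennreal ((lp_weight (2 powr real_of_int k * z))\<^sup>2) \<partial>count_space (UNIV :: int set)) \<le> ennreal 12"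
proof (cases "z = 0")
  case True
  then show ?thesis by (simp add: lp_weight_def)
next
  case False
  with z have z: "z > 0" by simp
  \<comment> \<open>Shifting the index by \<open>k0\<close> replaces \<open>z\<close> by
    \<open>u\<close> between 1 and 2, so the peak of the weights sits near index 0.\<close>
  define k0 where "k0 = \<lfloor>log 2 z\<rfloor>"
  define u where "u = z / 2 powr k0"
  have u: "1 \<le> u" "u \<le> 2"
  proof -
    have "2 powr k0 \<le> 2 powr (log 2 z)" "2 powr (log 2 z) \<le> 2 powr (k0 + 1)"
      by (intro powr_mono; simp add: k0_def; linarith)+
    then show "1 \<le> u" "u \<le> 2" using z by (auto simp: u_def powr_add field_simps)
  qed
  have zu: "2 powr real_of_int (n - k0) * z = 2 powr real_of_int n * u" for n
    by (simp add: u_def powr_diff)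
  have pos: "lp_weight (2 powr real_of_int n * u) \<ge> 0" for n using u by (intro lp_weight_nonneg) auto
  have 1: "(lp_weight (2 powr real_of_int (int n) * u))\<^sup>2 \<le> 4 * (1/4) ^ n" for n
  proof -
    have "lp_weight (2 powr real_of_int (int n) * u) \<le> 1 / (2 ^ n * u)"
      by (simp add: lp_weight_def powr_realpow)
    also have "\<dots> \<le> 2 * (1 / 2) ^ n" using u by (simp add: field_simps power_one_over)
    finally have "(lp_weight (2 powr real_of_int (int n) * u))\<^sup>2 \<le> (2 * (1 / 2) ^ n)\<^sup>2"
      using pos[of "int n"] by (intro power_mono) auto
    also have "\<dots> = 4 * (1/4) ^ n"
      by (simp add: power_mult_distrib power2_eq_square power_mult_distrib[symmetric])
    finally show ?thesis .
  qed
  have 2: "(lp_weight (2 powr real_of_int (- int n) * u))\<^sup>2 \<le> 4 * (1/4) ^ n" for n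
  proof -
    have "lp_weight (2 powr real_of_int (- int n) * u) \<le> 2 powr real_of_int (- int n) * u"
      by (simp add: lp_weight_def)
    also have "\<dots> \<le> 2 * (1 / 2) ^ n"
      using u by (simp add: powr_minus powr_realpow power_one_over field_simps)
    finally have "(lp_weight (2 powr real_of_int (- int n) * u))\<^sup>2 \<le> (2 * (1 / 2) ^ n)\<^sup>2"
      using pos[of "- int n"] by (intro power_mono) auto
    also have "\<dots> = 4 * (1/4) ^ n"
      by (simp add: power_mult_distrib power2_eq_square power_mult_distrib[symmetric])
    finally show ?thesis .
  qed
  have geo: "(\<Sum>n. ennreal (4 * (1/4) ^ n)) = ennreal (16/3)"
  proof -
    have "(\<lambda>n. 4 * (1/4::real) ^ n) sums (4 * (1 / (1 - 1/4)))"
      by (intro sums_mult geometric_sums) auto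
    then show ?thesis by (intro suminf_ennreal_eq) auto
  qed
  have "(\<integral>\<^sup>+k. ennreal ((lp_weight (2 powr real_of_int k * z))\<^sup>2) \<partial>count_space (UNIV :: int set))
      = (\<integral>\<^sup>+n. ennreal ((lp_weight (2 powr real_of_int (n - k0) * z))\<^sup>2) \<partial>count_space (UNIV :: int set))"
    by (rule nn_integral_bij_count_space[symmetric, where g="\<lambda>n. n - k0"])
       (auto simp: bij_betw_def inj_on_def image_def intro!: exI[of _ "_ + k0"])
  also have "\<dots> \<le> (\<Sum>n. ennreal ((lp_weight (2 powr real_of_int (int n - k0) * z))\<^sup>2))
      + (\<Sum>n. ennreal ((lp_weight (2 powr real_of_int (- int n - k0) * z))\<^sup>2))"
    by (rule nn_integral_int_le)
  also have "\<dots> \<le> (\<Sum>n. ennreal (4 * (1/4) ^ n)) + (\<Sum>n. ennreal (4 * (1/4) ^ n))"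
    unfolding zu by (intro add_mono suminf_le ennreal_leI 1 2) auto
  also have "\<dots> = ennreal (32/3)" unfolding geo by (subst ennreal_plus[symmetric]) auto
  also have "\<dots> \<le> ennreal 12" by (rule ennreal_leI) simp
  finally show ?thesis .
qed

lemma measurable_ft [measurable]: "nice f \<Longrightarrow> ft f \<in> borel_measurable borel"
proof -
  assume "nice f"
  note [measurable] = measurable_nice[OF this]
  show ?thesis unfolding ft_def[abs_def] by measurable
qed

lemma measurable_lp_weight [measurable]: "lp_weight \<in> borel_measurable borel"
  unfolding lp_weight_def[abs_def] by measurable

text \<open>Almost orthogonality of the scales: Tonelli puts the sum over \<open>k\<close> inside,
  where it is bounded at each frequency, and Plancherel's theorem returns to \<open>f\<close>. The
  bound is uniform in \<open>c\<close>, later \<open>1 / 2 ^ j\<close>.\<close>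

lemma sum_scales_lp_weight_ft_le:
  fixes f :: "'a::euclidean_space \<Rightarrow> complex"
  assumes f: "nice f" and c: "c > 0"
  shows "(\<integral>\<^sup>+k. (\<integral>\<^sup>+\<xi>. ennreal ((lp_weight (2 powr real_of_int k * c * norm \<xi>) * norm (ft f \<xi>))\<^sup>2) \<partial>lborel) \<partial>count_space (UNIV :: int set))
    \<le> 12 * l2 f"
proof -
  note [measurable] = measurable_ft[OF f]
  have "(\<integral>\<^sup>+k. (\<integral>\<^sup>+\<xi>. ennreal ((lp_weight (2 powr real_of_int k * c * norm \<xi>) * norm (ft f \<xi>))\<^sup>2) \<partial>lborel) \<partial>count_space (UNIV :: int set))
     = (\<integral>\<^sup>+\<xi>. (\<integral>\<^sup>+k. ennreal ((lp_weight (2 powr real_of_int k * c * norm \<xi>) * norm (ft f \<xi>))\<^sup>2) \<partial>count_space (UNIV :: int set)) \<partial>lborel)"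
    by (rule nn_integral_count_space_nn_integral[symmetric]) auto
  also have "\<dots> \<le> (\<integral>\<^sup>+\<xi>. 12 * ennreal ((norm (ft f \<xi>))\<^sup>2) \<partial>lborel)"
  proof (intro nn_integral_mono)
    fix \<xi> :: 'a
    have "(\<integral>\<^sup>+k. ennreal ((lp_weight (2 powr real_of_int k * c * norm \<xi>) * norm (ft f \<xi>))\<^sup>2) \<partial>count_space (UNIV :: int set))
      = (\<integral>\<^sup>+k. ennreal ((lp_weight (2 powr real_of_int k * (c * norm \<xi>)))\<^sup>2) * ennreal ((norm (ft f \<xi>))\<^sup>2) \<partial>count_space (UNIV :: int set))"
      by (simp add: power_mult_distrib ennreal_mult mult.assoc)
    also have "\<dots> = (\<integral>\<^sup>+k. ennreal ((lp_weight (2 powr real_of_int k * (c * norm \<xi>)))\<^sup>2) \<partial>count_space (UNIV :: int set)) * ennreal ((norm (ft f \<xi>))\<^sup>2)"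
      by (rule nn_integral_multc) auto
    also have "\<dots> \<le> ennreal 12 * ennreal ((norm (ft f \<xi>))\<^sup>2)"
      using c by (intro mult_right_mono sum_lp_weight_le) auto
    finally show "(\<integral>\<^sup>+k. ennreal ((lp_weight (2 powr real_of_int k * c * norm \<xi>) * norm (ft f \<xi>))\<^sup>2) \<partial>count_space (UNIV :: int set))
      \<le> 12 * ennreal ((norm (ft f \<xi>))\<^sup>2)" by simp
  qed
  also have "\<dots> = 12 * l2 f"
    using plancherel[OF f] by (simp add: nn_integral_cmult l2_def)
  finally show ?thesis .
qed

subsection \<open>Pointwise bounds for the truncations\<close>

text \<open>Local mass without normalisation: it is monotone in the radius, so repeated
  mollification only enlarges the ball. It is converted to \<open>avg\<close> at the end.\<close>

definition loc :: "real \<Rightarrow> ('a::euclidean_space \<Rightarrow> complex) \<Rightarrow> 'a \<Rightarrow> ennreal" where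
  "loc c g x = (\<integral>\<^sup>+z. (if dist x z \<le> c then 1 else 0) * ennreal (norm (g z)) \<partial>lborel)"

lemma loc_mono: "c + dist x x' \<le> c' \<Longrightarrow> loc c g x' \<le> loc c' g x"
proof -
  assume *: "c + dist x x' \<le> c'"
  have "dist x z \<le> c'" if "dist x' z \<le> c" for z
    using dist_triangle[of x z x'] that * by simp
  then show ?thesis unfolding loc_def by (intro nn_integral_mono mult_right_mono) auto
qed

lemma loc_eq_avg:
  fixes g :: "'a::euclidean_space \<Rightarrow> complex"
  assumes g: "nice g" and c: "c > 0"
  shows "loc c g x = ennreal (c ^ DIM('a)) * avg c (\<lambda>z. ennreal (norm (g z))) x"
proof -
  note [measurable] = measurable_nice[OF g]
  have "ennreal (c ^ DIM('a)) * ball_kernel c x z = (if dist x z \<le> c then 1 else 0)" for z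
    using c by (simp add: ball_kernel_def ennreal_mult[symmetric])
  then show ?thesis
    unfolding loc_def avg_def by (subst nn_integral_cmult[symmetric]) (simp_all add: mult.assoc[symmetric])
qed

lemma nn_integral_norm_bk: "r > 0 \<Longrightarrow> (\<integral>\<^sup>+v. ennreal (norm (bk r (v::'a::euclidean_space))) \<partial>lborel) = 1"
proof -
  assume r: "r > 0"
  have "integrable lborel (\<lambda>v::'a. norm (bk r v))" using nice_bk[OF r, where 'a='a] by (simp add: nice_def)
  then show ?thesis by (simp add: nn_integral_eq_integral integral_norm_bk[OF r])
qed

context
  fixes r :: real
  assumes r: "r > 0"
begin

lemma norm_star_bk_diff_le:
  fixes g :: "'a::euclidean_space \<Rightarrow> complex"
  assumes g: "nice g" and near: "\<And>v. norm v \<le> r \<Longrightarrow> norm (g (z - v) - w) \<le> e"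
  shows "norm (star (bk r) g z - w) \<le> e"
proof -
  have bki: "integrable lborel (\<lambda>v. bk r (v::'a))" using nice_bk[OF r, where 'a='a] by (simp add: nice_def)
  have int: "integrable lborel (\<lambda>v. bk r v * g (z - v) - bk r v * w)"
    by (intro Bochner_Integration.integrable_diff integrable_star nice_bk r g integrable_mult_left bki)
  have "star (bk r) g z - w = (\<integral>v. bk r v * g (z - v) - bk r v * w \<partial>lborel)"
    unfolding star_altdef using bki integrable_star[OF nice_bk[OF r] g, of z] integral_bk[OF r, where 'a='a]
    by simp
  also have "norm \<dots> \<le> (\<integral>v. norm (bk r v * g (z - v) - bk r v * w) \<partial>lborel)" by (rule integral_norm_bound)
  also have "\<dots> \<le> (\<integral>v. e * norm (bk r (v::'a)) \<partial>lborel)"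
  proof (rule integral_mono)
    fix v :: 'a
    show "norm (bk r v * g (z - v) - bk r v * w) \<le> e * norm (bk r v)"
    proof (cases "norm v \<le> r")
      case True
      have "norm (bk r v) * norm (g (z - v) - w) \<le> norm (bk r v) * e"
        by (intro mult_left_mono near True) auto
      moreover have "bk r v * g (z - v) - bk r v * w = bk r v * (g (z - v) - w)" by (simp add: right_diff_distrib)
      ultimately show ?thesis by (simp only: norm_mult mult.commute[of e])
    qed (simp add: bk_eq_0[OF r])
  qed (use int bki in auto)
  also have "\<dots> = e" by (simp add: integral_norm_bk[OF r])
  finally show ?thesis .
qed

lemma ennreal_norm_star_bk_le_loc:
  fixes g :: "'a::euclidean_space \<Rightarrow> complex"
  assumes g: "nice g"
  shows "ennreal (norm (star (bk r) g x)) \<le> ennreal (bump_const TYPE('a) / r ^ DIM('a)) * loc r g x"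
proof -
  note [measurable] = measurable_nice[OF g] measurable_nice[OF nice_bk[OF r], where 'a='a]
  have "ennreal (norm (star (bk r) g x)) \<le> (\<integral>\<^sup>+v. ennreal (norm (bk r v)) * ennreal (norm (g (x - v))) \<partial>lborel)"
    by (rule ennreal_norm_star_le[OF nice_bk[OF r] g])
  also have "\<dots> \<le> (\<integral>\<^sup>+v. ennreal (bump_const TYPE('a) / r ^ DIM('a)) * ((if norm v \<le> r then 1 else 0) * ennreal (norm (g (x - v)))) \<partial>lborel)"
    using norm_bk_le[OF r, where 'a='a] bk_eq_0[OF r, where 'a='a]
    by (intro nn_integral_mono) (auto intro!: mult_right_mono ennreal_leI)
  also have "\<dots> = ennreal (bump_const TYPE('a) / r ^ DIM('a)) * (\<integral>\<^sup>+v. (if norm v \<le> r then 1 else 0) * ennreal (norm (g (x - v))) \<partial>lborel)"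
    by (rule nn_integral_cmult) measurable
  also have "(\<integral>\<^sup>+v. (if norm v \<le> r then 1 else 0) * ennreal (norm (g (x - v))) \<partial>lborel) = loc r g x"
    unfolding loc_def
    by (subst nn_integral_lborel_reflect[symmetric, of _ x]) (simp_all add: dist_norm)
  finally show ?thesis .
qed

text \<open>Each translate by a vector of length at most \<open>r\<close> moves mass into the ball
  enlarged by \<open>r\<close>, and the kernel averages such translates with total mass one.\<close>

lemma loc_star_bk_le:
  fixes g :: "'a::euclidean_space \<Rightarrow> complex"
  assumes g: "nice g"
  shows "loc c (star (bk r) g) x \<le> loc (c + r) g x"
proof -
  note [measurable] = measurable_nice[OF g] measurable_nice[OF nice_bk[OF r], where 'a='a]
  let ?i = "\<lambda>z. (if dist x z \<le> c then 1 else 0) :: ennreal"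
  have "loc c (star (bk r) g) x \<le> (\<integral>\<^sup>+z. (\<integral>\<^sup>+v. ?i z * (ennreal (norm (bk r v)) * ennreal (norm (g (z - v)))) \<partial>lborel) \<partial>lborel)"
    unfolding loc_def
  proof (intro nn_integral_mono)
    fix z
    have "?i z * ennreal (norm (star (bk r) g z)) \<le> ?i z * (\<integral>\<^sup>+v. ennreal (norm (bk r v)) * ennreal (norm (g (z - v))) \<partial>lborel)"
      by (intro mult_left_mono ennreal_norm_star_le nice_bk r g) auto
    also have "\<dots> = (\<integral>\<^sup>+v. ?i z * (ennreal (norm (bk r v)) * ennreal (norm (g (z - v)))) \<partial>lborel)"
      by (subst nn_integral_cmult) simp_all
    finally show "?i z * ennreal (norm (star (bk r) g z)) \<le> \<dots>" .
  qed
  also have "\<dots> = (\<integral>\<^sup>+v. (\<integral>\<^sup>+z. ?i z * (ennreal (norm (bk r v)) * ennreal (norm (g (z - v)))) \<partial>lborel) \<partial>lborel)"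
    by (rule lborel_pair.Fubini') simp
  also have "\<dots> \<le> (\<integral>\<^sup>+v. ennreal (norm (bk r (v::'a))) * loc (c + r) g x \<partial>lborel)"
  proof (intro nn_integral_mono)
    fix v :: 'a
    have "(\<integral>\<^sup>+z. ?i z * (ennreal (norm (bk r v)) * ennreal (norm (g (z - v)))) \<partial>lborel)
        = ennreal (norm (bk r v)) * (\<integral>\<^sup>+z. ?i z * ennreal (norm (g (z - v))) \<partial>lborel)"
      by (subst nn_integral_cmult[symmetric]) (simp_all add: mult_ac)
    also have "(\<integral>\<^sup>+z. ?i z * ennreal (norm (g (z - v))) \<partial>lborel) = (\<integral>\<^sup>+z. ?i (v + z) * ennreal (norm (g (v + z - v))) \<partial>lborel)"
      by (rule nn_integral_lborel_shift[symmetric]) simp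
    also have "\<dots> = (\<integral>\<^sup>+z. ?i (v + z) * ennreal (norm (g z)) \<partial>lborel)" by simp
    also have "ennreal (norm (bk r v)) * \<dots> \<le> ennreal (norm (bk r v)) * loc (c + r) g x"
    proof (cases "norm v \<le> r")
      case True
      have "dist x z \<le> c + r" if "dist x (v + z) \<le> c" for z
        using norm_triangle_ineq[of "x - (v + z)" v] that True by (simp add: dist_norm algebra_simps)
      then show ?thesis unfolding loc_def by (intro mult_left_mono nn_integral_mono mult_right_mono) auto
    qed (simp add: bk_eq_0[OF r])
    finally show "(\<integral>\<^sup>+z. ?i z * (ennreal (norm (bk r v)) * ennreal (norm (g (z - v)))) \<partial>lborel)
        \<le> ennreal (norm (bk r v)) * loc (c + r) g x" .
  qed
  also have "\<dots> = loc (c + r) g x"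
    by (simp add: nn_integral_multc nn_integral_norm_bk[OF r])
  finally show ?thesis .
qed

lemma loc_fdiff_le:
  fixes g :: "'a::euclidean_space \<Rightarrow> complex"
  assumes g: "nice g"
  shows "loc c (fdiff r g) x \<le> 2 * loc (c + 2 * r) g x"
proof -
  let ?h = "star (bk r) (star (bk r) g)"
  have h: "nice ?h" by (intro nice_star nice_bk r g)
  note [measurable] = measurable_nice[OF g] measurable_nice[OF h]
  have "loc c (fdiff r g) x \<le> (\<integral>\<^sup>+z. (if dist x z \<le> c then 1 else 0) * ennreal (norm (g z))
      + (if dist x z \<le> c then 1 else 0) * ennreal (norm (?h z)) \<partial>lborel)"
    unfolding loc_def fdiff_def
    by (intro nn_integral_mono) (auto simp: ennreal_plus[symmetric] simp del: ennreal_plus intro!: ennreal_leI norm_triangle_ineq4)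
  also have "\<dots> = loc c g x + loc c ?h x"
    unfolding loc_def by (rule nn_integral_add) measurable
  finally have *: "loc c (fdiff r g) x \<le> loc c g x + loc c ?h x" .
  have "loc c ?h x \<le> loc (c + r + r) g x"
    by (rule order_trans[OF loc_star_bk_le loc_star_bk_le]) (intro nice_star nice_bk r g)+
  then have h_le: "loc c ?h x \<le> loc (c + 2 * r) g x" by (simp only: mult_2 add.assoc)
  have "loc c g x \<le> loc (c + 2 * r) g x" using r by (intro loc_mono) auto
  from order_trans[OF * add_mono[OF this h_le]] show ?thesis by (simp only: mult_2)
qed

lemma loc_fdiff_pow_le:
  fixes f :: "'a::euclidean_space \<Rightarrow> complex"
  assumes f: "nice f"
  shows "loc c ((fdiff r ^^ i) f) x \<le> 2 ^ i * loc (c + 2 * real i * r) f x"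
proof (induction i arbitrary: c)
  case (Suc i)
  have "loc c ((fdiff r ^^ Suc i) f) x \<le> 2 * loc (c + 2 * r) ((fdiff r ^^ i) f) x"
    by simp (rule loc_fdiff_le[OF nice_fdiff_pow[OF r f]])
  also have "\<dots> \<le> 2 * (2 ^ i * loc (c + 2 * r + 2 * real i * r) f x)"
    by (intro mult_left_mono Suc) auto
  finally show ?case by (simp add: algebra_simps)
qed simp

text \<open>The first mollification gives a bound by local mass and each \<open>fdiff\<close>
  enlarges the ball by \<open>2 * r\<close>. The offset \<open>4 * r\<close> leaves room for one
  more mollification in \<open>trunc_le_avg\<close>.\<close>

lemma pretrunc_le_avg:
  fixes f :: "'a::euclidean_space \<Rightarrow> complex"
  assumes f: "nice f" and x: "dist x x' \<le> 4 * r"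
  shows "ennreal (norm (pretrunc n r f x'))
    \<le> ennreal (real n * bump_const TYPE('a) * 2 ^ n * (2 ^ (2 * n + 5)) ^ DIM('a))
      * avg (2 ^ (2 * n + 5) * r) (\<lambda>z. ennreal (norm (f z))) x"
proof -
  let ?c = "bump_const TYPE('a) / r ^ DIM('a)" and ?R = "2 ^ (2 * n + 5) * r"
  have c0: "?c \<ge> 0" using bump_const_pos[where 'a='a] r by simp
  have "norm (pretrunc n r f x') \<le> (\<Sum>i<n. norm (star (bk r) ((fdiff r ^^ i) f) x'))"
    unfolding pretrunc_def by (rule norm_sum)
  then have "ennreal (norm (pretrunc n r f x')) \<le> ennreal (\<Sum>i<n. norm (star (bk r) ((fdiff r ^^ i) f) x'))"
    by (rule ennreal_leI)
  also have "\<dots> = (\<Sum>i<n. ennreal (norm (star (bk r) ((fdiff r ^^ i) f) x')))" by (simp add: sum_ennreal)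
  also have "\<dots> \<le> (\<Sum>i<n. ennreal ?c * (2 ^ n * loc ?R f x))"
  proof (intro sum_mono)
    fix i assume "i \<in> {..<n}"
    then have i: "i < n" by simp
    \<comment> \<open>The total radius is at most \<open>(1 + 2 * i + 4) * r\<close>. Rounding the
      factor up to a power of two keeps dyadic radii dyadic, so that the dyadic maximal function
      dominates the average.\<close>
    have "real (2 * n + 5) \<le> 2 ^ (2 * n + 5)" using of_nat_less_two_power[of "2 * n + 5", where 'a=real] by linarith
    moreover have "1 + 2 * real i + 4 \<le> real (2 * n + 5)" using i by simp
    ultimately have "(1 + 2 * real i + 4) * r \<le> ?R" using r by (intro mult_right_mono) linarith+
    then have R: "r + 2 * real i * r + dist x x' \<le> ?R" using x by (simp add: algebra_simps)
    have "ennreal (norm (star (bk r) ((fdiff r ^^ i) f) x')) \<le> ennreal ?c * loc r ((fdiff r ^^ i) f) x'"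
      by (rule ennreal_norm_star_bk_le_loc[OF nice_fdiff_pow[OF r f]])
    also have "loc r ((fdiff r ^^ i) f) x' \<le> 2 ^ i * loc (r + 2 * real i * r) f x'"
      by (rule loc_fdiff_pow_le[OF f])
    also have "\<dots> \<le> 2 ^ n * loc ?R f x"
      using i by (intro mult_mono loc_mono[OF R] power_increasing) auto
    finally show "ennreal (norm (star (bk r) ((fdiff r ^^ i) f) x')) \<le> ennreal ?c * (2 ^ n * loc ?R f x)"
      by (simp add: mult_left_mono)
  qed
  also have "\<dots> = ennreal (real n * ?c * 2 ^ n) * loc ?R f x"
  proof -
    have "(2::ennreal) ^ n = ennreal (2 ^ n)" using ennreal_power[of 2 n] by simp
    then have "of_nat n * (ennreal c * ((2::ennreal) ^ n * L)) = ennreal (real n * c * 2 ^ n) * L" if "c \<ge> 0" for c L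
      using that by (simp add: ennreal_mult ennreal_of_nat_eq_real_of_nat mult.assoc)
    from this[OF c0] show ?thesis by simp
  qed
  also have "\<dots> = ennreal (real n * ?c * 2 ^ n * ?R ^ DIM('a)) * avg ?R (\<lambda>z. ennreal (norm (f z))) x"
  proof -
    have "0 \<le> real n * ?c * 2 ^ n" by (intro mult_nonneg_nonneg c0) auto
    moreover have "0 \<le> ?R ^ DIM('a)" "0 < ?R" using r by auto
    ultimately show ?thesis
      by (simp only: loc_eq_avg[OF f] mult.assoc[symmetric] ennreal_mult[symmetric])
  qed
  also have "real n * ?c * 2 ^ n * ?R ^ DIM('a) = real n * bump_const TYPE('a) * 2 ^ n * (2 ^ (2 * n + 5)) ^ DIM('a)"
    using r by (simp add: power_mult_distrib field_simps)
  finally show ?thesis .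
qed

lemma trunc_le_avg:
  fixes f :: "'a::euclidean_space \<Rightarrow> complex"
  assumes f: "nice f" and x: "dist x x' \<le> 3 * r"
  shows "ennreal (norm (trunc n r f x'))
    \<le> ennreal (real n * bump_const TYPE('a) * 2 ^ n * (2 ^ (2 * n + 5)) ^ DIM('a))
      * avg (2 ^ (2 * n + 5) * r) (\<lambda>z. ennreal (norm (f z))) x" (is "_ \<le> ?A")
proof -
  note [measurable] = measurable_nice[OF nice_bk[OF r], where 'a='a]
  have "ennreal (norm (trunc n r f x')) \<le> (\<integral>\<^sup>+v. ennreal (norm (bk r v)) * ennreal (norm (pretrunc n r f (x' - v))) \<partial>lborel)"
    unfolding trunc_def by (rule ennreal_norm_star_le[OF nice_bk[OF r] nice_pretrunc[OF r f]])
  also have "\<dots> \<le> (\<integral>\<^sup>+v. ennreal (norm (bk r (v::'a))) * ?A \<partial>lborel)"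
  proof (intro nn_integral_mono)
    fix v :: 'a
    show "ennreal (norm (bk r v)) * ennreal (norm (pretrunc n r f (x' - v))) \<le> ennreal (norm (bk r v)) * ?A"
    proof (cases "norm v \<le> r")
      case True
      then have "dist x (x' - v) \<le> 4 * r"
        using x norm_triangle_ineq[of "x - x'" v] by (simp add: dist_norm algebra_simps)
      then show ?thesis by (intro mult_left_mono pretrunc_le_avg f) auto
    qed (simp add: bk_eq_0[OF r])
  qed
  also have "\<dots> = ?A" by (simp add: nn_integral_multc nn_integral_norm_bk[OF r])
  finally show ?thesis .
qed

lemma norm_fdiff_le:
  fixes g :: "'a::euclidean_space \<Rightarrow> complex"
  assumes g: "nice g" and near: "\<And>z'. dist z z' \<le> 2 * r \<Longrightarrow> norm (g z' - w) \<le> e"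
  shows "norm (fdiff r g z) \<le> 2 * e"
proof -
  have "norm (star (bk r) (star (bk r) g) z - w) \<le> e"
  proof (intro norm_star_bk_diff_le nice_star nice_bk r g near)
    fix v v' :: 'a assume "norm v \<le> r" "norm v' \<le> r"
    then show "dist z (z - v - v') \<le> 2 * r"
      using norm_triangle_ineq[of v' v] by (simp add: dist_norm)
  qed
  moreover have "norm (g z - w) \<le> e" using r by (intro near) simp
  ultimately show ?thesis
    unfolding fdiff_def using norm_triangle_ineq4[of "g z - w" "star (bk r) (star (bk r) g) z - w"] by simp
qed

text \<open>\<open>fdiff\<close> annihilates constants, so the innermost application sees only the
  oscillation of \<open>f\<close> about \<open>w\<close>; the later ones act on values that are
  already small. The choice \<open>w = 0\<close> gives uniform bounds, \<open>w = f x\<close> gives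
  convergence.\<close>

lemma norm_fdiff_pow_le:
  fixes f :: "'a::euclidean_space \<Rightarrow> complex"
  assumes f: "nice f" and near: "\<And>z'. dist z z' \<le> 2 * real (Suc i) * r \<Longrightarrow> norm (f z' - w) \<le> e"
  shows "norm ((fdiff r ^^ Suc i) f z) \<le> 2 ^ Suc i * e"
  using near
proof (induction i arbitrary: z)
  case 0
  then show ?case using norm_fdiff_le[OF f, of z w e] by simp
next
  case (Suc i)
  have "norm (fdiff r ((fdiff r ^^ Suc i) f) z) \<le> 2 * (2 ^ Suc i * e)"
  proof (rule norm_fdiff_le[OF nice_fdiff_pow[OF r f], where w=0])
    fix z' assume z': "dist z z' \<le> 2 * r"
    have "norm ((fdiff r ^^ Suc i) f z') \<le> 2 ^ Suc i * e"
    proof (rule Suc.IH)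
      fix z'' assume "dist z' z'' \<le> 2 * real (Suc i) * r"
      then have "dist z z'' \<le> 2 * real (Suc (Suc i)) * r"
        using z' dist_triangle[of z z'' z'] by (simp add: algebra_simps)
      then show "norm (f z'' - w) \<le> e" by (rule Suc.prems)
    qed
    then show "norm ((fdiff r ^^ Suc i) f z' - 0) \<le> 2 ^ Suc i * e" by simp
  qed
  then show ?case by simp
qed

end

lemma norm_trunc_le:
  fixes f :: "'a::euclidean_space \<Rightarrow> complex"
  assumes "r > 0" and f: "nice f" and B: "\<And>x. norm (f x) \<le> B"
  shows "norm (trunc (Suc n) r f x) \<le> (1 + 2 ^ Suc n) * B"
proof -
  have "norm ((fdiff r ^^ Suc n) f x) \<le> 2 ^ Suc n * B"
    by (rule norm_fdiff_pow_le[OF assms(1) f, where w=0]) (use B in simp)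
  then have "norm (f x - (fdiff r ^^ Suc n) f x) \<le> B + 2 ^ Suc n * B"
    using norm_triangle_ineq4[of "f x" "(fdiff r ^^ Suc n) f x"] B[of x] by linarith
  then show ?thesis unfolding trunc_eq_diff[OF assms(1) f] by (simp add: distrib_right)
qed

lemma trunc_tendsto:
  fixes f :: "'a::euclidean_space \<Rightarrow> complex"
  assumes f: "nice f" and R: "R \<longlonglongrightarrow> 0" "\<And>k. R k > 0"
  shows "(\<lambda>k. trunc (Suc n) (R k) f x) \<longlonglongrightarrow> f x"
proof (rule tendstoI)
  fix e :: real assume e: "e > 0"
  define e' where "e' = e / (2 * 2 ^ Suc n)"
  have e': "e' > 0" using e by (simp add: e'_def)
  have "isCont f x" using f by (auto simp: nice_def continuous_on_eq_continuous_at)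
  then obtain \<delta> where \<delta>: "\<delta> > 0" "\<And>z. dist z x < \<delta> \<Longrightarrow> dist (f z) (f x) < e'"
    using e' unfolding continuous_at_eps_delta by blast
  have "\<forall>\<^sub>F k in sequentially. R k < \<delta> / (2 * real (Suc n))"
    by (rule order_tendstoD(2)[OF R(1)]) (use \<delta> in simp)
  then show "\<forall>\<^sub>F k in sequentially. dist (trunc (Suc n) (R k) f x) (f x) < e"
  proof eventually_elim
    case (elim k)
    have "norm ((fdiff (R k) ^^ Suc n) f x) \<le> 2 ^ Suc n * e'"
    proof (rule norm_fdiff_pow_le[OF R(2) f, where w="f x"])
      fix z assume "dist x z \<le> 2 * real (Suc n) * R k"
      also have "\<dots> < \<delta>" using elim by (simp add: field_simps)
      finally show "norm (f z - f x) \<le> e'" using \<delta>(2)[of z] by (simp add: dist_norm norm_minus_commute)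
    qed
    also have "\<dots> < e" using e by (simp add: e'_def)
    finally show ?case unfolding trunc_eq_diff[OF R(2) f] by (simp add: dist_norm del: funpow.simps)
  qed
qed

subsection \<open>Local square averages at all scales\<close>

lemma nn_integral_avg:
  fixes f :: "'a::euclidean_space \<Rightarrow> ennreal"
  assumes [measurable]: "f \<in> borel_measurable borel" and "\<rho> > 0"
  shows "(\<integral>\<^sup>+x. avg \<rho> f x \<partial>lborel) = ennreal (unit_ball_vol (real DIM('a))) * (\<integral>\<^sup>+x. f x \<partial>lborel)"
proof -
  have "(\<integral>\<^sup>+x. avg \<rho> f x \<partial>lborel) = (\<integral>\<^sup>+z. (\<integral>\<^sup>+x. ball_kernel \<rho> x z * f z \<partial>lborel) \<partial>lborel)"
    unfolding avg_def by (rule lborel_pair.Fubini') simp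
  also have "\<dots> = (\<integral>\<^sup>+z. ennreal (unit_ball_vol (real DIM('a))) * f z \<partial>lborel)"
    using nn_integral_ball_kernel[OF assms(2), where 'a='a]
    by (simp add: nn_integral_multc ball_kernel_commute[of \<rho> _ "_::'a"])
  finally show ?thesis by (simp add: nn_integral_cmult)
qed

lemma l2_eq_ft: "nice f \<Longrightarrow> l2 f = (\<integral>\<^sup>+\<xi>. ennreal ((norm (ft f \<xi>))\<^sup>2) \<partial>lborel)"
  unfolding l2_def by (rule plancherel[symmetric])

text \<open>Cauchy--Schwarz for \<open>Suc j\<close> terms. This factor is one of the two powers of
  \<open>j\<close> in the growth of the square averages.\<close>

lemma norm_add_sum_power2_le:
  fixes p :: complex
  shows "(norm (p + (\<Sum>l<j. d l)))\<^sup>2 \<le> real (Suc j) * ((norm p)\<^sup>2 + (\<Sum>l<j. (norm (d l))\<^sup>2))"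
proof -
  define a where "a i = (case i of 0 \<Rightarrow> norm p | Suc l \<Rightarrow> norm (d l))" for i
  have s: "(\<Sum>i<Suc j. a i) = norm p + (\<Sum>l<j. norm (d l))"
    "(\<Sum>i<Suc j. (a i)\<^sup>2) = (norm p)\<^sup>2 + (\<Sum>l<j. (norm (d l))\<^sup>2)"
    unfolding sum.lessThan_Suc_shift by (simp_all add: a_def)
  have "norm (p + (\<Sum>l<j. d l)) \<le> (\<Sum>i<Suc j. a i)"
    unfolding s by (rule order_trans[OF norm_triangle_ineq]) (simp add: norm_sum)
  then have "(norm (p + (\<Sum>l<j. d l)))\<^sup>2 \<le> (\<Sum>i<Suc j. a i)\<^sup>2" by (intro power_mono) auto
  also have "\<dots> \<le> (\<Sum>i<Suc j. (a i)\<^sup>2) * card {..<Suc j}"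
    by (rule sum_squared_le_sum_of_squares)
  finally show ?thesis unfolding s by (simp add: mult.commute)
qed

lemma ennreal_square_mono:
  fixes a :: real and b :: ennreal
  assumes "0 \<le> a" "ennreal a \<le> b"
  shows "ennreal (a\<^sup>2) \<le> b\<^sup>2"
  using power_mono[OF assms(2), of 2] assms(1) by (simp add: ennreal_power)

lemma measurable_nn_integral_int:
  assumes [measurable]: "\<And>k::int. f k \<in> borel_measurable M"
  shows "(\<lambda>x. \<integral>\<^sup>+k. f k x \<partial>count_space UNIV) \<in> borel_measurable M"
proof -
  have "(\<integral>\<^sup>+k. f k x \<partial>count_space UNIV) = (\<Sum>n. f (int_decode n) x)" for x
    by (subst nn_integral_bij_count_space[symmetric, OF bij_int_decode])
       (simp add: nn_integral_count_space_nat)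
  then show ?thesis by simp
qed

text \<open>The ball is much larger than the smoothing scale, so averages of
  \<open>norm (f z)\<close> alone do not control these square averages. The function is telescoped
  from scale \<open>2 powr k\<close> down to \<open>2 powr k / 2 ^ j\<close>. The first piece lies
  below the maximal function; for each of the \<open>j\<close> differences the supremum over
  \<open>k\<close> is replaced by the sum, which converges thanks to
  \<open>lp_weight\<close>.\<close>

lemma pretrunc_sup_L2:
  obtains C where "C > 0"
    "\<And>(f :: 'a::euclidean_space \<Rightarrow> complex) j. nice f \<Longrightarrow>
      (\<integral>\<^sup>+x. (SUP k::int. avg (4 * 2 powr k) (\<lambda>z. ennreal ((norm (pretrunc (Suc n) (2 powr k / 2 ^ j) f z))\<^sup>2)) x) \<partial>lborel)
      \<le> ennreal (C * (real j + 1)\<^sup>2) * l2 f"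
proof -
  obtain M where M: "M > 0" "\<And>f::'a \<Rightarrow> ennreal. f \<in> borel_measurable borel \<Longrightarrow>
    (\<integral>\<^sup>+x. (SUP k::int. avg (2 powr k) f x)\<^sup>2 \<partial>lborel) \<le> ennreal M * (\<integral>\<^sup>+x. (f x)\<^sup>2 \<partial>lborel)"
    using dyadic_maximal_L2 by blast
  obtain D where D: "D > 0"
    "\<And>r f \<xi>::'a. r > 0 \<Longrightarrow> nice f \<Longrightarrow>
      norm (ft (pretrunc (Suc n) (r / 2) f) \<xi> - ft (pretrunc (Suc n) r f) \<xi>)
        \<le> D * lp_weight (r * norm \<xi>) * norm (ft f \<xi>)"
    using ft_pretrunc_diff_bound by metis
  define w where "w = unit_ball_vol (real DIM('a))"
  have w0: "w > 0" by (simp add: w_def)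
  define A where "A = real (Suc n) * bump_const TYPE('a) * 2 ^ Suc n * (2 ^ (2 * Suc n + 5)) ^ DIM('a)"
  have A0: "A \<ge> 0" using bump_const_pos[where 'a='a] by (simp add: A_def)
  define C where "C = w * A\<^sup>2 * M + w * (D\<^sup>2 * 12) + 1"
  have C: "C > 0" using w0 M(1) unfolding C_def by (intro add_nonneg_pos add_nonneg_nonneg mult_nonneg_nonneg) auto
  show thesis
  proof (rule that[OF C])
    fix f :: "'a \<Rightarrow> complex" and j :: nat assume f: "nice f"
    define Mf where "Mf x = (SUP k::int. avg (2 powr k) (\<lambda>z. ennreal (norm (f z))) x)" for x
    define P where "P k l = pretrunc (Suc n) (2 powr real_of_int k / 2 ^ l) f" for k :: int and l
    define d where "d k l z = P k (Suc l) z - P k l z" for k l z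
    have P: "nice (P k l)" for k l unfolding P_def by (intro nice_pretrunc f) simp
    have d: "nice (d k l)" for k l unfolding d_def[abs_def] by (intro nice_diff P)
    note [measurable] = measurable_nice[OF P] measurable_nice[OF d] measurable_nice[OF f] measurable_ft[OF f]
    have [measurable]: "Mf \<in> borel_measurable borel" unfolding Mf_def by measurable
    define E where "E k l x = avg (4 * 2 powr real_of_int k) (\<lambda>z. ennreal ((norm (d k l z))\<^sup>2)) x" for k :: int and l x
    have [measurable]: "E k l \<in> borel_measurable borel" for k l unfolding E_def by measurable
    have Pj: "P k j z = P k 0 z + (\<Sum>l<j. d k l z)" for k z
      unfolding d_def by (subst sum_lessThan_telescope) simp
    \<comment> \<open>At \<open>j = 0\<close> smoothing scale and ball are comparable, so the
      function is bounded on the whole ball by the maximal function at the centre.\<close>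
    have base: "avg (4 * 2 powr real_of_int k) (\<lambda>z. ennreal ((norm (P k 0 z))\<^sup>2)) x \<le> ennreal (w * A\<^sup>2) * (Mf x)\<^sup>2" for k :: int and x
    proof -
      let ?\<rho> = "2 powr real_of_int k"
      have "ball_kernel (4 * ?\<rho>) x z * ennreal ((norm (P k 0 z))\<^sup>2) \<le> ball_kernel (4 * ?\<rho>) x z * (ennreal A * Mf x)\<^sup>2" for z
      proof (cases "dist x z \<le> 4 * ?\<rho>")
        case True
        have "ennreal (norm (P k 0 z)) \<le> ennreal A * avg (2 ^ (2 * Suc n + 5) * ?\<rho>) (\<lambda>z. ennreal (norm (f z))) x"
          unfolding P_def A_def using pretrunc_le_avg[of ?\<rho> f x z "Suc n"] f True by simp
        also have "\<dots> \<le> ennreal A * Mf x"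
        proof (rule mult_left_mono)
          have "2 ^ (2 * Suc n + 5) * ?\<rho> = 2 powr real_of_int (k + int (2 * Suc n + 5))"
            by (simp only: powr_add powr_realpow of_int_add of_int_of_nat_eq zero_less_numeral mult.commute)
          then show "avg (2 ^ (2 * Suc n + 5) * ?\<rho>) (\<lambda>z. ennreal (norm (f z))) x \<le> Mf x"
            unfolding Mf_def by (simp only:) (rule SUP_upper, simp)
        qed simp
        finally have "ennreal (norm (P k 0 z)) \<le> ennreal A * Mf x" .
        then show ?thesis by (intro mult_left_mono ennreal_square_mono) auto
      qed (simp add: ball_kernel_def)
      then have "avg (4 * ?\<rho>) (\<lambda>z. ennreal ((norm (P k 0 z))\<^sup>2)) x \<le> (\<integral>\<^sup>+z. ball_kernel (4 * ?\<rho>) x z * (ennreal A * Mf x)\<^sup>2 \<partial>lborel)"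
        unfolding avg_def by (rule nn_integral_mono)
      also have "\<dots> = ennreal w * (ennreal A * Mf x)\<^sup>2"
        by (simp add: nn_integral_multc nn_integral_ball_kernel w_def)
      also have "\<dots> = ennreal (w * A\<^sup>2) * (Mf x)\<^sup>2"
        using A0 w0 by (simp add: power_mult_distrib ennreal_power ennreal_mult mult.assoc)
      finally show ?thesis .
    qed
    \<comment> \<open>The right side no longer depends on \<open>k\<close>: in the difference terms
      the given scale is one summand among all scales.\<close>
    have pt: "avg (4 * 2 powr real_of_int k) (\<lambda>z. ennreal ((norm (P k j z))\<^sup>2)) x
       \<le> ennreal (real j + 1) * (ennreal (w * A\<^sup>2) * (Mf x)\<^sup>2 + (\<Sum>l<j. \<integral>\<^sup>+k. E k l x \<partial>count_space UNIV))" for k :: int and x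
    proof -
      let ?b = "\<lambda>z. ball_kernel (4 * 2 powr real_of_int k) x z"
      have "?b z * ennreal ((norm (P k j z))\<^sup>2)
        \<le> ennreal (real j + 1) * (?b z * ennreal ((norm (P k 0 z))\<^sup>2) + (\<Sum>l<j. ?b z * ennreal ((norm (d k l z))\<^sup>2)))" for z
      proof -
        have "ennreal ((norm (P k j z))\<^sup>2) \<le> ennreal ((real j + 1) * ((norm (P k 0 z))\<^sup>2 + (\<Sum>l<j. (norm (d k l z))\<^sup>2)))"
          using norm_add_sum_power2_le[of "P k 0 z" "\<lambda>l. d k l z" j] unfolding Pj by (intro ennreal_leI) (simp add: add.commute)
        also have "\<dots> = ennreal (real j + 1) * (ennreal ((norm (P k 0 z))\<^sup>2) + (\<Sum>l<j. ennreal ((norm (d k l z))\<^sup>2)))"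
          by (subst ennreal_mult) (auto simp: ennreal_plus sum_nonneg sum_ennreal)
        finally have "?b z * ennreal ((norm (P k j z))\<^sup>2) \<le> ?b z * (ennreal (real j + 1) * (ennreal ((norm (P k 0 z))\<^sup>2) + (\<Sum>l<j. ennreal ((norm (d k l z))\<^sup>2))))"
          by (rule mult_left_mono) simp
        then show ?thesis by (simp only: distrib_left sum_distrib_left mult_ac)
      qed
      then have "avg (4 * 2 powr real_of_int k) (\<lambda>z. ennreal ((norm (P k j z))\<^sup>2)) x
        \<le> (\<integral>\<^sup>+z. ennreal (real j + 1) * (?b z * ennreal ((norm (P k 0 z))\<^sup>2) + (\<Sum>l<j. ?b z * ennreal ((norm (d k l z))\<^sup>2))) \<partial>lborel)"
        unfolding avg_def by (rule nn_integral_mono)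
      also have "\<dots> = ennreal (real j + 1) * (avg (4 * 2 powr real_of_int k) (\<lambda>z. ennreal ((norm (P k 0 z))\<^sup>2)) x + (\<Sum>l<j. E k l x))"
        by (simp add: nn_integral_cmult nn_integral_add nn_integral_sum avg_def E_def)
      also have "\<dots> \<le> ennreal (real j + 1) * (ennreal (w * A\<^sup>2) * (Mf x)\<^sup>2 + (\<Sum>l<j. \<integral>\<^sup>+k. E k l x \<partial>count_space UNIV))"
        by (intro mult_left_mono add_mono base sum_mono nn_integral_ge_point) auto
      finally show ?thesis .
    qed
    have Eint: "(\<integral>\<^sup>+x. (\<integral>\<^sup>+k. E k l x \<partial>count_space UNIV) \<partial>lborel) \<le> ennreal (w * (D\<^sup>2 * 12)) * l2 f" for l
    proof -
      have "(\<integral>\<^sup>+x. (\<integral>\<^sup>+k. E k l x \<partial>count_space UNIV) \<partial>lborel) = (\<integral>\<^sup>+k. (\<integral>\<^sup>+x. E k l x \<partial>lborel) \<partial>count_space UNIV)"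
        by (rule nn_integral_count_space_nn_integral) auto
      also have "\<dots> = (\<integral>\<^sup>+k. ennreal w * l2 (d k l) \<partial>count_space UNIV)"
        by (intro nn_integral_cong) (simp add: E_def nn_integral_avg l2_def w_def)
      also have "\<dots> \<le> (\<integral>\<^sup>+k. ennreal (w * D\<^sup>2) * (\<integral>\<^sup>+\<xi>. ennreal ((lp_weight (2 powr real_of_int k * (1 / 2 ^ l) * norm \<xi>) * norm (ft f \<xi>))\<^sup>2) \<partial>lborel) \<partial>count_space UNIV)"
      proof (intro nn_integral_mono)
        fix k :: int
        let ?r = "2 powr real_of_int k / 2 ^ l"
        have "l2 (d k l) = (\<integral>\<^sup>+\<xi>. ennreal ((norm (ft (d k l) \<xi>))\<^sup>2) \<partial>lborel)" by (rule l2_eq_ft[OF d])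
        also have "\<dots> \<le> (\<integral>\<^sup>+\<xi>. ennreal (D\<^sup>2) * ennreal ((lp_weight (2 powr real_of_int k * (1 / 2 ^ l) * norm \<xi>) * norm (ft f \<xi>))\<^sup>2) \<partial>lborel)"
        proof (intro nn_integral_mono)
          fix \<xi> :: 'a
          have "ft (d k l) \<xi> = ft (pretrunc (Suc n) (?r / 2) f) \<xi> - ft (pretrunc (Suc n) ?r f) \<xi>"
            using ft_diff[OF P P, of k "Suc l" k l \<xi>] by (simp add: d_def[abs_def] P_def divide_divide_eq_left mult.commute)
          then have "norm (ft (d k l) \<xi>) \<le> D * lp_weight (?r * norm \<xi>) * norm (ft f \<xi>)"
            using D(2)[of ?r f \<xi>] f by simp
          then have "(norm (ft (d k l) \<xi>))\<^sup>2 \<le> (D * (lp_weight (2 powr real_of_int k * (1 / 2 ^ l) * norm \<xi>) * norm (ft f \<xi>)))\<^sup>2"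
            by (intro power_mono) (simp_all add: mult.assoc)
          then show "ennreal ((norm (ft (d k l) \<xi>))\<^sup>2) \<le> ennreal (D\<^sup>2) * ennreal ((lp_weight (2 powr real_of_int k * (1 / 2 ^ l) * norm \<xi>) * norm (ft f \<xi>))\<^sup>2)"
            by (subst ennreal_mult[symmetric]) (auto simp: power_mult_distrib intro!: ennreal_leI)
        qed
        also have "\<dots> = ennreal (D\<^sup>2) * (\<integral>\<^sup>+\<xi>. ennreal ((lp_weight (2 powr real_of_int k * (1 / 2 ^ l) * norm \<xi>) * norm (ft f \<xi>))\<^sup>2) \<partial>lborel)"
          by (rule nn_integral_cmult) simp
        finally show "ennreal w * l2 (d k l) \<le> ennreal (w * D\<^sup>2) * (\<integral>\<^sup>+\<xi>. ennreal ((lp_weight (2 powr real_of_int k * (1 / 2 ^ l) * norm \<xi>) * norm (ft f \<xi>))\<^sup>2) \<partial>lborel)"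
          using w0 mult_left_mono[of "l2 (d k l)" _ "ennreal w"] by (simp add: ennreal_mult mult.assoc)
      qed
      also have "\<dots> = ennreal (w * D\<^sup>2) * (\<integral>\<^sup>+k. (\<integral>\<^sup>+\<xi>. ennreal ((lp_weight (2 powr real_of_int k * (1 / 2 ^ l) * norm \<xi>) * norm (ft f \<xi>))\<^sup>2) \<partial>lborel) \<partial>count_space (UNIV :: int set))"
        by (rule nn_integral_cmult) simp
      also have "\<dots> \<le> ennreal (w * D\<^sup>2) * (12 * l2 f)"
        by (intro mult_left_mono sum_scales_lp_weight_ft_le f) auto
      also have "\<dots> = ennreal (w * (D\<^sup>2 * 12)) * l2 f"
        using w0 by (simp add: ennreal_mult mult.assoc)
      finally show ?thesis .
    qed
    have "(\<integral>\<^sup>+x. (SUP k::int. avg (4 * 2 powr k) (\<lambda>z. ennreal ((norm (P k j z))\<^sup>2)) x) \<partial>lborel)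
      \<le> (\<integral>\<^sup>+x. ennreal (real j + 1) * (ennreal (w * A\<^sup>2) * (Mf x)\<^sup>2 + (\<Sum>l<j. \<integral>\<^sup>+k. E k l x \<partial>count_space UNIV)) \<partial>lborel)"
      by (intro nn_integral_mono SUP_least pt)
    also have "\<dots> = ennreal (real j + 1) * (ennreal (w * A\<^sup>2) * (\<integral>\<^sup>+x. (Mf x)\<^sup>2 \<partial>lborel) + (\<Sum>l<j. (\<integral>\<^sup>+x. (\<integral>\<^sup>+k. E k l x \<partial>count_space UNIV) \<partial>lborel)))"
    proof -
      have [measurable]: "(\<lambda>x. \<integral>\<^sup>+k. E k l x \<partial>count_space UNIV) \<in> borel_measurable borel" for l
        by (intro measurable_nn_integral_int) simp
      show ?thesis
        by (simp add: nn_integral_cmult nn_integral_add nn_integral_sum)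
    qed
    also have "\<dots> \<le> ennreal (real j + 1) * (ennreal (w * A\<^sup>2) * (ennreal M * l2 f) + (\<Sum>l<j. ennreal (w * (D\<^sup>2 * 12)) * l2 f))"
      using M(2)[of "\<lambda>z. ennreal (norm (f z))"]
      by (intro mult_left_mono add_mono sum_mono Eint) (auto simp: Mf_def l2_def ennreal_power)
    also have "\<dots> = ennreal ((real j + 1) * (w * A\<^sup>2 * M + real j * (w * (D\<^sup>2 * 12)))) * l2 f"
      using w0 M(1) A0
      by (simp add: ennreal_mult ennreal_of_nat_eq_real_of_nat distrib_right distrib_left mult.assoc)
    also have "\<dots> \<le> ennreal (C * (real j + 1)\<^sup>2) * l2 f"
    proof (intro mult_right_mono ennreal_leI)
      have "w * A\<^sup>2 * M + real j * (w * (D\<^sup>2 * 12)) \<le> (w * A\<^sup>2 * M + w * (D\<^sup>2 * 12)) * (real j + 1)"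
        using w0 M(1) by (simp add: algebra_simps)
      also have "\<dots> \<le> C * (real j + 1)" by (intro mult_right_mono) (auto simp: C_def)
      finally have "(real j + 1) * (w * A\<^sup>2 * M + real j * (w * (D\<^sup>2 * 12))) \<le> (real j + 1) * (C * (real j + 1))"
        by (intro mult_left_mono) auto
      then show "(real j + 1) * (w * A\<^sup>2 * M + real j * (w * (D\<^sup>2 * 12))) \<le> C * (real j + 1)\<^sup>2"
        by (simp add: power2_eq_square mult_ac)
    qed simp
    finally show "(\<integral>\<^sup>+x. (SUP k::int. avg (4 * 2 powr k) (\<lambda>z. ennreal ((norm (pretrunc (Suc n) (2 powr k / 2 ^ j) f z))\<^sup>2)) x) \<partial>lborel)
      \<le> ennreal (C * (real j + 1)\<^sup>2) * l2 f" unfolding P_def .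
  qed
qed

subsection \<open>Fourier decay of the coordinate moments of a measure\<close>

text \<open>Since \<open>cis \<theta> = 1 - (1 - cis \<theta>)\<close>, the sum is the truncated
  power series of minus the logarithm of \<open>cis \<theta>\<close>, to be compared with
  \<open>- \<i> * \<theta>\<close>. It expresses a linear factor through differences of characters,
  and these act on Fourier transforms by translation.\<close>

lemma truncated_log_error:
  "norm (\<i> * of_real \<theta> + (\<Sum>k<n. (1 - cis \<theta>) ^ Suc k / of_nat (Suc k))) \<le> \<bar>\<theta>\<bar> ^ Suc n"
proof -
  define g where "g z = \<i> * z + (\<Sum>k<n. (1 - exp (\<i> * z)) ^ Suc k / of_nat (Suc k))" for z :: complex
  \<comment> \<open>By the geometric sum the derivative of the error is the single power \<open>\<i> * (1 - exp (\<i> * z)) ^ n\<close>.\<close>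
  have deriv: "(g has_field_derivative \<i> * (1 - exp (\<i> * z)) ^ n) (at z within S)" for z S
  proof -
    have "((\<lambda>z. (1 - exp (\<i> * z)) ^ Suc k / of_nat (Suc k)) has_field_derivative
        (1 - exp (\<i> * z)) ^ k * (- exp (\<i> * z) * \<i>)) (at z within S)" for k
    proof -
      have "((\<lambda>z. (1 - exp (\<i> * z)) ^ Suc k) has_field_derivative
        of_nat (Suc k) * (1 - exp (\<i> * z)) ^ k * (- exp (\<i> * z) * \<i>)) (at z within S)"
      proof -
        have "((\<lambda>z. 1 - exp (\<i> * z)) has_field_derivative - exp (\<i> * z) * \<i>) (at z within S)"
          by (auto intro!: derivative_eq_intros)
        from DERIV_power[OF this, of "Suc k"] show ?thesis by (simp add: mult_ac del: of_nat_Suc)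
      qed
      from DERIV_cdivide[OF this, of "of_nat (Suc k)"] show ?thesis
        by (simp add: field_simps del: of_nat_Suc)
    qed
    then have "(g has_field_derivative \<i> + (\<Sum>k<n. (1 - exp (\<i> * z)) ^ k * (- exp (\<i> * z) * \<i>))) (at z within S)"
      unfolding g_def by (rule DERIV_add[OF DERIV_cmult_Id DERIV_sum])
    also have "\<i> + (\<Sum>k<n. (1 - exp (\<i> * z)) ^ k * (- exp (\<i> * z) * \<i>))
        = \<i> * (1 - (1 - (1 - exp (\<i> * z))) * (\<Sum>k<n. (1 - exp (\<i> * z)) ^ k))"
      by (simp add: algebra_simps sum_distrib_left sum_negf)
    also have "(1 - (1 - exp (\<i> * z))) * (\<Sum>k<n. (1 - exp (\<i> * z)) ^ k) = 1 - (1 - exp (\<i> * z)) ^ n"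
      by (rule one_diff_power_eq[symmetric])
    finally show ?thesis by simp
  qed
  have "norm (g (of_real \<theta>) - g 0) \<le> \<bar>\<theta>\<bar> ^ n * norm (complex_of_real \<theta> - 0)"
  proof (rule field_differentiable_bound[where S="closed_segment 0 (of_real \<theta>)"])
    fix z :: complex assume "z \<in> closed_segment 0 (of_real \<theta>)"
    then obtain u where u: "0 \<le> u" "u \<le> 1" "z = of_real (u * \<theta>)"
      by (auto simp: closed_segment_def scaleR_conv_of_real)
    have "norm (1 - exp (\<i> * z)) \<le> \<bar>u * \<theta>\<bar>"
      using norm_cis_minus_1_le[of "u * \<theta>"] by (simp add: u(3) cis_conv_exp norm_minus_commute)
    also have "\<dots> \<le> \<bar>\<theta>\<bar>" using u by (simp add: abs_mult mult_left_le_one_le)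
    finally show "norm (\<i> * (1 - exp (\<i> * z)) ^ n) \<le> \<bar>\<theta>\<bar> ^ n"
      by (simp add: norm_mult norm_power power_mono)
  qed (auto intro: deriv)
  moreover have "g 0 = 0" by (simp add: g_def)
  ultimately show ?thesis by (simp add: g_def cis_conv_exp mult.commute)
qed

text \<open>The moment is a combination of translates of the Fourier transform by multiples of \<open>h\<close>,
  up to an error of order \<open>h ^ n\<close>; taking \<open>h\<close> to be a small negative power of
  \<open>1 + norm \<xi>\<close> costs only \<open>\<delta>\<close> in the exponent.\<close>

lemma fourier_measure_moment_decay:
  fixes \<sigma> :: "'b::euclidean_space measure"
  assumes fin: "finite_measure \<sigma>" and sets[measurable_cong]: "sets \<sigma> = sets borel"
    and decay: "\<And>\<xi>. norm (fourier_measure \<sigma> \<xi>) \<le> K * (1 + norm \<xi>) powr (- s)"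
    and K: "K \<ge> 0" and s: "s \<ge> 0" and \<delta>: "\<delta> > 0" and e: "norm e = 1"
    and supp: "AE y in \<sigma>. norm y \<le> 1"
  shows "\<exists>K'\<ge>0. \<forall>\<xi>. norm (\<integral>y. of_real (y \<bullet> e) * cis (- 2 * pi * (\<xi> \<bullet> y)) \<partial>\<sigma>) \<le> K' * (1 + norm \<xi>) powr (- (s - \<delta>))"
proof -
  interpret finite_measure \<sigma> by fact
  define c where "c \<xi> y = cis (- 2 * pi * (\<xi> \<bullet> y))" for \<xi> y :: 'b
  define v where "v h y = 1 - cis (h * (y \<bullet> e))" for h y
  define \<Phi> where "\<Phi> h k \<xi> = (\<integral>y. v h y ^ k * c \<xi> y \<partial>\<sigma>)" for h k \<xi>
  define m where "m = measure \<sigma> (space \<sigma>)"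
  have m0: "m \<ge> 0" by (simp add: m_def)
  have [measurable]: "c \<xi> \<in> borel_measurable borel" "v h \<in> borel_measurable borel" for \<xi> h
    unfolding c_def v_def by measurable
  have v2: "norm (v h y) \<le> 2" for h y
    unfolding v_def using norm_triangle_ineq4[of 1 "cis (h * (y \<bullet> e))"] by simp
  have vint: "integrable \<sigma> (\<lambda>y. v h y ^ k * c \<xi> y)" for h k \<xi>
  proof (rule integrable_const_bound[where B="2 ^ k"])
    have "norm (v h y ^ k * c \<xi> y) \<le> 2 ^ k" for y
      unfolding norm_mult norm_power using v2 by (simp add: c_def power_mono)
    then show "AE y in \<sigma>. norm (v h y ^ k * c \<xi> y) \<le> 2 ^ k" by simp
  qed measurable
  \<comment> \<open>Each factor \<open>v h y\<close> is a difference of a character and its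
    translate by \<open>h / (2 * pi)\<close>, at most \<open>h\<close>, in the direction of
    \<open>e\<close>. After \<open>k\<close> factors there are 2^k values of the Fourier transform
    at distance at most \<open>k * h\<close>.\<close>
  have \<Phi>_bound: "norm (\<Phi> h k \<xi>) \<le> 2 ^ k * B"
    if "0 \<le> h" "\<And>\<xi>'. norm (\<xi>' - \<xi>) \<le> real k * h \<Longrightarrow> norm (fourier_measure \<sigma> \<xi>') \<le> B" for h k \<xi> B
    using that(2)
  proof (induction k arbitrary: \<xi>)
    case 0
    then show ?case using 0[of \<xi>] by (simp add: \<Phi>_def fourier_measure_def c_def)
  next
    case (Suc k)
    let ?\<xi> = "\<xi> - (h / (2 * pi)) *\<^sub>R e"
    have shift: "cis (h * (y \<bullet> e)) * c \<xi> y = c ?\<xi> y" for y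
      by (simp add: c_def cis_mult inner_diff_left inner_commute[of y e] algebra_simps)
    have "\<Phi> h (Suc k) \<xi> = (\<integral>y. v h y ^ k * c \<xi> y - v h y ^ k * c ?\<xi> y \<partial>\<sigma>)"
      unfolding \<Phi>_def shift[symmetric] by (simp add: v_def algebra_simps)
    also have "\<dots> = \<Phi> h k \<xi> - \<Phi> h k ?\<xi>"
      unfolding \<Phi>_def by (rule Bochner_Integration.integral_diff[OF vint vint])
    finally have "norm (\<Phi> h (Suc k) \<xi>) \<le> norm (\<Phi> h k \<xi>) + norm (\<Phi> h k ?\<xi>)"
      by (simp add: norm_triangle_ineq4)
    moreover have "norm (\<Phi> h k \<xi>) \<le> 2 ^ k * B"
      by (intro Suc.IH Suc.prems) (use that(1) in \<open>auto simp: distrib_right\<close>)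
    moreover have "norm (\<Phi> h k ?\<xi>) \<le> 2 ^ k * B"
    proof (intro Suc.IH Suc.prems)
      fix \<xi>' assume *: "norm (\<xi>' - ?\<xi>) \<le> real k * h"
      have 1: "norm (\<xi>' - \<xi>) \<le> norm (\<xi>' - ?\<xi>) + norm ((h / (2 * pi)) *\<^sub>R e)"
        using norm_triangle_ineq4[of "\<xi>' - ?\<xi>" "(h / (2 * pi)) *\<^sub>R e"] by simp
      have "norm ((h / (2 * pi)) *\<^sub>R e) = h / (2 * pi)" using that(1) e by simp
      also have "h / (2 * pi) \<le> h / 1" using that(1) pi_ge_two by (intro divide_left_mono) auto
      finally show "norm (\<xi>' - \<xi>) \<le> real (Suc k) * h" using * 1 by (simp add: distrib_right)
    qed
    ultimately show ?case by simp
  qed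
  \<comment> \<open>Enough terms for \<open>n * \<delta> \<ge> s\<close>: the error of order
    \<open>h ^ n\<close>, with \<open>h = u powr (- \<delta>)\<close>, is then within the required
    decay.\<close>
  define n where "n = nat \<lceil>s / \<delta>\<rceil>"
  have "s / \<delta> \<le> real n" unfolding n_def by (rule real_nat_ceiling_ge)
  then have n: "s \<le> real n * \<delta>" using \<delta> by (simp add: pos_divide_le_eq)
  define K' where "K' = m + real n * 2 ^ n * (K * (1 + real n) powr s)"
  show ?thesis
  proof (intro exI[of _ K'] conjI allI)
    show "K' \<ge> 0" unfolding K'_def using m0 K by (intro add_nonneg_nonneg mult_nonneg_nonneg) auto
    fix \<xi> :: 'b
    define u where "u = 1 + norm \<xi>"
    \<comment> \<open>The identity for the moment is divided by \<open>h\<close> at the end, which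
      costs exactly \<delta> in the exponent.\<close>
    define h where "h = u powr (- \<delta>)"
    have u1: "u \<ge> 1" by (simp add: u_def)
    have h: "h > 0" "h \<le> 1" using u1 \<delta> powr_mono[of "- \<delta>" 0 u] by (auto simp: h_def)
    define B where "B = K * (1 + real n) powr s * u powr (- s)"
    have B0: "B \<ge> 0" using K by (simp add: B_def)
    \<comment> \<open>All translates have length at most \<open>n\<close>, so
      \<open>1 + norm \<xi>\<close> changes at most by the factor \<open>1 + n\<close>.\<close>
    have near: "norm (fourier_measure \<sigma> \<xi>') \<le> B" if "norm (\<xi>' - \<xi>) \<le> real k * h" "k \<le> n" for \<xi>' k
    proof -
      have "real k * h \<le> real n * 1" using that(2) h by (intro mult_mono) auto
      moreover have "norm \<xi> \<le> norm \<xi>' + norm (\<xi>' - \<xi>)"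
        using norm_triangle_ineq4[of \<xi>' "\<xi>' - \<xi>"] by simp
      ultimately have "u \<le> 1 + norm \<xi>' + real n" using that(1) by (simp add: u_def)
      also have "\<dots> \<le> (1 + norm \<xi>') * (1 + real n)" by (simp add: algebra_simps)
      finally have "u / (1 + real n) \<le> 1 + norm \<xi>'" by (simp add: pos_divide_le_eq)
      then have "(1 + norm \<xi>') powr (- s) \<le> (u / (1 + real n)) powr (- s)"
        using s u1 by (intro powr_mono2') auto
      also have "\<dots> = (1 + real n) powr s * u powr (- s)"
        using u1 by (simp add: powr_divide powr_minus field_simps)
      finally have "K * (1 + norm \<xi>') powr (- s) \<le> B"
        unfolding B_def mult.assoc by (rule mult_left_mono[OF _ K])
      then show ?thesis using decay[of \<xi>'] by linarith
    qed
    have \<Phi>B: "norm (\<Phi> h (Suc k) \<xi> / of_nat (Suc k)) \<le> 2 ^ n * B" if "k < n" for k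
    proof -
      have "norm (\<Phi> h (Suc k) \<xi>) \<le> 2 ^ Suc k * B"
      proof (rule \<Phi>_bound)
        show "0 \<le> h" using h by simp
        show "norm (fourier_measure \<sigma> \<xi>') \<le> B" if "norm (\<xi>' - \<xi>) \<le> real (Suc k) * h" for \<xi>'
          using near[OF that] \<open>k < n\<close> by simp
      qed
      also have "\<dots> \<le> 2 ^ n * B" using that B0 by (intro mult_right_mono power_increasing) auto
      finally have 1: "norm (\<Phi> h (Suc k) \<xi>) \<le> 2 ^ n * B" .
      have "norm (\<Phi> h (Suc k) \<xi> / of_nat (Suc k)) = norm (\<Phi> h (Suc k) \<xi>) / real (Suc k)"
        by (simp only: norm_divide norm_of_nat)
      also have "\<dots> \<le> norm (\<Phi> h (Suc k) \<xi>) / 1" by (intro divide_left_mono) auto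
      finally show ?thesis using 1 by linarith
    qed
    define J where "J = (\<integral>y. of_real (y \<bullet> e) * c \<xi> y \<partial>\<sigma>)"
    define E where "E y = \<i> * of_real (h * (y \<bullet> e)) + (\<Sum>k<n. v h y ^ Suc k / of_nat (Suc k))" for y
    have [measurable]: "E \<in> borel_measurable borel" unfolding E_def by measurable
    have ye: "AE y in \<sigma>. \<bar>h * (y \<bullet> e)\<bar> \<le> h"
      using supp
    proof eventually_elim
      case (elim y)
      have "\<bar>y \<bullet> e\<bar> \<le> 1" using Cauchy_Schwarz_ineq2[of y e] elim e by simp
      then show ?case using h by (simp add: abs_mult)
    qed
    have E_le: "AE y in \<sigma>. norm (E y * c \<xi> y) \<le> h ^ Suc n"
      using ye
    proof eventually_elim
      case (elim y)
      have "norm (E y) \<le> \<bar>h * (y \<bullet> e)\<bar> ^ Suc n" unfolding E_def v_def by (rule truncated_log_error)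
      also have "\<dots> \<le> h ^ Suc n" using elim by (intro power_mono) auto
      finally show ?case by (simp add: norm_mult c_def)
    qed
    have Eint: "integrable \<sigma> (\<lambda>y. E y * c \<xi> y)" by (rule integrable_const_bound[OF E_le]) measurable
    have Sint: "integrable \<sigma> (\<lambda>y. \<Sum>k<n. v h y ^ Suc k * c \<xi> y / of_nat (Suc k))"
      by (intro Bochner_Integration.integrable_sum integrable_divide vint)
    have "\<i> * of_real h * J = (\<integral>y. E y * c \<xi> y - (\<Sum>k<n. v h y ^ Suc k * c \<xi> y / of_nat (Suc k)) \<partial>\<sigma>)"
    proof -
      have "\<i> * of_real h * (of_real (y \<bullet> e) * c \<xi> y) = E y * c \<xi> y - (\<Sum>k<n. v h y ^ Suc k * c \<xi> y / of_nat (Suc k))" for y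
        by (simp add: E_def distrib_right sum_distrib_right mult.assoc del: of_nat_Suc power_Suc)
      then show ?thesis unfolding J_def by (simp only: integral_mult_right_zero[symmetric])
    qed
    also have "\<dots> = (\<integral>y. E y * c \<xi> y \<partial>\<sigma>) - (\<Sum>k<n. \<Phi> h (Suc k) \<xi> / of_nat (Suc k))"
    proof -
      have "(\<integral>y. (\<Sum>k<n. v h y ^ Suc k * c \<xi> y / of_nat (Suc k)) \<partial>\<sigma>) = (\<Sum>k<n. \<Phi> h (Suc k) \<xi> / of_nat (Suc k))"
        unfolding \<Phi>_def by (subst Bochner_Integration.integral_sum, intro integrable_divide vint) (simp only: integral_divide_zero)
      then show ?thesis using Bochner_Integration.integral_diff[OF Eint Sint] by simp
    qed
    finally have J: "\<i> * of_real h * J = (\<integral>y. E y * c \<xi> y \<partial>\<sigma>) - (\<Sum>k<n. \<Phi> h (Suc k) \<xi> / of_nat (Suc k))" .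
    have "norm (\<integral>y. E y * c \<xi> y \<partial>\<sigma>) \<le> (\<integral>y. h ^ Suc n \<partial>\<sigma>)"
      by (rule order_trans[OF integral_norm_bound integral_mono_AE]) (use Eint E_le in auto)
    also have "\<dots> = m * h ^ Suc n" by (simp add: m_def)
    finally have 1: "norm (\<integral>y. E y * c \<xi> y \<partial>\<sigma>) \<le> m * h ^ Suc n" .
    have 2: "norm (\<Sum>k<n. \<Phi> h (Suc k) \<xi> / of_nat (Suc k)) \<le> (\<Sum>k<n. 2 ^ n * B)"
      by (intro sum_norm_le \<Phi>B) auto
    have "h * norm J = norm (\<i> * of_real h * J)" using h by (simp add: norm_mult)
    also have "\<dots> \<le> norm (\<integral>y. E y * c \<xi> y \<partial>\<sigma>) + norm (\<Sum>k<n. \<Phi> h (Suc k) \<xi> / of_nat (Suc k))"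
      unfolding J by (rule norm_triangle_ineq4)
    also have "\<dots> \<le> m * h ^ Suc n + (\<Sum>k<n. 2 ^ n * B)" by (rule add_mono[OF 1 2])
    also have "\<dots> = h * (m * h ^ n + real n * 2 ^ n * (B / h))"
      using h by (simp add: distrib_left mult_ac)
    finally have "norm J \<le> m * h ^ n + real n * 2 ^ n * (B / h)" using h(1) by simp
    moreover have "B / h = K * (1 + real n) powr s * u powr (- (s - \<delta>))"
      using u1 by (simp add: B_def h_def powr_diff powr_minus powr_add field_simps)
    moreover have "m * h ^ n \<le> m * u powr (- (s - \<delta>))"
    proof (rule mult_left_mono[OF _ m0])
      have "h ^ n = u powr (- \<delta> * real n)" using powr_realpow[OF h(1), of n] by (simp add: h_def powr_powr)
      also have "\<dots> \<le> u powr (- (s - \<delta>))" using u1 n \<delta> by (intro powr_mono) (auto simp: mult.commute)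
      finally show "h ^ n \<le> u powr (- (s - \<delta>))" .
    qed
    ultimately have "norm J \<le> m * u powr (- (s - \<delta>)) + real n * 2 ^ n * (K * (1 + real n) powr s * u powr (- (s - \<delta>)))"
      by simp
    then have "norm J \<le> K' * u powr (- (s - \<delta>))"
      unfolding K'_def by (simp add: distrib_right mult.assoc)
    then show "norm (\<integral>y. of_real (y \<bullet> e) * cis (- 2 * pi * (\<xi> \<bullet> y)) \<partial>\<sigma>) \<le> K' * (1 + norm \<xi>) powr (- (s - \<delta>))"
      by (simp add: J_def c_def u_def)
  qed
qed

subsection \<open>Restriction to the diagonal\<close>

lemma nice_vec_prod:
  fixes f :: "'m::finite \<Rightarrow> 'a::euclidean_space \<Rightarrow> complex"
  assumes f: "\<And>i. nice (f i)"
  shows "nice (\<lambda>w::'a ^ 'm. \<Prod>i\<in>UNIV. f i (w $ i))"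
  unfolding nice_def
proof (intro conjI)
  have "continuous_on UNIV (f i)" for i using f[of i] by (simp add: nice_def)
  then have "continuous_on UNIV (\<lambda>w::'a ^ 'm. f i (w $ i))" for i
    by (rule continuous_on_compose2) (auto intro!: continuous_intros)
  then show "continuous_on UNIV (\<lambda>w::'a ^ 'm. \<Prod>i\<in>UNIV. f i (w $ i))"
    by (rule continuous_on_prod)
  have "\<forall>i. \<exists>B. \<forall>x. norm (f i x) \<le> B" using nice_boundE[OF f] by metis
  then obtain B where "\<And>i x. norm (f i x) \<le> B i" by metis
  then have "norm (\<Prod>i\<in>UNIV. f i (w $ i)) \<le> (\<Prod>i\<in>UNIV. B i)" for w :: "'a ^ 'm"
    unfolding prod_norm[symmetric] by (intro prod_mono) auto
  then show "bounded (range (\<lambda>w::'a ^ 'm. \<Prod>i\<in>UNIV. f i (w $ i)))" by (auto simp: bounded_iff)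
  show "integrable lborel (\<lambda>w::'a ^ 'm. \<Prod>i\<in>UNIV. f i (w $ i))"
    by (rule integral_lborel_vec_prod(1)) (use f in \<open>auto simp: nice_def\<close>)
qed

lemma ft_vec_prod:
  fixes f :: "'m::finite \<Rightarrow> 'a::euclidean_space \<Rightarrow> complex"
  assumes f: "\<And>i. nice (f i)"
  shows "ft (\<lambda>w::'a ^ 'm. \<Prod>i\<in>UNIV. f i (w $ i)) \<xi> = (\<Prod>i\<in>UNIV. ft (f i) (\<xi> $ i))"
proof -
  have "cis (- 2 * pi * (\<xi> \<bullet> w)) = (\<Prod>i\<in>UNIV. cis (- 2 * pi * (\<xi> $ i \<bullet> w $ i)))" for w :: "'a ^ 'm"
    by (simp add: inner_vec_def sum_distrib_left cis_sum[symmetric])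
  then have "ft (\<lambda>w::'a ^ 'm. \<Prod>i\<in>UNIV. f i (w $ i)) \<xi>
      = (\<integral>w. (\<Prod>i\<in>UNIV. f i (w $ i) * cis (- 2 * pi * (\<xi> $ i \<bullet> w $ i))) \<partial>lborel)"
    by (simp add: ft_def prod.distrib)
  also have "\<dots> = (\<Prod>i\<in>UNIV. \<integral>x. f i x * cis (- 2 * pi * (\<xi> $ i \<bullet> x)) \<partial>lborel)"
    by (rule integral_lborel_vec_prod(2)[where f="\<lambda>i x. f i x * cis (- 2 * pi * (\<xi> $ i \<bullet> x))"])
       (rule integrable_nice_cis[OF f])
  finally show ?thesis by (simp add: ft_def)
qed

text \<open>The multilinear average at the diagonal point with all slots equal to \<open>x\<close>,
  with the function \<open>H\<close> in the slot \<open>i0\<close> kept apart from the rest.\<close>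

definition Vop ::
  "('a::euclidean_space ^ 'm::finite) measure \<Rightarrow> ('a ^ 'm \<Rightarrow> complex) \<Rightarrow> 'm \<Rightarrow> ('a \<Rightarrow> complex)
    \<Rightarrow> ('m \<Rightarrow> 'a \<Rightarrow> complex) \<Rightarrow> real \<Rightarrow> 'a \<Rightarrow> complex" where
  "Vop \<sigma> b i0 H h t x =
    (\<integral>y. b y * (H (x - t *\<^sub>R y $ i0) * (\<Prod>i\<in>UNIV - {i0}. h i (x - t *\<^sub>R y $ i))) \<partial>\<sigma>)"

text \<open>The slots other than \<open>i0\<close> are released from the diagonal: they carry
  kernels at independent points \<open>v i\<close>. As a function of \<open>x\<close> and
  \<open>v\<close> together this is the convolution of a dilate of the weighted measure with a
  tensor product.\<close>

definition Lker ::
  "('a::euclidean_space ^ 'm::finite) measure \<Rightarrow> ('a ^ 'm \<Rightarrow> complex) \<Rightarrow> 'm \<Rightarrow> ('a \<Rightarrow> complex)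
    \<Rightarrow> ('m \<Rightarrow> 'a \<Rightarrow> complex) \<Rightarrow> real \<Rightarrow> 'a \<Rightarrow> ('m \<Rightarrow> 'a) \<Rightarrow> complex" where
  "Lker \<sigma> b i0 H \<gamma> t x v =
    (\<integral>y. b y * (H (x - t *\<^sub>R y $ i0) * (\<Prod>i\<in>UNIV - {i0}. \<gamma> i (v i - t *\<^sub>R y $ i))) \<partial>\<sigma>)"

definition Rker ::
  "('a::euclidean_space ^ 'm::finite) measure \<Rightarrow> ('a ^ 'm \<Rightarrow> complex) \<Rightarrow> 'm \<Rightarrow> ('a \<Rightarrow> complex)
    \<Rightarrow> ('m \<Rightarrow> 'a \<Rightarrow> complex) \<Rightarrow> real \<Rightarrow> 'a \<Rightarrow> ennreal" where
  "Rker \<sigma> b i0 H \<gamma> t x =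
    (\<integral>\<^sup>+v. ennreal ((norm (Lker \<sigma> b i0 H \<gamma> t x v))\<^sup>2) \<partial>Pi\<^sub>M (UNIV - {i0}) (\<lambda>_. lborel))"

context
  fixes \<sigma> :: "('a::euclidean_space ^ 'm::finite) measure" and b :: "'a ^ 'm \<Rightarrow> complex" and i0 :: 'm
    and H :: "'a \<Rightarrow> complex" and \<gamma> :: "'m \<Rightarrow> 'a \<Rightarrow> complex"
  assumes fin: "finite_measure \<sigma>" and sets[measurable_cong]: "sets \<sigma> = sets borel"
    and b[measurable]: "b \<in> borel_measurable borel" and b1: "\<And>y. norm (b y) \<le> 1"
    and H: "nice H" and \<gamma>: "\<And>i. nice (\<gamma> i)"
begin

lemma measurable_Lker:
  "(\<lambda>(t, x, v). Lker \<sigma> b i0 H \<gamma> t x v) \<in> borel_measurable (borel \<Otimes>\<^sub>M borel \<Otimes>\<^sub>M Pi\<^sub>M (UNIV - {i0}) (\<lambda>_. lborel))"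
proof -
  interpret finite_measure \<sigma> by (rule fin)
  note [measurable] = measurable_nice[OF H] measurable_nice[OF \<gamma>]
  show ?thesis unfolding Lker_def by measurable
qed

lemma measurable_Rker: "(\<lambda>(t, x). Rker \<sigma> b i0 H \<gamma> t x) \<in> borel_measurable (borel \<Otimes>\<^sub>M borel)"
proof -
  interpret P: product_sigma_finite "\<lambda>_::'m. lborel :: 'a measure" ..
  interpret PI: sigma_finite_measure "Pi\<^sub>M (UNIV - {i0}) (\<lambda>_. lborel :: 'a measure)"
    by (rule P.sigma_finite) simp
  note [measurable] = measurable_Lker
  have "(\<lambda>p. \<integral>\<^sup>+v. ennreal ((norm (case (fst p, snd p, v) of (t, x, v) \<Rightarrow> Lker \<sigma> b i0 H \<gamma> t x v))\<^sup>2) \<partial>Pi\<^sub>M (UNIV - {i0}) (\<lambda>_. lborel))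
    \<in> borel_measurable (borel \<Otimes>\<^sub>M borel)"
    by measurable
  then show ?thesis by (simp add: Rker_def case_prod_unfold)
qed

text \<open>Integrating in \<open>x\<close> supplies the missing coordinate \<open>i0\<close>, so
  the left side is a full square norm over the power space. Plancherel's theorem there gives a
  product over slots; the transform of the measure is absorbed in \<open>Q\<close>, which sees only
  the frequency of slot \<open>i0\<close>.\<close>

lemma nn_integral_Rker_le:
  assumes t: "t > 0" and Q[measurable]: "Q \<in> borel_measurable borel"
    and le: "\<And>\<xi>. ennreal ((norm (\<integral>y. b y * cis (- 2 * pi * ((t *\<^sub>R \<xi>) \<bullet> y)) \<partial>\<sigma>) * norm (ft H (\<xi> $ i0)))\<^sup>2) \<le> Q (\<xi> $ i0)"
  shows "(\<integral>\<^sup>+x. Rker \<sigma> b i0 H \<gamma> t x \<partial>lborel) \<le> (\<integral>\<^sup>+\<xi>. Q \<xi> \<partial>lborel) * (\<Prod>i\<in>UNIV - {i0}. l2 (\<gamma> i))"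
proof -
  interpret finite_measure \<sigma> by (rule fin)
  interpret P: product_sigma_finite "\<lambda>_::'m. lborel :: 'a measure" ..
  define g where "g i = (if i = i0 then H else \<gamma> i)" for i
  have g: "nice (g i)" for i using H \<gamma> by (simp add: g_def)
  define G where "G w = (\<Prod>i\<in>UNIV. g i (w $ i))" for w :: "'a ^ 'm"
  have G: "nice G" unfolding G_def[abs_def] by (rule nice_vec_prod[OF g])
  have split: "(\<Prod>i\<in>UNIV. f i) = f i0 * (\<Prod>i\<in>UNIV - {i0}. f i)" for f :: "'m \<Rightarrow> 'c::comm_monoid_mult"
    by (rule prod.remove) auto
  have bint: "integrable \<sigma> b" by (rule integrable_const_bound[where B=1]) (use b1 in auto)
  define C where "C = conv \<sigma> b (\<lambda>y. t *\<^sub>R y) G"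
  have C: "nice C" unfolding C_def
    by (rule nice_conv) (use bint G sigma_finite_measure_axioms in auto)
  have CL: "C w = Lker \<sigma> b i0 H \<gamma> t (w $ i0) (\<lambda>i. w $ i)" for w
    unfolding C_def conv_def Lker_def G_def split by (simp add: g_def)
  note [measurable] = measurable_nice[OF C] measurable_nice[OF \<gamma>] measurable_ft[OF \<gamma>]
  define f where "f v = ennreal ((norm (C (\<chi> i. v i)))\<^sup>2)" for v
  have f[measurable]: "f \<in> borel_measurable (Pi\<^sub>M UNIV (\<lambda>_. lborel))" unfolding f_def by measurable
  have fL: "f (v(i0 := x)) = ennreal ((norm (Lker \<sigma> b i0 H \<gamma> t x v))\<^sup>2)" for v x
    unfolding f_def CL Lker_def by simp
  have "(\<integral>\<^sup>+x. Rker \<sigma> b i0 H \<gamma> t x \<partial>lborel)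
      = (\<integral>\<^sup>+x. (\<integral>\<^sup>+v. f (v(i0 := x)) \<partial>Pi\<^sub>M (UNIV - {i0}) (\<lambda>_. lborel)) \<partial>lborel)"
    by (simp add: Rker_def fL)
  also have "\<dots> = (\<integral>\<^sup>+v. f v \<partial>Pi\<^sub>M (insert i0 (UNIV - {i0})) (\<lambda>_. lborel))"
    by (rule P.product_nn_integral_insert_rev[symmetric]) (auto simp: insert_absorb)
  also have "insert i0 (UNIV - {i0}) = UNIV" by auto
  also have "(\<integral>\<^sup>+v. f v \<partial>Pi\<^sub>M UNIV (\<lambda>_. lborel)) = l2 C"
    unfolding l2_def f_def by (rule nn_integral_lborel_vec[symmetric]) measurable
  finally have "(\<integral>\<^sup>+x. Rker \<sigma> b i0 H \<gamma> t x \<partial>lborel) = (\<integral>\<^sup>+\<xi>. ennreal ((norm (ft C \<xi>))\<^sup>2) \<partial>lborel)"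
    unfolding l2_eq_ft[OF C] .
  also have "\<dots> \<le> (\<integral>\<^sup>+\<xi>. (\<Prod>i\<in>UNIV. (if i = i0 then Q else (\<lambda>\<zeta>. ennreal ((norm (ft (\<gamma> i) \<zeta>))\<^sup>2))) (\<xi> $ i)) \<partial>lborel)"
  proof (rule nn_integral_mono)
    fix \<xi> :: "'a ^ 'm"
    define q where "q = norm (\<integral>y. b y * cis (- 2 * pi * ((t *\<^sub>R \<xi>) \<bullet> y)) \<partial>\<sigma>) * norm (ft H (\<xi> $ i0))"
    have "ft C \<xi> = (\<integral>y. b y * cis (- 2 * pi * (\<xi> \<bullet> (t *\<^sub>R y))) \<partial>\<sigma>) * ft G \<xi>"
      unfolding C_def by (rule ft_conv) (use bint G sigma_finite_measure_axioms in auto)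
    moreover have "ft G \<xi> = (\<Prod>i\<in>UNIV. ft (g i) (\<xi> $ i))"
      unfolding G_def[abs_def] by (rule ft_vec_prod[OF g])
    moreover have "\<dots> = ft H (\<xi> $ i0) * (\<Prod>i\<in>UNIV - {i0}. ft (\<gamma> i) (\<xi> $ i))"
      by (subst split) (simp add: g_def)
    ultimately have "norm (ft C \<xi>) = q * (\<Prod>i\<in>UNIV - {i0}. norm (ft (\<gamma> i) (\<xi> $ i)))"
      by (simp add: norm_mult prod_norm q_def)
    then have "ennreal ((norm (ft C \<xi>))\<^sup>2) = ennreal (q\<^sup>2) * (\<Prod>i\<in>UNIV - {i0}. ennreal ((norm (ft (\<gamma> i) (\<xi> $ i)))\<^sup>2))"
      by (simp add: power_mult_distrib ennreal_mult prod_nonneg prod_ennreal prod_power_distrib)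
    also have "\<dots> \<le> Q (\<xi> $ i0) * (\<Prod>i\<in>UNIV - {i0}. ennreal ((norm (ft (\<gamma> i) (\<xi> $ i)))\<^sup>2))"
      using le[of \<xi>] by (intro mult_right_mono) (auto simp: q_def)
    also have "\<dots> = (\<Prod>i\<in>UNIV. (if i = i0 then Q else (\<lambda>\<zeta>. ennreal ((norm (ft (\<gamma> i) \<zeta>))\<^sup>2))) (\<xi> $ i))"
      unfolding split by simp
    finally show "ennreal ((norm (ft C \<xi>))\<^sup>2) \<le> (\<Prod>i\<in>UNIV. (if i = i0 then Q else (\<lambda>\<zeta>. ennreal ((norm (ft (\<gamma> i) \<zeta>))\<^sup>2))) (\<xi> $ i))" .
  qed
  also have "\<dots> = (\<Prod>i\<in>UNIV. \<integral>\<^sup>+\<zeta>. (if i = i0 then Q else (\<lambda>\<zeta>. ennreal ((norm (ft (\<gamma> i) \<zeta>))\<^sup>2))) \<zeta> \<partial>lborel)"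
    by (rule nn_integral_lborel_vec_prod) auto
  also have "\<dots> = (\<integral>\<^sup>+\<xi>. Q \<xi> \<partial>lborel) * (\<Prod>i\<in>UNIV - {i0}. l2 (\<gamma> i))"
    unfolding split by (simp add: l2_eq_ft[OF \<gamma>])
  finally show ?thesis .
qed

text \<open>Writing each \<open>star (\<gamma> i) (g i)\<close> as an integral and applying the Cauchy--Schwarz inequality
  in these variables leaves only the slot \<open>i0\<close> to be treated by Plancherel's theorem.\<close>

lemma Vop_le_Rker:
  assumes b0: "\<And>y. norm y > 1 \<Longrightarrow> b y = 0" and t: "0 < t" "t \<le> 2 * \<rho>"
    and \<gamma>0: "\<And>i v. norm v > \<rho> \<Longrightarrow> \<gamma> i v = 0" and g: "\<And>i. nice (g i)"
  shows "ennreal ((norm (Vop \<sigma> b i0 H (\<lambda>i. star (\<gamma> i) (g i)) t x))\<^sup>2)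
     \<le> (\<Prod>i\<in>UNIV - {i0}. ennreal ((4 * \<rho>) ^ DIM('a)) * avg (4 * \<rho>) (\<lambda>z. ennreal ((norm (g i z))\<^sup>2)) x)
       * Rker \<sigma> b i0 H \<gamma> t x"
proof -
  interpret finite_measure \<sigma> by (rule fin)
  interpret P: product_sigma_finite "\<lambda>_::'m. lborel :: 'a measure" ..
  define I where "I = UNIV - {i0}"
  have I: "finite I" by (simp add: I_def)
  define PI where "PI = Pi\<^sub>M I (\<lambda>_. lborel :: 'a measure)"
  interpret PI: sigma_finite_measure PI unfolding PI_def by (rule P.sigma_finite[OF I])
  interpret SP: pair_sigma_finite \<sigma> PI ..
  have [measurable_cong]: "sets PI = sets (Pi\<^sub>M I (\<lambda>_. lborel :: 'a measure))" by (simp add: PI_def)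
  have \<rho>: "\<rho> > 0" using t by simp
  note [measurable] = measurable_nice[OF H] measurable_nice[OF \<gamma>] measurable_nice[OF g]
  \<comment> \<open>The kernels have support radius \<rho> and the displacement
    \<open>t * norm (y $ i)\<close> is at most \<open>2 * \<rho>\<close>, so restricting
    \<open>v\<close> to radius \<open>3 * \<rho>\<close> changes nothing. The factor
    \<open>A\<close> thereby becomes local while staying independent of \<open>y\<close>.\<close>
  define cut where "cut v = (if norm v \<le> 3 * \<rho> then 1 else (0 :: complex))" for v :: 'a
  have [measurable]: "cut \<in> borel_measurable borel" unfolding cut_def by measurable
  define A where "A v = (\<Prod>i\<in>I. cut (v i) * g i (x - v i))" for v
  define K where "K y v = (\<Prod>i\<in>I. \<gamma> i (v i - t *\<^sub>R y $ i))" for y :: "'a ^ 'm" and v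
  define h where "h y = H (x - t *\<^sub>R y $ i0)" for y :: "'a ^ 'm"
  define L where "L v = Lker \<sigma> b i0 H \<gamma> t x v" for v
  have [measurable]: "A \<in> borel_measurable PI" unfolding A_def by measurable
  have [measurable]: "(\<lambda>(y, v). K y v) \<in> borel_measurable (borel \<Otimes>\<^sub>M PI)" unfolding K_def by measurable
  have [measurable]: "h \<in> borel_measurable borel" unfolding h_def by measurable
  have Lm[measurable]: "L \<in> borel_measurable PI"
    using measurable_Lker unfolding L_def PI_def I_def by measurable
  have gx: "integrable lborel (\<lambda>v. cut v * g i (x - v))" for i
  proof -
    have "integrable lborel (\<lambda>v. g i (x - v))"
      using integrable_lborel_affine_iff[of "-1" "g i" x] g[of i] by (simp add: nice_def)
    then have "integrable lborel (\<lambda>v. g i (x - v) * cut v)"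
      by (rule integrable_mult_bounded[where B=1]) (auto simp: cut_def)
    then show ?thesis by (simp add: mult.commute)
  qed
  have Aint: "integrable PI A"
    unfolding A_def PI_def by (rule P.product_integrable_prod[OF I gx])
  have "\<forall>i. \<exists>B\<ge>0. \<forall>x. norm (\<gamma> i x) \<le> B" using nice_boundE[OF \<gamma>] less_imp_le by metis
  then obtain B where B: "\<And>i. B i \<ge> 0" "\<And>i x. norm (\<gamma> i x) \<le> B i" by metis
  obtain BH where BH: "BH > 0" "\<And>x. norm (H x) \<le> BH" using nice_boundE[OF H] by metis
  have K_le: "norm (K y v) \<le> (\<Prod>i\<in>I. B i)" for y v
    unfolding K_def prod_norm[symmetric] by (intro prod_mono) (auto simp: B)
  have bhK_le: "norm (b y * h y * K y v) \<le> BH * (\<Prod>i\<in>I. B i)" for y v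
  proof -
    have "norm (b y * h y * K y v) \<le> 1 * BH * (\<Prod>i\<in>I. B i)"
      unfolding norm_mult using b1 BH K_le B by (intro mult_mono) (auto simp: h_def prod_nonneg)
    then show ?thesis by simp
  qed
  have int_v: "integrable PI (\<lambda>v. A v * (b y * h y * K y v))" for y
    by (rule integrable_mult_bounded[OF Aint _ bhK_le]) measurable
  have int_pair: "integrable (\<sigma> \<Otimes>\<^sub>M PI) (\<lambda>(y, v). A v * (b y * h y * K y v))"
  proof (rule SP.Fubini_integrable)
    show "AE y in \<sigma>. integrable PI (\<lambda>v. case (y, v) of (y, v) \<Rightarrow> A v * (b y * h y * K y v))"
      using int_v by simp
    show "integrable \<sigma> (\<lambda>y. \<integral>v. norm (case (y, v) of (y, v) \<Rightarrow> A v * (b y * h y * K y v)) \<partial>PI)"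
    proof (rule integrable_const_bound[where B="\<integral>v. norm (A v) * (BH * (\<Prod>i\<in>I. B i)) \<partial>PI"])
      have "(\<integral>v. norm (A v * (b y * h y * K y v)) \<partial>PI) \<le> (\<integral>v. norm (A v) * (BH * (\<Prod>i\<in>I. B i)) \<partial>PI)" for y
      proof (rule integral_mono)
        show "integrable PI (\<lambda>v. norm (A v * (b y * h y * K y v)))" by (rule integrable_norm[OF int_v])
        show "integrable PI (\<lambda>v. norm (A v) * (BH * (\<Prod>i\<in>I. B i)))" using Aint by simp
        show "norm (A v * (b y * h y * K y v)) \<le> norm (A v) * (BH * (\<Prod>i\<in>I. B i))" for v
          unfolding norm_mult[of "A v"] by (rule mult_left_mono[OF bhK_le]) simp
      qed
      then show "AE y in \<sigma>. norm (\<integral>v. norm (case (y, v) of (y, v) \<Rightarrow> A v * (b y * h y * K y v)) \<partial>PI) \<le> (\<integral>v. norm (A v) * (BH * (\<Prod>i\<in>I. B i)) \<partial>PI)"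
        by simp
    qed measurable
  qed measurable
  have star_eq: "star (\<gamma> i) (g i) (x - t *\<^sub>R y $ i) = (\<integral>v. (cut v * g i (x - v)) * \<gamma> i (v - t *\<^sub>R y $ i) \<partial>lborel)"
    and star_int: "integrable lborel (\<lambda>v. (cut v * g i (x - v)) * \<gamma> i (v - t *\<^sub>R y $ i))"
    if y: "norm y \<le> 1" for y i
  proof -
    let ?c = "t *\<^sub>R y $ i"
    let ?f = "\<lambda>w. \<gamma> i w * g i (x - ?c - w)"
    have f: "integrable lborel ?f" by (rule integrable_star[OF \<gamma> g])
    have "norm (y $ i) \<le> 1" by (rule order_trans[OF Finite_Cartesian_Product.norm_nth_le y])
    then have "t * norm (y $ i) \<le> 2 * \<rho> * 1" using t by (intro mult_mono) auto
    then have c: "norm ?c \<le> 2 * \<rho>" using t by simp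
    have eq: "?f (- ?c + v) = (cut v * g i (x - v)) * \<gamma> i (v - ?c)" for v
    proof (cases "norm v \<le> 3 * \<rho>")
      case False
      then have "norm (v - ?c) > \<rho>" using norm_triangle_ineq2[of v ?c] c by linarith
      then show ?thesis using \<gamma>0[of "v - ?c" i] False by (simp add: cut_def)
    qed (simp add: cut_def)
    show "star (\<gamma> i) (g i) (x - ?c) = (\<integral>v. (cut v * g i (x - v)) * \<gamma> i (v - ?c) \<partial>lborel)"
      unfolding star_altdef using lborel_integral_shift[OF f, of "- ?c"] unfolding eq by simp
    show "integrable lborel (\<lambda>v. (cut v * g i (x - v)) * \<gamma> i (v - ?c))"
    proof -
      have "integrable lborel (\<lambda>v. ?f (- ?c + 1 *\<^sub>R v))"
        by (rule integrable_lborel_affine_iff[THEN iffD2, OF _ f]) simp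
      then show ?thesis unfolding scaleR_one eq .
    qed
  qed
  have "Vop \<sigma> b i0 H (\<lambda>i. star (\<gamma> i) (g i)) t x = (\<integral>y. (\<integral>v. A v * (b y * h y * K y v) \<partial>PI) \<partial>\<sigma>)"
    unfolding Vop_def
  proof (rule Bochner_Integration.integral_cong[OF refl])
    fix y
    show "b y * (H (x - t *\<^sub>R y $ i0) * (\<Prod>i\<in>UNIV - {i0}. star (\<gamma> i) (g i) (x - t *\<^sub>R y $ i)))
        = (\<integral>v. A v * (b y * h y * K y v) \<partial>PI)"
    proof (cases "norm y \<le> 1")
      case True
      have "(\<Prod>i\<in>I. star (\<gamma> i) (g i) (x - t *\<^sub>R y $ i)) = (\<integral>v. A v * K y v \<partial>PI)"
        unfolding star_eq[OF True] PI_def A_def K_def prod.distrib[symmetric]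
        by (rule P.product_integral_prod[symmetric, OF I star_int[OF True]])
      then have "b y * (h y * (\<Prod>i\<in>I. star (\<gamma> i) (g i) (x - t *\<^sub>R y $ i))) = (\<integral>v. (b y * h y) * (A v * K y v) \<partial>PI)"
        by (simp add: mult.assoc)
      also have "(\<lambda>v. (b y * h y) * (A v * K y v)) = (\<lambda>v. A v * (b y * h y * K y v))"
        by (simp add: fun_eq_iff mult_ac)
      finally show ?thesis by (simp add: h_def I_def)
    qed (simp add: b0)
  qed
  also have "\<dots> = (\<integral>v. (\<integral>y. A v * (b y * h y * K y v) \<partial>\<sigma>) \<partial>PI)"
    by (rule SP.Fubini_integral[symmetric, OF int_pair])
  also have "\<dots> = (\<integral>v. A v * L v \<partial>PI)"
    by (simp add: L_def Lker_def h_def K_def I_def mult.assoc)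
  finally have V: "Vop \<sigma> b i0 H (\<lambda>i. star (\<gamma> i) (g i)) t x = (\<integral>v. A v * L v \<partial>PI)" .
  have "ennreal (norm (\<integral>v. A v * L v \<partial>PI)) \<le> (\<integral>\<^sup>+v. ennreal (norm (A v)) * ennreal (norm (L v)) \<partial>PI)"
    unfolding ennreal_mult'[OF norm_ge_zero, symmetric] norm_mult[symmetric]
  proof (rule integral_norm_bound_ennreal)
    show "integrable PI (\<lambda>v. A v * L v)"
      using SP.integrable_snd[OF int_pair] by (simp add: L_def Lker_def h_def K_def I_def mult.assoc)
  qed
  then have "ennreal ((norm (\<integral>v. A v * L v \<partial>PI))\<^sup>2) \<le> (\<integral>\<^sup>+v. ennreal (norm (A v)) * ennreal (norm (L v)) \<partial>PI)\<^sup>2"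
    by (intro ennreal_square_mono) auto
  also have "\<dots> \<le> (\<integral>\<^sup>+v. (ennreal (norm (A v)))\<^sup>2 \<partial>PI) * (\<integral>\<^sup>+v. (ennreal (norm (L v)))\<^sup>2 \<partial>PI)"
    by (rule Cauchy_Schwarz_nn_integral) measurable
  also have "(\<integral>\<^sup>+v. (ennreal (norm (L v)))\<^sup>2 \<partial>PI) = Rker \<sigma> b i0 H \<gamma> t x"
    by (simp add: Rker_def L_def PI_def I_def ennreal_power)
  also have "(\<integral>\<^sup>+v. (ennreal (norm (A v)))\<^sup>2 \<partial>PI) = (\<Prod>i\<in>I. \<integral>\<^sup>+v. ennreal ((norm (cut v * g i (x - v)))\<^sup>2) \<partial>lborel)"
  proof -
    have "(ennreal (norm (A v)))\<^sup>2 = (\<Prod>i\<in>I. ennreal ((norm (cut (v i) * g i (x - v i)))\<^sup>2))" for v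
      unfolding A_def by (simp add: prod_norm[symmetric] prod_ennreal[symmetric] prod_power_distrib ennreal_power)
    then show ?thesis unfolding PI_def by (simp only:) (rule P.product_nn_integral_prod[OF I], measurable)
  qed
  also have "(\<Prod>i\<in>I. \<integral>\<^sup>+v. ennreal ((norm (cut v * g i (x - v)))\<^sup>2) \<partial>lborel) * Rker \<sigma> b i0 H \<gamma> t x
    \<le> (\<Prod>i\<in>I. ennreal ((4 * \<rho>) ^ DIM('a)) * avg (4 * \<rho>) (\<lambda>z. ennreal ((norm (g i z))\<^sup>2)) x) * Rker \<sigma> b i0 H \<gamma> t x"
  proof (intro mult_right_mono prod_mono_ennreal)
    fix i
    have "(\<integral>\<^sup>+v. ennreal ((norm (cut v * g i (x - v)))\<^sup>2) \<partial>lborel)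
      = (\<integral>\<^sup>+z. ennreal ((norm (cut (x - z) * g i (x - (x - z))))\<^sup>2) \<partial>lborel)"
      by (rule nn_integral_lborel_reflect[symmetric]) measurable
    also have "\<dots> \<le> (\<integral>\<^sup>+z. ennreal ((4 * \<rho>) ^ DIM('a)) * (ball_kernel (4 * \<rho>) x z * ennreal ((norm (g i z))\<^sup>2)) \<partial>lborel)"
    proof (rule nn_integral_mono)
      fix z
      show "ennreal ((norm (cut (x - z) * g i (x - (x - z))))\<^sup>2) \<le> ennreal ((4 * \<rho>) ^ DIM('a)) * (ball_kernel (4 * \<rho>) x z * ennreal ((norm (g i z))\<^sup>2))"
      proof (cases "norm (x - z) \<le> 3 * \<rho>")
        case True
        \<comment> \<open>Rounded up from 3 to 4, the radius for which
          \<open>pretrunc_sup_L2\<close> controls the averages.\<close>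
        then have "dist x z \<le> 4 * \<rho>" using \<rho> by (simp add: dist_norm)
        moreover have "ennreal ((4 * \<rho>) ^ DIM('a)) * ennreal (1 / (4 * \<rho>) ^ DIM('a)) = 1"
          using \<rho> by (simp add: ennreal_mult[symmetric])
        ultimately show ?thesis using True by (simp add: cut_def ball_kernel_def mult.assoc[symmetric])
      qed (simp add: cut_def)
    qed
    also have "\<dots> = ennreal ((4 * \<rho>) ^ DIM('a)) * avg (4 * \<rho>) (\<lambda>z. ennreal ((norm (g i z))\<^sup>2)) x"
      unfolding avg_def by (rule nn_integral_cmult) measurable
    finally show "(\<integral>\<^sup>+v. ennreal ((norm (cut v * g i (x - v)))\<^sup>2) \<partial>lborel)
      \<le> ennreal ((4 * \<rho>) ^ DIM('a)) * avg (4 * \<rho>) (\<lambda>z. ennreal ((norm (g i z))\<^sup>2)) x" .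
  qed simp
  finally show ?thesis unfolding V I_def .
qed

end

subsection \<open>The supremum over one octave of dilations\<close>

text \<open>A one-dimensional Sobolev inequality: \<open>u t\<close> is compared with
  \<open>u \<tau>\<close> and averaged over an interval of length \<open>r\<close> around or beside
  \<open>t\<close>. The free length \<open>r\<close> balances the function against its derivative
  and is later the smoothing scale.\<close>

lemma sup_time_le:
  fixes u u' :: "real \<Rightarrow> complex"
  assumes [measurable]: "u \<in> borel_measurable borel" "u' \<in> borel_measurable borel"
    and r: "0 < r" "r \<le> \<rho>" and t: "\<rho> \<le> t" "t \<le> 2 * \<rho>"
    and ftc: "\<And>t1 t2. \<rho> \<le> t1 \<Longrightarrow> t1 \<le> t2 \<Longrightarrow> t2 \<le> 2 * \<rho> \<Longrightarrow>
      ennreal (norm (u t2 - u t1)) \<le> (\<integral>\<^sup>+\<tau>. indicator {t1..t2} \<tau> * ennreal (norm (u' \<tau>)) \<partial>lborel)"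
  shows "ennreal ((norm (u t))\<^sup>2) \<le> (\<integral>\<^sup>+\<tau>. indicator {\<rho>..2 * \<rho>} \<tau> *
     (ennreal (2 / r) * ennreal ((norm (u \<tau>))\<^sup>2) + ennreal (2 * r) * ennreal ((norm (u' \<tau>))\<^sup>2)) \<partial>lborel)"
proof -
  \<comment> \<open>The interval ends at \<open>t\<close> when there is room to the left and starts
    at \<rho> otherwise; as \<open>r \<le> \<rho>\<close> it stays inside the octave.\<close>
  define c where "c = (if \<rho> \<le> t - r then t - r else \<rho>)"
  define J where "J = {c..c + r}"
  have c: "\<rho> \<le> c" "c \<le> t" "t \<le> c + r" "c + r \<le> 2 * \<rho>" using r t by (auto simp: c_def)
  have [measurable]: "J \<in> sets borel" by (simp add: J_def)
  have J: "emeasure lborel J = ennreal r" using r by (simp add: J_def)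
  define D where "D = (\<integral>\<^sup>+\<tau>. indicator J \<tau> * ennreal (norm (u' \<tau>)) \<partial>lborel)"
  define E where "E = (\<integral>\<^sup>+\<tau>. indicator J \<tau> * ennreal ((norm (u' \<tau>))\<^sup>2) \<partial>lborel)"
  have ii: "(indicator J \<tau>)\<^sup>2 = (indicator J \<tau> :: ennreal)" for \<tau> by (auto simp: indicator_def)
  have "D = (\<integral>\<^sup>+\<tau>. indicator J \<tau> * (indicator J \<tau> * ennreal (norm (u' \<tau>))) \<partial>lborel)"
    unfolding D_def by (intro nn_integral_cong) (auto simp: indicator_def)
  then have "D\<^sup>2 \<le> (\<integral>\<^sup>+\<tau>. (indicator J \<tau>)\<^sup>2 \<partial>lborel) * (\<integral>\<^sup>+\<tau>. (indicator J \<tau> * ennreal (norm (u' \<tau>)))\<^sup>2 \<partial>lborel)"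
    by (simp only:) (rule Cauchy_Schwarz_nn_integral; measurable)
  then have D2: "D\<^sup>2 \<le> ennreal r * E"
    by (simp add: ii power_mult_distrib ennreal_power E_def J)
  have mono: "(\<integral>\<^sup>+\<tau>. indicator {t1..t2} \<tau> * ennreal (norm (u' \<tau>)) \<partial>lborel) \<le> D"
    if "c \<le> t1" "t2 \<le> c + r" for t1 t2
    unfolding D_def using that by (intro nn_integral_mono mult_right_mono) (auto simp: J_def indicator_def)
  have diff: "ennreal (norm (u t - u \<tau>)) \<le> D" if "\<tau> \<in> J" for \<tau>
  proof (cases "\<tau> \<le> t")
    case True
    then show ?thesis using that c by (intro order_trans[OF ftc mono]) (auto simp: J_def)
  next
    case False
    then have "ennreal (norm (u \<tau> - u t)) \<le> D" using that c t by (intro order_trans[OF ftc mono]) (auto simp: J_def)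
    then show ?thesis by (simp add: norm_minus_commute)
  qed
  have pt: "ennreal ((norm (u t))\<^sup>2) \<le> 2 * ennreal ((norm (u \<tau>))\<^sup>2) + 2 * D\<^sup>2" if "\<tau> \<in> J" for \<tau>
  proof -
    define a where "a = norm (u t - u \<tau>)"
    have "norm (u t) \<le> norm (u \<tau>) + a" unfolding a_def using norm_triangle_ineq[of "u t - u \<tau>" "u \<tau>"] by simp
    then have "(norm (u t))\<^sup>2 \<le> (norm (u \<tau>) + a)\<^sup>2" by (intro power_mono) auto
    also have "\<dots> \<le> 2 * (norm (u \<tau>))\<^sup>2 + 2 * a\<^sup>2"
      using sum_squares_bound[of "norm (u \<tau>)" a] by (simp add: power2_sum)
    finally have "ennreal ((norm (u t))\<^sup>2) \<le> ennreal (2 * (norm (u \<tau>))\<^sup>2 + 2 * a\<^sup>2)" by (rule ennreal_leI)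
    also have "\<dots> = 2 * ennreal ((norm (u \<tau>))\<^sup>2) + 2 * ennreal (a\<^sup>2)"
      by (simp add: ennreal_plus ennreal_mult)
    also have "\<dots> \<le> 2 * ennreal ((norm (u \<tau>))\<^sup>2) + 2 * D\<^sup>2"
      using diff[OF that] by (intro add_left_mono mult_left_mono ennreal_square_mono) (auto simp: a_def)
    finally show ?thesis .
  qed
  have "ennreal r * ennreal ((norm (u t))\<^sup>2) = (\<integral>\<^sup>+\<tau>. indicator J \<tau> * ennreal ((norm (u t))\<^sup>2) \<partial>lborel)"
    by (simp add: nn_integral_multc J)
  also have "\<dots> \<le> (\<integral>\<^sup>+\<tau>. 2 * (indicator J \<tau> * ennreal ((norm (u \<tau>))\<^sup>2)) + indicator J \<tau> * (2 * D\<^sup>2) \<partial>lborel)"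
    by (intro nn_integral_mono) (use pt in \<open>auto simp: indicator_def\<close>)
  also have "\<dots> = 2 * (\<integral>\<^sup>+\<tau>. indicator J \<tau> * ennreal ((norm (u \<tau>))\<^sup>2) \<partial>lborel) + ennreal r * (2 * D\<^sup>2)"
    by (simp add: nn_integral_add nn_integral_cmult nn_integral_multc J)
  also have "\<dots> \<le> 2 * (\<integral>\<^sup>+\<tau>. indicator J \<tau> * ennreal ((norm (u \<tau>))\<^sup>2) \<partial>lborel) + ennreal r * (2 * (ennreal r * E))"
    by (intro add_left_mono mult_left_mono D2) auto
  finally have "ennreal (1 / r) * (ennreal r * ennreal ((norm (u t))\<^sup>2))
    \<le> ennreal (1 / r) * (2 * (\<integral>\<^sup>+\<tau>. indicator J \<tau> * ennreal ((norm (u \<tau>))\<^sup>2) \<partial>lborel) + ennreal r * (2 * (ennreal r * E)))"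
    by (rule mult_left_mono) simp
  moreover have one: "ennreal (1 / r) * ennreal r = 1" using r by (simp add: ennreal_mult[symmetric])
  moreover have "ennreal (1 / r) * 2 = ennreal (2 / r)" "ennreal r * 2 = ennreal (2 * r)"
    using r ennreal_mult[of "1 / r" 2] ennreal_mult[of r 2] by (simp_all add: mult.commute)
  moreover have "ennreal (1 / r) * (2 * X + ennreal r * (2 * (ennreal r * E)))
      = (ennreal (1 / r) * 2) * X + (ennreal (1 / r) * ennreal r) * ((ennreal r * 2) * E)" for X
    by (simp only: distrib_left mult_ac)
  ultimately have "ennreal ((norm (u t))\<^sup>2) \<le> ennreal (2 / r) * (\<integral>\<^sup>+\<tau>. indicator J \<tau> * ennreal ((norm (u \<tau>))\<^sup>2) \<partial>lborel) + ennreal (2 * r) * E"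
    by (simp only: mult.assoc[symmetric] one mult_1)
  also have "\<dots> = (\<integral>\<^sup>+\<tau>. ennreal (2 / r) * (indicator J \<tau> * ennreal ((norm (u \<tau>))\<^sup>2)) + ennreal (2 * r) * (indicator J \<tau> * ennreal ((norm (u' \<tau>))\<^sup>2)) \<partial>lborel)"
    by (simp add: nn_integral_add nn_integral_cmult E_def)
  also have "\<dots> \<le> (\<integral>\<^sup>+\<tau>. indicator {\<rho>..2 * \<rho>} \<tau> *
     (ennreal (2 / r) * ennreal ((norm (u \<tau>))\<^sup>2) + ennreal (2 * r) * ennreal ((norm (u' \<tau>))\<^sup>2)) \<partial>lborel)"
    using c by (intro nn_integral_mono) (auto simp: indicator_def J_def)
  finally show ?thesis .
qed

definition Mop ::
  "('a::euclidean_space ^ 'm::finite) measure \<Rightarrow> ('a ^ 'm \<Rightarrow> complex) \<Rightarrow> ('m \<Rightarrow> 'a \<Rightarrow> complex) \<Rightarrow> real \<Rightarrow> 'a \<Rightarrow> complex" where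
  "Mop \<sigma> b h t x = (\<integral>y. b y * (\<Prod>i\<in>UNIV. h i (x - t *\<^sub>R y $ i)) \<partial>\<sigma>)"

lemma Mop_eq_Vop: "Mop \<sigma> b h t x = Vop \<sigma> b i0 (h i0) h t x"
  unfolding Mop_def Vop_def by (subst prod.remove[of UNIV i0]) auto

text \<open>The product rule for fixed \<open>y\<close>, integrated in time and then over \<sigma>
  by Fubini. The chain rule produces the coordinates of \<open>y\<close>, which join the weight
  \<open>b\<close>; this is how coordinate moments of the measure enter.\<close>

lemma Mop_ftc:
  fixes \<sigma> :: "('a::euclidean_space ^ 'm::finite) measure"
    and h :: "'m \<Rightarrow> 'a \<Rightarrow> complex" and dh :: "'m \<Rightarrow> 'a \<Rightarrow> 'a \<Rightarrow> complex"
  assumes fin: "finite_measure \<sigma>" and sets[measurable_cong]: "sets \<sigma> = sets borel"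
    and h: "\<And>i. nice (h i)" and dh: "\<And>i a. nice (dh i a)"
    and deriv: "\<And>i x y t. ((\<lambda>t. h i (x - t *\<^sub>R y)) has_vector_derivative
       - (\<Sum>a\<in>Basis. (y \<bullet> a) *\<^sub>R dh i a (x - t *\<^sub>R y))) (at t)"
    and b[measurable]: "b \<in> borel_measurable borel" and b1: "\<And>y. norm (b y) \<le> 1"
    and b0: "\<And>y. norm y > 1 \<Longrightarrow> b y = 0" and t: "t1 \<le> t2"
  shows "ennreal (norm (Mop \<sigma> b h t2 x - Mop \<sigma> b h t1 x)) \<le> (\<integral>\<^sup>+\<tau>. indicator {t1..t2} \<tau> *
     ennreal (norm (\<Sum>l\<in>UNIV. \<Sum>a\<in>Basis. Mop \<sigma> (\<lambda>y. of_real (y $ l \<bullet> a) * b y) (h(l := dh l a)) \<tau> x)) \<partial>lborel)"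
proof -
  interpret finite_measure \<sigma> by (rule fin)
  interpret SP: pair_sigma_finite \<sigma> "lborel :: real measure" ..
  note [measurable] = measurable_nice[OF h] measurable_nice[OF dh]
  define hl where "hl l a = h(l := dh l a)" for l a
  have hl: "nice (hl l a i)" for l a i using h dh by (simp add: hl_def)
  note [measurable] = measurable_nice[OF hl]
  define \<Psi> where "\<Psi> t y = (\<Prod>i\<in>UNIV. h i (x - t *\<^sub>R y $ i))" for t and y :: "'a ^ 'm"
  define \<Psi>' where "\<Psi>' t y = - (\<Sum>l\<in>UNIV. \<Sum>a\<in>Basis. of_real (y $ l \<bullet> a) * (\<Prod>i\<in>UNIV. hl l a i (x - t *\<^sub>R y $ i)))"
    for t and y :: "'a ^ 'm"
  have d\<Psi>: "((\<lambda>t. \<Psi> t y) has_vector_derivative \<Psi>' t y) (at t)" for t y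
  proof -
    let ?d = "\<lambda>i. - (\<Sum>a\<in>Basis. (y $ i \<bullet> a) *\<^sub>R dh i a (x - t *\<^sub>R y $ i))"
    have "((\<lambda>t. \<Psi> t y) has_derivative (\<lambda>e. \<Sum>l\<in>UNIV. (e *\<^sub>R ?d l) * (\<Prod>i\<in>UNIV - {l}. h i (x - t *\<^sub>R y $ i)))) (at t)"
      unfolding \<Psi>_def by (rule has_derivative_prod) (rule deriv[unfolded has_vector_derivative_def])
    moreover have "?d l * (\<Prod>i\<in>UNIV - {l}. h i (x - t *\<^sub>R y $ i))
        = - (\<Sum>a\<in>Basis. of_real (y $ l \<bullet> a) * (\<Prod>i\<in>UNIV. hl l a i (x - t *\<^sub>R y $ i)))" for l
    proof -
      have "(\<Prod>i\<in>UNIV. hl l a i (x - t *\<^sub>R y $ i)) = dh l a (x - t *\<^sub>R y $ l) * (\<Prod>i\<in>UNIV - {l}. h i (x - t *\<^sub>R y $ i))" for a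
        by (subst prod.remove[of UNIV l]) (auto simp: hl_def)
      then show ?thesis by (simp add: sum_distrib_right scaleR_conv_of_real mult.assoc)
    qed
    then have "(\<lambda>e. \<Sum>l\<in>UNIV. (e *\<^sub>R ?d l) * (\<Prod>i\<in>UNIV - {l}. h i (x - t *\<^sub>R y $ i))) = (\<lambda>e. e *\<^sub>R \<Psi>' t y)"
      by (simp only: \<Psi>'_def mult_scaleR_left scaleR_sum_right[symmetric] sum_negf)
    ultimately show ?thesis by (simp add: has_vector_derivative_def)
  qed
  have cont\<Psi>': "continuous_on S (\<lambda>t. \<Psi>' t y)" for S y
  proof -
    have "continuous_on UNIV (hl l a i)" for l a i using hl[of l a i] by (simp add: nice_def)
    then have "continuous_on S (\<lambda>t. hl l a i (x - t *\<^sub>R y $ i))" for l a i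
      by (rule continuous_on_compose2) (auto intro!: continuous_intros)
    then show ?thesis unfolding \<Psi>'_def
      by (intro continuous_on_minus continuous_on_sum continuous_on_mult continuous_on_const continuous_on_prod)
  qed
  have "\<forall>l a i. \<exists>B\<ge>0. \<forall>x. norm (hl l a i x) \<le> B" using nice_boundE[OF hl] less_imp_le by metis
  then obtain B where B: "\<And>l a i. B l a i \<ge> 0" "\<And>l a i x. norm (hl l a i x) \<le> B l a i" by metis
  define M where "M = (\<Sum>l\<in>(UNIV::'m set). \<Sum>a\<in>(Basis::'a set). \<Prod>i\<in>UNIV. B l a i)"
  have b\<Psi>'_le: "norm (b y * \<Psi>' t y) \<le> M" for t y
  proof (cases "norm y \<le> 1")
    case True
    have "norm (\<Psi>' t y) \<le> (\<Sum>l\<in>UNIV. \<Sum>a\<in>Basis. norm (of_real (y $ l \<bullet> a) * (\<Prod>i\<in>UNIV. hl l a i (x - t *\<^sub>R y $ i))))"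
      unfolding \<Psi>'_def norm_minus_cancel
      by (rule order_trans[OF norm_sum sum_mono[OF norm_sum]])
    also have "\<dots> \<le> M"
      unfolding M_def
    proof (intro sum_mono)
      fix l and a :: 'a assume a: "a \<in> Basis"
      have "\<bar>y $ l \<bullet> a\<bar> \<le> norm (y $ l)" using Basis_le_norm[OF a] by simp
      also have "\<dots> \<le> 1" by (rule order_trans[OF Finite_Cartesian_Product.norm_nth_le True])
      finally have "\<bar>y $ l \<bullet> a\<bar> \<le> 1" .
      moreover have "norm (\<Prod>i\<in>UNIV. hl l a i (x - t *\<^sub>R y $ i)) \<le> (\<Prod>i\<in>UNIV. B l a i)"
        unfolding prod_norm[symmetric] by (rule prod_mono) (simp add: B)
      ultimately have "\<bar>y $ l \<bullet> a\<bar> * norm (\<Prod>i\<in>UNIV. hl l a i (x - t *\<^sub>R y $ i)) \<le> 1 * (\<Prod>i\<in>UNIV. B l a i)"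
        by (rule mult_mono) auto
      then show "norm (of_real (y $ l \<bullet> a) * (\<Prod>i\<in>UNIV. hl l a i (x - t *\<^sub>R y $ i))) \<le> (\<Prod>i\<in>UNIV. B l a i)"
        by (simp add: norm_mult)
    qed
    finally have "norm (\<Psi>' t y) \<le> M" .
    then have "norm (b y) * norm (\<Psi>' t y) \<le> 1 * M" using b1[of y] by (intro mult_mono) auto
    then show ?thesis by (simp add: norm_mult)
  next
    case False
    have "M \<ge> 0" unfolding M_def by (intro sum_nonneg prod_nonneg) (auto simp: B)
    then show ?thesis using False by (simp add: b0)
  qed
  have [measurable]: "(\<lambda>(y, \<tau>). \<Psi>' \<tau> y) \<in> borel_measurable (borel \<Otimes>\<^sub>M borel)"
    unfolding \<Psi>'_def by measurable
  define k where "k y \<tau> = indicator {t1..t2} \<tau> *\<^sub>R (b y * \<Psi>' \<tau> y)" for y \<tau>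
  have k_FTC: "has_bochner_integral lborel (k y) (b y * \<Psi> t2 y - b y * \<Psi> t1 y)" for y
    unfolding k_def
  proof (rule has_bochner_integral_FTC_Icc[OF t])
    show "((\<lambda>t. b y * \<Psi> t y) has_vector_derivative b y * \<Psi>' t y) (at t within {t1..t2})" for t
      by (rule has_vector_derivative_mult_right[OF has_vector_derivative_at_within[OF d\<Psi>]])
    show "continuous_on {t1..t2} (\<lambda>\<tau>. b y * \<Psi>' \<tau> y)" by (rule continuous_on_mult[OF continuous_on_const cont\<Psi>'])
  qed
  have kint: "integrable (\<sigma> \<Otimes>\<^sub>M lborel) (\<lambda>(y, \<tau>). k y \<tau>)"
  proof (rule SP.Fubini_integrable)
    show "(\<lambda>(y, \<tau>). k y \<tau>) \<in> borel_measurable (\<sigma> \<Otimes>\<^sub>M lborel)" unfolding k_def by measurable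
    show "AE y in \<sigma>. integrable lborel (\<lambda>\<tau>. case (y, \<tau>) of (y, \<tau>) \<Rightarrow> k y \<tau>)"
      using k_FTC by (auto simp: has_bochner_integral_iff)
    show "integrable \<sigma> (\<lambda>y. \<integral>\<tau>. norm (case (y, \<tau>) of (y, \<tau>) \<Rightarrow> k y \<tau>) \<partial>lborel)"
    proof (rule integrable_const_bound[where B="\<integral>\<tau>. indicator {t1..t2} \<tau> *\<^sub>R M \<partial>lborel"])
      have "(\<integral>\<tau>. norm (k y \<tau>) \<partial>lborel) \<le> (\<integral>\<tau>. indicator {t1..t2} \<tau> *\<^sub>R M \<partial>lborel)" for y
      proof (rule integral_mono)
        show "integrable lborel (\<lambda>\<tau>. norm (k y \<tau>))" using k_FTC[of y] by (auto simp: has_bochner_integral_iff)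
        show "integrable lborel (\<lambda>\<tau>. indicator {t1..t2} \<tau> *\<^sub>R M)" using t by (intro integrable_scaleR_left integrable_real_indicator) auto
        show "norm (k y \<tau>) \<le> indicator {t1..t2} \<tau> *\<^sub>R M" for \<tau>
          using b\<Psi>'_le[of y \<tau>] by (auto simp: k_def indicator_def)
      qed
      then show "AE y in \<sigma>. norm (\<integral>\<tau>. norm (case (y, \<tau>) of (y, \<tau>) \<Rightarrow> k y \<tau>) \<partial>lborel) \<le> (\<integral>\<tau>. indicator {t1..t2} \<tau> *\<^sub>R M \<partial>lborel)"
        by simp
    qed (simp add: k_def, measurable)
  qed
  have bint: "integrable \<sigma> (\<lambda>y. c y * (\<Prod>i\<in>UNIV. f i (x - t *\<^sub>R y $ i)))"
    if c: "c \<in> borel_measurable borel" "\<And>y. norm (c y) \<le> 1" and f: "\<And>i. nice (f i)" for c f t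
  proof -
    note [measurable] = measurable_nice[OF f] c(1)
    have "\<forall>i. \<exists>B. \<forall>x. norm (f i x) \<le> B" using nice_boundE[OF f] by metis
    then obtain B where B: "\<And>i x. norm (f i x) \<le> B i" by metis
    have "norm (\<Prod>i\<in>UNIV. f i (x - t *\<^sub>R y $ i)) \<le> (\<Prod>i\<in>UNIV. B i)" for y
      unfolding prod_norm[symmetric] by (rule prod_mono) (simp add: B)
    then have "norm (c y * (\<Prod>i\<in>UNIV. f i (x - t *\<^sub>R y $ i))) \<le> 1 * (\<Prod>i\<in>UNIV. B i)" for y
      unfolding norm_mult by (rule mult_mono[OF c(2)]) auto
    then have "AE y in \<sigma>. norm (c y * (\<Prod>i\<in>UNIV. f i (x - t *\<^sub>R y $ i))) \<le> 1 * (\<Prod>i\<in>UNIV. B i)" by simp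
    then show ?thesis by (rule integrable_const_bound) measurable
  qed
  have inner: "(\<integral>y. k y \<tau> \<partial>\<sigma>) = indicator {t1..t2} \<tau> *\<^sub>R
     (- (\<Sum>l\<in>UNIV. \<Sum>a\<in>Basis. Mop \<sigma> (\<lambda>y. of_real (y $ l \<bullet> a) * b y) (hl l a) \<tau> x))" for \<tau>
  proof -
    have c1: "norm (of_real (y $ l \<bullet> a) * b y) \<le> 1" if "a \<in> Basis" for l a and y :: "'a ^ 'm"
    proof (cases "norm y \<le> 1")
      case True
      have "\<bar>y $ l \<bullet> a\<bar> \<le> norm (y $ l)" using Basis_le_norm[OF that] by simp
      also have "\<dots> \<le> 1" by (rule order_trans[OF Finite_Cartesian_Product.norm_nth_le True])
      finally have "\<bar>y $ l \<bullet> a\<bar> * norm (b y) \<le> 1 * 1" by (intro mult_mono b1) auto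
      then show ?thesis by (simp add: norm_mult)
    qed (simp add: b0)
    have "(\<integral>y. b y * \<Psi>' \<tau> y \<partial>\<sigma>)
       = (\<integral>y. - (\<Sum>l\<in>UNIV. \<Sum>a\<in>Basis. (of_real (y $ l \<bullet> a) * b y) * (\<Prod>i\<in>UNIV. hl l a i (x - \<tau> *\<^sub>R y $ i))) \<partial>\<sigma>)"
      by (simp add: \<Psi>'_def sum_distrib_left mult_ac)
    also have "\<dots> = - (\<Sum>l\<in>UNIV. \<Sum>a\<in>Basis. Mop \<sigma> (\<lambda>y. of_real (y $ l \<bullet> a) * b y) (hl l a) \<tau> x)"
    proof -
      have "integrable \<sigma> (\<lambda>y. (of_real (y $ l \<bullet> a) * b y) * (\<Prod>i\<in>UNIV. hl l a i (x - \<tau> *\<^sub>R y $ i)))" if "a \<in> Basis" for l a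
        by (rule bint[OF _ c1[OF that] hl]) measurable
      then show ?thesis
        unfolding Mop_def by (simp add: Bochner_Integration.integral_sum)
    qed
    finally show ?thesis by (simp add: k_def)
  qed
  have "Mop \<sigma> b h t2 x - Mop \<sigma> b h t1 x = (\<integral>y. b y * \<Psi> t2 y - b y * \<Psi> t1 y \<partial>\<sigma>)"
    unfolding Mop_def \<Psi>_def by (rule Bochner_Integration.integral_diff[symmetric]; rule bint[OF b b1 h])
  also have "\<dots> = (\<integral>y. (\<integral>\<tau>. k y \<tau> \<partial>lborel) \<partial>\<sigma>)"
    using k_FTC by (simp add: has_bochner_integral_iff)
  also have "\<dots> = (\<integral>\<tau>. (\<integral>y. k y \<tau> \<partial>\<sigma>) \<partial>lborel)"
    by (rule SP.Fubini_integral[symmetric, OF kint])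
  finally have eq: "Mop \<sigma> b h t2 x - Mop \<sigma> b h t1 x = (\<integral>\<tau>. (\<integral>y. k y \<tau> \<partial>\<sigma>) \<partial>lborel)" .
  have "ennreal (norm (\<integral>\<tau>. (\<integral>y. k y \<tau> \<partial>\<sigma>) \<partial>lborel)) \<le> (\<integral>\<^sup>+\<tau>. ennreal (norm (\<integral>y. k y \<tau> \<partial>\<sigma>)) \<partial>lborel)"
    by (rule integral_norm_bound_ennreal[OF SP.integrable_snd[OF kint]])
  also have "\<dots> = (\<integral>\<^sup>+\<tau>. indicator {t1..t2} \<tau> *
     ennreal (norm (\<Sum>l\<in>UNIV. \<Sum>a\<in>Basis. Mop \<sigma> (\<lambda>y. of_real (y $ l \<bullet> a) * b y) (hl l a) \<tau> x)) \<partial>lborel)"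
    unfolding inner by (intro nn_integral_cong) (auto simp: indicator_def)
  finally show ?thesis unfolding eq hl_def .
qed

text \<open>Squared supremum times volume of the support. The factor \<open>1 / r ^ DIM('a)\<close>,
  once per slot off \<open>i0\<close>, against the volume of the ball of radius comparable to
  \<rho>, is the cost of leaving the diagonal.\<close>

lemma l2_kernel_bounds:
  obtains C where "C > 0"
    "\<And>r. r > 0 \<Longrightarrow> l2 (bk r :: 'a::euclidean_space \<Rightarrow> complex) \<le> ennreal (C / r ^ DIM('a))"
    "\<And>r a. r > 0 \<Longrightarrow> a \<in> Basis \<Longrightarrow> l2 (bkd r (a::'a)) \<le> ennreal (C / r ^ DIM('a) / r\<^sup>2)"
proof -
  define c where "c = bump_const TYPE('a)"
  define w where "w = unit_ball_vol (real DIM('a))"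
  have c0: "c > 0" and w0: "w > 0" by (simp_all add: c_def w_def bump_const_pos)
  have gen: "l2 f \<le> ennreal (B\<^sup>2 * (w * r ^ DIM('a)))"
    if "r > 0" "\<And>v. norm (f v) \<le> B" "\<And>v. norm v > r \<Longrightarrow> f v = 0" for f :: "'a \<Rightarrow> complex" and B r
  proof -
    have "l2 f \<le> (\<integral>\<^sup>+v. ennreal (B\<^sup>2) * indicator (cball (0::'a) r) v \<partial>lborel)"
      unfolding l2_def
    proof (rule nn_integral_mono)
      fix v
      show "ennreal ((norm (f v))\<^sup>2) \<le> ennreal (B\<^sup>2) * indicator (cball 0 r) v"
        using that(2)[of v] that(3)[of v] by (cases "norm v \<le> r") (auto intro!: ennreal_leI power_mono)
    qed
    also have "\<dots> = ennreal (B\<^sup>2 * (w * r ^ DIM('a)))"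
      using that(1) w0 by (simp add: nn_integral_cmult_indicator emeasure_cball w_def ennreal_mult[symmetric])
    finally show ?thesis .
  qed
  show thesis
  \<comment> \<open>The 16 is the square of the 4 in the bound for \<open>bkd\<close> and covers
    \<open>bk\<close> as well.\<close>
  proof (rule that[of "16 * c\<^sup>2 * w"])
    show "16 * c\<^sup>2 * w > 0" using c0 w0 by simp
    fix r :: real assume r: "r > 0"
    have "l2 (bk r :: 'a \<Rightarrow> complex) \<le> ennreal ((c / r ^ DIM('a))\<^sup>2 * (w * r ^ DIM('a)))"
      by (rule gen[OF r]) (auto simp: c_def norm_bk_le[OF r] bk_eq_0[OF r])
    also have "(c / r ^ DIM('a))\<^sup>2 * (w * r ^ DIM('a)) = c\<^sup>2 * w / r ^ DIM('a)"
      using r by (simp add: power2_eq_square field_simps)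
    also have "ennreal (c\<^sup>2 * w / r ^ DIM('a)) \<le> ennreal (16 * c\<^sup>2 * w / r ^ DIM('a))"
      using r w0 by (intro ennreal_leI divide_right_mono) auto
    finally show "l2 (bk r :: 'a \<Rightarrow> complex) \<le> ennreal (16 * c\<^sup>2 * w / r ^ DIM('a))" .
    fix a :: 'a assume a: "a \<in> Basis"
    have "l2 (bkd r a) \<le> ennreal ((4 * c / r ^ DIM('a) / r)\<^sup>2 * (w * r ^ DIM('a)))"
      by (rule gen[OF r norm_bkd_le[OF r a, folded c_def] bkd_eq_0[OF r]])
    also have "(4 * c / r ^ DIM('a) / r)\<^sup>2 * (w * r ^ DIM('a)) = 16 * c\<^sup>2 * w / r ^ DIM('a) / r\<^sup>2"
      using r by (simp add: power2_eq_square field_simps)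
    finally show "l2 (bkd r a) \<le> ennreal (16 * c\<^sup>2 * w / r ^ DIM('a) / r\<^sup>2)" .
  qed
qed

subsection \<open>The estimate at a single scale\<close>

text \<open>With \<open>z\<close> the frequency in slot \<open>i0\<close> and \<open>N\<close> the
  full frequency, decay gives \<open>(\<rho> * z) powr (- s)\<close> and vanishing of order at least
  \<open>s\<close> gives \<open>(r * z) powr s\<close>. The frequency cancels and only the ratio of
  the scales remains.\<close>

lemma decay_times_vanishing_le:
  fixes r \<rho> s t z N :: real
  assumes r: "0 < r" "0 < \<rho>" and s: "0 \<le> s" "s \<le> real n" and t: "\<rho> \<le> t" and z: "0 \<le> z" "z \<le> N"
  shows "(1 + t * N) powr (- s) * min 1 (r * z) ^ n \<le> (r / \<rho>) powr s"
proof (cases "z = 0")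
  case True
  show ?thesis
  proof (cases "n = 0")
    case True
    then have "s = 0" using s by simp
    then show ?thesis using True t r z by (simp add: add_pos_nonneg)
  qed (use True in \<open>simp add: power_0_left\<close>)
next
  case False
  then have z0: "z > 0" using z by simp
  have "\<rho> * z \<le> t * N" using t z r by (intro mult_mono) auto
  then have "\<rho> * z \<le> 1 + t * N" by simp
  then have 1: "(1 + t * N) powr (- s) \<le> (\<rho> * z) powr (- s)"
    using s r z0 by (intro powr_mono2') auto
  have 2: "min 1 (r * z) ^ n \<le> (r * z) powr s"
  proof (cases "r * z \<le> 1")
    case True
    have "min 1 (r * z) ^ n = (r * z) powr real n" using True r z0 by (simp add: powr_realpow min_def)
    also have "\<dots> \<le> (r * z) powr s" using True r z0 s by (intro powr_mono') auto
    finally show ?thesis .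
  next
    case False
    then show ?thesis using s by (simp add: min_def ge_one_powr_ge_zero)
  qed
  have "(1 + t * N) powr (- s) * min 1 (r * z) ^ n \<le> (\<rho> * z) powr (- s) * (r * z) powr s"
    using r z0 by (intro mult_mono 1 2) auto
  also have "\<dots> = (r / \<rho>) powr s"
    using r z0 by (simp add: powr_minus powr_divide powr_mult field_simps)
  finally show ?thesis .
qed

text \<open>The decay of the measure is spent against the \<open>n\<close> vanishing powers,
  producing \<open>(r / \<rho>) powr s\<close>; the factor \<open>lp_weight\<close> is kept back for
  the sum over scales.\<close>

lemma Rker_bound:
  fixes \<sigma> :: "('a::euclidean_space ^ 'm::finite) measure"
  assumes fin: "finite_measure \<sigma>" and sets: "sets \<sigma> = sets borel"
    and b: "b \<in> borel_measurable borel" "\<And>y. norm (b y) \<le> 1"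
    and decay: "\<And>\<xi>. norm (\<integral>y. b y * cis (- 2 * pi * (\<xi> \<bullet> y)) \<partial>\<sigma>) \<le> K * (1 + norm \<xi>) powr (- s)"
    and K: "K \<ge> 0" and s: "0 \<le> s" "s \<le> real n"
    and H: "nice H" and \<gamma>: "\<And>i. nice (\<gamma> i)" and f: "nice f"
    and ftH: "\<And>\<zeta>. norm (ft H \<zeta>) \<le> E * (min 1 (r * norm \<zeta>) ^ n * lp_weight (r * norm \<zeta>)) * norm (ft f \<zeta>)"
    and E: "E \<ge> 0" and r: "0 < r" "0 < \<rho>" and t: "\<rho> \<le> t"
  shows "(\<integral>\<^sup>+x. Rker \<sigma> b i0 H \<gamma> t x \<partial>lborel) \<le> ennreal ((K * E * (r / \<rho>) powr s)\<^sup>2)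
     * (\<integral>\<^sup>+\<zeta>. ennreal ((lp_weight (r * norm \<zeta>) * norm (ft f \<zeta>))\<^sup>2) \<partial>lborel) * (\<Prod>i\<in>UNIV - {i0}. l2 (\<gamma> i))"
proof -
  note [measurable] = measurable_ft[OF f]
  define A where "A = K * E * (r / \<rho>) powr s"
  define Q where "Q \<zeta> = ennreal (A\<^sup>2) * ennreal ((lp_weight (r * norm \<zeta>) * norm (ft f \<zeta>))\<^sup>2)" for \<zeta>
  have Q[measurable]: "Q \<in> borel_measurable borel" unfolding Q_def by measurable
  have "(\<integral>\<^sup>+x. Rker \<sigma> b i0 H \<gamma> t x \<partial>lborel) \<le> (\<integral>\<^sup>+\<xi>. Q \<xi> \<partial>lborel) * (\<Prod>i\<in>UNIV - {i0}. l2 (\<gamma> i))"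
  proof (rule nn_integral_Rker_le[OF fin sets b H \<gamma> _ Q])
    show "t > 0" using r t by simp
    fix \<xi> :: "'a ^ 'm"
    let ?\<zeta> = "\<xi> $ i0"
    let ?w = "lp_weight (r * norm ?\<zeta>)"
    have w0: "?w \<ge> 0" using r by (intro lp_weight_nonneg) auto
    have "norm (\<integral>y. b y * cis (- 2 * pi * ((t *\<^sub>R \<xi>) \<bullet> y)) \<partial>\<sigma>) \<le> K * (1 + t * norm \<xi>) powr (- s)"
      using decay[of "t *\<^sub>R \<xi>"] r t by simp
    then have "norm (\<integral>y. b y * cis (- 2 * pi * ((t *\<^sub>R \<xi>) \<bullet> y)) \<partial>\<sigma>) * norm (ft H ?\<zeta>)
      \<le> (K * (1 + t * norm \<xi>) powr (- s)) * (E * (min 1 (r * norm ?\<zeta>) ^ n * ?w) * norm (ft f ?\<zeta>))"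
      using K by (intro mult_mono ftH) auto
    also have "\<dots> = (K * E) * ((1 + t * norm \<xi>) powr (- s) * min 1 (r * norm ?\<zeta>) ^ n) * (?w * norm (ft f ?\<zeta>))"
      by (simp only: mult_ac)
    also have "\<dots> \<le> (K * E) * (r / \<rho>) powr s * (?w * norm (ft f ?\<zeta>))"
    proof (rule mult_right_mono[OF mult_left_mono])
      show "(1 + t * norm \<xi>) powr (- s) * min 1 (r * norm ?\<zeta>) ^ n \<le> (r / \<rho>) powr s"
        by (rule decay_times_vanishing_le[OF r s t]) (auto simp: Finite_Cartesian_Product.norm_nth_le)
    qed (use K E w0 in auto)
    finally have "(norm (\<integral>y. b y * cis (- 2 * pi * ((t *\<^sub>R \<xi>) \<bullet> y)) \<partial>\<sigma>) * norm (ft H ?\<zeta>))\<^sup>2 \<le> (A * (?w * norm (ft f ?\<zeta>)))\<^sup>2"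
      unfolding A_def by (rule power_mono) simp
    then have "ennreal ((norm (\<integral>y. b y * cis (- 2 * pi * ((t *\<^sub>R \<xi>) \<bullet> y)) \<partial>\<sigma>) * norm (ft H ?\<zeta>))\<^sup>2) \<le> ennreal (A\<^sup>2 * (?w * norm (ft f ?\<zeta>))\<^sup>2)"
      unfolding power_mult_distrib[of A] by (rule ennreal_leI)
    then show "ennreal ((norm (\<integral>y. b y * cis (- 2 * pi * ((t *\<^sub>R \<xi>) \<bullet> y)) \<partial>\<sigma>) * norm (ft H ?\<zeta>))\<^sup>2) \<le> Q ?\<zeta>"
      unfolding Q_def by (simp only: ennreal_mult zero_le_power2)
  qed
  also have "(\<integral>\<^sup>+\<xi>. Q \<xi> \<partial>lborel) = ennreal (A\<^sup>2) * (\<integral>\<^sup>+\<zeta>. ennreal ((lp_weight (r * norm \<zeta>) * norm (ft f \<zeta>))\<^sup>2) \<partial>lborel)"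
    unfolding Q_def by (rule nn_integral_cmult) simp
  finally show ?thesis by (simp only: A_def)
qed

lemma measurable_Mop:
  fixes \<sigma> :: "('a::euclidean_space ^ 'm::finite) measure"
  assumes fin: "finite_measure \<sigma>" and sets[measurable_cong]: "sets \<sigma> = sets borel"
    and [measurable]: "b \<in> borel_measurable borel" and h: "\<And>i. nice (h i)"
  shows "(\<lambda>t. Mop \<sigma> b h t x) \<in> borel_measurable borel"
proof -
  interpret finite_measure \<sigma> by (rule fin)
  note [measurable] = measurable_nice[OF h]
  show ?thesis unfolding Mop_def by measurable
qed

text \<open>Multiplying by the indicator of the unit ball, on which \<sigma> is concentrated, makes
  the weights bounded and compactly supported everywhere instead of almost everywhere.\<close>

definition cutball :: "'b::real_normed_vector \<Rightarrow> complex" where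
  "cutball y = indicator (cball 0 1) y"

definition moment :: "'m::finite \<Rightarrow> 'a \<Rightarrow> 'a::euclidean_space ^ 'm \<Rightarrow> complex" where
  "moment l a y = of_real (y $ l \<bullet> a) * cutball y"

lemma measurable_cutball [measurable]: "(cutball :: 'b::euclidean_space \<Rightarrow> complex) \<in> borel_measurable borel"
  unfolding cutball_def[abs_def] by (rule borel_measurable_indicator) simp

lemma measurable_moment [measurable]: "moment l a \<in> borel_measurable borel"
  unfolding moment_def[abs_def] by measurable

lemma norm_cutball_le: "norm (cutball y) \<le> 1" and cutball_0: "norm y > 1 \<Longrightarrow> cutball y = 0"
  by (auto simp: cutball_def indicator_def)

lemma norm_moment_le:
  assumes "a \<in> Basis"
  shows "norm (moment l a y) \<le> 1"
proof (cases "norm y \<le> 1")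
  case True
  have "\<bar>y $ l \<bullet> a\<bar> \<le> norm (y $ l)" using Basis_le_norm[OF assms] by simp
  also have "\<dots> \<le> 1" by (rule order_trans[OF Finite_Cartesian_Product.norm_nth_le True])
  finally have "\<bar>y $ l \<bullet> a\<bar> \<le> 1" .
  then have "\<bar>y $ l \<bullet> a\<bar> * norm (cutball y) \<le> 1 * 1" by (rule mult_mono) (auto simp: norm_cutball_le)
  then show ?thesis by (simp add: moment_def norm_mult)
qed (simp add: moment_def cutball_0)

lemma norm_sum_power2_le:
  fixes p :: "'i \<Rightarrow> complex"
  shows "(norm (\<Sum>q\<in>I. p q))\<^sup>2 \<le> real (card I) * (\<Sum>q\<in>I. (norm (p q))\<^sup>2)"
proof -
  have "(norm (\<Sum>q\<in>I. p q))\<^sup>2 \<le> (\<Sum>q\<in>I. norm (p q))\<^sup>2" by (intro power_mono norm_sum) auto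
  also have "\<dots> \<le> (\<Sum>q\<in>I. (norm (p q))\<^sup>2) * card I" by (rule sum_squared_le_sum_of_squares)
  finally show ?thesis by (simp add: mult.commute)
qed

text \<open>The slot \<open>i0\<close> carries the frequency localisation, the other slots are smooth at scale
  \<open>r\<close> or \<open>r / 2\<close>, as recorded by \<open>c\<close>.\<close>

definition slots :: "nat \<Rightarrow> real \<Rightarrow> ('m \<Rightarrow> real) \<Rightarrow> 'm \<Rightarrow> ('m \<Rightarrow> 'a::euclidean_space \<Rightarrow> complex) \<Rightarrow> 'm \<Rightarrow> 'a \<Rightarrow> complex" where
  "slots n r c i0 f i = (if i = i0 then (\<lambda>x. trunc n (r / 2) (f i0) x - trunc n r (f i0) x) else trunc n (c i) (f i))"

text \<open>The derivative of each slot in the direction \<open>a\<close>: in every truncation the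
  outermost \<open>bk\<close> is exchanged for \<open>bkd\<close>.\<close>

definition dslots :: "nat \<Rightarrow> real \<Rightarrow> ('m \<Rightarrow> real) \<Rightarrow> 'm \<Rightarrow> ('m \<Rightarrow> 'a::euclidean_space \<Rightarrow> complex) \<Rightarrow> 'm \<Rightarrow> 'a \<Rightarrow> 'a \<Rightarrow> complex" where
  "dslots n r c i0 f i a = (if i = i0
     then (\<lambda>x. star (bkd (r / 2) a) (pretrunc n (r / 2) (f i0)) x - star (bkd r a) (pretrunc n r (f i0)) x)
     else star (bkd (c i) a) (pretrunc n (c i) (f i)))"

lemma
  assumes r: "r > 0" and c: "\<And>i. c i > 0" and f: "\<And>i. nice (f i)"
  shows nice_slots: "nice (slots n r c i0 f i)"
    and nice_dslots: "nice (dslots n r c i0 f i a)"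
    and deriv_slots: "((\<lambda>t. slots n r c i0 f i (x - t *\<^sub>R y)) has_vector_derivative
       - (\<Sum>a\<in>Basis. (y \<bullet> a) *\<^sub>R dslots n r c i0 f i a (x - t *\<^sub>R y))) (at t)"
proof -
  have r2: "r / 2 > 0" using r by simp
  show "nice (slots n r c i0 f i)"
    using r c f by (auto simp: slots_def intro!: nice_diff nice_trunc)
  show "nice (dslots n r c i0 f i a)"
    using r c f by (auto simp: dslots_def intro!: nice_diff nice_star nice_bkd nice_pretrunc)
  have d: "((\<lambda>t. trunc n q g (x - t *\<^sub>R y)) has_vector_derivative
      - (\<Sum>a\<in>Basis. (y \<bullet> a) *\<^sub>R star (bkd q a) (pretrunc n q g) (x - t *\<^sub>R y))) (at t)" if "q > 0" "nice g" for q g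
    unfolding trunc_def by (rule has_vector_derivative_star_bk[OF that(1) nice_pretrunc[OF that]])
  show "((\<lambda>t. slots n r c i0 f i (x - t *\<^sub>R y)) has_vector_derivative
       - (\<Sum>a\<in>Basis. (y \<bullet> a) *\<^sub>R dslots n r c i0 f i a (x - t *\<^sub>R y))) (at t)"
  proof (cases "i = i0")
    case True
    show ?thesis
      using has_vector_derivative_diff[OF d[OF r2 f[of i0]] d[OF r f[of i0]]] True
      by (simp add: slots_def dslots_def scaleR_diff_right sum_subtractf)
  next
    case False
    then show ?thesis using d[OF c f, of i i] by (simp add: slots_def dslots_def)
  qed
qed

text \<open>The data entering \<open>Vop\<close> for the function itself (\<open>None\<close>) and for the terms of its
  \<open>t\<close>-derivative (\<open>Some (l, a)\<close>).\<close>

definition pweight :: "('m::finite \<times> 'a) option \<Rightarrow> 'a::euclidean_space ^ 'm \<Rightarrow> complex" where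
  "pweight p = (case p of None \<Rightarrow> cutball | Some (l, a) \<Rightarrow> moment l a)"

text \<open>A derivative falling on slot \<open>i0\<close> changes this function; one falling on
  another slot changes a kernel in \<open>pkernel\<close> instead.\<close>

definition pfirst :: "nat \<Rightarrow> real \<Rightarrow> ('m \<Rightarrow> real) \<Rightarrow> 'm \<Rightarrow> ('m \<Rightarrow> 'a::euclidean_space \<Rightarrow> complex) \<Rightarrow> ('m \<times> 'a) option \<Rightarrow> 'a \<Rightarrow> complex" where
  "pfirst n r c i0 f p = (case p of None \<Rightarrow> slots n r c i0 f i0
     | Some (l, a) \<Rightarrow> if l = i0 then dslots n r c i0 f i0 a else slots n r c i0 f i0)"

definition pkernel :: "('m \<Rightarrow> real) \<Rightarrow> 'm \<Rightarrow> ('m \<times> 'a::euclidean_space) option \<Rightarrow> 'm \<Rightarrow> 'a \<Rightarrow> complex" where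
  "pkernel c i0 p i = (case p of None \<Rightarrow> bk (c i)
     | Some (l, a) \<Rightarrow> if l = i \<and> l \<noteq> i0 then bkd (c i) a else bk (c i))"

definition pfull :: "nat \<Rightarrow> real \<Rightarrow> ('m \<Rightarrow> real) \<Rightarrow> 'm \<Rightarrow> ('m \<Rightarrow> 'a::euclidean_space \<Rightarrow> complex) \<Rightarrow> ('m \<times> 'a) option \<Rightarrow> 'm \<Rightarrow> 'a \<Rightarrow> complex" where
  "pfull n r c i0 f p = (case p of None \<Rightarrow> slots n r c i0 f
     | Some (l, a) \<Rightarrow> (slots n r c i0 f)(l := dslots n r c i0 f l a))"

lemma Mop_pfull:
  "Mop \<sigma> (pweight p) (pfull n r c i0 f p) t x =
   Vop \<sigma> (pweight p) i0 (pfirst n r c i0 f p) (\<lambda>i. star (pkernel c i0 p i) (pretrunc n (c i) (f i))) t x"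
proof -
  have 1: "pfull n r c i0 f p i0 = pfirst n r c i0 f p"
    by (auto simp: pfull_def pfirst_def split: option.split)
  have 2: "pfull n r c i0 f p i = star (pkernel c i0 p i) (pretrunc n (c i) (f i))" if "i \<noteq> i0" for i
    using that by (auto simp: pfull_def pkernel_def slots_def dslots_def trunc_def split: option.split)
  show ?thesis
    unfolding Mop_eq_Vop[of _ _ _ _ _ i0] Vop_def 1
    by (intro Bochner_Integration.integral_cong refl arg_cong2[where f="(*)"] prod.cong) (simp add: 2)
qed

text \<open>The function \<open>R\<close> collects everything attached to slot \<open>i0\<close> and
  the whole octave, hence is free of \<open>t\<close>. In the exponent of 2^j the 1 comes from the
  supremum over \<open>t\<close>, the dimension term from the kernels in the other slots, and - 2 s
  from the squared Fourier decay.\<close>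

lemma single_scale:
  fixes \<sigma> :: "('a::euclidean_space ^ 'm::finite) measure"
  assumes fin: "finite_measure \<sigma>" and sets: "sets \<sigma> = sets borel"
    and decay: "\<And>\<xi>. norm (\<integral>y. cutball y * cis (- 2 * pi * (\<xi> \<bullet> y)) \<partial>\<sigma>) \<le> K * (1 + norm \<xi>) powr (- s)"
    and decay': "\<And>l a \<xi>. a \<in> Basis \<Longrightarrow> norm (\<integral>y. moment l a y * cis (- 2 * pi * (\<xi> \<bullet> y)) \<partial>\<sigma>) \<le> K * (1 + norm \<xi>) powr (- s)"
    and K: "K \<ge> 0" and s: "0 \<le> s" "s \<le> real n"
  obtains C where "C > 0"
    "\<And>(f :: 'm \<Rightarrow> 'a \<Rightarrow> complex) \<rho> (j::nat) c i0.
      (\<And>i. nice (f i)) \<Longrightarrow> \<rho> > 0 \<Longrightarrow> (\<And>i. c i = \<rho> / 2 ^ j \<or> c i = \<rho> / 2 ^ j / 2) \<Longrightarrow>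
      \<exists>R\<in>borel_measurable borel.
        (\<forall>t\<in>{\<rho>..2 * \<rho>}. \<forall>x. ennreal ((norm (Mop \<sigma> cutball (slots (Suc n) (\<rho> / 2 ^ j) c i0 f) t x))\<^sup>2)
           \<le> (\<Prod>i\<in>UNIV - {i0}. avg (4 * \<rho>) (\<lambda>z. ennreal ((norm (pretrunc (Suc n) (c i) (f i) z))\<^sup>2)) x) * R x) \<and>
        (\<integral>\<^sup>+x. R x \<partial>lborel) \<le> ennreal (C * (2 ^ j) powr (1 + real (DIM('a) * (CARD('m) - 1)) - 2 * s))
           * (\<integral>\<^sup>+\<zeta>. ennreal ((lp_weight (\<rho> / 2 ^ j * norm \<zeta>) * norm (ft (f i0) \<zeta>))\<^sup>2) \<partial>lborel)"
proof -
  obtain E where E: "E > 0"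
    "\<And>r f \<xi>::'a. r > 0 \<Longrightarrow> nice f \<Longrightarrow>
      norm (ft (trunc (Suc n) (r / 2) f) \<xi> - ft (trunc (Suc n) r f) \<xi>)
        \<le> E * (min 1 (r * norm \<xi>) ^ n * lp_weight (r * norm \<xi>)) * norm (ft f \<xi>)"
    "\<And>r f \<xi>::'a. r > 0 \<Longrightarrow> nice f \<Longrightarrow>
      r * norm \<xi> * norm (ft (trunc (Suc n) (r / 2) f) \<xi> - ft (trunc (Suc n) r f) \<xi>)
        \<le> E * (min 1 (r * norm \<xi>) ^ n * lp_weight (r * norm \<xi>)) * norm (ft f \<xi>)"
    using ft_trunc_diff_bound by metis
  obtain D where D: "D > 0"
    "\<And>r. r > 0 \<Longrightarrow> l2 (bk r :: 'a \<Rightarrow> complex) \<le> ennreal (D / r ^ DIM('a))"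
    "\<And>r a. r > 0 \<Longrightarrow> a \<in> Basis \<Longrightarrow> l2 (bkd r (a::'a)) \<le> ennreal (D / r ^ DIM('a) / r\<^sup>2)"
    using l2_kernel_bounds by metis
  define d where "d = DIM('a)"
  define m1 where "m1 = CARD('m) - 1"
  \<comment> \<open>Each \<open>c i\<close> is at least \<open>r / 2\<close>, which costs 2^d in the
    volume and 4 in the squared derivative.\<close>
  define D1 where "D1 = D * 2 ^ d * 4"
  have D1: "D1 > 0" using D(1) by (simp add: D1_def)
  \<comment> \<open>The derivative of a character brings the factor \<open>2 * pi\<close>; as
    \<open>E \<le> E1\<close>, one constant serves the slot and its derivative.\<close>
  define E1 where "E1 = 2 * pi * E"
  have E1: "E1 > 0" "E \<le> E1" using E(1) pi_gt3 by (auto simp: E1_def mult_le_cancel_right1)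
  define PP where "PP = (UNIV :: 'm set) \<times> (Basis :: 'a set)"
  have PPfin: "finite PP" by (simp add: PP_def)
  define k where "k = real (card PP)"
  define C where "C = 4 ^ (d * m1) * ((2 + 2 * k * k) * (K * E1)\<^sup>2 * D1 ^ m1) + 1"
  have C: "C > 0" unfolding C_def k_def using D1 by (intro add_nonneg_pos mult_nonneg_nonneg) auto
  show thesis
  proof (rule that[OF C])
    fix f :: "'m \<Rightarrow> 'a \<Rightarrow> complex" and \<rho> :: real and j :: nat and c :: "'m \<Rightarrow> real" and i0 :: 'm
    assume f: "\<And>i. nice (f i)" and \<rho>: "\<rho> > 0" and cc: "\<And>i. c i = \<rho> / 2 ^ j \<or> c i = \<rho> / 2 ^ j / 2"
    define r where "r = \<rho> / 2 ^ j"
    have r: "r > 0" "r \<le> \<rho>" using \<rho> by (auto simp: r_def field_simps mult_le_cancel_left1)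
    have c: "c i > 0" "c i \<le> r" "r \<le> 2 * c i" for i using cc[of i] r by (auto simp: r_def)
    define \<Theta> where "\<Theta> = (\<integral>\<^sup>+\<zeta>. ennreal ((lp_weight (r * norm \<zeta>) * norm (ft (f i0) \<zeta>))\<^sup>2) \<partial>lborel)"
    define g where "g i = pretrunc (Suc n) (c i) (f i)" for i
    have g: "nice (g i)" for i unfolding g_def by (rule nice_pretrunc[OF c(1) f])
    define h where "h = slots (Suc n) r c i0 f"
    define dh where "dh = dslots (Suc n) r c i0 f"
    have h: "nice (h i)" and dh: "nice (dh i a)" for i a
      unfolding h_def dh_def by (rule nice_slots[OF r(1) c(1) f] nice_dslots[OF r(1) c(1) f])+
    have deriv: "((\<lambda>t. h i (x - t *\<^sub>R y)) has_vector_derivative - (\<Sum>a\<in>Basis. (y \<bullet> a) *\<^sub>R dh i a (x - t *\<^sub>R y))) (at t)"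
      for i x y t
      unfolding h_def dh_def by (rule deriv_slots[OF r(1) c(1) f])
    define P where "P = insert None (Some ` PP)"
    define W where "W x = (\<Prod>i\<in>UNIV - {i0}. ennreal ((4 * \<rho>) ^ DIM('a)) * avg (4 * \<rho>) (\<lambda>z. ennreal ((norm (g i z))\<^sup>2)) x)" for x
    define Rp where "Rp p = Rker \<sigma> (pweight p) i0 (pfirst (Suc n) r c i0 f p) (pkernel c i0 p)" for p
    have pw: "pweight p \<in> borel_measurable borel" "norm (pweight p y) \<le> 1" "norm y > 1 \<Longrightarrow> pweight p y = 0"
      "norm (\<integral>y. pweight p y * cis (- 2 * pi * (\<xi> \<bullet> y)) \<partial>\<sigma>) \<le> K * (1 + norm \<xi>) powr (- s)" if "p \<in> P" for p y \<xi>
    proof -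
      consider "p = None" | l a where "p = Some (l, a)" "a \<in> Basis" using \<open>p \<in> P\<close> by (auto simp: P_def PP_def)
      then have "pweight p \<in> borel_measurable borel \<and> norm (pweight p y) \<le> 1 \<and> (norm y > 1 \<longrightarrow> pweight p y = 0) \<and>
        norm (\<integral>y. pweight p y * cis (- 2 * pi * (\<xi> \<bullet> y)) \<partial>\<sigma>) \<le> K * (1 + norm \<xi>) powr (- s)"
      proof cases
        case 1
        then show ?thesis using decay[of \<xi>] by (simp add: pweight_def norm_cutball_le cutball_0)
      next
        case (2 l a)
        have "norm y > 1 \<longrightarrow> moment l a y = 0" by (simp add: moment_def cutball_0)
        then show ?thesis using decay'[OF 2(2), of l \<xi>] norm_moment_le[OF 2(2), of l y] 2(1)
          by (simp add: pweight_def)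
      qed
      then show "pweight p \<in> borel_measurable borel" "norm (pweight p y) \<le> 1" "norm y > 1 \<Longrightarrow> pweight p y = 0"
        "norm (\<integral>y. pweight p y * cis (- 2 * pi * (\<xi> \<bullet> y)) \<partial>\<sigma>) \<le> K * (1 + norm \<xi>) powr (- s)" by auto
    qed
    have pf: "nice (pfirst (Suc n) r c i0 f p)" for p
      using h[of i0] dh[of i0] by (auto simp: pfirst_def h_def dh_def split: option.split)
    have pk: "nice (pkernel c i0 p i)" for p i
      using c(1)[of i] by (auto simp: pkernel_def nice_bk nice_bkd split: option.split)
    have pk0: "pkernel c i0 p i v = 0" if "norm v > \<rho>" for p i v
      using that c[of i] r bk_eq_0[of "c i" v] bkd_eq_0[of "c i" v] by (auto simp: pkernel_def split: option.split)
    have Rp[measurable]: "(\<lambda>(t, x). Rp p t x) \<in> borel_measurable (borel \<Otimes>\<^sub>M borel)" if "p \<in> P" for p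
      unfolding Rp_def by (rule measurable_Rker[OF fin sets pw(1,2)[OF that] pf pk])
    have step1: "ennreal ((norm (Mop \<sigma> (pweight p) (pfull (Suc n) r c i0 f p) t x))\<^sup>2) \<le> W x * Rp p t x"
      if "p \<in> P" "\<rho> \<le> t" "t \<le> 2 * \<rho>" for p t x
      unfolding Mop_pfull W_def Rp_def g_def[abs_def]
      by (rule Vop_le_Rker[OF fin sets pw(1,2)[OF that(1)] pf pk pw(3)[OF that(1)]])
         (use that \<rho> pk0 in \<open>auto intro: nice_pretrunc c(1) f\<close>)
    have None: "None \<in> P" and Some: "q \<in> PP \<Longrightarrow> Some q \<in> P" for q by (auto simp: P_def)
    \<comment> \<open>The integrand in time from \<open>sup_time_le\<close> after division by
      \<open>W x\<close>; the number \<open>k\<close> of derivative terms enters through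
      Cauchy--Schwarz.\<close>
    define S where "S t x = ennreal (2 / r) * Rp None t x + ennreal (2 * r) * (ennreal k * (\<Sum>q\<in>PP. Rp (Some q) t x))" for t x
    have S[measurable]: "(\<lambda>(t, x). S t x) \<in> borel_measurable (borel \<Otimes>\<^sub>M borel)"
    proof -
      have [measurable]: "(\<lambda>z. Rp (Some q) (fst z) (snd z)) \<in> borel_measurable (borel \<Otimes>\<^sub>M borel)" if "q \<in> PP" for q
        using Rp[OF Some[OF that]] by (simp add: case_prod_unfold)
      have [measurable]: "(\<lambda>z. Rp None (fst z) (snd z)) \<in> borel_measurable (borel \<Otimes>\<^sub>M borel)"
        using Rp[OF None] by (simp add: case_prod_unfold)
      show ?thesis unfolding S_def case_prod_unfold by measurable
    qed
    define R0 where "R0 x = (\<integral>\<^sup>+t. indicator {\<rho>..2 * \<rho>} t * S t x \<partial>lborel)" for x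
    have R0[measurable]: "R0 \<in> borel_measurable borel" unfolding R0_def by measurable
    have step2: "ennreal ((norm (Mop \<sigma> cutball h t x))\<^sup>2) \<le> W x * R0 x" if t: "\<rho> \<le> t" "t \<le> 2 * \<rho>" for t x
    proof -
      define u where "u \<tau> = Mop \<sigma> cutball h \<tau> x" for \<tau>
      define up where "up q \<tau> = Mop \<sigma> (pweight (Some q)) (pfull (Suc n) r c i0 f (Some q)) \<tau> x" for q \<tau>
      define u' where "u' \<tau> = (\<Sum>q\<in>PP. up q \<tau>)" for \<tau>
      have u'_eq: "u' \<tau> = (\<Sum>l\<in>UNIV. \<Sum>a\<in>Basis. Mop \<sigma> (\<lambda>y. of_real (y $ l \<bullet> a) * cutball y) (h(l := dh l a)) \<tau> x)" for \<tau>
        unfolding u'_def PP_def sum.cartesian_product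
        by (simp add: up_def pweight_def pfull_def h_def dh_def moment_def[abs_def] case_prod_unfold)
      have um: "u \<in> borel_measurable borel" unfolding u_def by (rule measurable_Mop[OF fin sets measurable_cutball h])
      have upm: "up q \<in> borel_measurable borel" if "q \<in> PP" for q
        unfolding up_def
      proof (rule measurable_Mop[OF fin sets pw(1)[OF Some[OF that]]])
        show "nice (pfull (Suc n) r c i0 f (Some q) i)" for i
          using h[of i] dh by (auto simp: pfull_def h_def dh_def split: prod.split)
      qed
      then have u'm: "u' \<in> borel_measurable borel" unfolding u'_def by (rule borel_measurable_sum)
      have "ennreal ((norm (u t))\<^sup>2) \<le> (\<integral>\<^sup>+\<tau>. indicator {\<rho>..2 * \<rho>} \<tau> *
         (ennreal (2 / r) * ennreal ((norm (u \<tau>))\<^sup>2) + ennreal (2 * r) * ennreal ((norm (u' \<tau>))\<^sup>2)) \<partial>lborel)"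
      proof (rule sup_time_le[OF um u'm r t])
        fix t1 t2 :: real assume "t1 \<le> t2"
        show "ennreal (norm (u t2 - u t1)) \<le> (\<integral>\<^sup>+\<tau>. indicator {t1..t2} \<tau> * ennreal (norm (u' \<tau>)) \<partial>lborel)"
          unfolding u_def u'_eq
          by (rule Mop_ftc[OF fin sets h dh deriv measurable_cutball norm_cutball_le cutball_0 \<open>t1 \<le> t2\<close>])
      qed
      also have "\<dots> \<le> (\<integral>\<^sup>+\<tau>. W x * (indicator {\<rho>..2 * \<rho>} \<tau> * S \<tau> x) \<partial>lborel)"
      proof (rule nn_integral_mono)
        fix \<tau> :: real
        show "indicator {\<rho>..2 * \<rho>} \<tau> * (ennreal (2 / r) * ennreal ((norm (u \<tau>))\<^sup>2) + ennreal (2 * r) * ennreal ((norm (u' \<tau>))\<^sup>2))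
          \<le> W x * (indicator {\<rho>..2 * \<rho>} \<tau> * S \<tau> x)"
        proof (cases "\<tau> \<in> {\<rho>..2 * \<rho>}")
          case True
          then have \<tau>: "\<rho> \<le> \<tau>" "\<tau> \<le> 2 * \<rho>" by auto
          have 1: "ennreal ((norm (u \<tau>))\<^sup>2) \<le> W x * Rp None \<tau> x"
            using step1[OF None \<tau>, of x] by (simp add: u_def pweight_def pfull_def h_def)
          have "ennreal ((norm (u' \<tau>))\<^sup>2) \<le> ennreal (k * (\<Sum>q\<in>PP. (norm (up q \<tau>))\<^sup>2))"
            unfolding u'_def k_def by (rule ennreal_leI[OF norm_sum_power2_le])
          also have "\<dots> = ennreal k * (\<Sum>q\<in>PP. ennreal ((norm (up q \<tau>))\<^sup>2))"
            by (subst ennreal_mult) (auto simp: k_def sum_nonneg sum_ennreal)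
          also have "\<dots> \<le> ennreal k * (\<Sum>q\<in>PP. W x * Rp (Some q) \<tau> x)"
            unfolding up_def by (intro mult_left_mono sum_mono step1 Some \<tau>) auto
          finally have 2: "ennreal ((norm (u' \<tau>))\<^sup>2) \<le> ennreal k * (\<Sum>q\<in>PP. W x * Rp (Some q) \<tau> x)" .
          have "ennreal (2 / r) * ennreal ((norm (u \<tau>))\<^sup>2) + ennreal (2 * r) * ennreal ((norm (u' \<tau>))\<^sup>2)
            \<le> ennreal (2 / r) * (W x * Rp None \<tau> x) + ennreal (2 * r) * (ennreal k * (\<Sum>q\<in>PP. W x * Rp (Some q) \<tau> x))"
            by (rule add_mono[OF mult_left_mono[OF 1] mult_left_mono[OF 2]]) auto
          also have "\<dots> = W x * S \<tau> x"
            unfolding S_def sum_distrib_left[symmetric] by (simp only: distrib_left mult_ac)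
          finally show ?thesis using True by simp
        qed simp
      qed
      also have "\<dots> = W x * R0 x"
        unfolding R0_def by (rule nn_integral_cmult) simp
      finally show ?thesis unfolding u_def .
    qed
    have Rint: "(\<integral>\<^sup>+x. Rp p t x \<partial>lborel) \<le> ennreal (z * ((K * E1)\<^sup>2 * (r / \<rho>) powr (2 * s) * (D1 / r ^ d) ^ m1)) * \<Theta>"
      if p: "p \<in> P" and t: "\<rho> \<le> t" and z: "z = (if p = None then 1 else 1 / r\<^sup>2)" for p t z
    proof -
      \<comment> \<open>In squares a derivative costs \<open>1 / r\<^sup>2\<close> wherever it
        falls: \<open>e\<close> records it for slot \<open>i0\<close>, \<open>\<kappa>\<close> for
        the other slots, and \<open>ez\<close> shows that the product is the same.\<close>
      define e where "e = (case p of None \<Rightarrow> E1 | Some (l, a) \<Rightarrow> if l = i0 then E1 / r else E1)"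
      define \<kappa> where "\<kappa> = (case p of None \<Rightarrow> 1 | Some (l, a) \<Rightarrow> if l = i0 then 1 else 1 / r\<^sup>2)"
      have e0: "e \<ge> 0" and \<kappa>0: "\<kappa> \<ge> 0" using E1 r(1) by (auto simp: e_def \<kappa>_def split: option.split)
      have ez: "e\<^sup>2 * \<kappa> = z * E1\<^sup>2"
        unfolding z e_def \<kappa>_def by (auto simp: power_divide split: option.split)
      have base: "norm (ft (slots (Suc n) r c i0 f i0) \<zeta>)
          \<le> E1 * (min 1 (r * norm \<zeta>) ^ n * lp_weight (r * norm \<zeta>)) * norm (ft (f i0) \<zeta>)" for \<zeta>
      proof -
        have "ft (slots (Suc n) r c i0 f i0) \<zeta> = ft (trunc (Suc n) (r / 2) (f i0)) \<zeta> - ft (trunc (Suc n) r (f i0)) \<zeta>"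
          using ft_diff[OF nice_trunc[OF half_gt_zero[OF r(1)] f] nice_trunc[OF r(1) f], of "Suc n" i0 "Suc n" i0 \<zeta>]
          by (simp add: slots_def[abs_def])
        then have "norm (ft (slots (Suc n) r c i0 f i0) \<zeta>)
          \<le> E * (min 1 (r * norm \<zeta>) ^ n * lp_weight (r * norm \<zeta>)) * norm (ft (f i0) \<zeta>)"
          using E(2)[OF r(1) f[of i0], of \<zeta>] by simp
        also have "\<dots> \<le> E1 * (min 1 (r * norm \<zeta>) ^ n * lp_weight (r * norm \<zeta>)) * norm (ft (f i0) \<zeta>)"
          using E1(2) r(1) by (intro mult_right_mono) (auto intro!: mult_nonneg_nonneg lp_weight_nonneg)
        finally show ?thesis .
      qed
      have deriv_bound: "norm (ft (dslots (Suc n) r c i0 f i0 a) \<zeta>)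
          \<le> E1 / r * (min 1 (r * norm \<zeta>) ^ n * lp_weight (r * norm \<zeta>)) * norm (ft (f i0) \<zeta>)" if a: "a \<in> Basis" for a \<zeta>
      proof -
        have r2: "r / 2 > 0" using r by simp
        have "ft (dslots (Suc n) r c i0 f i0 a) \<zeta> = ft (star (bkd (r / 2) a) (pretrunc (Suc n) (r / 2) (f i0))) \<zeta>
            - ft (star (bkd r a) (pretrunc (Suc n) r (f i0))) \<zeta>"
          unfolding dslots_def[abs_def] if_P[OF refl]
          by (rule ft_diff) (intro nice_star nice_bkd nice_pretrunc r r2 f)+
        also have "\<dots> = 2 * pi * \<i> * (\<zeta> \<bullet> a) * (ft (trunc (Suc n) (r / 2) (f i0)) \<zeta> - ft (trunc (Suc n) r (f i0)) \<zeta>)"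
          unfolding ft_star_bkd_pretrunc[OF r2 f a] ft_star_bkd_pretrunc[OF r(1) f a] by (simp only: right_diff_distrib)
        finally have eq: "norm (ft (dslots (Suc n) r c i0 f i0 a) \<zeta>)
            = 2 * pi * \<bar>\<zeta> \<bullet> a\<bar> * norm (ft (trunc (Suc n) (r / 2) (f i0)) \<zeta> - ft (trunc (Suc n) r (f i0)) \<zeta>)"
          by (simp add: norm_mult)
        define T where "T = norm (ft (trunc (Suc n) (r / 2) (f i0)) \<zeta> - ft (trunc (Suc n) r (f i0)) \<zeta>)"
        have "2 * pi * \<bar>\<zeta> \<bullet> a\<bar> * T \<le> 2 * pi * norm \<zeta> * T"
          using Basis_le_norm[OF a, of \<zeta>] by (intro mult_right_mono mult_left_mono) (auto simp: T_def)
        also have "\<dots> = 2 * pi / r * (r * norm \<zeta> * T)" using r by simp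
        also have "\<dots> \<le> 2 * pi / r * (E * (min 1 (r * norm \<zeta>) ^ n * lp_weight (r * norm \<zeta>)) * norm (ft (f i0) \<zeta>))"
          unfolding T_def using r by (intro mult_left_mono E(3) f) auto
        finally show ?thesis unfolding eq T_def[symmetric] by (simp add: E1_def)
      qed
      have pcases: "p = None \<or> (\<exists>l a. p = Some (l, a) \<and> a \<in> Basis)"
        using p by (auto simp: P_def PP_def)
      have ftH: "norm (ft (pfirst (Suc n) r c i0 f p) \<zeta>)
          \<le> e * (min 1 (r * norm \<zeta>) ^ n * lp_weight (r * norm \<zeta>)) * norm (ft (f i0) \<zeta>)" for \<zeta>
        using pcases base[of \<zeta>] deriv_bound[of _ \<zeta>] by (auto simp: pfirst_def e_def)
      have rc: "r / 2 \<le> c i" for i using c(3)[of i] by simp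
      have lbk: "l2 (bk (c i) :: 'a \<Rightarrow> complex) \<le> ennreal (D1 / r ^ d)" for i
      proof -
        have "D / c i ^ d \<le> D / (r / 2) ^ d"
          using D(1) rc[of i] r(1) c(1)[of i] by (intro divide_left_mono power_mono mult_pos_pos) auto
        also have "\<dots> = D * 2 ^ d / r ^ d" by (simp add: power_divide)
        also have "\<dots> \<le> D1 / r ^ d" using D(1) r(1) by (intro divide_right_mono) (auto simp: D1_def)
        finally have "ennreal (D / c i ^ d) \<le> ennreal (D1 / r ^ d)" by (rule ennreal_leI)
        with D(2)[OF c(1), of i] show ?thesis unfolding d_def by (rule order_trans)
      qed
      have lbkd: "l2 (bkd (c i) a) \<le> ennreal (D1 / r ^ d * (1 / r\<^sup>2))" if "a \<in> Basis" for i and a :: 'a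
      proof -
        have "D / c i ^ d / (c i)\<^sup>2 = D / (c i ^ d * (c i)\<^sup>2)" by simp
        also have "\<dots> \<le> D / ((r / 2) ^ d * (r / 2)\<^sup>2)"
          using D(1) rc[of i] r(1) c(1)[of i] by (intro divide_left_mono mult_mono power_mono mult_pos_pos) auto
        also have "\<dots> = D1 / r ^ d * (1 / r\<^sup>2)" by (simp add: power_divide D1_def)
        finally have "ennreal (D / c i ^ d / (c i)\<^sup>2) \<le> ennreal (D1 / r ^ d * (1 / r\<^sup>2))" by (rule ennreal_leI)
        with D(3)[OF c(1) that, of i] show ?thesis unfolding d_def by (rule order_trans)
      qed
      define \<beta> where "\<beta> i = D1 / r ^ d * (case p of None \<Rightarrow> 1 | Some (l, a) \<Rightarrow> if l = i \<and> l \<noteq> i0 then 1 / r\<^sup>2 else 1)" for i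
      have \<beta>0: "\<beta> i \<ge> 0" for i using D1 r(1) by (auto simp: \<beta>_def split: option.split)
      have "(\<Prod>i\<in>UNIV - {i0}. l2 (pkernel c i0 p i)) \<le> (\<Prod>i\<in>UNIV - {i0}. ennreal (\<beta> i))"
      proof (rule prod_mono_ennreal)
        fix i
        show "l2 (pkernel c i0 p i) \<le> ennreal (\<beta> i)"
        proof (cases "\<exists>a. p = Some (i, a) \<and> i \<noteq> i0")
          case True
          then obtain a where a: "p = Some (i, a)" "i \<noteq> i0" by blast
          then have "a \<in> Basis" using pcases by auto
          moreover have "pkernel c i0 p i = bkd (c i) a" "\<beta> i = D1 / r ^ d * (1 / r\<^sup>2)"
            using a by (simp_all add: pkernel_def \<beta>_def)
          ultimately show ?thesis using lbkd[of a i] by (simp only:)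
        next
          case False
          then have "pkernel c i0 p i = bk (c i)" "\<beta> i = D1 / r ^ d"
            by (auto simp: pkernel_def \<beta>_def split: option.split)
          then show ?thesis using lbk[of i] by (simp only:)
        qed
      qed
      also have "\<dots> = ennreal (\<Prod>i\<in>UNIV - {i0}. \<beta> i)" by (rule prod_ennreal) (rule \<beta>0)
      also have "(\<Prod>i\<in>UNIV - {i0}. \<beta> i) = (D1 / r ^ d) ^ m1 * \<kappa>"
      proof -
        have "(\<Prod>i\<in>UNIV - {i0}. case p of None \<Rightarrow> 1 | Some (l, a) \<Rightarrow> if l = i \<and> l \<noteq> i0 then 1 / r\<^sup>2 else 1) = \<kappa>"
        proof (cases p)
          case (Some q)
          obtain l a where q: "q = (l, a)" by (cases q)
          have "(\<Prod>i\<in>UNIV - {i0}. if l = i then 1 / r\<^sup>2 else 1) = (if l \<in> UNIV - {i0} then 1 / r\<^sup>2 else 1)"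
            by (rule prod.delta') simp
          then show ?thesis using Some q by (auto simp: \<kappa>_def)
        qed (simp add: \<kappa>_def)
        moreover have "card (UNIV - {i0}) = m1" by (simp add: m1_def card_Diff_singleton)
        ultimately show ?thesis unfolding \<beta>_def prod.distrib by (simp only: prod_constant)
      qed
      finally have prod_le: "(\<Prod>i\<in>UNIV - {i0}. l2 (pkernel c i0 p i)) \<le> ennreal ((D1 / r ^ d) ^ m1 * \<kappa>)" .
      have "(\<integral>\<^sup>+x. Rp p t x \<partial>lborel) \<le> ennreal ((K * e * (r / \<rho>) powr s)\<^sup>2) * \<Theta> * (\<Prod>i\<in>UNIV - {i0}. l2 (pkernel c i0 p i))"
        unfolding Rp_def \<Theta>_def
        by (rule Rker_bound[OF fin sets pw(1,2)[OF p] pw(4)[OF p] K s pf pk f ftH e0 r(1) \<rho> t])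
      also have "\<dots> \<le> ennreal ((K * e * (r / \<rho>) powr s)\<^sup>2) * \<Theta> * ennreal ((D1 / r ^ d) ^ m1 * \<kappa>)"
        by (rule mult_left_mono[OF prod_le]) simp
      also have "\<dots> = ennreal ((K * e * (r / \<rho>) powr s)\<^sup>2 * ((D1 / r ^ d) ^ m1 * \<kappa>)) * \<Theta>"
        using D1 r(1) \<kappa>0 by (subst ennreal_mult) (auto simp: mult_ac)
      also have "(K * e * (r / \<rho>) powr s)\<^sup>2 * ((D1 / r ^ d) ^ m1 * \<kappa>) = (e\<^sup>2 * \<kappa>) * (K\<^sup>2 * ((r / \<rho>) powr s)\<^sup>2 * (D1 / r ^ d) ^ m1)"
        by (simp only: power_mult_distrib mult_ac)
      also have "((r / \<rho>) powr s)\<^sup>2 = (r / \<rho>) powr (2 * s)"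
        unfolding mult_2 powr_add by (simp only: power2_eq_square)
      also have "(e\<^sup>2 * \<kappa>) * (K\<^sup>2 * (r / \<rho>) powr (2 * s) * (D1 / r ^ d) ^ m1) = z * ((K * E1)\<^sup>2 * (r / \<rho>) powr (2 * s) * (D1 / r ^ d) ^ m1)"
        unfolding ez by (simp only: power_mult_distrib mult_ac)
      finally show ?thesis .
    qed
    define G where "G = (K * E1)\<^sup>2 * (r / \<rho>) powr (2 * s) * (D1 / r ^ d) ^ m1"
    have G0: "G \<ge> 0" using D1 r(1) by (simp add: G_def)
    have k0: "k \<ge> 0" by (simp add: k_def)
    have Sint: "(\<integral>\<^sup>+x. S t x \<partial>lborel) \<le> ennreal ((2 + 2 * k * k) / r * G) * \<Theta>" if t: "\<rho> \<le> t" for t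
    proof -
      have Rpt[measurable]: "(\<lambda>x. Rp p t x) \<in> borel_measurable borel" if "p \<in> P" for p
        using measurable_compose[OF measurable_Pair1'[of t borel borel] Rp[OF that]] by simp
      have [measurable]: "Rp None t \<in> borel_measurable borel" "\<And>q. q \<in> PP \<Longrightarrow> Rp (Some q) t \<in> borel_measurable borel"
        using Rpt[OF None] Rpt[OF Some] by auto
      have "(\<integral>\<^sup>+x. S t x \<partial>lborel) = ennreal (2 / r) * (\<integral>\<^sup>+x. Rp None t x \<partial>lborel)
         + ennreal (2 * r) * (ennreal k * (\<Sum>q\<in>PP. \<integral>\<^sup>+x. Rp (Some q) t x \<partial>lborel))"
        unfolding S_def by (simp add: nn_integral_add nn_integral_cmult nn_integral_sum)
      also have "\<dots> \<le> ennreal (2 / r) * (ennreal (1 * G) * \<Theta>) + ennreal (2 * r) * (ennreal k * (\<Sum>q\<in>PP. ennreal (1 / r\<^sup>2 * G) * \<Theta>))"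
        unfolding G_def
        by (intro add_mono mult_left_mono sum_mono Rint[OF None t] Rint[OF Some t]) auto
      also have "(\<Sum>q\<in>PP. ennreal (1 / r\<^sup>2 * G) * \<Theta>) = ennreal (k * (1 / r\<^sup>2 * G)) * \<Theta>"
        using G0 k0 by (simp only: sum_constant k_def ennreal_mult' ennreal_of_nat_eq_real_of_nat of_nat_0_le_iff mult.assoc)
      also have "ennreal (2 / r) * (ennreal (1 * G) * \<Theta>) + ennreal (2 * r) * (ennreal k * (ennreal (k * (1 / r\<^sup>2 * G)) * \<Theta>))
        = ennreal (2 / r * (1 * G) + 2 * r * (k * (k * (1 / r\<^sup>2 * G)))) * \<Theta>"
      proof -
        have "ennreal (2 / r * (1 * G) + 2 * r * (k * (k * (1 / r\<^sup>2 * G)))) = ennreal (2 / r) * ennreal (1 * G) + ennreal (2 * r) * (ennreal k * ennreal (k * (1 / r\<^sup>2 * G)))"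
          using G0 k0 r(1) by (subst ennreal_plus) (auto simp: ennreal_mult[symmetric])
        then show ?thesis by (simp only: distrib_right mult.assoc)
      qed
      also have "2 / r * (1 * G) + 2 * r * (k * (k * (1 / r\<^sup>2 * G))) = (2 + 2 * k * k) / r * G"
        using r(1) by (simp add: field_simps power2_eq_square)
      finally show ?thesis .
    qed
    \<comment> \<open>The octave has length \<rho> and the bound at fixed time contains
      \<open>1 / r\<close>; their product is the factor 2^j lost to the supremum over
      \<open>t\<close>.\<close>
    have R0int: "(\<integral>\<^sup>+x. R0 x \<partial>lborel) \<le> ennreal (\<rho> * ((2 + 2 * k * k) / r * G)) * \<Theta>"
    proof -
      have "(\<integral>\<^sup>+x. R0 x \<partial>lborel) = (\<integral>\<^sup>+t. (\<integral>\<^sup>+x. indicator {\<rho>..2 * \<rho>} t * S t x \<partial>lborel) \<partial>lborel)"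
        unfolding R0_def by (rule lborel_pair.Fubini') simp
      also have "\<dots> \<le> (\<integral>\<^sup>+t. indicator {\<rho>..2 * \<rho>} t * (ennreal ((2 + 2 * k * k) / r * G) * \<Theta>) \<partial>lborel)"
      proof (rule nn_integral_mono)
        fix t :: real
        show "(\<integral>\<^sup>+x. indicator {\<rho>..2 * \<rho>} t * S t x \<partial>lborel) \<le> indicator {\<rho>..2 * \<rho>} t * (ennreal ((2 + 2 * k * k) / r * G) * \<Theta>)"
          using Sint[of t] by (auto simp: indicator_def)
      qed
      also have "\<dots> = ennreal \<rho> * (ennreal ((2 + 2 * k * k) / r * G) * \<Theta>)"
        using \<rho> by (simp add: nn_integral_multc)
      also have "\<dots> = ennreal (\<rho> * ((2 + 2 * k * k) / r * G)) * \<Theta>"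
        using \<rho> by (simp only: ennreal_mult' less_imp_le mult.assoc)
      finally show ?thesis .
    qed
    define q where "q = (2::real) ^ j"
    have q: "q > 0" by (simp add: q_def)
    have rq: "r = \<rho> / q" by (simp add: r_def q_def)
    \<comment> \<open>By scaling only the ratio \<open>q\<close> of \<rho> and \<open>r\<close>
      survives: to the power 1 from the time integral, \<open>d\<close> from each of the
      \<open>m1\<close> kernels, and \<open>- 2 * s\<close> from the decay.\<close>
    have const: "((4 * \<rho>) ^ d) ^ m1 * (\<rho> * ((2 + 2 * k * k) / r * G)) \<le> C * q powr (1 + real (d * m1) - 2 * s)"
    proof -
      have "((4 * \<rho>) ^ d) ^ m1 * (D1 / r ^ d) ^ m1 = (4 ^ d * D1 * q ^ d) ^ m1"
      proof -
        have "(4 * \<rho>) ^ d * (D1 / r ^ d) = 4 ^ d * D1 * q ^ d"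
          using \<rho> q unfolding rq power_divide power_mult_distrib by simp
        then show ?thesis by (simp only: power_mult_distrib[symmetric])
      qed
      also have "\<dots> = 4 ^ (d * m1) * D1 ^ m1 * q powr real (d * m1)"
        using powr_realpow[OF q, of "d * m1"] by (simp add: power_mult_distrib power_mult[symmetric])
      finally have 1: "((4 * \<rho>) ^ d) ^ m1 * (D1 / r ^ d) ^ m1 = 4 ^ (d * m1) * D1 ^ m1 * q powr real (d * m1)" .
      have 2: "\<rho> / r = q powr 1" using \<rho> q unfolding rq by simp
      have 3: "(r / \<rho>) powr (2 * s) = q powr (- 2 * s)"
        using \<rho> q unfolding rq by (simp add: powr_divide powr_minus field_simps)
      have "((4 * \<rho>) ^ d) ^ m1 * (\<rho> * ((2 + 2 * k * k) / r * G))
        = (2 + 2 * k * k) * (K * E1)\<^sup>2 * (((4 * \<rho>) ^ d) ^ m1 * (D1 / r ^ d) ^ m1) * ((\<rho> / r) * (r / \<rho>) powr (2 * s))"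
        unfolding G_def by (simp add: mult_ac)
      also have "\<dots> = 4 ^ (d * m1) * ((2 + 2 * k * k) * (K * E1)\<^sup>2 * D1 ^ m1) * (q powr real (d * m1) * (q powr 1 * q powr (- 2 * s)))"
        unfolding 1 2 3 by (simp only: mult_ac)
      also have "q powr real (d * m1) * (q powr 1 * q powr (- 2 * s)) = q powr (1 + real (d * m1) - 2 * s)"
        by (simp only: powr_add[symmetric]) (simp add: algebra_simps)
      also have "4 ^ (d * m1) * ((2 + 2 * k * k) * (K * E1)\<^sup>2 * D1 ^ m1) * q powr (1 + real (d * m1) - 2 * s) \<le> C * q powr (1 + real (d * m1) - 2 * s)"
        by (rule mult_right_mono) (simp_all add: C_def)
      finally show ?thesis .
    qed
    define R where "R x = ennreal (((4 * \<rho>) ^ d) ^ m1) * R0 x" for x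
    show "\<exists>R\<in>borel_measurable borel.
        (\<forall>t\<in>{\<rho>..2 * \<rho>}. \<forall>x. ennreal ((norm (Mop \<sigma> cutball (slots (Suc n) (\<rho> / 2 ^ j) c i0 f) t x))\<^sup>2)
           \<le> (\<Prod>i\<in>UNIV - {i0}. avg (4 * \<rho>) (\<lambda>z. ennreal ((norm (pretrunc (Suc n) (c i) (f i) z))\<^sup>2)) x) * R x) \<and>
        (\<integral>\<^sup>+x. R x \<partial>lborel) \<le> ennreal (C * (2 ^ j) powr (1 + real (DIM('a) * (CARD('m) - 1)) - 2 * s))
           * (\<integral>\<^sup>+\<zeta>. ennreal ((lp_weight (\<rho> / 2 ^ j * norm \<zeta>) * norm (ft (f i0) \<zeta>))\<^sup>2) \<partial>lborel)"
    proof (intro bexI[of _ R] conjI ballI allI)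
      show "R \<in> borel_measurable borel" unfolding R_def by measurable
      fix t x assume "t \<in> {\<rho>..2 * \<rho>}"
      then have "ennreal ((norm (Mop \<sigma> cutball h t x))\<^sup>2) \<le> W x * R0 x" by (intro step2) auto
      also have "W x = ennreal (((4 * \<rho>) ^ d) ^ m1) * (\<Prod>i\<in>UNIV - {i0}. avg (4 * \<rho>) (\<lambda>z. ennreal ((norm (g i z))\<^sup>2)) x)"
        using \<rho> by (simp add: W_def prod.distrib d_def m1_def card_Diff_singleton ennreal_power)
      finally show "ennreal ((norm (Mop \<sigma> cutball (slots (Suc n) (\<rho> / 2 ^ j) c i0 f) t x))\<^sup>2)
           \<le> (\<Prod>i\<in>UNIV - {i0}. avg (4 * \<rho>) (\<lambda>z. ennreal ((norm (pretrunc (Suc n) (c i) (f i) z))\<^sup>2)) x) * R x"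
        by (simp add: h_def r_def R_def g_def mult_ac)
    next
      have "(\<integral>\<^sup>+x. R x \<partial>lborel) = ennreal (((4 * \<rho>) ^ d) ^ m1) * (\<integral>\<^sup>+x. R0 x \<partial>lborel)"
        unfolding R_def by (rule nn_integral_cmult) simp
      also have "\<dots> \<le> ennreal (((4 * \<rho>) ^ d) ^ m1) * (ennreal (\<rho> * ((2 + 2 * k * k) / r * G)) * \<Theta>)"
        by (rule mult_left_mono[OF R0int]) simp
      also have "\<dots> = ennreal (((4 * \<rho>) ^ d) ^ m1 * (\<rho> * ((2 + 2 * k * k) / r * G))) * \<Theta>"
        using \<rho> by (simp only: ennreal_mult' zero_le_power mult_nonneg_nonneg less_imp_le zero_le_numeral mult.assoc)
      also have "\<dots> \<le> ennreal (C * q powr (1 + real (d * m1) - 2 * s)) * \<Theta>"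
        by (intro mult_right_mono ennreal_leI const) auto
      finally show "(\<integral>\<^sup>+x. R x \<partial>lborel) \<le> ennreal (C * (2 ^ j) powr (1 + real (DIM('a) * (CARD('m) - 1)) - 2 * s))
           * (\<integral>\<^sup>+\<zeta>. ennreal ((lp_weight (\<rho> / 2 ^ j * norm \<zeta>) * norm (ft (f i0) \<zeta>))\<^sup>2) \<partial>lborel)"
        by (simp only: q_def d_def m1_def \<Theta>_def r_def)
    qed
  qed
qed

subsection \<open>Powers of extended nonnegative reals\<close>

lemma ennreal_powr_ennreal: "0 \<le> a \<Longrightarrow> ennreal_powr (ennreal a) p = ennreal (a powr p)"
  by (simp add: ennreal_powr_def)

lemma ennreal_powr_top [simp]: "ennreal_powr \<top> p = \<top>"
  by (simp add: ennreal_powr_def)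

lemma ennreal_powr_0 [simp]: "ennreal_powr 0 p = 0"
  using ennreal_powr_ennreal[of 0 p] by simp

lemma ennreal_powr_mono:
  assumes "a \<le> b" "0 \<le> p"
  shows "ennreal_powr a p \<le> ennreal_powr b p"
proof (cases b rule: ennreal_cases)
  case (real y)
  then obtain x where "a = ennreal x" "0 \<le> x" using assms(1) by (cases a rule: ennreal_cases) (auto simp: top_unique)
  then show ?thesis using real assms by (auto simp: ennreal_powr_ennreal intro!: ennreal_leI powr_mono2)
qed simp

lemma ennreal_powr_mult:
  assumes "0 < p"
  shows "ennreal_powr (a * b) p = ennreal_powr a p * ennreal_powr b p"
proof -
  have top: "ennreal_powr (\<top> * b) p = \<top> * ennreal_powr b p" for b
  proof (cases b rule: ennreal_cases)
    case (real y)
    then show ?thesis by (cases "y = 0") (auto simp: ennreal_powr_ennreal ennreal_top_mult)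
  qed simp
  show ?thesis
  proof (cases a rule: ennreal_cases)
    case x: (real x)
    show ?thesis
    proof (cases b rule: ennreal_cases)
      case (real y)
      then show ?thesis using x by (simp add: ennreal_mult[symmetric] ennreal_powr_ennreal powr_mult)
    next
      case top
      then show ?thesis using \<open>ennreal_powr (\<top> * a) p = \<top> * ennreal_powr a p\<close> by (simp add: mult.commute)
    qed
  qed (simp add: top)
qed

lemma ennreal_powr_powr:
  assumes "0 < p"
  shows "ennreal_powr (ennreal_powr a p) r = ennreal_powr a (p * r)"
  by (cases a rule: ennreal_cases) (auto simp: ennreal_powr_ennreal powr_powr)

lemma ennreal_powr_2: "ennreal_powr a 2 = a\<^sup>2"
  by (cases a rule: ennreal_cases) (auto simp: ennreal_powr_ennreal ennreal_power powr_numeral)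

lemma measurable_ennreal_powr [measurable]:
  assumes [measurable]: "f \<in> borel_measurable M"
  shows "(\<lambda>x. ennreal_powr (f x) p) \<in> borel_measurable M"
  unfolding ennreal_powr_def by measurable

text \<open>Each \<open>b n = ennreal_powr (a n) p\<close> is at most the total \<open>S\<close>, so
  \<open>a n\<close>, being \<open>b n\<close> to the power \<open>1 / p\<close>, is at most
  \<open>b n\<close> times \<open>S powr (1 / p - 1)\<close>. Summing and taking the power
  \<open>p\<close> gives the claim.\<close>

lemma ennreal_powr_suminf_le:
  fixes a :: "nat \<Rightarrow> ennreal"
  assumes p: "0 < p" "p \<le> 1"
  shows "ennreal_powr (\<Sum>n. a n) p \<le> (\<Sum>n. ennreal_powr (a n) p)"
proof (cases "(\<Sum>n. ennreal_powr (a n) p)" rule: ennreal_cases)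
  case (real S)
  define b where "b n = ennreal_powr (a n) p" for n
  have bS: "b n \<le> ennreal S" for n
    using sum_le_suminf[of b "{n}"] real by (auto simp: b_def[symmetric])
  have p1: "1 / p - 1 \<ge> 0" using p by (simp add: field_simps)
  have "a n \<le> b n * ennreal (S powr (1 / p - 1))" for n
  proof -
    have an: "a n = ennreal_powr (b n) (1 / p)"
    proof -
      have "ennreal_powr (a n) 1 = a n" by (cases "a n" rule: ennreal_cases) (auto simp: ennreal_powr_ennreal)
      then show ?thesis using p by (simp add: b_def ennreal_powr_powr)
    qed
    obtain y where y: "b n = ennreal y" "0 \<le> y" "y \<le> S"
      using bS[of n] real(1) by (cases "b n" rule: ennreal_cases) (auto simp: top_unique)
    have "y powr (1 / p) = y * y powr (1 / p - 1)" using y(2) powr_add[of y 1 "1 / p - 1"] by (cases "y = 0") auto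
    also have "\<dots> \<le> y * S powr (1 / p - 1)" using y p1 by (intro mult_left_mono powr_mono2) auto
    finally show ?thesis unfolding an y(1) using y(2) by (simp add: ennreal_powr_ennreal ennreal_mult[symmetric] ennreal_leI)
  qed
  then have "(\<Sum>n. a n) \<le> (\<Sum>n. b n * ennreal (S powr (1 / p - 1)))" by (intro suminf_le) auto
  also have "\<dots> = ennreal S * ennreal (S powr (1 / p - 1))" using real by (simp add: b_def)
  also have "\<dots> = ennreal (S powr (1 / p))"
    using real(1) powr_add[of S 1 "1 / p - 1"] by (cases "S = 0") (auto simp: ennreal_mult[symmetric])
  finally have "ennreal_powr (\<Sum>n. a n) p \<le> ennreal_powr (ennreal (S powr (1 / p))) p"
    using p by (intro ennreal_powr_mono) auto
  also have "\<dots> = ennreal S" using p real(1) by (simp add: ennreal_powr_ennreal powr_powr)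
  finally show ?thesis using real by simp
qed simp

lemma ennreal_powr_add_le:
  assumes p: "0 < p" "p \<le> 1"
  shows "ennreal_powr (a + b) p \<le> ennreal_powr a p + ennreal_powr b p"
proof -
  define c where "c n = (if n = 0 then a else if n = 1 then b else 0)" for n :: nat
  have *: "(\<Sum>n. g (c n)) = g a + g b" if "g 0 = (0 :: ennreal)" for g
  proof -
    have "(\<Sum>n. g (c n)) = (\<Sum>n\<in>{0, 1}. g (c n))" by (rule suminf_finite) (auto simp: c_def that)
    then show ?thesis by (simp add: c_def)
  qed
  show ?thesis using ennreal_powr_suminf_le[OF p, of c] *[of "\<lambda>x. x"] *[of "\<lambda>x. ennreal_powr x p"] by simp
qed

lemma ennreal_powr_sum_le:
  assumes p: "0 < p" "p \<le> 1"
  shows "ennreal_powr (\<Sum>i\<in>I. a i) p \<le> (\<Sum>i\<in>I. ennreal_powr (a i) p)"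
proof (induction I rule: infinite_finite_induct)
  case (insert i I)
  then show ?case using ennreal_powr_add_le[OF p, of "a i" "\<Sum>i\<in>I. a i"] by (auto intro: order_trans add_left_mono)
qed auto

text \<open>After division by the arithmetic mean \<open>A\<close>, the inequality
  \<open>ln x \<le> x - 1\<close> is summed over the slots; the right sides add up to 0.\<close>

lemma arith_geo_mean_weighted:
  fixes w :: "'m::finite \<Rightarrow> real"
  assumes w: "\<And>i. w i \<ge> 0"
  shows "(\<Prod>i\<in>UNIV. w i) powr (1 / CARD('m)) \<le> (\<Sum>i\<in>UNIV. w i) / CARD('m)"
proof (cases "\<exists>i. w i = 0")
  case True
  then have 0: "(\<Prod>i\<in>UNIV. w i) = 0" by (simp add: prod_zero_iff)
  have "0 \<le> (\<Sum>i\<in>UNIV. w i) / CARD('m)" by (intro divide_nonneg_nonneg sum_nonneg w) auto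
  then show ?thesis unfolding 0 by simp
next
  case False
  then have w0: "w i > 0" for i using w[of i] by (metis less_eq_real_def)
  define A where "A = (\<Sum>i\<in>UNIV. w i) / CARD('m)"
  have A: "A > 0" unfolding A_def using w0 by (intro divide_pos_pos sum_pos) auto
  have "(\<Sum>i\<in>UNIV. ln (w i)) - CARD('m) * ln A = (\<Sum>i\<in>UNIV. ln (w i / A))"
  proof -
    have "ln (w i / A) = ln (w i) - ln A" for i using w0[of i] A by (simp add: ln_div)
    then show ?thesis by (simp add: sum_subtractf)
  qed
  also have "\<dots> \<le> (\<Sum>i\<in>UNIV. w i / A - 1)" using w0 A by (intro sum_mono ln_le_minus_one) auto
  also have "\<dots> = 0"
  proof -
    have "(\<Sum>i\<in>UNIV. w i) = A * CARD('m)" by (simp add: A_def)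
    then show ?thesis using A by (simp add: sum_subtractf sum_divide_distrib[symmetric])
  qed
  finally have "(\<Sum>i\<in>UNIV. ln (w i)) / CARD('m) \<le> ln A" by (simp add: field_simps)
  then have "exp ((\<Sum>i\<in>UNIV. ln (w i)) / CARD('m)) \<le> A" using A by (metis exp_ln exp_le_cancel_iff)
  moreover have "(\<Prod>i\<in>UNIV. w i) powr (1 / CARD('m)) = exp ((\<Sum>i\<in>UNIV. ln (w i)) / CARD('m))"
    using w0 by (simp add: powr_def ln_prod prod_zero_iff less_imp_neq[symmetric])
  ultimately show ?thesis by (simp add: A_def)
qed

text \<open>Hoelder's inequality with equal exponents: the functions are normalised by the bounds
  \<open>c i\<close> of their integrals, and the arithmetic mean dominates the geometric mean at
  every point.\<close>

lemma nn_integral_geometric_mean_le: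
  fixes Z :: "'m::finite \<Rightarrow> 'a \<Rightarrow> ennreal" and c :: "'m \<Rightarrow> real"
  assumes Z[measurable]: "\<And>i. Z i \<in> borel_measurable M" and c: "\<And>i. c i > 0"
    and le: "\<And>i. (\<integral>\<^sup>+x. Z i x \<partial>M) \<le> ennreal (c i)"
  shows "(\<integral>\<^sup>+x. ennreal_powr (\<Prod>i\<in>UNIV. Z i x) (1 / CARD('m)) \<partial>M) \<le> ennreal ((\<Prod>i\<in>UNIV. c i) powr (1 / CARD('m)))"
proof -
  define A where "A = (\<Prod>i\<in>UNIV. c i) powr (1 / CARD('m))"
  have A: "A > 0" unfolding A_def using c by (simp add: prod_pos less_imp_neq[symmetric])
  have pt: "ennreal_powr (\<Prod>i\<in>UNIV. Z i x) (1 / CARD('m)) \<le> ennreal (A / CARD('m)) * (\<Sum>i\<in>UNIV. ennreal (1 / c i) * Z i x)" for x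
  proof (cases "\<exists>i. Z i x = \<top>")
    case True
    then obtain i where "Z i x = \<top>" by blast
    then have "ennreal (1 / c i) * Z i x = \<top>" using c[of i] by (simp add: ennreal_mult_eq_top_iff)
    moreover have "ennreal (1 / c i) * Z i x \<le> (\<Sum>i\<in>UNIV. ennreal (1 / c i) * Z i x)"
      by (rule member_le_sum) auto
    ultimately have top: "(\<Sum>i\<in>UNIV. ennreal (1 / c i) * Z i x) = \<top>" by (simp only: top_unique)
    show ?thesis unfolding top using A by (simp add: ennreal_mult_top)
  next
    case False
    define z where "z i = enn2real (Z i x)" for i
    have z: "Z i x = ennreal (z i)" "z i \<ge> 0" for i using False by (auto simp: z_def less_top)
    define w where "w i = z i / c i" for i
    have w: "w i \<ge> 0" for i using z c[of i] by (simp add: w_def)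
    have zw: "z i = c i * w i" for i using c[of i] by (simp add: w_def)
    have "(\<Prod>i\<in>UNIV. z i) powr (1 / CARD('m)) = A * (\<Prod>i\<in>UNIV. w i) powr (1 / CARD('m))"
      unfolding zw prod.distrib A_def by (rule powr_mult)
    also have "\<dots> \<le> A * ((\<Sum>i\<in>UNIV. w i) / CARD('m))"
      using A w by (intro mult_left_mono arith_geo_mean_weighted) auto
    finally have "ennreal ((\<Prod>i\<in>UNIV. z i) powr (1 / CARD('m))) \<le> ennreal (A / CARD('m) * (\<Sum>i\<in>UNIV. w i))"
      by (simp add: ennreal_leI)
    also have "\<dots> = ennreal (A / CARD('m)) * (\<Sum>i\<in>UNIV. ennreal (w i))"
      using A w by (subst ennreal_mult) (auto simp: sum_nonneg sum_ennreal)
    also have "\<dots> = ennreal (A / CARD('m)) * (\<Sum>i\<in>UNIV. ennreal (1 / c i) * Z i x)"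
      using c z less_imp_le[OF c] by (simp add: w_def ennreal_mult[symmetric])
    finally show ?thesis
      using z by (simp add: prod_ennreal ennreal_powr_ennreal prod_nonneg)
  qed
  have "(\<integral>\<^sup>+x. ennreal_powr (\<Prod>i\<in>UNIV. Z i x) (1 / CARD('m)) \<partial>M)
    \<le> (\<integral>\<^sup>+x. ennreal (A / CARD('m)) * (\<Sum>i\<in>UNIV. ennreal (1 / c i) * Z i x) \<partial>M)"
    by (intro nn_integral_mono pt)
  also have "\<dots> = ennreal (A / CARD('m)) * (\<Sum>i\<in>UNIV. ennreal (1 / c i) * (\<integral>\<^sup>+x. Z i x \<partial>M))"
    by (simp add: nn_integral_cmult nn_integral_sum)
  also have "\<dots> \<le> ennreal (A / CARD('m)) * (\<Sum>i\<in>(UNIV::'m set). 1)"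
  proof (intro mult_left_mono sum_mono)
    fix i
    have "ennreal (1 / c i) * (\<integral>\<^sup>+x. Z i x \<partial>M) \<le> ennreal (1 / c i) * ennreal (c i)" by (intro mult_left_mono le) auto
    also have "\<dots> = 1" using c[of i] by (simp add: ennreal_mult[symmetric])
    finally show "ennreal (1 / c i) * (\<integral>\<^sup>+x. Z i x \<partial>M) \<le> 1" .
  qed auto
  also have "\<dots> = ennreal A"
    using A by (simp add: ennreal_of_nat_eq_real_of_nat ennreal_mult[symmetric])
  finally show ?thesis by (simp add: A_def)
qed

subsection \<open>Telescoping and the low frequencies\<close>

text \<open>Factors are exchanged one at a time; \<open>T i\<close> is the set of slots that show
  \<open>a\<close> when slot \<open>i\<close> is exchanged. It is chosen before \<open>a\<close> and
  \<open>b\<close>, so the same pattern serves at every point of an integral.\<close>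

lemma prod_telescope:
  assumes "finite A"
  shows "\<exists>T :: 'm \<Rightarrow> 'm set. \<forall>a b :: 'm \<Rightarrow> 'c::comm_ring_1. (\<Prod>i\<in>A. a i) - (\<Prod>i\<in>A. b i) =
    (\<Sum>i\<in>A. (a i - b i) * (\<Prod>l\<in>A - {i}. if l \<in> T i then a l else b l))"
  using assms
proof (induction A)
  case (insert j A)
  then obtain T :: "'m \<Rightarrow> 'm set" where T: "\<And>a b :: 'm \<Rightarrow> 'c. (\<Prod>i\<in>A. a i) - (\<Prod>i\<in>A. b i) =
    (\<Sum>i\<in>A. (a i - b i) * (\<Prod>l\<in>A - {i}. if l \<in> T i then a l else b l))" by blast
  \<comment> \<open>The new slot \<open>j\<close> is exchanged while all of \<open>A\<close> shows
    \<open>a\<close>; during the exchanges inside \<open>A\<close> it shows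
    \<open>b\<close>.\<close>
  define T' where "T' i = (if i = j then A else T i - {j})" for i
  show ?case
  proof (intro exI[of _ T'] allI)
    fix a b :: "'m \<Rightarrow> 'c"
    have 1: "(\<Prod>l\<in>insert j A - {j}. if l \<in> T' j then a l else b l) = (\<Prod>i\<in>A. a i)"
      using insert.hyps by (intro prod.cong) (auto simp: T'_def)
    have 2: "(\<Prod>l\<in>insert j A - {i}. if l \<in> T' i then a l else b l) = b j * (\<Prod>l\<in>A - {i}. if l \<in> T i then a l else b l)"
      if "i \<in> A" for i
    proof -
      have ij: "i \<noteq> j" using that insert.hyps by auto
      then have "insert j A - {i} = insert j (A - {i})" by auto
      then have "(\<Prod>l\<in>insert j A - {i}. if l \<in> T' i then a l else b l)
          = (if j \<in> T' i then a j else b j) * (\<Prod>l\<in>A - {i}. if l \<in> T' i then a l else b l)"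
        using insert.hyps by simp
      also have "(\<Prod>l\<in>A - {i}. if l \<in> T' i then a l else b l) = (\<Prod>l\<in>A - {i}. if l \<in> T i then a l else b l)"
        using insert.hyps ij by (intro prod.cong) (auto simp: T'_def)
      finally show ?thesis using ij by (simp add: T'_def)
    qed
    have "(\<Prod>i\<in>insert j A. a i) - (\<Prod>i\<in>insert j A. b i) = (a j - b j) * (\<Prod>i\<in>A. a i) + b j * ((\<Prod>i\<in>A. a i) - (\<Prod>i\<in>A. b i))"
      using insert.hyps by (simp add: algebra_simps)
    also have "b j * ((\<Prod>i\<in>A. a i) - (\<Prod>i\<in>A. b i))
      = (\<Sum>i\<in>A. (a i - b i) * (\<Prod>l\<in>insert j A - {i}. if l \<in> T' i then a l else b l))"
      unfolding T sum_distrib_left by (intro sum.cong) (simp_all add: 2 mult_ac)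
    finally show "(\<Prod>i\<in>insert j A. a i) - (\<Prod>i\<in>insert j A. b i) =
      (\<Sum>i\<in>insert j A. (a i - b i) * (\<Prod>l\<in>insert j A - {i}. if l \<in> T' i then a l else b l))"
      using insert.hyps 1 by simp
  qed
qed simp

lemma norm_limit_le_telescope:
  fixes z :: "nat \<Rightarrow> complex"
  assumes "z \<longlonglongrightarrow> w"
  shows "ennreal (norm w) \<le> ennreal (norm (z 0)) + (\<Sum>j. ennreal (norm (z (Suc j) - z j)))"
proof (rule LIMSEQ_le_const2)
  show "(\<lambda>J. ennreal (norm (z J))) \<longlonglongrightarrow> ennreal (norm w)" by (intro tendsto_ennrealI tendsto_norm assms)
  have "ennreal (norm (z J)) \<le> ennreal (norm (z 0)) + (\<Sum>j. ennreal (norm (z (Suc j) - z j)))" for J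
  proof -
    have "norm (z J) \<le> norm (z 0) + (\<Sum>j<J. norm (z (Suc j) - z j))"
    proof (induction J)
      case (Suc J)
      have "norm (z (Suc J)) \<le> norm (z J) + norm (z (Suc J) - z J)"
        using norm_triangle_ineq[of "z J" "z (Suc J) - z J"] by simp
      then show ?case using Suc by simp
    qed simp
    then have "ennreal (norm (z J)) \<le> ennreal (norm (z 0) + (\<Sum>j<J. norm (z (Suc j) - z j)))" by (rule ennreal_leI)
    also have "\<dots> = ennreal (norm (z 0)) + (\<Sum>j<J. ennreal (norm (z (Suc j) - z j)))"
      by (simp add: ennreal_plus sum_nonneg sum_ennreal)
    also have "\<dots> \<le> ennreal (norm (z 0)) + (\<Sum>j. ennreal (norm (z (Suc j) - z j)))"
      by (intro add_left_mono sum_le_suminf) auto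
    finally show ?thesis .
  qed
  then show "\<exists>N. \<forall>n\<ge>N. ennreal (norm (z n)) \<le> ennreal (norm (z 0)) + (\<Sum>j. ennreal (norm (z (Suc j) - z j)))" by blast
qed

lemma integrable_Mop:
  fixes \<sigma> :: "('a::euclidean_space ^ 'm::finite) measure"
  assumes fin: "finite_measure \<sigma>" and sets[measurable_cong]: "sets \<sigma> = sets borel"
    and b[measurable]: "b \<in> borel_measurable borel" and b1: "\<And>y. norm (b y) \<le> 1" and h: "\<And>i. nice (h i)"
  shows "integrable \<sigma> (\<lambda>y. b y * (\<Prod>i\<in>UNIV. h i (x - t *\<^sub>R y $ i)))"
proof -
  interpret finite_measure \<sigma> by (rule fin)
  note [measurable] = measurable_nice[OF h]
  have "\<forall>i. \<exists>B. \<forall>x. norm (h i x) \<le> B" using nice_boundE[OF h] by metis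
  then obtain B where B: "\<And>i x. norm (h i x) \<le> B i" by metis
  have "norm (\<Prod>i\<in>UNIV. h i (x - t *\<^sub>R y $ i)) \<le> (\<Prod>i\<in>UNIV. B i)" for y
    unfolding prod_norm[symmetric] by (rule prod_mono) (simp add: B)
  then have "norm (b y * (\<Prod>i\<in>UNIV. h i (x - t *\<^sub>R y $ i))) \<le> 1 * (\<Prod>i\<in>UNIV. B i)" for y
    unfolding norm_mult by (rule mult_mono[OF b1]) auto
  then have "AE y in \<sigma>. norm (b y * (\<Prod>i\<in>UNIV. h i (x - t *\<^sub>R y $ i))) \<le> 1 * (\<Prod>i\<in>UNIV. B i)" by simp
  then show ?thesis by (rule integrable_const_bound) measurable
qed

text \<open>Translates the pattern of \<open>prod_telescope\<close> into scales: the factors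
  \<open>a\<close> are truncations at \<open>r / 2\<close>, the factors \<open>b\<close> truncations
  at \<open>r\<close>.\<close>

definition choice_scale :: "('m \<Rightarrow> 'm set) \<Rightarrow> real \<Rightarrow> 'm \<Rightarrow> 'm \<Rightarrow> real" where
  "choice_scale T r i0 l = (if l \<in> T i0 then r / 2 else r)"

lemma Mop_trunc_diff:
  fixes \<sigma> :: "('a::euclidean_space ^ 'm::finite) measure" and f :: "'m \<Rightarrow> 'a \<Rightarrow> complex"
  assumes fin: "finite_measure \<sigma>" and sets: "sets \<sigma> = sets borel" and r: "r > 0" and f: "\<And>i. nice (f i)"
    and T: "\<And>a b :: 'm \<Rightarrow> complex. (\<Prod>i\<in>UNIV. a i) - (\<Prod>i\<in>UNIV. b i) =
      (\<Sum>i\<in>UNIV. (a i - b i) * (\<Prod>l\<in>UNIV - {i}. if l \<in> T i then a l else b l))"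
  shows "Mop \<sigma> cutball (\<lambda>i. trunc n (r / 2) (f i)) t x - Mop \<sigma> cutball (\<lambda>i. trunc n r (f i)) t x
    = (\<Sum>i0\<in>UNIV. Mop \<sigma> cutball (slots n r (choice_scale T r i0) i0 f) t x)"
proof -
  have c: "choice_scale T r i0 l > 0" for i0 l using r by (simp add: choice_scale_def)
  have tr: "nice (trunc n r (f i))" "nice (trunc n (r / 2) (f i))" for i using r f by (auto intro: nice_trunc)
  note int = integrable_Mop[OF fin sets measurable_cutball norm_cutball_le]
  have eq: "(\<Prod>i\<in>UNIV. slots n r (choice_scale T r i0) i0 f i (p i)) =
     (trunc n (r / 2) (f i0) (p i0) - trunc n r (f i0) (p i0)) *
     (\<Prod>l\<in>UNIV - {i0}. if l \<in> T i0 then trunc n (r / 2) (f l) (p l) else trunc n r (f l) (p l))" for i0 p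
  proof -
    have "(\<Prod>i\<in>UNIV - {i0}. slots n r (choice_scale T r i0) i0 f i (p i))
        = (\<Prod>l\<in>UNIV - {i0}. if l \<in> T i0 then trunc n (r / 2) (f l) (p l) else trunc n r (f l) (p l))"
      by (rule prod.cong) (auto simp: slots_def choice_scale_def)
    then show ?thesis by (subst prod.remove[of UNIV i0]) (simp_all add: slots_def[of _ _ _ i0 _ i0])
  qed
  have "Mop \<sigma> cutball (\<lambda>i. trunc n (r / 2) (f i)) t x - Mop \<sigma> cutball (\<lambda>i. trunc n r (f i)) t x
    = (\<integral>y. cutball y * (\<Prod>i\<in>UNIV. trunc n (r / 2) (f i) (x - t *\<^sub>R y $ i)) - cutball y * (\<Prod>i\<in>UNIV. trunc n r (f i) (x - t *\<^sub>R y $ i)) \<partial>\<sigma>)"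
    unfolding Mop_def by (rule Bochner_Integration.integral_diff[symmetric, OF int[OF tr(2)] int[OF tr(1)]])
  also have "\<dots> = (\<integral>y. (\<Sum>i0\<in>UNIV. cutball y * (\<Prod>i\<in>UNIV. slots n r (choice_scale T r i0) i0 f i (x - t *\<^sub>R y $ i))) \<partial>\<sigma>)"
    unfolding right_diff_distrib[symmetric] T eq sum_distrib_left ..
  also have "\<dots> = (\<Sum>i0\<in>UNIV. Mop \<sigma> cutball (slots n r (choice_scale T r i0) i0 f) t x)"
    unfolding Mop_def by (rule Bochner_Integration.integral_sum[OF int[OF nice_slots[OF r c f]]])
  finally show ?thesis .
qed

text \<open>The truncations converge pointwise and are bounded uniformly in the scale, so a constant
  is an integrable majorant for the finite measure.\<close>

lemma Mop_trunc_tendsto: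
  fixes \<sigma> :: "('a::euclidean_space ^ 'm::finite) measure" and f :: "'m \<Rightarrow> 'a \<Rightarrow> complex"
  assumes fin: "finite_measure \<sigma>" and sets[measurable_cong]: "sets \<sigma> = sets borel" and \<rho>: "\<rho> > 0" and f: "\<And>i. nice (f i)"
  shows "(\<lambda>J. Mop \<sigma> cutball (\<lambda>i. trunc (Suc n) (\<rho> / 2 ^ J) (f i)) t x) \<longlonglongrightarrow> Mop \<sigma> cutball f t x"
proof -
  interpret finite_measure \<sigma> by (rule fin)
  have r: "\<rho> / 2 ^ J > 0" for J :: nat using \<rho> by simp
  have r0: "(\<lambda>J. \<rho> / 2 ^ J) \<longlonglongrightarrow> 0" by real_asymp
  note [measurable] = measurable_nice[OF f] measurable_nice[OF nice_trunc[OF r f]]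
  have "\<forall>i. \<exists>B. \<forall>x. norm (f i x) \<le> B" using nice_boundE[OF f] by metis
  then obtain B where B: "\<And>i x. norm (f i x) \<le> B i" by metis
  define M where "M = (\<Prod>i\<in>UNIV. (1 + 2 ^ Suc n) * B i)"
  show ?thesis
    unfolding Mop_def
  proof (rule integral_dominated_convergence[where w="\<lambda>_. M"])
    show "AE y in \<sigma>. (\<lambda>J. cutball y * (\<Prod>i\<in>UNIV. trunc (Suc n) (\<rho> / 2 ^ J) (f i) (x - t *\<^sub>R y $ i)))
        \<longlonglongrightarrow> cutball y * (\<Prod>i\<in>UNIV. f i (x - t *\<^sub>R y $ i))"
      by (intro AE_I2 tendsto_mult tendsto_const tendsto_prod trunc_tendsto f r0 r)
    show "AE y in \<sigma>. norm (cutball y * (\<Prod>i\<in>UNIV. trunc (Suc n) (\<rho> / 2 ^ J) (f i) (x - t *\<^sub>R y $ i))) \<le> M" for J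
    proof (intro AE_I2)
      fix y
      have "norm (\<Prod>i\<in>UNIV. trunc (Suc n) (\<rho> / 2 ^ J) (f i) (x - t *\<^sub>R y $ i)) \<le> M"
        unfolding M_def prod_norm[symmetric] by (rule prod_mono) (use norm_trunc_le[OF r f B] in auto)
      then have "norm (cutball y) * norm (\<Prod>i\<in>UNIV. trunc (Suc n) (\<rho> / 2 ^ J) (f i) (x - t *\<^sub>R y $ i)) \<le> 1 * M"
        by (rule mult_mono[OF norm_cutball_le]) auto
      then show "norm (cutball y * (\<Prod>i\<in>UNIV. trunc (Suc n) (\<rho> / 2 ^ J) (f i) (x - t *\<^sub>R y $ i))) \<le> M"
        by (simp add: norm_mult)
    qed
  qed (simp, measurable)
qed

text \<open>On the unit ball the points \<open>x - t *\<^sub>R y $ i\<close> lie within twice the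
  smoothing scale of \<open>x\<close>, where each truncation is below a dyadic average of fixed
  relative radius.\<close>

lemma Mop_trunc_le_maximal:
  fixes \<sigma> :: "('a::euclidean_space ^ 'm::finite) measure" and f :: "'m \<Rightarrow> 'a \<Rightarrow> complex" and k :: int and n :: nat
  assumes fin: "finite_measure \<sigma>" and sets: "sets \<sigma> = sets borel" and f: "\<And>i. nice (f i)"
    and t: "2 powr k \<le> t" "t \<le> 2 * 2 powr k"
  defines "A \<equiv> real n * bump_const TYPE('a) * 2 ^ n * (2 ^ (2 * n + 5)) ^ DIM('a)"
  shows "ennreal (norm (Mop \<sigma> cutball (\<lambda>i. trunc n (2 powr k) (f i)) t x))
    \<le> ennreal (measure \<sigma> (space \<sigma>)) * (\<Prod>i\<in>UNIV. ennreal A * (SUP k::int. avg (2 powr k) (\<lambda>z. ennreal (norm (f i z))) x))"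
proof -
  interpret finite_measure \<sigma> by (rule fin)
  let ?\<rho> = "2 powr real_of_int k"
  let ?Mf = "\<lambda>i. SUP k::int. avg (2 powr k) (\<lambda>z. ennreal (norm (f i z))) x"
  have tr: "nice (trunc n ?\<rho> (f i))" for i using f by (auto intro: nice_trunc)
  have "ennreal (norm (Mop \<sigma> cutball (\<lambda>i. trunc n ?\<rho> (f i)) t x))
    \<le> (\<integral>\<^sup>+y. ennreal (norm (cutball y * (\<Prod>i\<in>UNIV. trunc n ?\<rho> (f i) (x - t *\<^sub>R y $ i)))) \<partial>\<sigma>)"
    unfolding Mop_def
    by (rule integral_norm_bound_ennreal[OF integrable_Mop[OF fin sets measurable_cutball norm_cutball_le tr]])
  also have "\<dots> \<le> (\<integral>\<^sup>+y. (\<Prod>i\<in>UNIV. ennreal A * ?Mf i) \<partial>\<sigma>)"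
  proof (rule nn_integral_mono)
    fix y
    show "ennreal (norm (cutball y * (\<Prod>i\<in>UNIV. trunc n ?\<rho> (f i) (x - t *\<^sub>R y $ i)))) \<le> (\<Prod>i\<in>UNIV. ennreal A * ?Mf i)"
    proof (cases "norm y \<le> 1")
      case True
      have "ennreal (norm (trunc n ?\<rho> (f i) (x - t *\<^sub>R y $ i))) \<le> ennreal A * ?Mf i" for i
      proof -
        have "norm (y $ i) \<le> 1" by (rule order_trans[OF Finite_Cartesian_Product.norm_nth_le True])
        moreover have "t > 0" using t(1) by (rule less_le_trans[rotated]) simp
        ultimately have "t * norm (y $ i) \<le> 2 * ?\<rho> * 1" using t(2) by (intro mult_mono) auto
        moreover have "dist x (x - t *\<^sub>R y $ i) = t * norm (y $ i)" using \<open>t > 0\<close> by (simp add: dist_norm)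
        moreover have "?\<rho> > 0" by simp
        ultimately have "dist x (x - t *\<^sub>R y $ i) \<le> 3 * ?\<rho>" by linarith
        then have "ennreal (norm (trunc n ?\<rho> (f i) (x - t *\<^sub>R y $ i)))
          \<le> ennreal A * avg (2 ^ (2 * n + 5) * ?\<rho>) (\<lambda>z. ennreal (norm (f i z))) x"
          unfolding A_def by (intro trunc_le_avg f) auto
        also have "2 ^ (2 * n + 5) * ?\<rho> = 2 powr real_of_int (k + int (2 * n + 5))"
          by (simp only: powr_add powr_realpow of_int_add of_int_of_nat_eq zero_less_numeral mult.commute)
        finally have 1: "ennreal (norm (trunc n ?\<rho> (f i) (x - t *\<^sub>R y $ i)))
          \<le> ennreal A * avg (2 powr real_of_int (k + int (2 * n + 5))) (\<lambda>z. ennreal (norm (f i z))) x" .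
        have 2: "avg (2 powr real_of_int (k + int (2 * n + 5))) (\<lambda>z. ennreal (norm (f i z))) x \<le> ?Mf i"
          by (rule SUP_upper) simp
        show ?thesis by (rule order_trans[OF 1 mult_left_mono[OF 2]]) simp
      qed
      then have "(\<Prod>i\<in>UNIV. ennreal (norm (trunc n ?\<rho> (f i) (x - t *\<^sub>R y $ i)))) \<le> (\<Prod>i\<in>UNIV. ennreal A * ?Mf i)"
        by (rule prod_mono_ennreal)
      moreover have "ennreal (norm (cutball y * (\<Prod>i\<in>UNIV. trunc n ?\<rho> (f i) (x - t *\<^sub>R y $ i))))
        = (\<Prod>i\<in>UNIV. ennreal (norm (trunc n ?\<rho> (f i) (x - t *\<^sub>R y $ i))))"
        using True by (simp add: cutball_def prod_norm[symmetric] prod_ennreal)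
      ultimately show ?thesis by simp
    qed (simp add: cutball_0)
  qed
  also have "\<dots> = ennreal (measure \<sigma> (space \<sigma>)) * (\<Prod>i\<in>UNIV. ennreal A * ?Mf i)"
    by (simp add: emeasure_eq_measure mult.commute)
  finally show ?thesis .
qed

subsection \<open>The maximal estimate\<close>

text \<open>The scales are separated before Hoelder's inequality: slots off \<open>i0\<close> take
  the supremum over \<open>k\<close>, slot \<open>i0\<close> takes the sum. Each \<open>Z i\<close>
  then has an integral bound linear in \<open>l2 (f i)\<close> alone, and the product bounds every
  scale at once.\<close>

lemma high_piece:
  fixes \<sigma> :: "('a::euclidean_space ^ 'm::finite) measure"
  assumes fin: "finite_measure \<sigma>" and sets: "sets \<sigma> = sets borel"
    and decay: "\<And>\<xi>. norm (\<integral>y. cutball y * cis (- 2 * pi * (\<xi> \<bullet> y)) \<partial>\<sigma>) \<le> K * (1 + norm \<xi>) powr (- s)"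
    and decay': "\<And>l a \<xi>. a \<in> Basis \<Longrightarrow> norm (\<integral>y. moment l a y * cis (- 2 * pi * (\<xi> \<bullet> y)) \<partial>\<sigma>) \<le> K * (1 + norm \<xi>) powr (- s)"
    and K: "K \<ge> 0" and s: "0 \<le> s" "s \<le> real n"
  defines "\<kappa> \<equiv> 2 * s - 1 - real (DIM('a) * (CARD('m) - 1))"
  obtains C where "C > 0"
    "\<And>(f :: 'm \<Rightarrow> 'a \<Rightarrow> complex) (j::nat) T i0. (\<And>i. nice (f i)) \<Longrightarrow>
      \<exists>Z :: 'm \<Rightarrow> 'a \<Rightarrow> ennreal. (\<forall>i. Z i \<in> borel_measurable borel) \<and>
        (\<forall>(k::int) t x. 2 powr k \<le> t \<longrightarrow> t \<le> 2 * 2 powr k \<longrightarrow>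
           ennreal ((norm (Mop \<sigma> cutball (slots (Suc n) (2 powr k / 2 ^ j) (choice_scale T (2 powr k / 2 ^ j) i0) i0 f) t x))\<^sup>2)
             \<le> (\<Prod>i\<in>UNIV. Z i x)) \<and>
        (\<forall>i. (\<integral>\<^sup>+x. Z i x \<partial>lborel) \<le> ennreal (C * (if i = i0 then (2 ^ j) powr (- \<kappa>) else (real j + 2)\<^sup>2)) * l2 (f i))"
proof -
  obtain C1 where C1: "C1 > 0"
    "\<And>(f :: 'm \<Rightarrow> 'a \<Rightarrow> complex) \<rho> (j::nat) c i0.
      (\<And>i. nice (f i)) \<Longrightarrow> \<rho> > 0 \<Longrightarrow> (\<And>i. c i = \<rho> / 2 ^ j \<or> c i = \<rho> / 2 ^ j / 2) \<Longrightarrow>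
      \<exists>R\<in>borel_measurable borel.
        (\<forall>t\<in>{\<rho>..2 * \<rho>}. \<forall>x. ennreal ((norm (Mop \<sigma> cutball (slots (Suc n) (\<rho> / 2 ^ j) c i0 f) t x))\<^sup>2)
           \<le> (\<Prod>i\<in>UNIV - {i0}. avg (4 * \<rho>) (\<lambda>z. ennreal ((norm (pretrunc (Suc n) (c i) (f i) z))\<^sup>2)) x) * R x) \<and>
        (\<integral>\<^sup>+x. R x \<partial>lborel) \<le> ennreal (C1 * (2 ^ j) powr (1 + real (DIM('a) * (CARD('m) - 1)) - 2 * s))
           * (\<integral>\<^sup>+\<zeta>. ennreal ((lp_weight (\<rho> / 2 ^ j * norm \<zeta>) * norm (ft (f i0) \<zeta>))\<^sup>2) \<partial>lborel)"
    using single_scale[OF fin sets decay decay' K s] by blast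
  obtain C2 where C2: "C2 > 0"
    "\<And>(f :: 'a \<Rightarrow> complex) j. nice f \<Longrightarrow>
      (\<integral>\<^sup>+x. (SUP k::int. avg (4 * 2 powr k) (\<lambda>z. ennreal ((norm (pretrunc (Suc n) (2 powr k / 2 ^ j) f z))\<^sup>2)) x) \<partial>lborel)
      \<le> ennreal (C2 * (real j + 1)\<^sup>2) * l2 f"
    using pretrunc_sup_L2 by blast
  define C where "C = C1 * 12 + C2"
  have C: "C > 0" "C1 * 12 \<le> C" "C2 \<le> C" using C1(1) C2(1) by (auto simp: C_def)
  show thesis
  proof (rule that[OF C(1)])
    fix f :: "'m \<Rightarrow> 'a \<Rightarrow> complex" and j :: nat and T :: "'m \<Rightarrow> 'm set" and i0 :: 'm
    assume f: "\<And>i. nice (f i)"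
    \<comment> \<open>A slot at scale \<open>r / 2\<close> counts as one further halving; this is
      why \<open>(real j + 2)\<^sup>2\<close> replaces \<open>(real j + 1)\<^sup>2\<close>.\<close>
    define jj where "jj l = (if l \<in> T i0 then Suc j else j)" for l
    define c where "c k l = choice_scale T (2 powr real_of_int k / 2 ^ j) i0 l" for k :: int and l
    have c_jj: "c k l = 2 powr k / 2 ^ jj l" for k l by (simp add: c_def choice_scale_def jj_def)
    define \<Theta> where "\<Theta> k = (\<integral>\<^sup>+\<zeta>. ennreal ((lp_weight (2 powr real_of_int k * (1 / 2 ^ j) * norm \<zeta>) * norm (ft (f i0) \<zeta>))\<^sup>2) \<partial>lborel)" for k :: int
    define A where "A k l x = avg (4 * 2 powr real_of_int k) (\<lambda>z. ennreal ((norm (pretrunc (Suc n) (c k l) (f l) z))\<^sup>2)) x" for k :: int and l x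
    have "\<exists>R\<in>borel_measurable borel. (\<forall>t\<in>{2 powr real_of_int k..2 * 2 powr real_of_int k}. \<forall>x.
        ennreal ((norm (Mop \<sigma> cutball (slots (Suc n) (2 powr k / 2 ^ j) (c k) i0 f) t x))\<^sup>2) \<le> (\<Prod>i\<in>UNIV - {i0}. A k i x) * R x) \<and>
        (\<integral>\<^sup>+x. R x \<partial>lborel) \<le> ennreal (C1 * (2 ^ j) powr (- \<kappa>)) * \<Theta> k" for k :: int
      unfolding A_def \<Theta>_def
      using C1(2)[of f "2 powr real_of_int k" "c k" j i0] f
      by (simp add: \<kappa>_def c_def choice_scale_def algebra_simps)
    then obtain R where R: "\<And>k. R k \<in> borel_measurable borel"
      "\<And>k t x. 2 powr real_of_int k \<le> t \<Longrightarrow> t \<le> 2 * 2 powr real_of_int k \<Longrightarrow>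
        ennreal ((norm (Mop \<sigma> cutball (slots (Suc n) (2 powr k / 2 ^ j) (c k) i0 f) t x))\<^sup>2) \<le> (\<Prod>i\<in>UNIV - {i0}. A k i x) * R k x"
      "\<And>k. (\<integral>\<^sup>+x. R k x \<partial>lborel) \<le> ennreal (C1 * (2 ^ j) powr (- \<kappa>)) * \<Theta> k"
      by (metis atLeastAtMost_iff)
    \<comment> \<open>Summability over \<open>k\<close> is available only for \<open>R\<close>,
      through its \<open>lp_weight\<close>; the other factors are merely bounded uniformly in
      \<open>k\<close>.\<close>
    define Z where "Z l x = (if l = i0 then (\<integral>\<^sup>+k. R k x \<partial>count_space UNIV) else (SUP k. A k l x))" for l x
    have Ameas: "A k l \<in> borel_measurable borel" for k l
    proof -
      have "c k l > 0" by (simp add: c_jj)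
      note [measurable] = measurable_nice[OF nice_pretrunc[OF this f[of l]]]
      show ?thesis unfolding A_def by measurable
    qed
    have Zmeas: "Z l \<in> borel_measurable borel" for l
    proof (cases "l = i0")
      case True
      then show ?thesis unfolding Z_def using measurable_nn_integral_int[OF R(1)] by simp
    next
      case False
      then show ?thesis unfolding Z_def using Ameas by (simp add: borel_measurable_SUP)
    qed
    have bound: "ennreal ((norm (Mop \<sigma> cutball (slots (Suc n) (2 powr k / 2 ^ j) (c k) i0 f) t x))\<^sup>2) \<le> (\<Prod>i\<in>UNIV. Z i x)"
      if "2 powr real_of_int k \<le> t" "t \<le> 2 * 2 powr real_of_int k" for k t x
    proof -
      have "(\<Prod>i\<in>UNIV - {i0}. A k i x) * R k x \<le> (\<Prod>i\<in>UNIV - {i0}. Z i x) * Z i0 x"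
      proof (rule mult_mono)
        show "(\<Prod>i\<in>UNIV - {i0}. A k i x) \<le> (\<Prod>i\<in>UNIV - {i0}. Z i x)"
          by (rule prod_mono_ennreal) (auto simp: Z_def intro: SUP_upper)
        show "R k x \<le> Z i0 x" unfolding Z_def if_P[OF refl] by (rule nn_integral_ge_point[of k UNIV "\<lambda>k. R k x"]) simp
      qed auto
      also have "\<dots> = (\<Prod>i\<in>UNIV. Z i x)" by (subst prod.remove[of UNIV i0]) (auto simp: mult.commute)
      finally show ?thesis using R(2)[OF that, of x] by (rule order_trans[rotated])
    qed
    have Zint: "(\<integral>\<^sup>+x. Z l x \<partial>lborel) \<le> ennreal (C * (if l = i0 then (2 ^ j) powr (- \<kappa>) else (real j + 2)\<^sup>2)) * l2 (f l)" for l
    proof (cases "l = i0")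
      case True
      have "(\<integral>\<^sup>+x. Z l x \<partial>lborel) = (\<integral>\<^sup>+x. (\<integral>\<^sup>+k. R k x \<partial>count_space UNIV) \<partial>lborel)" using True by (simp add: Z_def)
      also have "\<dots> = (\<integral>\<^sup>+k. (\<integral>\<^sup>+x. R k x \<partial>lborel) \<partial>count_space UNIV)"
        by (rule nn_integral_count_space_nn_integral) (auto simp: R(1))
      also have "\<dots> \<le> (\<integral>\<^sup>+k. ennreal (C1 * (2 ^ j) powr (- \<kappa>)) * \<Theta> k \<partial>count_space UNIV)"
        by (rule nn_integral_mono) (rule R(3))
      also have "\<dots> = ennreal (C1 * (2 ^ j) powr (- \<kappa>)) * (\<integral>\<^sup>+k. \<Theta> k \<partial>count_space UNIV)"
        by (rule nn_integral_cmult) simp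
      also have "\<dots> \<le> ennreal (C1 * (2 ^ j) powr (- \<kappa>)) * (12 * l2 (f i0))"
        unfolding \<Theta>_def by (intro mult_left_mono sum_scales_lp_weight_ft_le f) auto
      also have "\<dots> = ennreal ((C1 * 12) * (2 ^ j) powr (- \<kappa>)) * l2 (f i0)"
        using C1(1) by (simp add: ennreal_mult mult_ac)
      also have "\<dots> \<le> ennreal (C * (2 ^ j) powr (- \<kappa>)) * l2 (f i0)"
        by (rule mult_right_mono[OF ennreal_leI[OF mult_right_mono[OF C(2)]]]) auto
      finally show ?thesis using True by simp
    next
      case False
      then have "(\<integral>\<^sup>+x. Z l x \<partial>lborel) \<le> ennreal (C2 * (real (jj l) + 1)\<^sup>2) * l2 (f l)"
        unfolding Z_def A_def c_jj using C2(2)[OF f, of "jj l" l] by simp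
      also have "\<dots> \<le> ennreal (C * (real j + 2)\<^sup>2) * l2 (f l)"
        using C C2(1) by (intro mult_right_mono ennreal_leI mult_mono power_mono) (auto simp: jj_def)
      finally show ?thesis using False by simp
    qed
    show "\<exists>Z :: 'm \<Rightarrow> 'a \<Rightarrow> ennreal. (\<forall>i. Z i \<in> borel_measurable borel) \<and>
        (\<forall>(k::int) t x. 2 powr k \<le> t \<longrightarrow> t \<le> 2 * 2 powr k \<longrightarrow>
           ennreal ((norm (Mop \<sigma> cutball (slots (Suc n) (2 powr k / 2 ^ j) (choice_scale T (2 powr k / 2 ^ j) i0) i0 f) t x))\<^sup>2)
             \<le> (\<Prod>i\<in>UNIV. Z i x)) \<and>
        (\<forall>i. (\<integral>\<^sup>+x. Z i x \<partial>lborel) \<le> ennreal (C * (if i = i0 then (2 ^ j) powr (- \<kappa>) else (real j + 2)\<^sup>2)) * l2 (f i))"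
      using Zmeas bound Zint unfolding c_def[abs_def] by (intro exI[of _ Z]) blast
  qed
qed

text \<open>Half of the exponential decay is spent on the polynomial: \<open>a ^ (2 * j)\<close> has
  exponent \<open>\<kappa> / 2 * j\<close>, and Bernoulli's inequality makes \<open>a ^ j\<close>
  dominate a linear function of \<open>j\<close>.\<close>

lemma polynomial_times_geometric_le:
  assumes "\<kappa> > 0"
  obtains K where "K > 0" "\<And>j::nat. (real j + 2)\<^sup>2 * (2 ^ j) powr (- \<kappa>) \<le> K * (2 powr (- \<kappa> / 2)) ^ j"
proof -
  define a where "a = 2 powr (\<kappa> / 4)"
  have a: "a > 1" using assms by (simp add: a_def)
  \<comment> \<open>The summand 2 takes care of the constant in \<open>j + 2\<close>, the summand
    \<open>1 / (a - 1)\<close> of the slope.\<close>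
  define b where "b = 2 + 1 / (a - 1)"
  have b: "b > 0" using a by (simp add: b_def add_pos_pos)
  show thesis
  proof (rule that[of "b\<^sup>2"])
    show "b\<^sup>2 > 0" using b by simp
    fix j :: nat
    have "1 + real j * (a - 1) \<le> (1 + (a - 1)) ^ j" by (rule Bernoulli_inequality) (use a in simp)
    then have aj: "1 + real j * (a - 1) \<le> a ^ j" by simp
    have "real j + 2 \<le> b * (1 + real j * (a - 1))"
    proof -
      have "b * (1 + real j * (a - 1)) = 2 + 1 / (a - 1) + 2 * (real j * (a - 1)) + real j"
        using a by (simp add: b_def field_simps)
      moreover have "0 \<le> 1 / (a - 1)" "0 \<le> real j * (a - 1)" using a by auto
      ultimately show ?thesis by linarith
    qed
    also have "\<dots> \<le> b * a ^ j" using b aj by (intro mult_left_mono) auto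
    finally have "(real j + 2)\<^sup>2 \<le> (b * a ^ j)\<^sup>2" by (intro power_mono) auto
    then have "(real j + 2)\<^sup>2 * (2 ^ j) powr (- \<kappa>) \<le> (b * a ^ j)\<^sup>2 * (2 ^ j) powr (- \<kappa>)" by (intro mult_right_mono) auto
    also have "\<dots> = b\<^sup>2 * ((a ^ j)\<^sup>2 * (2 ^ j) powr (- \<kappa>))" by (simp add: power_mult_distrib)
    also have "(a ^ j)\<^sup>2 * (2 ^ j) powr (- \<kappa>) = (2 powr (- \<kappa> / 2)) ^ j"
    proof -
      have "(a ^ j)\<^sup>2 = 2 powr (\<kappa> / 2 * real j)"
        by (simp add: a_def powr_powr power_mult[symmetric] powr_realpow[symmetric] mult.commute)
      moreover have "(2 ^ j) powr (- \<kappa>) = 2 powr (- \<kappa> * real j)"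
        by (simp add: powr_powr powr_realpow[symmetric] mult.commute)
      moreover have "(2 powr (- \<kappa> / 2)) ^ j = 2 powr (- \<kappa> / 2 * real j)"
        by (simp add: powr_powr powr_realpow[symmetric])
      ultimately show ?thesis by (simp add: powr_add[symmetric] field_simps)
    qed
    finally show "(real j + 2)\<^sup>2 * (2 ^ j) powr (- \<kappa>) \<le> b\<^sup>2 * (2 powr (- \<kappa> / 2)) ^ j" .
  qed
qed

text \<open>Positive \<open>L i\<close> serve as normalisations in the geometric mean. The bound is
  stated before the final root is taken, where the integral of the power \<open>2 / CARD('m)\<close>
  is countably subadditive over the pieces.\<close>

lemma multilinear_maximal_nice:
  fixes \<sigma> :: "('a::euclidean_space ^ 'm::finite) measure"
  assumes fin: "finite_measure \<sigma>" and sets: "sets \<sigma> = sets borel" and m2: "CARD('m) \<ge> 2"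
    and decay: "\<And>\<xi>. norm (\<integral>y. cutball y * cis (- 2 * pi * (\<xi> \<bullet> y)) \<partial>\<sigma>) \<le> K * (1 + norm \<xi>) powr (- s)"
    and decay': "\<And>l a \<xi>. a \<in> Basis \<Longrightarrow> norm (\<integral>y. moment l a y * cis (- 2 * pi * (\<xi> \<bullet> y)) \<partial>\<sigma>) \<le> K * (1 + norm \<xi>) powr (- s)"
    and K: "K \<ge> 0" and s: "0 \<le> s" "2 * s > 1 + real (DIM('a) * (CARD('m) - 1))"
  obtains B where "B \<ge> 0"
    "\<And>(f :: 'm \<Rightarrow> 'a \<Rightarrow> complex) L. (\<And>i. nice (f i)) \<Longrightarrow> (\<And>i. l2 (f i) = ennreal (L i)) \<Longrightarrow> (\<And>i. L i > 0) \<Longrightarrow>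
      (\<integral>\<^sup>+x. ennreal_powr (SUP t\<in>{0<..}. ennreal (norm (Mop \<sigma> cutball f t x))) (2 / CARD('m)) \<partial>lborel)
        \<le> ennreal (B * (\<Prod>i\<in>UNIV. L i) powr (1 / CARD('m)))"
proof -
  define n where "n = nat \<lceil>s\<rceil>"
  have n: "s \<le> real n" unfolding n_def by (rule real_nat_ceiling_ge)
  define \<kappa> where "\<kappa> = 2 * s - 1 - real (DIM('a) * (CARD('m) - 1))"
  have \<kappa>: "\<kappa> > 0" using s(2) by (simp add: \<kappa>_def)
  define m where "m = real (CARD('m))"
  have m: "m \<ge> 2" using m2 by (simp add: m_def)
  obtain C where C: "C > 0"
    "\<And>(f :: 'm \<Rightarrow> 'a \<Rightarrow> complex) (j::nat) T i0. (\<And>i. nice (f i)) \<Longrightarrow>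
      \<exists>Z :: 'm \<Rightarrow> 'a \<Rightarrow> ennreal. (\<forall>i. Z i \<in> borel_measurable borel) \<and>
        (\<forall>(k::int) t x. 2 powr k \<le> t \<longrightarrow> t \<le> 2 * 2 powr k \<longrightarrow>
           ennreal ((norm (Mop \<sigma> cutball (slots (Suc n) (2 powr k / 2 ^ j) (choice_scale T (2 powr k / 2 ^ j) i0) i0 f) t x))\<^sup>2)
             \<le> (\<Prod>i\<in>UNIV. Z i x)) \<and>
        (\<forall>i. (\<integral>\<^sup>+x. Z i x \<partial>lborel) \<le> ennreal (C * (if i = i0 then (2 ^ j) powr (- \<kappa>) else (real j + 2)\<^sup>2)) * l2 (f i))"
    unfolding \<kappa>_def using high_piece[OF fin sets decay decay' K s(1) n] by blast
  obtain M where M: "M > 0" "\<And>f::'a \<Rightarrow> ennreal. f \<in> borel_measurable borel \<Longrightarrow>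
    (\<integral>\<^sup>+x. (SUP k::int. avg (2 powr k) f x)\<^sup>2 \<partial>lborel) \<le> ennreal M * (\<integral>\<^sup>+x. (f x)\<^sup>2 \<partial>lborel)"
    using dyadic_maximal_L2 by blast
  obtain T :: "'m \<Rightarrow> 'm set" where T: "\<And>a b :: 'm \<Rightarrow> complex. (\<Prod>i\<in>UNIV. a i) - (\<Prod>i\<in>UNIV. b i) =
      (\<Sum>i\<in>UNIV. (a i - b i) * (\<Prod>l\<in>UNIV - {i}. if l \<in> T i then a l else b l))"
    using prod_telescope[of "UNIV :: 'm set", where 'c=complex] by auto
  have "\<kappa> / m > 0" using \<kappa> m by simp
  then obtain Kg where Kg: "Kg > 0" "\<And>j::nat. (real j + 2)\<^sup>2 * (2 ^ j) powr (- (\<kappa> / m)) \<le> Kg * (2 powr (- (\<kappa> / m) / 2)) ^ j"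
    using polynomial_times_geometric_le by blast
  define g where "g = 2 powr (- (\<kappa> / m) / 2)"
  have g: "0 < g" "g < 1"
  proof -
    show "0 < g" by (simp add: g_def)
    have "2 powr (- (\<kappa> / m) / 2) < 2 powr 0" using \<open>\<kappa> / m > 0\<close> by (intro powr_less_mono) auto
    then show "g < 1" by (simp add: g_def)
  qed
  define A where "A = real (Suc n) * bump_const TYPE('a) * 2 ^ Suc n * (2 ^ (2 * Suc n + 5)) ^ DIM('a)"
  have A: "A > 0" using bump_const_pos[where 'a='a] by (simp add: A_def)
  define \<mu> where "\<mu> = measure \<sigma> (space \<sigma>)"
  have \<mu>: "\<mu> \<ge> 0" by (simp add: \<mu>_def)
  define B0 where "B0 = (\<mu>\<^sup>2) powr (1 / m) * ((A\<^sup>2 * M) ^ CARD('m)) powr (1 / m)"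
  define B1 where "B1 = C * Kg * (1 / (1 - g))"
  have B0: "B0 \<ge> 0" by (simp add: B0_def)
  have B1: "B1 \<ge> 0" using C(1) Kg(1) g by (simp add: B1_def)
  show thesis
  proof (rule that[of "B0 + m * B1"])
    show "B0 + m * B1 \<ge> 0" using B0 B1 m by simp
    fix f :: "'m \<Rightarrow> 'a \<Rightarrow> complex" and L :: "'m \<Rightarrow> real"
    assume f: "\<And>i. nice (f i)" and L: "\<And>i. l2 (f i) = ennreal (L i)" and L0: "\<And>i. L i > 0"
    note [measurable] = measurable_nice[OF f]
    define \<Lambda> where "\<Lambda> = (\<Prod>i\<in>UNIV. L i) powr (1 / m)"
    have \<Lambda>: "\<Lambda> \<ge> 0" by (simp add: \<Lambda>_def)
    have "\<forall>j i0. \<exists>Z :: 'm \<Rightarrow> 'a \<Rightarrow> ennreal. (\<forall>i. Z i \<in> borel_measurable borel) \<and>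
        (\<forall>(k::int) t x. 2 powr k \<le> t \<longrightarrow> t \<le> 2 * 2 powr k \<longrightarrow>
           ennreal ((norm (Mop \<sigma> cutball (slots (Suc n) (2 powr k / 2 ^ j) (choice_scale T (2 powr k / 2 ^ j) i0) i0 f) t x))\<^sup>2)
             \<le> (\<Prod>i\<in>UNIV. Z i x)) \<and>
        (\<forall>i. (\<integral>\<^sup>+x. Z i x \<partial>lborel) \<le> ennreal (C * (if i = i0 then (2 ^ j) powr (- \<kappa>) else (real j + 2)\<^sup>2)) * l2 (f i))"
      by (intro allI C(2) f)
    then obtain Z :: "nat \<Rightarrow> 'm \<Rightarrow> 'm \<Rightarrow> 'a \<Rightarrow> ennreal" where Z[measurable]: "\<And>j i0 i. Z j i0 i \<in> borel_measurable borel"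
      and Zle: "\<And>j i0 k t x. 2 powr real_of_int k \<le> t \<Longrightarrow> t \<le> 2 * 2 powr real_of_int k \<Longrightarrow>
           ennreal ((norm (Mop \<sigma> cutball (slots (Suc n) (2 powr k / 2 ^ j) (choice_scale T (2 powr k / 2 ^ j) i0) i0 f) t x))\<^sup>2)
             \<le> (\<Prod>i\<in>UNIV. Z j i0 i x)"
      and Zint: "\<And>j i0 i. (\<integral>\<^sup>+x. Z j i0 i x \<partial>lborel) \<le> ennreal (C * (if i = i0 then (2 ^ j) powr (- \<kappa>) else (real j + 2)\<^sup>2)) * l2 (f i)"
      unfolding choice_iff by blast
    define Mf where "Mf i x = (SUP k::int. avg (2 powr k) (\<lambda>z. ennreal (norm (f i z))) x)" for i x
    have [measurable]: "Mf i \<in> borel_measurable borel" for i unfolding Mf_def by measurable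
    define E0 where "E0 x = ennreal \<mu> * (\<Prod>i\<in>UNIV. ennreal A * Mf i x)" for x
    define E where "E j i0 x = ennreal_powr (\<Prod>i\<in>UNIV. Z j i0 i x) (1 / 2)" for j i0 x
    have [measurable]: "E0 \<in> borel_measurable borel" "E j i0 \<in> borel_measurable borel" for j i0
      unfolding E0_def E_def by measurable
    have pt: "ennreal (norm (Mop \<sigma> cutball f t x)) \<le> E0 x + (\<Sum>j. \<Sum>i0\<in>UNIV. E j i0 x)" if t: "t > 0" for t x
    proof -
      \<comment> \<open>The telescoping starts at the octave containing \<open>t\<close>, while the
        majorants \<open>E0\<close> and \<open>E\<close> already cover all octaves; hence the
        supremum over \<open>t\<close> costs nothing more.\<close>
      define k where "k = \<lfloor>log 2 t\<rfloor>"
      have "2 powr real_of_int k \<le> 2 powr (log 2 t)" "2 powr (log 2 t) \<le> 2 powr (real_of_int k + 1)"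
        unfolding k_def by (intro powr_mono; linarith)+
      then have tk: "2 powr real_of_int k \<le> t" "t \<le> 2 * 2 powr real_of_int k" using t by (auto simp: powr_add mult.commute)
      define u where "u j = Mop \<sigma> cutball (\<lambda>i. trunc (Suc n) (2 powr real_of_int k / 2 ^ j) (f i)) t x" for j
      have "u \<longlonglongrightarrow> Mop \<sigma> cutball f t x"
        unfolding u_def by (rule Mop_trunc_tendsto[where f=f, OF fin sets _ f]) simp
      then have "ennreal (norm (Mop \<sigma> cutball f t x)) \<le> ennreal (norm (u 0)) + (\<Sum>j. ennreal (norm (u (Suc j) - u j)))"
        by (rule norm_limit_le_telescope)
      also have "\<dots> \<le> E0 x + (\<Sum>j. \<Sum>i0\<in>UNIV. E j i0 x)"
      proof (intro add_mono suminf_le)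
        show "ennreal (norm (u 0)) \<le> E0 x"
          using Mop_trunc_le_maximal[where f=f and n="Suc n" and x=x, OF fin sets f tk]
          by (simp only: u_def E0_def \<mu>_def A_def Mf_def power_0 div_by_1)
        fix j
        let ?r = "2 powr real_of_int k / 2 ^ j"
        define v where "v i0 = Mop \<sigma> cutball (slots (Suc n) ?r (choice_scale T ?r i0) i0 f) t x" for i0
        have "u (Suc j) = Mop \<sigma> cutball (\<lambda>i. trunc (Suc n) (?r / 2) (f i)) t x"
          by (simp add: u_def divide_divide_eq_left mult.commute)
        then have "u (Suc j) - u j = (\<Sum>i0\<in>UNIV. v i0)"
          unfolding u_def[of j] v_def by (simp only:) (rule Mop_trunc_diff[where f=f, OF fin sets _ f T], simp)
        then have "ennreal (norm (u (Suc j) - u j)) \<le> ennreal (\<Sum>i0\<in>UNIV. norm (v i0))"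
          by (simp only:) (intro ennreal_leI norm_sum)
        also have "\<dots> = (\<Sum>i0\<in>UNIV. ennreal (norm (v i0)))" by (simp add: sum_ennreal)
        also have "\<dots> \<le> (\<Sum>i0\<in>UNIV. E j i0 x)"
        proof (rule sum_mono)
          fix i0
          have "ennreal (norm (v i0)) = ennreal_powr (ennreal ((norm (v i0))\<^sup>2)) (1 / 2)"
            by (simp add: ennreal_powr_ennreal powr_half_sqrt)
          also have "\<dots> \<le> E j i0 x"
            unfolding E_def v_def by (intro ennreal_powr_mono Zle tk) simp
          finally show "ennreal (norm (v i0)) \<le> E j i0 x" .
        qed
        finally show "ennreal (norm (u (Suc j) - u j)) \<le> (\<Sum>i0\<in>UNIV. E j i0 x)" .
      qed auto
      finally show ?thesis .
    qed
    have p: "0 < 2 / m" "2 / m \<le> 1" using m by auto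
    have E0int: "(\<integral>\<^sup>+x. ennreal_powr (E0 x) (2 / m) \<partial>lborel) \<le> ennreal (B0 * \<Lambda>)"
    proof -
      have eq: "ennreal_powr (E0 x) (2 / m) = ennreal ((\<mu>\<^sup>2) powr (1 / m)) * ennreal_powr (\<Prod>i\<in>UNIV. (ennreal A * Mf i x)\<^sup>2) (1 / CARD('m))" for x
      proof -
        have "ennreal_powr (E0 x) (2 / m) = ennreal_powr ((E0 x)\<^sup>2) (1 / m)"
          unfolding ennreal_powr_2[symmetric] by (subst ennreal_powr_powr) auto
        also have "(E0 x)\<^sup>2 = ennreal (\<mu>\<^sup>2) * (\<Prod>i\<in>UNIV. (ennreal A * Mf i x)\<^sup>2)"
          unfolding E0_def power_mult_distrib[of "ennreal \<mu>"] prod_power_distrib using \<mu> by (simp add: ennreal_power)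
        also have "ennreal_powr \<dots> (1 / m) = ennreal ((\<mu>\<^sup>2) powr (1 / m)) * ennreal_powr (\<Prod>i\<in>UNIV. (ennreal A * Mf i x)\<^sup>2) (1 / CARD('m))"
          using m by (subst ennreal_powr_mult) (auto simp: ennreal_powr_ennreal m_def)
        finally show ?thesis .
      qed
      have "(\<integral>\<^sup>+x. ennreal_powr (\<Prod>i\<in>UNIV. (ennreal A * Mf i x)\<^sup>2) (1 / CARD('m)) \<partial>lborel)
        \<le> ennreal ((\<Prod>i\<in>UNIV. A\<^sup>2 * M * L i) powr (1 / CARD('m)))"
      proof (rule nn_integral_geometric_mean_le)
        show "A\<^sup>2 * M * L i > 0" for i using A M(1) L0[of i] by simp
        fix i
        have "(\<integral>\<^sup>+x. (ennreal A * Mf i x)\<^sup>2 \<partial>lborel) = ennreal (A\<^sup>2) * (\<integral>\<^sup>+x. (Mf i x)\<^sup>2 \<partial>lborel)"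
          using A by (simp add: power_mult_distrib ennreal_power nn_integral_cmult)
        also have "\<dots> \<le> ennreal (A\<^sup>2) * (ennreal M * (\<integral>\<^sup>+x. (ennreal (norm (f i x)))\<^sup>2 \<partial>lborel))"
          unfolding Mf_def by (intro mult_left_mono M(2)) auto
        also have "(\<integral>\<^sup>+x. (ennreal (norm (f i x)))\<^sup>2 \<partial>lborel) = ennreal (L i)"
          using L[of i] by (simp add: l2_def ennreal_power)
        also have "ennreal (A\<^sup>2) * (ennreal M * ennreal (L i)) = ennreal (A\<^sup>2 * M * L i)"
          using M(1) L0[of i] by (simp add: ennreal_mult mult.assoc)
        finally show "(\<integral>\<^sup>+x. (ennreal A * Mf i x)\<^sup>2 \<partial>lborel) \<le> ennreal (A\<^sup>2 * M * L i)" .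
      qed measurable
      also have "(\<Prod>i\<in>UNIV. A\<^sup>2 * M * L i) powr (1 / CARD('m)) = ((A\<^sup>2 * M) ^ CARD('m)) powr (1 / m) * \<Lambda>"
        unfolding prod.distrib \<Lambda>_def m_def[symmetric] powr_mult[symmetric] by (simp add: power_mult_distrib)
      finally have le: "(\<integral>\<^sup>+x. ennreal_powr (\<Prod>i\<in>UNIV. (ennreal A * Mf i x)\<^sup>2) (1 / CARD('m)) \<partial>lborel)
        \<le> ennreal (((A\<^sup>2 * M) ^ CARD('m)) powr (1 / m) * \<Lambda>)" .
      have "(\<integral>\<^sup>+x. ennreal_powr (E0 x) (2 / m) \<partial>lborel) = ennreal ((\<mu>\<^sup>2) powr (1 / m)) * (\<integral>\<^sup>+x. ennreal_powr (\<Prod>i\<in>UNIV. (ennreal A * Mf i x)\<^sup>2) (1 / CARD('m)) \<partial>lborel)"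
        unfolding eq by (rule nn_integral_cmult) measurable
      also have "\<dots> \<le> ennreal ((\<mu>\<^sup>2) powr (1 / m)) * ennreal (((A\<^sup>2 * M) ^ CARD('m)) powr (1 / m) * \<Lambda>)"
        by (rule mult_left_mono[OF le]) simp
      also have "\<dots> = ennreal (B0 * \<Lambda>)"
        unfolding B0_def using \<Lambda> by (simp add: ennreal_mult[symmetric] mult.assoc)
      finally show ?thesis .
    qed
    have Eint: "(\<integral>\<^sup>+x. ennreal_powr (E j i0 x) (2 / m) \<partial>lborel) \<le> ennreal (C * Kg * g ^ j * \<Lambda>)" for j i0
    proof -
      define c where "c i = C * (if i = i0 then (2 ^ j) powr (- \<kappa>) else (real j + 2)\<^sup>2) * L i" for i
      have c: "c i > 0" for i using C(1) L0[of i] by (simp add: c_def)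
      have "ennreal_powr (E j i0 x) (2 / m) = ennreal_powr (\<Prod>i\<in>UNIV. Z j i0 i x) (1 / CARD('m))" for x
        unfolding E_def by (subst ennreal_powr_powr) (auto simp: m_def)
      then have "(\<integral>\<^sup>+x. ennreal_powr (E j i0 x) (2 / m) \<partial>lborel) = (\<integral>\<^sup>+x. ennreal_powr (\<Prod>i\<in>UNIV. Z j i0 i x) (1 / CARD('m)) \<partial>lborel)"
        by simp
      also have "\<dots> \<le> ennreal ((\<Prod>i\<in>UNIV. c i) powr (1 / CARD('m)))"
      proof (rule nn_integral_geometric_mean_le[OF _ c])
        fix i
        have "ennreal (C * (if i = i0 then (2 ^ j) powr (- \<kappa>) else (real j + 2)\<^sup>2)) * l2 (f i) = ennreal (c i)"
          unfolding L c_def using C(1) L0[of i] by (intro ennreal_mult[symmetric]) auto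
        then show "(\<integral>\<^sup>+x. Z j i0 i x \<partial>lborel) \<le> ennreal (c i)" using Zint[of j i0 i] by simp
      qed simp
      also have "(\<Prod>i\<in>UNIV. c i) powr (1 / CARD('m)) \<le> C * Kg * g ^ j * \<Lambda>"
      proof -
        define w where "w = (\<Prod>i\<in>UNIV. if i = i0 then (2 ^ j) powr (- \<kappa>) else (real j + 2)\<^sup>2)"
        have w: "w = (2 ^ j) powr (- \<kappa>) * ((real j + 2)\<^sup>2) ^ (CARD('m) - 1)"
          unfolding w_def by (subst prod.remove[of UNIV i0]) (auto simp: card_Diff_singleton)
        have q1: "(real j + 2)\<^sup>2 \<ge> 1" by (simp add: power2_eq_square algebra_simps)
        \<comment> \<open>Raising the exponent from \<open>CARD('m) - 1\<close> to
          \<open>CARD('m)\<close> makes the root exact; the extra polynomial factor is absorbed by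
          the geometric decay.\<close>
        have "((real j + 2)\<^sup>2) ^ (CARD('m) - 1) \<le> ((real j + 2)\<^sup>2) ^ CARD('m)"
          using q1 by (intro power_increasing) auto
        then have "w \<le> (2 ^ j) powr (- \<kappa>) * ((real j + 2)\<^sup>2) ^ CARD('m)"
          unfolding w by (intro mult_left_mono) auto
        then have "w powr (1 / m) \<le> ((2 ^ j) powr (- \<kappa>) * ((real j + 2)\<^sup>2) ^ CARD('m)) powr (1 / m)"
          using m by (intro powr_mono2) (auto simp: w)
        also have "\<dots> = (2 ^ j) powr (- (\<kappa> / m)) * (((real j + 2)\<^sup>2) ^ CARD('m)) powr (1 / m)"
          by (simp add: powr_mult powr_powr)
        also have "(((real j + 2)\<^sup>2) ^ CARD('m)) powr (1 / m) = (real j + 2)\<^sup>2"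
        proof -
          have "((real j + 2)\<^sup>2) ^ CARD('m) = ((real j + 2)\<^sup>2) powr m"
            unfolding m_def by (rule powr_realpow[symmetric]) (use q1 in linarith)
          then show ?thesis using m q1 by (simp add: powr_powr)
        qed
        also have "(2 ^ j) powr (- (\<kappa> / m)) * (real j + 2)\<^sup>2 \<le> Kg * g ^ j"
          using Kg(2)[of j] by (simp add: g_def mult.commute)
        finally have wle: "w powr (1 / m) \<le> Kg * g ^ j" .
        have "(\<Prod>i\<in>UNIV. c i) powr (1 / CARD('m)) = (C ^ CARD('m)) powr (1 / m) * w powr (1 / m) * \<Lambda>"
          unfolding c_def prod.distrib w_def[symmetric] \<Lambda>_def m_def[symmetric] powr_mult[symmetric] by simp
        also have "(C ^ CARD('m)) powr (1 / m) = C"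
        proof -
          have "C ^ CARD('m) = C powr m" unfolding m_def by (rule powr_realpow[symmetric, OF C(1)])
          then show ?thesis using m C(1) by (simp add: powr_powr)
        qed
        also have "C * w powr (1 / m) * \<Lambda> \<le> C * (Kg * g ^ j) * \<Lambda>"
          using C(1) \<Lambda> by (intro mult_right_mono mult_left_mono wle) auto
        finally show ?thesis by (simp add: mult.assoc)
      qed
      finally show ?thesis by (simp add: ennreal_leI)
    qed
    have "(\<integral>\<^sup>+x. ennreal_powr (SUP t\<in>{0<..}. ennreal (norm (Mop \<sigma> cutball f t x))) (2 / CARD('m)) \<partial>lborel)
      \<le> (\<integral>\<^sup>+x. ennreal_powr (E0 x) (2 / m) + (\<Sum>j. \<Sum>i0\<in>UNIV. ennreal_powr (E j i0 x) (2 / m)) \<partial>lborel)"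
    proof (rule nn_integral_mono)
      fix x
      have "ennreal_powr (SUP t\<in>{0<..}. ennreal (norm (Mop \<sigma> cutball f t x))) (2 / m)
        \<le> ennreal_powr (E0 x + (\<Sum>j. \<Sum>i0\<in>UNIV. E j i0 x)) (2 / m)"
        using p by (intro ennreal_powr_mono SUP_least pt) auto
      also have "\<dots> \<le> ennreal_powr (E0 x) (2 / m) + ennreal_powr (\<Sum>j. \<Sum>i0\<in>UNIV. E j i0 x) (2 / m)"
        by (rule ennreal_powr_add_le[OF p])
      also have "\<dots> \<le> ennreal_powr (E0 x) (2 / m) + (\<Sum>j. ennreal_powr (\<Sum>i0\<in>UNIV. E j i0 x) (2 / m))"
        by (intro add_left_mono ennreal_powr_suminf_le[OF p])
      also have "\<dots> \<le> ennreal_powr (E0 x) (2 / m) + (\<Sum>j. \<Sum>i0\<in>UNIV. ennreal_powr (E j i0 x) (2 / m))"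
        by (intro add_left_mono suminf_le ennreal_powr_sum_le[OF p]) auto
      finally show "ennreal_powr (SUP t\<in>{0<..}. ennreal (norm (Mop \<sigma> cutball f t x))) (2 / CARD('m))
        \<le> ennreal_powr (E0 x) (2 / m) + (\<Sum>j. \<Sum>i0\<in>UNIV. ennreal_powr (E j i0 x) (2 / m))" by (simp add: m_def)
    qed
    also have "\<dots> = (\<integral>\<^sup>+x. ennreal_powr (E0 x) (2 / m) \<partial>lborel) + (\<Sum>j. \<Sum>i0\<in>UNIV. \<integral>\<^sup>+x. ennreal_powr (E j i0 x) (2 / m) \<partial>lborel)"
      by (simp add: nn_integral_add nn_integral_suminf nn_integral_sum)
    also have "\<dots> \<le> ennreal (B0 * \<Lambda>) + (\<Sum>j. \<Sum>i0\<in>(UNIV::'m set). ennreal (C * Kg * g ^ j * \<Lambda>))"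
      by (intro add_mono suminf_le sum_mono Eint E0int) auto
    also have "(\<Sum>j. \<Sum>i0\<in>(UNIV::'m set). ennreal (C * Kg * g ^ j * \<Lambda>)) = ennreal (m * B1 * \<Lambda>)"
    proof -
      have "(\<Sum>i0\<in>(UNIV::'m set). ennreal (C * Kg * g ^ j * \<Lambda>)) = ennreal (m * C * Kg * \<Lambda> * g ^ j)" for j
        using C(1) Kg(1) g \<Lambda> by (simp add: m_def ennreal_of_nat_eq_real_of_nat ennreal_mult[symmetric] mult_ac)
      moreover have "(\<lambda>j. m * C * Kg * \<Lambda> * g ^ j) sums (m * C * Kg * \<Lambda> * (1 / (1 - g)))"
        using g by (intro sums_mult geometric_sums) auto
      then have "(\<Sum>j. ennreal (m * C * Kg * \<Lambda> * g ^ j)) = ennreal (m * C * Kg * \<Lambda> * (1 / (1 - g)))"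
        using C(1) Kg(1) g \<Lambda> m by (intro suminf_ennreal_eq) auto
      ultimately show ?thesis by (simp add: B1_def mult_ac)
    qed
    also have "ennreal (B0 * \<Lambda>) + ennreal (m * B1 * \<Lambda>) = ennreal ((B0 + m * B1) * \<Lambda>)"
      using B0 B1 m \<Lambda> by (subst ennreal_plus[symmetric]) (auto simp: distrib_right)
    finally show "(\<integral>\<^sup>+x. ennreal_powr (SUP t\<in>{0<..}. ennreal (norm (Mop \<sigma> cutball f t x))) (2 / CARD('m)) \<partial>lborel)
        \<le> ennreal ((B0 + m * B1) * (\<Prod>i\<in>UNIV. L i) powr (1 / CARD('m)))"
      by (simp add: \<Lambda>_def m_def)
  qed
qed

subsection \<open>Schwartz functions\<close>

lemma nn_integral_inverse_one_plus_square_finite: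
  "(\<integral>\<^sup>+x. ennreal (inverse (1 + x\<^sup>2)) \<partial>(lborel :: real measure)) < \<infinity>"
proof -
  have "integrable lborel (\<lambda>x::real. inverse (1 + x\<^sup>2))"
    using integrable_inverse_1_plus_square by (simp add: set_integrable_def)
  moreover have "norm (inverse (1 + x\<^sup>2)) = inverse (1 + x\<^sup>2)" for x :: real by (simp add: add_pos_nonneg)
  ultimately show ?thesis by (simp add: integrable_iff_bounded)
qed

text \<open>The product of the weights 1/(1 + x_b^2) over the coordinates is integrable by Tonelli,
  and each inverse factor is at most (1 + |x|)^2. Decay of order \<open>2 * DIM(real^'n)\<close> of
  the function itself therefore suffices.\<close>

lemma nice_schwartz:
  fixes f :: "real^'n::finite \<Rightarrow> complex"
  assumes "schwartz f"
  shows "nice f"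
proof -
  have diff: "f differentiable (at x)" for x
    using assms[unfolded schwartz_def, rule_format, of "[]"] by simp
  have cont: "continuous_on UNIV f"
    by (intro differentiable_imp_continuous_on) (auto simp: differentiable_on_def diff)
  have [measurable]: "f \<in> borel_measurable borel" by (rule borel_measurable_continuous_onI[OF cont])
  have "\<exists>C. \<forall>x. (1 + norm x) ^ N * norm (f x) \<le> C" for N
    using assms[unfolded schwartz_def, rule_format, of "[]"] by simp
  then obtain C where C: "\<And>x. (1 + norm x) ^ (2 * DIM(real^'n)) * norm (f x) \<le> C" by blast
  have C0: "C \<ge> 0" using C[of 0] by (auto intro: order_trans[OF norm_ge_zero])
  define w where "w x = (\<Prod>b\<in>Basis. inverse (1 + (x \<bullet> b)\<^sup>2))" for x :: "real^'n"
  have [measurable]: "w \<in> borel_measurable borel" unfolding w_def by measurable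
  have w: "0 < w x" "w x \<le> 1" for x
    unfolding w_def
    by (auto intro!: prod_pos prod_le_1 simp: add_pos_nonneg inverse_le_1_iff)
  have fw: "norm (f x) \<le> C * w x" for x
  proof -
    have "(\<Prod>b\<in>(Basis::(real^'n) set). 1 + (x \<bullet> b)\<^sup>2) \<le> (\<Prod>b\<in>(Basis::(real^'n) set). (1 + norm x)\<^sup>2)"
    proof (rule prod_mono)
      fix b :: "real^'n" assume "b \<in> Basis"
      then have "\<bar>x \<bullet> b\<bar>\<^sup>2 \<le> (norm x)\<^sup>2" by (intro power_mono Basis_le_norm) auto
      moreover have "(1 + norm x)\<^sup>2 = 1 + 2 * norm x + (norm x)\<^sup>2" by (simp add: power2_sum)
      ultimately have "1 + (x \<bullet> b)\<^sup>2 \<le> (1 + norm x)\<^sup>2" unfolding power2_abs using norm_ge_zero[of x] by linarith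
      then show "0 \<le> 1 + (x \<bullet> b)\<^sup>2 \<and> 1 + (x \<bullet> b)\<^sup>2 \<le> (1 + norm x)\<^sup>2" by simp
    qed
    also have "\<dots> = (1 + norm x) ^ (2 * DIM(real^'n))" by (simp add: power_mult)
    also have "(\<Prod>b\<in>(Basis::(real^'n) set). 1 + (x \<bullet> b)\<^sup>2) = inverse (w x)"
      unfolding w_def prod_inversef[unfolded o_def] inverse_inverse_eq ..
    finally have "inverse (w x) * norm (f x) \<le> C"
      by (rule order_trans[OF mult_right_mono[OF _ norm_ge_zero] C])
    then show ?thesis using w(1)[of x] by (simp add: field_simps)
  qed
  have "bounded (range f)"
    unfolding bounded_iff
  proof (intro exI[of _ C] ballI)
    fix z assume "z \<in> range f"
    then obtain x where "z = f x" by blast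
    then show "norm z \<le> C" using order_trans[OF fw[of x] mult_left_le[OF w(2) C0]] by simp
  qed
  moreover have "integrable lborel f"
  proof (rule Bochner_Integration.integrable_bound[where f="\<lambda>x. C * w x"])
    have "(\<integral>\<^sup>+x. ennreal (w x) \<partial>lborel) = (\<integral>\<^sup>+x. (\<Prod>b\<in>Basis. ennreal (inverse (1 + (x \<bullet> b)\<^sup>2))) \<partial>(lborel :: (real^'n) measure))"
      unfolding w_def by (simp add: prod_ennreal)
    also have "\<dots> = (\<Prod>b\<in>(Basis::(real^'n) set). (\<integral>\<^sup>+t. ennreal (inverse (1 + t\<^sup>2)) \<partial>lborel))"
      by (rule nn_integral_lborel_prod) auto
    also have "\<dots> < \<infinity>"
      using nn_integral_inverse_one_plus_square_finite by (simp add: power_less_top_ennreal)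
    finally have "integrable lborel w"
      using w(1) by (simp add: integrable_iff_bounded abs_of_pos)
    then show "integrable lborel (\<lambda>x. C * w x)" by (rule integrable_mult_right)
    show "AE x in lborel. norm (f x) \<le> norm (C * w x)" unfolding real_norm_def by (rule AE_I2) (rule order_trans[OF fw abs_ge_self])
  qed measurable
  ultimately show ?thesis using cont by (simp add: nice_def)
qed

lemma l2_finite:
  assumes "nice f"
  shows "l2 f < \<infinity>"
proof -
  note [measurable] = measurable_nice[OF assms]
  obtain B where B: "B > 0" "\<And>x. norm (f x) \<le> B" using nice_boundE[OF assms] by blast
  have "l2 f \<le> (\<integral>\<^sup>+x. ennreal B * ennreal (norm (f x)) \<partial>lborel)"
    unfolding l2_def
  proof (rule nn_integral_mono)
    fix x
    have "(norm (f x))\<^sup>2 \<le> B * norm (f x)" unfolding power2_eq_square by (rule mult_right_mono[OF B(2)]) simp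
    then show "ennreal ((norm (f x))\<^sup>2) \<le> ennreal B * ennreal (norm (f x))"
      using B(1) by (simp add: ennreal_mult[symmetric] ennreal_leI)
  qed
  also have "\<dots> = ennreal B * (\<integral>\<^sup>+x. ennreal (norm (f x)) \<partial>lborel)" by (rule nn_integral_cmult) measurable
  also have "\<dots> < \<infinity>"
    using assms by (auto simp: nice_def integrable_iff_bounded ennreal_mult_less_top)
  finally show ?thesis .
qed

text \<open>By continuity the set where the function is nonzero is open, and a nonempty open set is
  not negligible.\<close>

lemma l2_eq_0_imp:
  assumes "nice f" "l2 f = 0"
  shows "f x = 0"
proof (rule ccontr)
  assume x: "f x \<noteq> 0"
  note [measurable] = measurable_nice[OF assms(1)]
  have "AE z in lborel. f z = 0"
    using assms(2) unfolding l2_def by (subst (asm) nn_integral_0_iff_AE) (auto simp: ennreal_eq_0_iff)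
  then have "emeasure lborel {z. f z \<noteq> 0} = 0" by (subst (asm) AE_iff_measurable[OF _ refl]) auto
  then have "{z. f z \<noteq> 0} \<in> null_sets lborel" by (auto simp: null_sets_def)
  then have "negligible {z. f z \<noteq> 0}"
    unfolding negligible_iff_null_sets by (rule null_sets_completionI)
  moreover have "open {z. f z \<noteq> 0}"
    using assms(1) by (intro open_Collect_neq) (auto simp: nice_def)
  ultimately show False using open_not_negligible x by blast
qed

lemma Lp_norm_2: "Lp_norm 2 (\<lambda>x. ennreal (norm (f x))) = ennreal_powr (l2 f) (1 / 2)"
  unfolding Lp_norm_def ennreal_powr_2 l2_def by (simp add: ennreal_power)

text \<open>There are finitely many moments, one for each slot and basis vector, so one constant
  serves them all; the measure itself is stated with the same weakened exponent. The support
  condition lets \<open>cutball\<close> enter almost everywhere without changing the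
  integrals.\<close>

lemma localized_decay:
  fixes \<sigma> :: "('a::euclidean_space ^ 'm::finite) measure"
  assumes fin: "finite_measure \<sigma>" and sets[measurable_cong]: "sets \<sigma> = sets borel"
    and decay: "\<And>\<xi>. norm (fourier_measure \<sigma> \<xi>) \<le> K * (1 + norm \<xi>) powr (- s)"
    and s: "s \<ge> 0" and \<delta>: "\<delta> > 0" and supp: "AE y in \<sigma>. norm y \<le> 1"
  obtains K' where "K' \<ge> 0"
    "\<And>\<xi>. norm (\<integral>y. cutball y * cis (- 2 * pi * (\<xi> \<bullet> y)) \<partial>\<sigma>) \<le> K' * (1 + norm \<xi>) powr (- (s - \<delta>))"
    "\<And>l a \<xi>. a \<in> Basis \<Longrightarrow> norm (\<integral>y. moment l a y * cis (- 2 * pi * (\<xi> \<bullet> y)) \<partial>\<sigma>) \<le> K' * (1 + norm \<xi>) powr (- (s - \<delta>))"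
proof -
  have K: "norm (fourier_measure \<sigma> \<xi>) \<le> \<bar>K\<bar> * (1 + norm \<xi>) powr (- s)" for \<xi>
    by (rule order_trans[OF decay]) (simp add: mult_right_mono)
  define e where "e l a = (axis l a :: 'a ^ 'm)" for l a
  define P where "P l a k \<longleftrightarrow> k \<ge> 0 \<and> (\<forall>\<xi>. norm (\<integral>y. of_real (y \<bullet> e l a) * cis (- 2 * pi * (\<xi> \<bullet> y)) \<partial>\<sigma>) \<le> k * (1 + norm \<xi>) powr (- (s - \<delta>)))" for l a k
  have ex: "\<exists>k. P l a k" if "a \<in> Basis" for l a
    using fourier_measure_moment_decay[OF fin sets K _ s \<delta> _ supp, of "e l a"] that
    unfolding P_def e_def by (auto simp: norm_eq_sqrt_inner inner_axis_axis inner_same_Basis)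
  define k where "k l a = (SOME k. P l a k)" for l a
  have "P l a (k l a)" if "a \<in> Basis" for l a unfolding k_def by (rule someI_ex[OF ex[OF that]])
  then have k: "\<And>l a. a \<in> Basis \<Longrightarrow> k l a \<ge> 0"
    "\<And>l a \<xi>. a \<in> Basis \<Longrightarrow> norm (\<integral>y. of_real (y \<bullet> e l a) * cis (- 2 * pi * (\<xi> \<bullet> y)) \<partial>\<sigma>) \<le> k l a * (1 + norm \<xi>) powr (- (s - \<delta>))"
    by (simp_all add: P_def)
  define K' where "K' = \<bar>K\<bar> + (\<Sum>l\<in>UNIV. \<Sum>a\<in>Basis. k l a)"
  have K'1: "\<bar>K\<bar> \<le> K'" unfolding K'_def by (simp add: k(1) sum_nonneg)
  have K'2: "k l a \<le> K'" if "a \<in> Basis" for l a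
  proof -
    have "k l a \<le> (\<Sum>a\<in>Basis. k l a)" by (rule member_le_sum) (auto simp: k(1) that)
    also have "\<dots> \<le> (\<Sum>l\<in>UNIV. \<Sum>a\<in>Basis. k l a)"
      by (rule member_le_sum[of l UNIV "\<lambda>l. \<Sum>a\<in>Basis. k l a"]) (auto simp: k(1) sum_nonneg)
    finally show ?thesis by (simp add: K'_def)
  qed
  have one: "AE y in \<sigma>. cutball y = 1" using supp by eventually_elim (simp add: cutball_def)
  show thesis
  proof (rule that[of K'])
    show "K' \<ge> 0" using K'1 by simp
    fix \<xi> :: "'a ^ 'm"
    have "(\<integral>y. cutball y * cis (- 2 * pi * (\<xi> \<bullet> y)) \<partial>\<sigma>) = fourier_measure \<sigma> \<xi>"
      unfolding fourier_measure_def
    proof (rule integral_cong_AE)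
      show "AE y in \<sigma>. cutball y * cis (- 2 * pi * (\<xi> \<bullet> y)) = cis (- 2 * pi * (\<xi> \<bullet> y))"
        using one by eventually_elim simp
    qed measurable
    moreover have "norm (fourier_measure \<sigma> \<xi>) \<le> K' * (1 + norm \<xi>) powr (- (s - \<delta>))"
      by (rule order_trans[OF K mult_mono[OF K'1 powr_mono]]) (use \<delta> K'1 in auto)
    ultimately show "norm (\<integral>y. cutball y * cis (- 2 * pi * (\<xi> \<bullet> y)) \<partial>\<sigma>) \<le> K' * (1 + norm \<xi>) powr (- (s - \<delta>))"
      by simp
    fix l and a :: 'a assume a: "a \<in> Basis"
    have "(\<integral>y. moment l a y * cis (- 2 * pi * (\<xi> \<bullet> y)) \<partial>\<sigma>) = (\<integral>y. of_real (y \<bullet> e l a) * cis (- 2 * pi * (\<xi> \<bullet> y)) \<partial>\<sigma>)"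
    proof (rule integral_cong_AE)
      show "AE y in \<sigma>. moment l a y * cis (- 2 * pi * (\<xi> \<bullet> y)) = of_real (y \<bullet> e l a) * cis (- 2 * pi * (\<xi> \<bullet> y))"
        using one by eventually_elim (simp add: moment_def e_def inner_axis)
    qed measurable
    then have "norm (\<integral>y. moment l a y * cis (- 2 * pi * (\<xi> \<bullet> y)) \<partial>\<sigma>) \<le> k l a * (1 + norm \<xi>) powr (- (s - \<delta>))"
      using k(2)[OF a] by simp
    also have "\<dots> \<le> K' * (1 + norm \<xi>) powr (- (s - \<delta>))" by (rule mult_right_mono[OF K'2[OF a]]) simp
    finally show "norm (\<integral>y. moment l a y * cis (- 2 * pi * (\<xi> \<bullet> y)) \<partial>\<sigma>) \<le> K' * (1 + norm \<xi>) powr (- (s - \<delta>))" .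
  qed
qed

lemma maximal_op_eq_Mop:
  assumes sets[measurable_cong]: "sets \<sigma> = sets borel" and supp: "AE y in \<sigma>. norm y \<le> 1"
    and F: "\<And>i. nice (F i)"
  shows "maximal_op \<sigma> F x = (SUP t\<in>{0<..}. ennreal (norm (Mop \<sigma> cutball F t x)))"
proof -
  note [measurable] = measurable_nice[OF F]
  have "(\<integral>y. (\<Prod>i\<in>UNIV. F i (x - t *\<^sub>R y $ i)) \<partial>\<sigma>) = Mop \<sigma> cutball F t x" for t
    unfolding Mop_def
  proof (rule integral_cong_AE)
    show "AE y in \<sigma>. (\<Prod>i\<in>UNIV. F i (x - t *\<^sub>R y $ i)) = cutball y * (\<Prod>i\<in>UNIV. F i (x - t *\<^sub>R y $ i))"
      using supp by eventually_elim (simp add: cutball_def)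
  qed measurable
  then show ?thesis by (simp add: maximal_op_def)
qed

theorem theorem1p3:
  fixes \<sigma> :: "(real^'d::finite^'m::finite) measure" and s :: real
  assumes m2: "CARD('m) \<ge> 2"
    and s_gt: "s > real ((CARD('m) - 1) * CARD('d)) / 2 + 1 / 2"
    and sets_\<sigma>: "sets \<sigma> = sets borel"
    and fin: "finite_measure \<sigma>"
    and supp: "emeasure \<sigma> (- cball 0 1) = 0"
    and decay: "\<exists>K. \<forall>\<xi>. norm (fourier_measure \<sigma> \<xi>) \<le> K * (1 + norm \<xi>) powr (- s)"
  shows "\<exists>C. \<forall>F :: 'm \<Rightarrow> real^'d \<Rightarrow> complex. (\<forall>i. schwartz (F i)) \<longrightarrow>
           Lp_norm (2 / real CARD('m)) (maximal_op \<sigma> F)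
             \<le> ennreal (C * (\<Prod>i\<in>UNIV. enn2real (Lp_norm 2 (\<lambda>x. ennreal (norm (F i x))))))"
proof -
  define D where "D = real ((CARD('m) - 1) * CARD('d))"
  \<comment> \<open>Half of the gap left by the strict hypothesis on \<open>s\<close>, so that
    \<open>s - \<delta>\<close> still satisfies it.\<close>
  define \<delta> where "\<delta> = (s - (D / 2 + 1 / 2)) / 2"
  define m where "m = real CARD('m)"
  have m: "m > 0" by (simp add: m_def)
  have D: "D \<ge> 0" by (simp add: D_def)
  have \<delta>: "\<delta> > 0" using s_gt by (simp add: \<delta>_def D_def)
  have s: "s \<ge> 0" "0 \<le> s - \<delta>" "2 * (s - \<delta>) > 1 + D" using s_gt[folded D_def] D unfolding \<delta>_def by (simp_all add: field_simps)
  have AE: "AE y in \<sigma>. norm y \<le> 1"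
  proof (rule AE_I)
    show "{y \<in> space \<sigma>. \<not> norm y \<le> 1} \<subseteq> - cball 0 1" by auto
    show "emeasure \<sigma> (- cball 0 1) = 0" by (rule supp)
    show "- cball 0 1 \<in> sets \<sigma>" by (simp add: sets_\<sigma>)
  qed
  obtain K where K: "\<And>\<xi>. norm (fourier_measure \<sigma> \<xi>) \<le> K * (1 + norm \<xi>) powr (- s)" using decay by blast
  obtain K' where K': "K' \<ge> 0"
    "\<And>\<xi>. norm (\<integral>y. cutball y * cis (- 2 * pi * (\<xi> \<bullet> y)) \<partial>\<sigma>) \<le> K' * (1 + norm \<xi>) powr (- (s - \<delta>))"
    "\<And>l a \<xi>. a \<in> Basis \<Longrightarrow> norm (\<integral>y. moment l a y * cis (- 2 * pi * (\<xi> \<bullet> y)) \<partial>\<sigma>) \<le> K' * (1 + norm \<xi>) powr (- (s - \<delta>))"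
    using localized_decay[OF fin sets_\<sigma> K s(1) \<delta> AE] by blast
  have "2 * (s - \<delta>) > 1 + real (DIM(real^'d) * (CARD('m) - 1))" using s(3) by (simp add: D_def mult.commute)
  from multilinear_maximal_nice[OF fin sets_\<sigma> m2 K'(2,3,1) s(2) this]
  obtain B where B: "B \<ge> 0"
    "\<And>(f :: 'm \<Rightarrow> real^'d \<Rightarrow> complex) L. (\<And>i. nice (f i)) \<Longrightarrow> (\<And>i. l2 (f i) = ennreal (L i)) \<Longrightarrow> (\<And>i. L i > 0) \<Longrightarrow>
      (\<integral>\<^sup>+x. ennreal_powr (SUP t\<in>{0<..}. ennreal (norm (Mop \<sigma> cutball f t x))) (2 / CARD('m)) \<partial>lborel)
        \<le> ennreal (B * (\<Prod>i\<in>UNIV. L i) powr (1 / CARD('m)))"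
    by blast
  show ?thesis
  \<comment> \<open>The exponent \<open>m / 2\<close> is the inverse of \<open>2 / m\<close>: the
    bound for the integral is raised to this power to obtain the quasinorm.\<close>
  proof (intro exI[of _ "B powr (m / 2)"] allI impI)
    fix F :: "'m \<Rightarrow> real^'d \<Rightarrow> complex"
    assume "\<forall>i. schwartz (F i)"
    then have F: "nice (F i)" for i by (simp add: nice_schwartz)
    define L where "L i = enn2real (l2 (F i))" for i
    have L: "l2 (F i) = ennreal (L i)" for i using l2_finite[OF F] by (simp add: L_def)
    have L0: "L i \<ge> 0" for i by (simp add: L_def)
    have norm2: "enn2real (Lp_norm 2 (\<lambda>x. ennreal (norm (F i x)))) = L i powr (1 / 2)" for i
      using L0[of i] by (simp add: Lp_norm_2 L ennreal_powr_ennreal)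
    have max: "maximal_op \<sigma> F = (\<lambda>x. SUP t\<in>{0<..}. ennreal (norm (Mop \<sigma> cutball F t x)))"
      by (intro ext maximal_op_eq_Mop[where F=F] sets_\<sigma> AE F)
    show "Lp_norm (2 / real CARD('m)) (maximal_op \<sigma> F)
      \<le> ennreal (B powr (m / 2) * (\<Prod>i\<in>UNIV. enn2real (Lp_norm 2 (\<lambda>x. ennreal (norm (F i x))))))"
    proof (cases "\<exists>i. L i = 0")
      \<comment> \<open>The normalised geometric mean divides by the norms, so a vanishing norm is
        treated apart: by continuity the function is then identically zero and so is the maximal
        function.\<close>
      case True
      then obtain i where "L i = 0" by blast
      then have "l2 (F i) = 0" by (simp add: L)
      then have "F i x = 0" for x by (rule l2_eq_0_imp[OF F])
      then have "(\<Prod>i\<in>UNIV. F i (p i)) = 0" for p by (intro prod_zero) auto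
      then have "maximal_op \<sigma> F = (\<lambda>_. 0)" unfolding maximal_op_def by (simp only:) simp
      then show ?thesis by (simp add: Lp_norm_def)
    next
      case False
      then have Lpos: "L i > 0" for i using L0[of i] by (simp add: less_le)
      have "Lp_norm (2 / real CARD('m)) (maximal_op \<sigma> F)
        \<le> ennreal_powr (ennreal (B * (\<Prod>i\<in>UNIV. L i) powr (1 / m))) (m / 2)"
        unfolding Lp_norm_def max using B(2)[where f=F, OF F L Lpos]
        by (auto simp: m_def intro!: ennreal_powr_mono)
      also have "\<dots> = ennreal (B powr (m / 2) * (\<Prod>i\<in>UNIV. L i powr (1 / 2)))"
      proof (subst ennreal_powr_ennreal)
        have "(B * (\<Prod>i\<in>UNIV. L i) powr (1 / m)) powr (m / 2) = B powr (m / 2) * (\<Prod>i\<in>UNIV. L i) powr (1 / 2)"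
          using m by (simp add: powr_mult powr_powr)
        then show "ennreal ((B * (\<Prod>i\<in>UNIV. L i) powr (1 / m)) powr (m / 2)) = ennreal (B powr (m / 2) * (\<Prod>i\<in>UNIV. L i powr (1 / 2)))"
          by (simp only: prod_powr_distrib)
      qed (use B(1) in simp)
      finally show ?thesis by (simp add: norm2)
    qed
  qed
qed

end
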